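(* Consider a dense $K$-user network: the $K(K-1)$ cross-channel strengths $\mathrm{INR}^{[rt]}$, $r\neq t$, are drawn i.i.d. from a common distribution $\mu$ on $[0,\infty)$ and then held fixed for all time ($\mathrm{INR}^{[rt]}(n)=\mathrm{INR}^{[rt]}$ for all $n$), while direct strengths equal $\sqrt{\mathrm{SNR}}$ and phases are i.i.d. uniform as in the model. Assume that for every $\epsilon>0$, $\delta(\epsilon):=\mu\{a\ge 0: C_Z(a)\le \log(1+2\,\mathrm{SNR})+\epsilon\}>0$. Let $C_\Sigma$ denote the (random, depending on the realized cross strengths) ergodic sum capacity of the network. Then for every $\epsilon>0$, $\lim_{K\to\infty}\Pr\left[\left|\frac{C_\Sigma}{K}-\frac12\log(1+2\,\mathrm{SNR})\right|>\epsilon\right]=0$, i.e. $C_\Sigma/K$ converges in probability to $\frac12\log(1+2\,\mathrm{SNR})$.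
   Context: Model: for an integer $K\ge 2$, $\mathcal K=\{1,\dots,K\}$, and a constant $\mathrm{SNR}>0$: at each channel use $n\in\mathbb N$, receiver $r\in\mathcal K$ observes $Y^{[r]}(n)=\sum_{t\in\mathcal K}H^{[rt]}(n)e^{j\phi^{[rt]}(n)}X^{[t]}(n)+Z^{[r]}(n)$, where $X^{[t]}(n)\in\mathbb C$ is the symbol of transmitter $t$ with power constraint $E|X^{[t]}|^2\le 1$, the noises $Z^{[r]}(n)$ are zero-mean unit-variance circularly symmetric complex Gaussian, i.i.d. over $n$; the phases $\phi^{[rt]}(n)$ are i.i.d. uniform on $[0,2\pi)$ (over $r,t,n$) and independent of the strengths; direct strengths are $H^{[kk]}(n)=\sqrt{\mathrm{SNR}}$; cross strengths are $H^{[rt]}(n)=\sqrt{\mathrm{INR}^{[rt]}(n)}$ for $r\ne t$. $H^{[rt]}$ is the link from transmitter $t$ to receiver $r$. All transmitters and receivers know all channel strengths and phases, and codewords may depend on the channel states. There are $K$ independent messages, $W_k$ sent from transmitter $k$ to receiver $k$; achievable rates and sum capacity are defined in the standard Shannon sense. Logarithms are base 2. Notation: for $a\ge 0$, $C_Z(a)$ denotes the sum capacity of the two-user ($K=2$) instance of this model in which the cross-link from transmitter $2$ to receiver $1$ has constant strength $\sqrt a$ for all $n$ and the cross-link from transmitter $1$ to receiver $2$ is zero (a "Z interference channel"). A cross-link $H^{[rt]}$ with strength $\mathrm{INR}^{[rt]}=a$ is called an $\epsilon$-bottleneck link if $C_Z(a)\le\log(1+2\,\mathrm{SNR})+\epsilon$.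 *)

theory Defs
  imports "HOL-Probability.Probability"
begin

text \<open>Indices: users are 0,...,K-1 (rather than 1,...,K).  A strength matrix
  INR :: nat \<times> nat \<Rightarrow> real maps (r,t) to INR^[rt], the link from transmitter t to
  receiver r; only entries with r \<noteq> t are used (direct links have strength sqrt SNR).
  Strengths are time-invariant (all that is needed for this theorem).\<close>

type_synonym phases = "nat \<times> nat \<times> nat \<Rightarrow> real"   \<comment> \<open>(n, r, t) \<mapsto> phi^[rt](n)\<close>
type_synonym noises = "nat \<times> nat \<Rightarrow> complex"       \<comment> \<open>(n, r) \<mapsto> Z^[r](n)\<close>
type_synonym msgs = "nat \<Rightarrow> nat"                    \<comment> \<open>k \<mapsto> W_k\<close>

definition cgauss :: "complex measure" where
  "cgauss = density lborel (\<lambda>z. ennreal (exp (- (cmod z)\<^sup>2) / pi))"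

definition phase_dist :: "real measure" where
  "phase_dist = uniform_measure lborel {0..<2*pi}"

definition chan_coeff :: "real \<Rightarrow> (nat \<times> nat \<Rightarrow> real) \<Rightarrow> nat \<Rightarrow> nat \<Rightarrow> real \<Rightarrow> complex" where
  "chan_coeff SNR INR r t ph =
     complex_of_real (if r = t then sqrt SNR else sqrt (INR (r, t))) * cis ph"

definition code_space :: "nat \<Rightarrow> nat \<Rightarrow> (nat \<Rightarrow> nat) \<Rightarrow> (msgs \<times> phases \<times> noises) measure" where
  "code_space K N M =
     (PiM {..<K} (\<lambda>k. uniform_count_measure {..<M k})) \<Otimes>\<^sub>M
     ((PiM ({..<N} \<times> {..<K} \<times> {..<K}) (\<lambda>_. phase_dist)) \<Otimes>\<^sub>M
      (PiM ({..<N} \<times> {..<K}) (\<lambda>_. cgauss)))"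

text \<open>Encoders: enc k w phi n is the symbol X^[k](n) sent by transmitter k with message w
  under phase realisation phi.  Decoders: dec k y phi is receiver k's estimate from its
  received block y and the phases.\<close>

definition tx_symbol :: "(nat \<Rightarrow> nat \<Rightarrow> phases \<Rightarrow> nat \<Rightarrow> complex) \<Rightarrow> msgs \<times> phases \<times> noises \<Rightarrow> nat \<Rightarrow> nat \<Rightarrow> complex" where
  "tx_symbol enc \<omega> t n = enc t (fst \<omega> t) (fst (snd \<omega>)) n"

definition received :: "nat \<Rightarrow> real \<Rightarrow> (nat \<times> nat \<Rightarrow> real) \<Rightarrow> (nat \<Rightarrow> nat \<Rightarrow> phases \<Rightarrow> nat \<Rightarrow> complex)
    \<Rightarrow> msgs \<times> phases \<times> noises \<Rightarrow> nat \<Rightarrow> nat \<Rightarrow> complex" where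
  "received K SNR INR enc \<omega> r n =
     (\<Sum>t<K. chan_coeff SNR INR r t (fst (snd \<omega>) (n, r, t)) * tx_symbol enc \<omega> t n)
     + snd (snd \<omega>) (n, r)"

definition error_event :: "nat \<Rightarrow> real \<Rightarrow> (nat \<times> nat \<Rightarrow> real) \<Rightarrow> nat \<Rightarrow> (nat \<Rightarrow> nat)
    \<Rightarrow> (nat \<Rightarrow> nat \<Rightarrow> phases \<Rightarrow> nat \<Rightarrow> complex) \<Rightarrow> (nat \<Rightarrow> (nat \<Rightarrow> complex) \<Rightarrow> phases \<Rightarrow> nat)
    \<Rightarrow> (msgs \<times> phases \<times> noises) set" where
  "error_event K SNR INR N M enc dec =
     {\<omega> \<in> space (code_space K N M).
        \<exists>k<K. dec k (\<lambda>n. if n < N then received K SNR INR enc \<omega> k n else 0) (fst (snd \<omega>)) \<noteq> fst \<omega> k}"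

definition error_prob :: "nat \<Rightarrow> real \<Rightarrow> (nat \<times> nat \<Rightarrow> real) \<Rightarrow> nat \<Rightarrow> (nat \<Rightarrow> nat)
    \<Rightarrow> (nat \<Rightarrow> nat \<Rightarrow> phases \<Rightarrow> nat \<Rightarrow> complex) \<Rightarrow> (nat \<Rightarrow> (nat \<Rightarrow> complex) \<Rightarrow> phases \<Rightarrow> nat) \<Rightarrow> real" where
  "error_prob K SNR INR N M enc dec = measure (code_space K N M) (error_event K SNR INR N M enc dec)"

definition is_code :: "nat \<Rightarrow> real \<Rightarrow> (nat \<times> nat \<Rightarrow> real) \<Rightarrow> nat \<Rightarrow> (nat \<Rightarrow> nat)
    \<Rightarrow> (nat \<Rightarrow> nat \<Rightarrow> phases \<Rightarrow> nat \<Rightarrow> complex) \<Rightarrow> (nat \<Rightarrow> (nat \<Rightarrow> complex) \<Rightarrow> phases \<Rightarrow> nat) \<Rightarrow> bool" where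
  "is_code K SNR INR N M enc dec \<longleftrightarrow>
     (\<forall>k<K. 0 < M k) \<and>
     (\<forall>k<K. \<forall>w n. \<forall>\<phi> \<phi>'. (\<forall>m\<le>n. \<forall>r<K. \<forall>t<K. \<phi> (m, r, t) = \<phi>' (m, r, t))
         \<longrightarrow> enc k w \<phi> n = enc k w \<phi>' n) \<and>
     (\<forall>k<K. \<forall>n<N.
         (\<lambda>\<omega>. tx_symbol enc \<omega> k n) \<in> borel_measurable (code_space K N M) \<and>
         integrable (code_space K N M) (\<lambda>\<omega>. (cmod (tx_symbol enc \<omega> k n))\<^sup>2) \<and>
         (\<integral>\<omega>. (cmod (tx_symbol enc \<omega> k n))\<^sup>2 \<partial>code_space K N M) \<le> 1) \<and>
     error_event K SNR INR N M enc dec \<in> sets (code_space K N M)"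

definition msg_sizes :: "nat \<Rightarrow> (nat \<Rightarrow> real) \<Rightarrow> nat \<Rightarrow> nat" where
  "msg_sizes N R k = nat \<lceil>2 powr (real N * R k)\<rceil>"

definition achievable :: "nat \<Rightarrow> real \<Rightarrow> (nat \<times> nat \<Rightarrow> real) \<Rightarrow> (nat \<Rightarrow> real) \<Rightarrow> bool" where
  "achievable K SNR INR R \<longleftrightarrow>
     (\<forall>k<K. 0 \<le> R k) \<and>
     (\<forall>e>0. \<exists>N0. \<forall>N\<ge>N0. \<exists>enc dec.
         is_code K SNR INR N (msg_sizes N R) enc dec \<and>
         error_prob K SNR INR N (msg_sizes N R) enc dec \<le> e)"

definition sum_capacity :: "nat \<Rightarrow> real \<Rightarrow> (nat \<times> nat \<Rightarrow> real) \<Rightarrow> real" where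
  "sum_capacity K SNR INR = Sup {\<Sum>k<K. R k | R. achievable K SNR INR R}"

text \<open>C_Z(a): two users, cross link from transmitter 2 to receiver 1 (indices (0,1))
  of strength sqrt a, the other cross link zero.\<close>
definition C_Z :: "real \<Rightarrow> real \<Rightarrow> real" where
  "C_Z SNR a = sum_capacity 2 SNR (\<lambda>p. if p = (0, 1) then a else 0)"

definition bottleneck :: "real \<Rightarrow> real \<Rightarrow> real \<Rightarrow> bool" where
  "bottleneck SNR \<epsilon> a \<longleftrightarrow> C_Z SNR a \<le> log 2 (1 + 2 * SNR) + \<epsilon>"

definition offdiag :: "nat \<Rightarrow> (nat \<times> nat) set" where
  "offdiag K = {(r, t). r < K \<and> t < K \<and> r \<noteq> t}"

definition INR_dist :: "nat \<Rightarrow> real measure \<Rightarrow> (nat \<times> nat \<Rightarrow> real) measure" where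
  "INR_dist K \<mu> = PiM (offdiag K) (\<lambda>_. \<mu>)"

definition outer_prob :: "'a measure \<Rightarrow> 'a set \<Rightarrow> real" where
  "outer_prob M A = Inf (measure M ` {B \<in> sets M. A \<subseteq> B})"

end

theory Submission
  imports Defs
begin

text \<open>
  Lower bound. By ergodic interference alignment every user achieves every rate below
  \<open>1/2 log (1 + 2 SNR)\<close>, whatever the cross strengths are. Quantise the phases. In the first half of
  the block fresh Gaussian symbols are sent; in the second half a symbol is repeated in a channel
  use whose cross phases are opposite and whose direct phases equal those of its first
  transmission. By the law of large numbers almost all symbols find such a partner, and adding the
  two observations cancels the interference up to the quantisation error, leaving a channel with
  signal-to-noise ratio \<open>2 SNR\<close> over half of the uses. The decoder thresholds the log-likelihood
  ratio. The random codebook is computed from the binary digits of a single phase: it is common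
  randomness, so that the power constraint and the random coding bound hold without derandomising.

  Upper bound. If the link from \<open>t\<close> to \<open>r\<close> has strength \<open>a\<close>, then \<open>R\<^sub>r + R\<^sub>t \<le> C\<^sub>Z a\<close>: the two users can run
  the network code over the Z channel, simulating all other users by common randomness drawn from
  the phase of the dead link. So every edge of a matching of bottleneck links costs at most
  \<open>log (1 + 2 SNR) + \<epsilon>\<close>. The vertices outside a maximal matching form a set without bottleneck
  links, and by a union bound no such set has size proportional to \<open>K\<close> with high probability; each
  of its users has bounded rate by a change of measure to a wider Gaussian.
\<close>

section \<open>Common randomness from a single phase\<close>

text \<open>No entropy or mutual information is involved. \<open>C_Z\<close> enters only as a
  supremum over achievable rates, so the upper bound transforms codes into codes and evaluates no
  capacity. Two clauses of \<open>is_code\<close> shape the constructions. Encoders are causal in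
  the phases, so common randomness comes from a phase of channel use 0, which every terminal knows
  before anything depends on it; the use that the aligned code leaves idle costs no rate. Power is
  averaged over messages and phases, so a Gaussian codebook computed from that phase satisfies the
  constraint in expectation. The error analysis rests on two moments: Chebyshev's inequality for the
  true message, which takes fourth moments of Gaussians, and an exponential moment, known exactly,
  for the wrong ones. The crude bound on single rates serves twice: it bounds the set whose
  \<open>Sup\<close> is the sum capacity, and it pays for the users that the matching leaves over.
  The sum capacity is not shown to be measurable in the strengths; its deviation event is only ever
  covered by measurable sets, which is what \<open>outer_prob\<close> asks for.\<close>

lemma emeasure_PiM_PiE:
  assumes "finite I" "\<And>i. i \<in> I \<Longrightarrow> prob_space (M i)" "\<And>i. i \<in> I \<Longrightarrow> A i \<in> sets (M i)"
  shows "emeasure (PiM I M) (Pi\<^sub>E I A) = (\<Prod>i\<in>I. emeasure (M i) (A i))"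
proof -
  have "prod_emb I M I (Pi\<^sub>E I A) = Pi\<^sub>E I A"
    using assms(3) by (intro prod_emb_PiE_same_index) (auto dest: sets.sets_into_space)
  then show ?thesis
    using emeasure_PiM_emb[of I M I A] assms by auto
qed

text \<open>The factors are probability measures on \<open>I\<close> only. Outside \<open>I\<close>
  point masses are put in their place, so that the whole family forms a product probability space;
  the product over \<open>I\<close> stays the same.\<close>

lemma PiM_eqI_prob:
  assumes "finite I" "\<And>i. i \<in> I \<Longrightarrow> prob_space (M i)" "sets P = sets (PiM I M)"
    and eq: "\<And>A. (\<And>i. i \<in> I \<Longrightarrow> A i \<in> sets (M i)) \<Longrightarrow>
      emeasure P (Pi\<^sub>E I A) = (\<Prod>i\<in>I. emeasure (M i) (A i))"
  shows "P = PiM I M"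
proof -
  define N where "N = (\<lambda>i. if i \<in> I then M i else return (count_space UNIV) undefined)"
  have N: "prob_space (N i)" for i
    using assms by (auto simp: N_def intro!: prob_space_return)
  interpret product_prob_space N I
    using N by (intro product_prob_spaceI)
  have *: "PiM I N = PiM I M" by (intro PiM_cong) (auto simp: N_def)
  have "P = PiM I N"
  proof (rule PiM_eqI)
    show "sets P = sets (PiM I N)" using assms * by simp
  qed (use assms in \<open>auto simp: N_def\<close>)
  with * show ?thesis by simp
qed

lemma distr_PiM_map:
  assumes "finite I" "\<And>i. i \<in> I \<Longrightarrow> prob_space (M i)"
    and f[measurable]: "\<And>i. i \<in> I \<Longrightarrow> f i \<in> measurable (M i) (M' i)"
  shows "distr (PiM I M) (PiM I M') (\<lambda>x. \<lambda>i\<in>I. f i (x i)) = PiM I (\<lambda>i. distr (M i) (M' i) (f i))"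
proof (rule PiM_eqI_prob)
  have m: "(\<lambda>x. \<lambda>i\<in>I. f i (x i)) \<in> measurable (PiM I M) (PiM I M')"
    by measurable
  show "prob_space (distr (M i) (M' i) (f i))" if "i \<in> I" for i
    using that assms by (intro prob_space.prob_space_distr) auto
  show "sets (distr (PiM I M) (PiM I M') (\<lambda>x. \<lambda>i\<in>I. f i (x i))) = sets (PiM I (\<lambda>i. distr (M i) (M' i) (f i)))"
    by (auto intro!: sets_PiM_cong)
  fix A assume A: "\<And>i. i \<in> I \<Longrightarrow> A i \<in> sets (distr (M i) (M' i) (f i))"
  have eq: "(\<lambda>x. \<lambda>i\<in>I. f i (x i)) -` Pi\<^sub>E I A \<inter> space (PiM I M) = Pi\<^sub>E I (\<lambda>i. f i -` A i \<inter> space (M i))"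
    by (auto simp: space_PiM PiE_iff)
  have "emeasure (distr (PiM I M) (PiM I M') (\<lambda>x. \<lambda>i\<in>I. f i (x i))) (Pi\<^sub>E I A) =
      emeasure (PiM I M) (Pi\<^sub>E I (\<lambda>i. f i -` A i \<inter> space (M i)))"
    using A assms(1) by (subst emeasure_distr[OF m]) (auto simp: eq intro!: sets_PiM_I_finite)
  also have "\<dots> = (\<Prod>i\<in>I. emeasure (M i) (f i -` A i \<inter> space (M i)))"
    using A assms by (intro emeasure_PiM_PiE) (auto intro!: measurable_sets[OF f])
  also have "\<dots> = (\<Prod>i\<in>I. emeasure (distr (M i) (M' i) (f i)) (A i))"
    using A by (intro prod.cong) (auto simp: emeasure_distr[OF f])
  finally show "emeasure (distr (PiM I M) (PiM I M') (\<lambda>x. \<lambda>i\<in>I. f i (x i))) (Pi\<^sub>E I A) = \<dots>" .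
qed (use assms in auto)

lemma indep_vars_PiM_coordinates:
  assumes "\<And>i. i \<in> I \<Longrightarrow> prob_space (M i)" "I \<noteq> {}"
  shows "prob_space.indep_vars (PiM I M) M (\<lambda>i x. x i) I"
proof -
  interpret prob_space "PiM I M" using assms by (intro prob_space_PiM) auto
  have "distr (PiM I M) (PiM I M) (\<lambda>x. \<lambda>i\<in>I. x i) = distr (PiM I M) (PiM I M) (\<lambda>x. x)"
    by (intro distr_cong) (auto simp: space_PiM)
  also have "\<dots> = PiM I M" by (simp add: distr_id2)
  also have "\<dots> = PiM I (\<lambda>i. distr (PiM I M) (M i) (\<lambda>x. x i))"
    by (intro PiM_cong refl) (auto simp: distr_PiM_component assms)
  finally show ?thesis
    using assms by (subst indep_vars_iff_distr_eq_PiM') auto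
qed

section \<open>Fair coins and uniform numbers\<close>

definition unif01 :: "real measure" where "unif01 = uniform_measure lborel {0..<1}"
definition coin :: "bool measure" where "coin = uniform_count_measure UNIV"
text \<open>For \<open>u\<close> in [0,1) the floor of \<open>2 ^ Suc j * u\<close> is the integer
  formed by the first \<open>j + 1\<close> binary places, and its parity is the last of them; digit
  0 has weight 1/2.\<close>

definition bdigit :: "real \<Rightarrow> nat \<Rightarrow> bool" where "bdigit u j = odd \<lfloor>2 ^ Suc j * u\<rfloor>"
definition bsum :: "(nat \<Rightarrow> bool) \<Rightarrow> real" where "bsum b = (\<Sum>j. of_bool (b j) / 2 ^ Suc j)"

lemma sets_unif01[measurable_cong, simp]: "sets unif01 = sets borel" and space_unif01[simp]: "space unif01 = UNIV"
  and prob_space_unif01: "prob_space unif01"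
  by (auto simp: unif01_def intro!: prob_space_uniform_measure)

lemma sets_phase_dist[measurable_cong, simp]: "sets phase_dist = sets borel"
  and space_phase_dist[simp]: "space phase_dist = UNIV"
  and prob_space_phase_dist: "prob_space phase_dist"
  by (auto simp: phase_dist_def intro!: prob_space_uniform_measure)

lemma sets_coin[measurable_cong, simp]: "sets coin = sets (count_space UNIV)" and space_coin[simp]: "space coin = UNIV"
  and prob_space_coin: "prob_space coin"
  by (auto simp: coin_def space_uniform_count_measure intro!: prob_space_uniform_count_measure)

lemma floor_bdigit: "\<lfloor>2 ^ Suc n * u\<rfloor> = 2 * \<lfloor>2 ^ n * u\<rfloor> + of_bool (bdigit u n)"
proof -
  define v where "v = 2 ^ n * u"
  have "\<lfloor>2 * v\<rfloor> = 2 * \<lfloor>v\<rfloor> \<or> \<lfloor>2 * v\<rfloor> = 2 * \<lfloor>v\<rfloor> + 1" by linarith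
  then show ?thesis unfolding bdigit_def by (auto simp: v_def mult.assoc)
qed

text \<open>Appending a digit doubles the floor of \<open>2 ^ n * u\<close> and adds the digit.
  Prescribing a prefix therefore amounts to prescribing this integer, and the prefix sets are dyadic
  intervals.\<close>

lemma bdigit_prefix:
  "\<exists>k::int. 0 \<le> k \<and> k < 2 ^ n \<and> (\<forall>u. 0 \<le> u \<longrightarrow> u < 1 \<longrightarrow> ((\<forall>j<n. bdigit u j = c j) \<longleftrightarrow> \<lfloor>2 ^ n * u\<rfloor> = k))"
proof (induction n)
  case 0
  then show ?case by (intro exI[of _ 0]) (auto intro!: floor_eq_iff[THEN iffD2] simp: floor_unique)
next
  case (Suc n)
  then obtain k where k: "0 \<le> k" "k < 2 ^ n"
    "\<And>u. 0 \<le> u \<Longrightarrow> u < 1 \<Longrightarrow> (\<forall>j<n. bdigit u j = c j) \<longleftrightarrow> \<lfloor>2 ^ n * u\<rfloor> = k" by blast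
  have *: "2 * a + of_bool p = 2 * b + (of_bool q :: int) \<longleftrightarrow> a = b \<and> p = q" for a b p q
    by (cases p; cases q; auto; presburger)
  show ?case
    by (rule exI[of _ "2 * k + of_bool (c n)"])
       (use k in \<open>auto simp: floor_bdigit * less_Suc_eq simp del: power_Suc\<close>; simp)
qed

text \<open>The partial sums are \<open>u\<close> rounded down to a multiple of
  \<open>1 / 2 ^ n\<close>, hence within \<open>1 / 2 ^ n\<close> of \<open>u\<close>.\<close>

lemma bdigit_sums:
  assumes "0 \<le> u" "u < 1"
  shows "(\<lambda>j. of_bool (bdigit u j) / 2 ^ Suc j) sums u"
proof -
  have part: "(\<Sum>j<n. of_bool (bdigit u j) / 2 ^ Suc j) = \<lfloor>2 ^ n * u\<rfloor> / (2 ^ n :: real)" for n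
  proof (induction n)
    case 0
    have "\<lfloor>u\<rfloor> = 0" using assms by linarith
    then show ?case by simp
  next
    case (Suc n)
    show ?case unfolding sum.lessThan_Suc Suc floor_bdigit
      by (simp add: field_simps)
  qed
  have "(\<lambda>n. \<lfloor>2 ^ n * u\<rfloor> / (2 ^ n :: real)) \<longlonglongrightarrow> u"
  proof (rule real_tendsto_sandwich)
    show "\<forall>\<^sub>F n in sequentially. u - (1/2) ^ n \<le> \<lfloor>2 ^ n * u\<rfloor> / (2 ^ n :: real)"
    proof (intro always_eventually allI)
      fix n
      have "2 ^ n * u - 1 \<le> \<lfloor>2 ^ n * u\<rfloor>" by linarith
      then have "(2 ^ n * u - 1) / 2 ^ n \<le> \<lfloor>2 ^ n * u\<rfloor> / (2 ^ n :: real)" by (intro divide_right_mono) auto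
      then show "u - (1/2) ^ n \<le> \<lfloor>2 ^ n * u\<rfloor> / (2 ^ n :: real)" by (simp add: field_simps)
    qed
    show "\<forall>\<^sub>F n in sequentially. \<lfloor>2 ^ n * u\<rfloor> / (2 ^ n :: real) \<le> u"
      by (intro always_eventually allI) (simp add: field_simps)
    have "(\<lambda>n. u - (1/2) ^ n) \<longlonglongrightarrow> u - 0"
      by (intro tendsto_intros LIMSEQ_power_zero) auto
    then show "(\<lambda>n. u - (1/2) ^ n) \<longlonglongrightarrow> u" by simp
  qed auto
  then show ?thesis unfolding sums_def part .
qed

lemma measurable_bdigit[measurable]: "(\<lambda>u. bdigit u j) \<in> measurable borel (count_space UNIV)"
  unfolding bdigit_def by measurable

lemma measurable_bsum[measurable]: "bsum \<in> borel_measurable (PiM UNIV (\<lambda>_. coin))"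
  unfolding bsum_def by measurable

text \<open>A prefix of length \<open>n\<close> cuts out a dyadic interval of length
  \<open>1 / 2 ^ n\<close>, which is also the mass of that prefix under \<open>n\<close> fair coins.
  Cylinder sets over finitely many digits determine the measure.\<close>

lemma distr_bdigit: "distr unif01 (PiM UNIV (\<lambda>_. coin)) bdigit = PiM UNIV (\<lambda>_. coin)"
proof (rule measure_eqI_PiM_infinite)
  have mb[measurable]: "bdigit \<in> measurable unif01 (PiM UNIV (\<lambda>_. coin))"
    by (rule measurable_PiM_single') (auto simp: measurable_cong_sets[OF sets_unif01 sets_coin])
  interpret prob_space unif01 by (rule prob_space_unif01)
  show "finite_measure (distr unif01 (PiM UNIV (\<lambda>_. coin)) bdigit)"
    by (intro finite_measure_distr) simp
  fix A :: "nat \<Rightarrow> bool set" and J :: "nat set"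
  assume J: "finite J" "J \<subseteq> UNIV" and A: "\<And>i. i \<in> J \<Longrightarrow> A i \<in> sets coin"
  obtain n where n: "J \<subseteq> {..<n}" using J finite_nat_bounded by blast
  \<comment> \<open>The cylinder over \<open>J\<close> is viewed as one over an initial segment of
    digits, with full factors at the indices that are not in \<open>J\<close>.\<close>
  define A' where "A' i = (if i \<in> J then A i else UNIV)" for i
  let ?P = "PiM {..<n} (\<lambda>_. coin)"
  let ?f = "\<lambda>u. \<lambda>j\<in>{..<n}. bdigit u j"
  have mf[measurable]: "?f \<in> measurable unif01 ?P" by (intro measurable_restrict) measurable
  have setsP: "sets ?P = Pow (Pi\<^sub>E {..<n} (\<lambda>_. UNIV))"
  proof -
    have "sets ?P = sets (PiM {..<n} (\<lambda>_. count_space (UNIV :: bool set)))"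
      by (intro sets_PiM_cong) auto
    then show ?thesis by (subst (asm) count_space_PiM_finite) auto
  qed
  have eq: "distr unif01 ?P ?f = ?P"
  proof (rule measure_eqI_finite[of _ "Pi\<^sub>E {..<n} (\<lambda>_. UNIV)"])
    fix c :: "nat \<Rightarrow> bool" assume c: "c \<in> Pi\<^sub>E {..<n} (\<lambda>_. UNIV)"
    obtain k :: int where k: "0 \<le> k" "k < 2 ^ n"
      "\<And>u. 0 \<le> u \<Longrightarrow> u < 1 \<Longrightarrow> (\<forall>j<n. bdigit u j = c j) \<longleftrightarrow> \<lfloor>2 ^ n * u\<rfloor> = k"
      using bdigit_prefix[of n c] by blast
    have "real_of_int (k + 1) \<le> real_of_int (2 ^ n)" using k by (subst of_int_le_iff) linarith
    then have k2: "(real_of_int k + 1) / 2 ^ n \<le> 1" by simp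
    have ceq: "?f u = c \<longleftrightarrow> (\<forall>j<n. bdigit u j = c j)" for u
      using c by (auto simp: fun_eq_iff PiE_iff extensional_def restrict_def)
    have "emeasure (distr unif01 ?P ?f) {c} = emeasure unif01 {u. \<forall>j<n. bdigit u j = c j}"
      using c setsP by (subst emeasure_distr) (auto simp: ceq vimage_def)
    also have "\<dots> = emeasure lborel ({0..<1} \<inter> {u. \<forall>j<n. bdigit u j = c j})"
      unfolding unif01_def by (subst emeasure_uniform_measure) (auto simp: divide_ennreal_def)
    also have "{0..<1} \<inter> {u. \<forall>j<n. bdigit u j = c j} = {real_of_int k / 2 ^ n ..< (real_of_int k + 1) / 2 ^ n}"
    proof (rule set_eqI)
      fix u :: real
      have 0: "0 \<le> real_of_int k / 2 ^ n" using k by simp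
      have "\<lfloor>2 ^ n * u\<rfloor> = k \<longleftrightarrow> real_of_int k / 2 ^ n \<le> u \<and> u < (real_of_int k + 1) / 2 ^ n"
        by (subst floor_eq_iff) (auto simp: field_simps)
      then show "u \<in> {0..<1} \<inter> {u. \<forall>j<n. bdigit u j = c j} \<longleftrightarrow>
          u \<in> {real_of_int k / 2 ^ n ..< (real_of_int k + 1) / 2 ^ n}"
        using order_trans[OF 0, of u] order_less_le_trans[OF _ k2, of u] k(3)[of u]
        unfolding Int_iff atLeastLessThan_iff mem_Collect_eq by blast
    qed
    also have "emeasure lborel {real_of_int k / 2 ^ n ..< (real_of_int k + 1) / 2 ^ n} = ennreal (1 / 2 ^ n)"
      by (subst emeasure_lborel_Ico) (auto intro!: divide_right_mono simp: diff_divide_distrib[symmetric])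
    also have "\<dots> = emeasure ?P {c}"
    proof -
      have "{c} = Pi\<^sub>E {..<n} (\<lambda>j. {c j})" using c by (auto simp: PiE_singleton PiE_iff)
      then have "emeasure ?P {c} = (\<Prod>j<n. emeasure coin {c j})"
        by (simp add: emeasure_PiM_PiE prob_space_coin)
      also have "emeasure coin {x} = ennreal (1/2)" for x
        unfolding coin_def by (subst emeasure_uniform_count_measure) auto
      then have "(\<Prod>j<n. emeasure coin {c j}) = ennreal (1/2) ^ n" by simp
      finally show ?thesis by (simp only: ennreal_power power_one_over zero_le_divide_1_iff zero_le_numeral)
    qed
    finally show "emeasure (distr unif01 ?P ?f) {c} = emeasure ?P {c}" .
  qed (auto simp: setsP finite_PiE)
  have A's: "Pi\<^sub>E {..<n} A' \<in> sets ?P" by (auto simp: setsP)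
  have "emeasure (distr unif01 (PiM UNIV (\<lambda>_. coin)) bdigit) (prod_emb UNIV (\<lambda>_. coin) J (Pi\<^sub>E J A)) =
     emeasure unif01 {u. \<forall>j\<in>J. bdigit u j \<in> A j}"
    using J A by (subst emeasure_distr) (auto simp: prod_emb_iff PiE_iff vimage_def intro!: sets_PiM_I arg_cong[where f="emeasure unif01"])
  also have "\<dots> = emeasure (distr unif01 ?P ?f) (Pi\<^sub>E {..<n} A')"
    using A's n by (subst emeasure_distr) (auto simp: A'_def PiE_iff intro!: arg_cong[where f="emeasure unif01"] split: if_splits)
  also have "\<dots> = (\<Prod>j<n. emeasure coin (A' j))"
    unfolding eq by (subst emeasure_PiM_PiE) (auto simp: prob_space_coin)
  also have "\<dots> = (\<Prod>j\<in>J. emeasure coin (A' j))"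
    using n prob_space.emeasure_space_1[OF prob_space_coin] by (intro prod.mono_neutral_right) (auto simp: A'_def)
  also have "\<dots> = emeasure (PiM UNIV (\<lambda>_. coin)) (prod_emb UNIV (\<lambda>_. coin) J (Pi\<^sub>E J A))"
    using J A by (subst emeasure_PiM_emb) (auto simp: prob_space_coin A'_def)
  finally show "emeasure (distr unif01 (PiM UNIV (\<lambda>_. coin)) bdigit) (prod_emb UNIV (\<lambda>_. coin) J (Pi\<^sub>E J A)) = \<dots>" .
qed auto

text \<open>The digits of a uniform number are fair coins and \<open>bsum\<close> recovers the
  number from them almost everywhere; so \<open>bsum\<close> of fair coins has the law of the
  number.\<close>

lemma distr_bsum: "distr (PiM UNIV (\<lambda>_. coin)) borel bsum = unif01"
proof -
  have mb[measurable]: "bdigit \<in> measurable unif01 (PiM UNIV (\<lambda>_. coin))"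
    by (rule measurable_PiM_single') (auto simp: measurable_cong_sets[OF sets_unif01 sets_coin])
  have "distr (PiM UNIV (\<lambda>_. coin)) borel bsum = distr unif01 borel (\<lambda>u. bsum (bdigit u))"
    by (subst distr_bdigit[symmetric], subst distr_distr) (auto simp: comp_def)
  also have "\<dots> = distr unif01 borel (\<lambda>u. u)"
  proof (rule distr_cong_AE)
    have "AE u in unif01. u \<in> {0..<1}" unfolding unif01_def by (rule AE_uniform_measureI) auto
    then show "AE u in unif01. bsum (bdigit u) = u"
      by eventually_elim (auto simp: bsum_def dest!: bdigit_sums sums_unique)
  qed (auto intro: measurable_compose[OF mb measurable_bsum])
  also have "\<dots> = unif01" by (rule distr_id2) simp
  finally show ?thesis .
qed

text \<open>The digits of one number are dealt out to infinitely many rows by the pairing function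
  \<open>prod_encode\<close>, and row \<open>i\<close> is read as the expansion of the number with
  index \<open>i\<close>.\<close>

definition unif_seq :: "real \<Rightarrow> nat \<Rightarrow> real" where
  "unif_seq u i = bsum (\<lambda>j. bdigit u (prod_encode (i, j)))"

lemma restrict_UNIV: "restrict f UNIV = f"
  by (simp add: restrict_def)

text \<open>Different rows use disjoint sets of digits and are therefore independent; each row,
  reindexed, is again a sequence of fair coins.\<close>

lemma distr_unif_seq:
  shows "unif_seq \<in> measurable unif01 (PiM UNIV (\<lambda>_. unif01))"
    and "distr unif01 (PiM UNIV (\<lambda>_. unif01)) unif_seq = PiM UNIV (\<lambda>_. unif01)"
proof -
  let ?P = "PiM UNIV (\<lambda>_. coin) :: (nat \<Rightarrow> bool) measure"
  interpret P: prob_space ?P by (intro prob_space_PiM prob_space_coin)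
  let ?K = "\<lambda>i. range (\<lambda>j. prod_encode (i, j))"
  let ?V = "\<lambda>i b. bsum (\<lambda>j. b (prod_encode (i, j)))"
  have mb[measurable]: "bdigit \<in> measurable unif01 ?P"
    by (rule measurable_PiM_single') (auto simp: measurable_cong_sets[OF sets_unif01 sets_coin])
  have r[measurable]: "(\<lambda>b. (\<lambda>j. b (prod_encode (i, j)))) \<in> measurable (PiM K (\<lambda>_. coin)) ?P" if "?K i \<subseteq> K" for i K
    using that by (intro measurable_PiM_single') (auto simp: space_PiM intro!: measurable_component_singleton)
  have V[measurable]: "?V i \<in> borel_measurable (PiM K (\<lambda>_. coin))" if "?K i \<subseteq> K" for i K
    by (rule measurable_compose[OF r[OF that] measurable_bsum])
  have "P.indep_vars (\<lambda>_. coin) (\<lambda>i x. x i) UNIV"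
    by (intro indep_vars_PiM_coordinates prob_space_coin) auto
  then have "P.indep_vars (\<lambda>i. PiM (?K i) (\<lambda>_. coin)) (\<lambda>i b. restrict (\<lambda>j. b j) (?K i)) UNIV"
    by (rule P.indep_vars_restrict) (auto simp: disjoint_family_on_def prod_encode_eq)
  then have "P.indep_vars (\<lambda>i. borel) (\<lambda>i b. ?V i (restrict (\<lambda>j. b j) (?K i))) UNIV"
    by (rule P.indep_vars_compose2[where Y="?V"]) (auto intro!: V)
  then have ind: "P.indep_vars (\<lambda>i. borel) ?V UNIV" by simp
  have *: "distr ?P borel (?V i) = unif01" for i
  proof -
    have "distr ?P borel (?V i) = distr (distr ?P ?P (\<lambda>b. \<lambda>j\<in>UNIV. b (prod_encode (i, j)))) borel bsum"
      by (subst distr_distr) (auto intro!: measurable_restrict simp: comp_def restrict_UNIV)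
    also have "distr ?P ?P (\<lambda>b. \<lambda>j\<in>UNIV. b (prod_encode (i, j))) = ?P"
      by (rule distr_PiM_reindex[of UNIV "\<lambda>_. coin" "\<lambda>j. prod_encode (i, j)" UNIV])
         (auto simp: prob_space_coin inj_on_def prod_encode_eq)
    finally show ?thesis by (simp add: distr_bsum)
  qed
  have "distr ?P (PiM UNIV (\<lambda>_. borel)) (\<lambda>b. \<lambda>i\<in>UNIV. ?V i b) = PiM UNIV (\<lambda>i. distr ?P borel (?V i))"
    using P.indep_vars_iff_distr_eq_PiM[where I=UNIV and M'="\<lambda>_. borel" and X="?V"] ind V by auto
  then have 1: "distr ?P (PiM UNIV (\<lambda>_. borel)) (\<lambda>b i. ?V i b) = PiM UNIV (\<lambda>i. unif01)"
    by (simp add: * restrict_def)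
  have s: "sets (PiM UNIV (\<lambda>_. borel)) = sets (PiM UNIV (\<lambda>_. unif01) :: (nat \<Rightarrow> real) measure)"
    by (intro sets_PiM_cong) auto
  have mV[measurable]: "(\<lambda>b i. ?V i b) \<in> measurable ?P (PiM UNIV (\<lambda>_. unif01))"
    by (rule measurable_PiM_single') (auto intro!: V simp: measurable_cong_sets[OF refl sets_unif01])
  have "(\<lambda>u. (\<lambda>b i. ?V i b) (bdigit u)) \<in> measurable unif01 (PiM UNIV (\<lambda>_. unif01))"
    by (rule measurable_compose[OF mb mV])
  then show "unif_seq \<in> measurable unif01 (PiM UNIV (\<lambda>_. unif01))"
    by (simp add: unif_seq_def[abs_def])
  have "distr unif01 (PiM UNIV (\<lambda>_. unif01)) unif_seq = distr (distr unif01 ?P bdigit) (PiM UNIV (\<lambda>_. unif01)) (\<lambda>b i. ?V i b)"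
    by (subst distr_distr) (auto simp: comp_def unif_seq_def[abs_def])
  also have "\<dots> = distr ?P (PiM UNIV (\<lambda>_. borel)) (\<lambda>b i. ?V i b)"
    unfolding distr_bdigit by (rule distr_cong) (auto simp: s)
  finally show "distr unif01 (PiM UNIV (\<lambda>_. unif01)) unif_seq = PiM UNIV (\<lambda>_. unif01)"
    unfolding 1 .
qed

section \<open>Laws that a single phase can simulate\<close>

definition simulable :: "'a measure \<Rightarrow> bool" where
  "simulable M \<longleftrightarrow> (\<exists>g\<in>measurable phase_dist M. distr phase_dist M g = M)"

lemma distr_phase_unif01: "distr phase_dist borel (\<lambda>x. x / (2 * pi)) = unif01"
  and distr_unif01_phase: "distr unif01 borel (\<lambda>x. 2 * pi * x) = phase_dist"
proof -
  show 1: "distr unif01 borel (\<lambda>x. 2 * pi * x) = phase_dist"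
  proof (rule measure_eqI)
    fix A assume "A \<in> sets (distr unif01 borel (\<lambda>x. 2 * pi * x))"
    then have A[measurable]: "A \<in> sets borel" by simp
    have "emeasure (distr unif01 borel (\<lambda>x. 2 * pi * x)) A = emeasure unif01 ((\<lambda>x. 2 * pi * x) -` A)"
      by (subst emeasure_distr) auto
    also have "\<dots> = emeasure lborel ({0..<1} \<inter> (\<lambda>x. 2 * pi * x) -` A)"
      using measurable_sets[of "\<lambda>x. 2 * pi * x" borel borel A]
      unfolding unif01_def by (subst emeasure_uniform_measure) (auto simp: divide_ennreal_def)
    also have "{0..<1} \<inter> (\<lambda>x. 2 * pi * x) -` A = (\<lambda>x. 2 * pi * x) -` ({0..<2 * pi} \<inter> A)"
      using pi_gt_zero by (auto simp: zero_le_mult_iff not_le[symmetric])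
    also have "emeasure lborel \<dots> = emeasure lborel ({0..<2 * pi} \<inter> A) / ennreal (2 * pi)"
    proof -
      have "emeasure lborel ({0..<2 * pi} \<inter> A) =
        emeasure (density (distr lborel borel (\<lambda>x. 0 + (2 * pi) * x)) (\<lambda>_. ennreal \<bar>2 * pi\<bar>)) ({0..<2 * pi} \<inter> A)"
        by (subst lborel_real_affine[of "2 * pi" 0]) auto
      also have "\<dots> = ennreal (2 * pi) * emeasure lborel ((\<lambda>x. 2 * pi * x) -` ({0..<2 * pi} \<inter> A))"
        by (subst emeasure_density) (auto simp: nn_integral_cmult nn_integral_distr emeasure_distr)
      finally show ?thesis
        by (simp add: ennreal_mult_divide_eq mult.commute[of "ennreal _"] ennreal_times_divide[symmetric])
    qed
    also have "\<dots> = emeasure phase_dist A"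
      unfolding phase_dist_def by (subst emeasure_uniform_measure) (auto simp: )
    finally show "emeasure (distr unif01 borel (\<lambda>x. 2 * pi * x)) A = emeasure phase_dist A" .
  qed auto
  show "distr phase_dist borel (\<lambda>x. x / (2 * pi)) = unif01"
    by (subst 1[symmetric], subst distr_distr) (auto simp: comp_def distr_id2)
qed

text \<open>One phase scales to one uniform number, and this number unfolds into a whole independent
  sequence; an image of such a sequence is therefore within reach of one phase.\<close>

lemma simulable_unif_seqI:
  assumes [measurable]: "h \<in> measurable (PiM UNIV (\<lambda>_. unif01)) M" and "distr (PiM (UNIV :: nat set) (\<lambda>_. unif01)) M h = M"
  shows "simulable M"
  unfolding simulable_def
proof (intro bexI)
  note distr_unif_seq(1)[measurable]
  let ?g = "\<lambda>x. h (unif_seq (x / (2 * pi)))"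
  have [measurable]: "(\<lambda>x. x / (2 * pi)) \<in> measurable phase_dist unif01"
    by (simp add: measurable_cong_sets[OF sets_phase_dist sets_unif01])
  have *: "distr phase_dist unif01 (\<lambda>x. x / (2 * pi)) = unif01"
    by (rule trans[OF distr_cong[OF refl _ refl] distr_phase_unif01]) simp
  show "?g \<in> measurable phase_dist M" by measurable
  have "distr phase_dist M ?g = distr (distr (distr phase_dist unif01 (\<lambda>x. x / (2 * pi))) (PiM UNIV (\<lambda>_. unif01)) unif_seq) M h"
    by (subst distr_distr, measurable, subst distr_distr) (auto simp: comp_def)
  then show "distr phase_dist M ?g = M"
    using assms(2) by (simp add: * distr_unif_seq(2))
qed

lemma simulable_imp_prob_space: "simulable M \<Longrightarrow> prob_space M"
  unfolding simulable_def by (metis prob_space.prob_space_distr prob_space_phase_dist)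

lemma simulable_distr:
  assumes "simulable M" and [measurable]: "f \<in> measurable M N"
  shows "simulable (distr M N f)"
proof -
  from assms(1) obtain g where g[measurable]: "g \<in> measurable phase_dist M" "distr phase_dist M g = M"
    unfolding simulable_def by blast
  have "distr phase_dist N (\<lambda>x. f (g x)) = distr (distr phase_dist M g) N f"
    by (subst distr_distr) (auto simp: comp_def)
  moreover have "distr phase_dist (distr M N f) (\<lambda>x. f (g x)) = distr phase_dist N (\<lambda>x. f (g x))"
    by (rule distr_cong) auto
  ultimately show ?thesis unfolding simulable_def using g
    by (intro bexI[of _ "\<lambda>x. f (g x)"]) auto
qed

text \<open>A numbering of the finite set \<open>I\<close> gives each factor its own member of the
  uniform sequence, which is scaled back to a phase before \<open>g i\<close> is applied.\<close>

lemma simulable_PiM: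
  assumes I: "finite I" and M: "\<And>i. i \<in> I \<Longrightarrow> simulable (M i)"
  shows "simulable (PiM I M)"
proof -
  from M obtain g where g[measurable]: "\<And>i. i \<in> I \<Longrightarrow> g i \<in> measurable phase_dist (M i)"
    and eq: "\<And>i. i \<in> I \<Longrightarrow> distr phase_dist (M i) (g i) = M i"
    unfolding simulable_def by metis
  let ?U = "PiM (UNIV :: nat set) (\<lambda>_. unif01)"
  let ?f = "\<lambda>i u. g i (2 * pi * u)"
  have [measurable]: "(\<lambda>x. 2 * pi * x) \<in> measurable unif01 phase_dist"
    by (simp add: measurable_cong_sets[OF sets_unif01 sets_phase_dist])
  have ph: "distr unif01 phase_dist (\<lambda>x. 2 * pi * x) = phase_dist"
    by (rule trans[OF distr_cong[OF refl _ refl] distr_unif01_phase]) simp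
  have f: "distr unif01 (M i) (?f i) = M i" if "i \<in> I" for i
  proof -
    have "distr unif01 (M i) (?f i) = distr (distr unif01 phase_dist (\<lambda>x. 2 * pi * x)) (M i) (g i)"
      using that by (subst distr_distr) (auto simp: comp_def)
    then show ?thesis using that by (simp add: ph eq)
  qed
  have inj: "inj_on (to_nat_on I) I" using I by (intro inj_on_to_nat_on countable_finite)
  let ?h = "\<lambda>x. \<lambda>i\<in>I. ?f i (x (to_nat_on I i))"
  have r[measurable]: "(\<lambda>x. \<lambda>i\<in>I. x (to_nat_on I i)) \<in> measurable ?U (PiM I (\<lambda>_. unif01))"
    by (intro measurable_restrict) auto
  have f'[measurable]: "(\<lambda>x. \<lambda>i\<in>I. ?f i (x i)) \<in> measurable (PiM I (\<lambda>_. unif01)) (PiM I M)"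
    by (intro measurable_restrict) measurable
  have eqh: "?h = (\<lambda>x. \<lambda>i\<in>I. ?f i (x i)) \<circ> (\<lambda>x. \<lambda>i\<in>I. x (to_nat_on I i))"
    by (auto simp: fun_eq_iff)
  show ?thesis
  proof (rule simulable_unif_seqI)
    show "?h \<in> measurable ?U (PiM I M)" unfolding eqh by (rule measurable_comp[OF r f'])
    have "distr ?U (PiM I M) ?h = distr (distr ?U (PiM I (\<lambda>_. unif01)) (\<lambda>x. \<lambda>i\<in>I. x (to_nat_on I i))) (PiM I M) (\<lambda>x. \<lambda>i\<in>I. ?f i (x i))"
      unfolding eqh by (rule distr_distr[symmetric]) measurable
    also have "distr ?U (PiM I (\<lambda>_. unif01)) (\<lambda>x. \<lambda>i\<in>I. x (to_nat_on I i)) = PiM I (\<lambda>_. unif01)"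
      by (rule distr_PiM_reindex) (auto simp: prob_space_unif01 inj)
    also have "distr (PiM I (\<lambda>_. unif01)) (PiM I M) (\<lambda>x. \<lambda>i\<in>I. ?f i (x i)) = PiM I (\<lambda>i. distr unif01 (M i) (?f i))"
      by (rule distr_PiM_map[OF I]) (auto simp: prob_space_unif01)
    also have "\<dots> = PiM I M" by (intro PiM_cong refl f)
    finally show "distr ?U (PiM I M) ?h = PiM I M" .
  qed
qed

text \<open>Two independent phases come from the product over \<open>bool\<close>, and the given
  maps are then applied to the two components.\<close>

lemma simulable_pair:
  assumes "simulable M" "simulable N"
  shows "simulable (M \<Otimes>\<^sub>M N)"
proof -
  from assms obtain f g where [measurable]: "f \<in> measurable phase_dist M" "g \<in> measurable phase_dist N"
    and eq: "distr phase_dist M f = M" "distr phase_dist N g = N"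
    unfolding simulable_def by blast
  interpret P: product_prob_space "\<lambda>_::bool. phase_dist" UNIV
    by (intro product_prob_spaceI prob_space_phase_dist)
  have s: "simulable (phase_dist \<Otimes>\<^sub>M phase_dist)"
  proof -
    have "simulable (PiM (UNIV :: bool set) (\<lambda>_. phase_dist))"
      by (rule simulable_PiM) (auto simp: simulable_def distr_id2 intro!: bexI[of _ "\<lambda>x. x"])
    then have "simulable (distr (PiM (UNIV :: bool set) (\<lambda>_. phase_dist)) (phase_dist \<Otimes>\<^sub>M phase_dist) (\<lambda>x. (x True, x False)))"
      by (rule simulable_distr) measurable
    also have "distr (PiM (UNIV :: bool set) (\<lambda>_. phase_dist)) (phase_dist \<Otimes>\<^sub>M phase_dist) (\<lambda>x. (x True, x False)) = phase_dist \<Otimes>\<^sub>M phase_dist"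
      using pair_measure_eq_distr_PiM[OF prob_space_imp_sigma_finite[OF prob_space_phase_dist] prob_space_imp_sigma_finite[OF prob_space_phase_dist]]
      by (simp add: UNIV_bool case_bool_if)
    finally show ?thesis .
  qed
  have "M \<Otimes>\<^sub>M N = distr (phase_dist \<Otimes>\<^sub>M phase_dist) (M \<Otimes>\<^sub>M N) (\<lambda>(x, y). (f x, g y))"
    using pair_measure_distr[of f phase_dist M g phase_dist N] assms
    by (simp add: eq simulable_imp_prob_space prob_space_imp_sigma_finite)
  then show ?thesis using simulable_distr[OF s, of "\<lambda>(x, y). (f x, g y)" "M \<Otimes>\<^sub>M N"] by simp
qed

text \<open>Inverse transform sampling: the generalised inverse \<open>I\<close> of the distribution
  function sends the uniform law to \<open>M\<close>.\<close>

lemma simulable_real_distribution: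
  assumes "real_distribution M" shows "simulable M"
proof -
  interpret cdf_distribution M using assms by (simp add: cdf_distribution_def)
  let ?R = "restrict_space lborel {0<..<1::real}"
  \<comment> \<open>The inverse is used on the open unit interval only; the left endpoint is a null
    set, where the value 0 is arbitrary.\<close>
  define I' where "I' u = (if u \<in> {0<..<1} then I u else 0)" for u
  have mI: "I' \<in> borel_measurable borel"
    unfolding I'_def by (subst measurable_restrict_space_iff[symmetric]) auto
  have eq: "distr unif01 borel I' = M"
  proof (rule measure_eqI)
    fix A assume "A \<in> sets (distr unif01 borel I')"
    then have A[measurable]: "A \<in> sets borel" by simp
    have m: "I' -` A \<in> sets borel" using measurable_sets[OF mI A] by simp
    have "emeasure (distr unif01 borel I') A = emeasure unif01 (I' -` A)"
      using mI by (subst emeasure_distr) auto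
    also have "\<dots> = emeasure lborel ({0..<1} \<inter> I' -` A)"
      using m unfolding unif01_def by (subst emeasure_uniform_measure) (auto simp: divide_ennreal_def)
    also have "\<dots> = emeasure lborel ({0<..<1} \<inter> I' -` A)"
    proof (rule emeasure_eq_AE)
      show "AE x in lborel. (x \<in> {0..<1} \<inter> I' -` A) = (x \<in> {0<..<1} \<inter> I' -` A)"
        using AE_lborel_singleton[of 0] by eventually_elim auto
    qed (use m in auto)
    also have "{0<..<1} \<inter> I' -` A = I -` A \<inter> space ?R"
      by (auto simp: I'_def space_restrict_space)
    also have "emeasure lborel \<dots> = emeasure ?R (I -` A \<inter> space ?R)"
      by (subst emeasure_restrict_space) (auto simp: space_restrict_space)
    also have "\<dots> = emeasure (distr ?R borel I) A"
      by (subst emeasure_distr) (auto simp: measurable_CI)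
    finally show "emeasure (distr unif01 borel I') A = emeasure M A" by (simp add: distr_I_eq_M)
  qed auto
  have "simulable unif01"
    unfolding simulable_def
    by (intro bexI[of _ "\<lambda>x. x / (2 * pi)"] trans[OF distr_cong[OF refl _ refl] distr_phase_unif01])
       (auto simp: measurable_cong_sets[OF sets_phase_dist sets_unif01])
  from simulable_distr[OF this, of I' borel] show ?thesis using mI eq by simp
qed

text \<open>The law is carried to the reals, where inverse transform sampling applies, and read back
  by taking floors; the default 0 keeps the result inside \<open>{..<m}\<close>.\<close>

lemma simulable_uniform_count:
  assumes "0 < m" shows "simulable (uniform_count_measure {..<m::nat})"
proof -
  interpret U: prob_space "uniform_count_measure {..<m}"
    using assms by (intro prob_space_uniform_count_measure) auto
  let ?R = "distr (uniform_count_measure {..<m}) borel real"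
  have [measurable]: "real \<in> borel_measurable (uniform_count_measure {..<m})"
    by (simp add: measurable_cong_sets[OF sets_uniform_count_measure_count_space refl])
  have "prob_space ?R" by (intro U.prob_space_distr) simp
  then have "real_distribution ?R" by (simp add: real_distribution_def real_distribution_axioms_def)
  then have s: "simulable ?R" by (rule simulable_real_distribution)
  let ?f = "\<lambda>x::real. if nat \<lfloor>x\<rfloor> < m then nat \<lfloor>x\<rfloor> else 0"
  have f[measurable]: "?f \<in> measurable borel (uniform_count_measure {..<m})"
  proof (subst measurable_cong_sets[OF refl sets_uniform_count_measure_count_space])
    have "?f \<in> measurable borel (count_space UNIV)" by measurable
    then have "?f -` {a} \<inter> space borel \<in> sets borel" for a
      by (rule measurable_sets) auto
    then show "?f \<in> measurable borel (count_space {..<m})"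
      using assms by (subst measurable_count_space_eq2_countable) (auto simp: if_distrib[where f="\<lambda>x. x < m"])
  qed
  have "distr ?R (uniform_count_measure {..<m}) ?f = distr (uniform_count_measure {..<m}) (uniform_count_measure {..<m}) (\<lambda>x. x)"
    by (subst distr_distr[OF f], simp, rule distr_cong) (auto simp: space_uniform_count_measure)
  also have "\<dots> = uniform_count_measure {..<m}" by (simp add: distr_id2)
  finally show ?thesis using simulable_distr[OF s, of ?f "uniform_count_measure {..<m}"] f by simp
qed

section \<open>Complex Gaussian variables\<close>

lemma cgauss_sets[measurable_cong, simp]: "sets cgauss = sets borel"
  and space_cgauss[simp]: "space cgauss = UNIV"
  by (auto simp: cgauss_def)

lemma lborel_complex_eq_distr: "lborel = distr (lborel \<Otimes>\<^sub>M lborel) borel (\<lambda>(a, b). Complex a b)"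
proof (rule lborel_eqI)
  have [measurable]: "(\<lambda>(a, b). Complex a b) \<in> borel_measurable (borel \<Otimes>\<^sub>M borel)"
    by (auto simp: Complex_eq split_beta')
  fix l u :: complex assume le: "\<And>b. b \<in> Basis \<Longrightarrow> l \<bullet> b \<le> u \<bullet> b"
  have le': "Re l \<le> Re u" "Im l \<le> Im u" using le[of 1] le[of \<i>] by (auto simp: Basis_complex_def)
  have "emeasure (distr (lborel \<Otimes>\<^sub>M lborel) borel (\<lambda>(a, b). Complex a b)) (box l u) =
     emeasure (lborel \<Otimes>\<^sub>M lborel) ({Re l<..<Re u} \<times> {Im l<..<Im u})"
  proof (subst emeasure_distr)
    show "(\<lambda>(a, b). Complex a b) \<in> lborel \<Otimes>\<^sub>M lborel \<rightarrow>\<^sub>M borel" by measurable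
    have "(\<lambda>(a, b). Complex a b) -` box l u \<inter> space (lborel \<Otimes>\<^sub>M lborel) = {Re l<..<Re u} \<times> {Im l<..<Im u}"
      by (auto simp: in_box_complex_iff space_pair_measure)
    then show "emeasure (lborel \<Otimes>\<^sub>M lborel) ((\<lambda>(a, b). Complex a b) -` box l u \<inter> space (lborel \<Otimes>\<^sub>M lborel)) =
       emeasure (lborel \<Otimes>\<^sub>M lborel) ({Re l<..<Re u} \<times> {Im l<..<Im u})" by simp
  qed simp
  also have "\<dots> = ennreal ((Re u - Re l) * (Im u - Im l))"
    using le' by (subst lborel.emeasure_pair_measure_Times) (auto simp: ennreal_mult)
  finally show "emeasure (distr (lborel \<Otimes>\<^sub>M lborel) borel (\<lambda>(a, b). Complex a b)) (box l u) = ennreal (\<Prod>b\<in>Basis. (u - l) \<bullet> b)"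
    by (simp add: Basis_complex_def)
qed simp

lemma measurable_Complex[measurable]: "(\<lambda>(a, b). Complex a b) \<in> borel_measurable (borel \<Otimes>\<^sub>M borel)"
    by (auto simp: Complex_eq split_beta')

lemma nn_integral_complex:
  assumes [measurable]: "f \<in> borel_measurable borel"
  shows "(\<integral>\<^sup>+z. f z \<partial>lborel) = (\<integral>\<^sup>+a. \<integral>\<^sup>+b. f (Complex a b) \<partial>lborel \<partial>lborel)"
proof -
  have "(\<integral>\<^sup>+z. f z \<partial>lborel) = (\<integral>\<^sup>+z. f ((\<lambda>(a, b). Complex a b) z) \<partial>(lborel \<Otimes>\<^sub>M lborel))"
    by (subst lborel_complex_eq_distr, subst nn_integral_distr) auto
  also have "\<dots> = (\<integral>\<^sup>+a. \<integral>\<^sup>+b. f (Complex a b) \<partial>lborel \<partial>lborel)"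
    by (subst lborel.nn_integral_fst[symmetric]) auto
  finally show ?thesis .
qed

text \<open>Variance 1/2 in each of the two real components makes a complex variable of unit
  variance.\<close>

definition hnormal :: "real measure" where "hnormal = density lborel (normal_density 0 (sqrt (1/2)))"

lemma sets_hnormal[measurable_cong, simp]: "sets hnormal = sets borel" "space hnormal = UNIV"
  and prob_space_hnormal: "prob_space hnormal"
  by (auto simp: hnormal_def intro!: prob_space_normal_density)

lemma cgauss_eq_distr: "cgauss = distr (hnormal \<Otimes>\<^sub>M hnormal) borel (\<lambda>(a, b). Complex a b)"
proof (rule measure_eqI)
  interpret H: prob_space hnormal by (rule prob_space_hnormal)
  fix A assume "A \<in> sets cgauss"
  then have A[measurable]: "A \<in> sets borel" by simp
  have nd: "exp (- (cmod (Complex a b))\<^sup>2) / pi = normal_density 0 (sqrt (1/2)) a * normal_density 0 (sqrt (1/2)) b" for a b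
    by (simp add: normal_density_def cmod_power2 mult_exp_exp power_divide)
  have "emeasure cgauss A = (\<integral>\<^sup>+z. ennreal (exp (- (cmod z)\<^sup>2) / pi) * indicator A z \<partial>lborel)"
    unfolding cgauss_def by (subst emeasure_density) auto
  also have "\<dots> = (\<integral>\<^sup>+a. \<integral>\<^sup>+b. ennreal (exp (- (cmod (Complex a b))\<^sup>2) / pi) * indicator A (Complex a b) \<partial>lborel \<partial>lborel)"
    by (subst nn_integral_complex) auto
  also have "\<dots> = (\<integral>\<^sup>+a. ennreal (normal_density 0 (sqrt (1/2)) a) * (\<integral>\<^sup>+b. ennreal (normal_density 0 (sqrt (1/2)) b) * indicator A (Complex a b) \<partial>lborel) \<partial>lborel)"
    by (intro nn_integral_cong) (simp add: nd ennreal_mult mult.assoc nn_integral_cmult)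
  also have "\<dots> = (\<integral>\<^sup>+a. \<integral>\<^sup>+b. indicator A (Complex a b) \<partial>hnormal \<partial>hnormal)"
    unfolding hnormal_def by (simp add: nn_integral_density)
  also have "\<dots> = (\<integral>\<^sup>+z. indicator A ((\<lambda>(a, b). Complex a b) z) \<partial>(hnormal \<Otimes>\<^sub>M hnormal))"
    by (subst H.nn_integral_fst[symmetric]) auto
  also have "\<dots> = emeasure (distr (hnormal \<Otimes>\<^sub>M hnormal) borel (\<lambda>(a, b). Complex a b)) A"
    by (subst nn_integral_indicator[symmetric], simp, subst nn_integral_distr) auto
  finally show "emeasure cgauss A = \<dots>" .
qed simp

lemma prob_space_cgauss: "prob_space cgauss"
proof -
  interpret H: prob_space hnormal by (rule prob_space_hnormal)
  interpret P: pair_prob_space hnormal hnormal ..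
  show ?thesis unfolding cgauss_eq_distr by (rule P.prob_space_distr) simp
qed

lemma simulable_cgauss: "simulable cgauss"
proof -
  have "real_distribution hnormal" using prob_space_hnormal
    by (simp add: real_distribution_def real_distribution_axioms_def)
  then show ?thesis unfolding cgauss_eq_distr
    by (intro simulable_distr simulable_pair simulable_real_distribution) auto
qed

text \<open>Substituting \<open>m + w / sqrt q\<close> for \<open>z\<close> has Jacobian
  \<open>1 / q\<close> in two real dimensions.\<close>

lemma nn_integral_gauss_shift:
  assumes q: "0 < q"
  shows "(\<integral>\<^sup>+z. ennreal (exp (- q * (cmod (z - m))\<^sup>2) / pi) \<partial>lborel) = ennreal (1 / q)"
proof -
  have 1: "(\<integral>\<^sup>+z. ennreal (exp (- (cmod z)\<^sup>2) / pi) \<partial>lborel) = 1"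
    using prob_space.emeasure_space_1[OF prob_space_cgauss]
    by (simp add: cgauss_def emeasure_density)
  have "(\<integral>\<^sup>+z. ennreal (exp (- q * (cmod (z - m))\<^sup>2) / pi) \<partial>lborel)
     = (\<integral>\<^sup>+z. ennreal (exp (- q * (cmod (z - m))\<^sup>2) / pi) \<partial>density (distr lborel borel (\<lambda>x. m + (1 / sqrt q) *\<^sub>R x)) (\<lambda>_. ennreal (\<bar>1 / sqrt q\<bar>^DIM(complex))))"
    using q by (subst lborel_affine[of "1 / sqrt q" m]) auto
  also have "\<dots> = ennreal (1 / q) * (\<integral>\<^sup>+z. ennreal (exp (- q * (cmod ((1 / sqrt q) *\<^sub>R z))\<^sup>2) / pi) \<partial>lborel)"
    using q by (subst nn_integral_density) (auto simp: nn_integral_distr nn_integral_cmult power_divide)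
  also have "(\<lambda>z. ennreal (exp (- q * (cmod ((1 / sqrt q) *\<^sub>R z))\<^sup>2) / pi)) = (\<lambda>z. ennreal (exp (- (cmod z)\<^sup>2) / pi))"
    using q by (auto simp: fun_eq_iff power_divide norm_divide)
  finally show ?thesis using 1 by simp
qed

text \<open>Completing the square in \<open>z\<close>, including the exponent of the Gaussian
  density, leaves \<open>- q |z - m|^2\<close> with \<open>q = 1 + c^2 / 2\<close>. The term
  \<open>|t|^2 / (2 + c^2)\<close> is just what cancels the remainder, so the value does not depend
  on \<open>t\<close>: it is the constant expectation of an unnormalised likelihood ratio.\<close>

lemma cgauss_exp_quadratic:
  fixes c :: real and t :: complex
  shows "(\<integral>\<^sup>+z. ennreal (exp ((cmod t)\<^sup>2 / (2 + c\<^sup>2) - (cmod (t - c * z))\<^sup>2 / 2)) \<partial>cgauss) = ennreal (1 / (1 + c\<^sup>2 / 2))"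
proof -
  define q where "q = 1 + c\<^sup>2 / 2"
  have q: "q > 0" "2 + c\<^sup>2 = 2 * q" by (auto simp: q_def add_pos_nonneg)
  define m where "m = (c / (2 * q)) * t"
  have sq: "(cmod t)\<^sup>2 / (2 * q) - (cmod (t - c * z))\<^sup>2 / 2 - (cmod z)\<^sup>2 = - q * (cmod (z - m))\<^sup>2" for z :: complex
  proof -
    have 1: "(cmod (t - c * z))\<^sup>2 = (cmod t)\<^sup>2 - 2 * c * (Re t * Re z + Im t * Im z) + c\<^sup>2 * (cmod z)\<^sup>2"
      by (simp add: cmod_power2) (simp add: power2_eq_square algebra_simps)
    have 2: "(cmod (z - m))\<^sup>2 = (cmod z)\<^sup>2 - 2 * (c / (2 * q)) * (Re t * Re z + Im t * Im z) + (c / (2 * q))\<^sup>2 * (cmod t)\<^sup>2"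
      by (simp add: cmod_power2 m_def) (simp add: power2_eq_square algebra_simps add_divide_distrib)
    have c: "c\<^sup>2 = 2 * q - 2" by (simp add: q_def)
    have 3: "(c / (2 * q))\<^sup>2 = (q - 1) / (2 * q\<^sup>2)" using q by (simp add: power_divide c field_simps power2_eq_square)
    show ?thesis unfolding 1 2 3 c using q by (simp add: field_simps power2_eq_square)
  qed
  have "(\<integral>\<^sup>+z. ennreal (exp ((cmod t)\<^sup>2 / (2 + c\<^sup>2) - (cmod (t - c * z))\<^sup>2 / 2)) \<partial>cgauss)
    = (\<integral>\<^sup>+z. ennreal (exp (- q * (cmod (z - m))\<^sup>2) / pi) \<partial>lborel)"
    unfolding cgauss_def q(2)
  proof (subst nn_integral_density)
    have "exp (- (cmod z)\<^sup>2) / pi * exp ((cmod t)\<^sup>2 / (2 * q) - (cmod (t - c * z))\<^sup>2 / 2) = exp (- q * (cmod (z - m))\<^sup>2) / pi" for z :: complex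
      using sq[of z] by (simp add: mult_exp_exp)
    then show "(\<integral>\<^sup>+(z::complex). ennreal (exp (- (cmod z)\<^sup>2) / pi) * ennreal (exp ((cmod t)\<^sup>2 / (2 * q) - (cmod (t - c * z))\<^sup>2 / 2)) \<partial>lborel)
       = (\<integral>\<^sup>+z. ennreal (exp (- q * (cmod (z - m))\<^sup>2) / pi) \<partial>lborel)"
      by (intro nn_integral_cong) (simp add: ennreal_mult[symmetric])
  qed auto
  also have "\<dots> = ennreal (1 / q)" by (rule nn_integral_gauss_shift[OF q(1)])
  finally show ?thesis by (simp add: q_def)
qed

lemma hnormal_moments:
  "integrable hnormal (\<lambda>x. x)" "integral\<^sup>L hnormal (\<lambda>x. x) = 0"
  "integrable hnormal (\<lambda>x. x\<^sup>2)" "integral\<^sup>L hnormal (\<lambda>x. x\<^sup>2) = 1/2"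
  "integrable hnormal (\<lambda>x. x^4)"
proof -
  have s: "0 < sqrt (1/2::real)" by simp
  have "has_bochner_integral lborel (\<lambda>x. normal_density 0 (sqrt (1/2)) x * x) 0"
    using normal_moment_nz_1[OF s, of 0] by simp
  then show "integrable hnormal (\<lambda>x. x)" "integral\<^sup>L hnormal (\<lambda>x. x) = 0"
    by (auto simp: hnormal_def integrable_density integral_density has_bochner_integral_iff)
  have "has_bochner_integral lborel (\<lambda>x. normal_density 0 (sqrt (1/2)) x * x\<^sup>2) (1/2)"
    using normal_moment_even[OF s, of 0 1] by simp
  then show "integrable hnormal (\<lambda>x. x\<^sup>2)" "integral\<^sup>L hnormal (\<lambda>x. x\<^sup>2) = 1/2"
    by (auto simp: hnormal_def integrable_density integral_density has_bochner_integral_iff)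
  show "integrable hnormal (\<lambda>x. x^4)"
    using integrable_normal_moment[OF s, of 0 4] by (auto simp: hnormal_def integrable_density)
qed

lemma cgauss_moments:
  "integrable cgauss (\<lambda>z. z)" "integral\<^sup>L cgauss (\<lambda>z. z) = 0"
  "integrable cgauss (\<lambda>z. (cmod z)\<^sup>2)" "integral\<^sup>L cgauss (\<lambda>z. (cmod z)\<^sup>2) = 1"
  "integrable cgauss (\<lambda>z. (cmod z)^4)"
proof -
  interpret H: prob_space hnormal by (rule prob_space_hnormal)
  interpret P: pair_prob_space hnormal hnormal ..
  have F: "integrable (hnormal \<Otimes>\<^sub>M hnormal) (\<lambda>x. f (fst x)) \<and> integral\<^sup>L (hnormal \<Otimes>\<^sub>M hnormal) (\<lambda>x. f (fst x)) = integral\<^sup>L hnormal f"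
    "integrable (hnormal \<Otimes>\<^sub>M hnormal) (\<lambda>x. f (snd x)) \<and> integral\<^sup>L (hnormal \<Otimes>\<^sub>M hnormal) (\<lambda>x. f (snd x)) = integral\<^sup>L hnormal f"
    if "integrable hnormal f" for f :: "real \<Rightarrow> real"
  proof -
    have [measurable]: "f \<in> borel_measurable hnormal" using that by auto
    have 1: "distr (hnormal \<Otimes>\<^sub>M hnormal) hnormal fst = hnormal" by (rule H.distr_pair_fst)
    have 2: "distr (hnormal \<Otimes>\<^sub>M hnormal) hnormal snd = hnormal"
      using arg_cong[OF P.distr_pair_swap, of "\<lambda>m. distr m hnormal fst"]
      by (subst (asm) distr_distr) (auto simp: comp_def split_beta' 1)
    show "integrable (hnormal \<Otimes>\<^sub>M hnormal) (\<lambda>x. f (fst x)) \<and> integral\<^sup>L (hnormal \<Otimes>\<^sub>M hnormal) (\<lambda>x. f (fst x)) = integral\<^sup>L hnormal f"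
      using integrable_distr_eq[of fst "hnormal \<Otimes>\<^sub>M hnormal" hnormal f] integral_distr[of fst "hnormal \<Otimes>\<^sub>M hnormal" hnormal f] that
      by (simp add: 1)
    show "integrable (hnormal \<Otimes>\<^sub>M hnormal) (\<lambda>x. f (snd x)) \<and> integral\<^sup>L (hnormal \<Otimes>\<^sub>M hnormal) (\<lambda>x. f (snd x)) = integral\<^sup>L hnormal f"
      using integrable_distr_eq[of snd "hnormal \<Otimes>\<^sub>M hnormal" hnormal f] integral_distr[of snd "hnormal \<Otimes>\<^sub>M hnormal" hnormal f] that
      by (simp add: 2)
  qed
  note m = hnormal_moments
  have D: "integrable cgauss g \<longleftrightarrow> integrable (hnormal \<Otimes>\<^sub>M hnormal) (\<lambda>x. g (Complex (fst x) (snd x)))"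
    "integral\<^sup>L cgauss g = integral\<^sup>L (hnormal \<Otimes>\<^sub>M hnormal) (\<lambda>x. g (Complex (fst x) (snd x)))"
    if "g \<in> borel_measurable borel" for g :: "complex \<Rightarrow> 'b :: {banach, second_countable_topology}"
    unfolding cgauss_eq_distr using that
    by (subst integrable_distr_eq integral_distr; auto simp: split_beta')+
  have "has_bochner_integral (hnormal \<Otimes>\<^sub>M hnormal) (\<lambda>x. of_real (fst x) + \<i> * of_real (snd x)) (of_real 0 + \<i> * of_real 0)"
    by (intro has_bochner_integral_add has_bochner_integral_mult_right has_bochner_integral_of_real)
       (use F[OF m(1)] m(2) in \<open>auto simp: has_bochner_integral_iff\<close>)
  then show "integrable cgauss (\<lambda>z. z)" "integral\<^sup>L cgauss (\<lambda>z. z) = 0"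
    by (auto simp: D has_bochner_integral_iff Complex_eq)
  have "has_bochner_integral (hnormal \<Otimes>\<^sub>M hnormal) (\<lambda>x. (fst x)\<^sup>2 + (snd x)\<^sup>2) (1/2 + 1/2)"
    by (intro has_bochner_integral_add)
       (use F[OF m(3)] m(4) in \<open>auto simp: has_bochner_integral_iff\<close>)
  then show "integrable cgauss (\<lambda>z. (cmod z)\<^sup>2)" "integral\<^sup>L cgauss (\<lambda>z. (cmod z)\<^sup>2) = 1"
    by (auto simp: D has_bochner_integral_iff cmod_power2)
  \<comment> \<open>The square of a sum is at most twice the sum of the squares; for the fourth
    moment only finiteness is at stake.\<close>
  have 4: "(cmod (Complex a b))^4 \<le> 2 * a^4 + 2 * b^4" for a b
  proof -
    have "(cmod (Complex a b))^4 = (a\<^sup>2 + b\<^sup>2)\<^sup>2"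
      by (simp add: cmod_power2[of "Complex a b", simplified, symmetric] power_mult[symmetric] del: complex_norm)
    also have "\<dots> = 2 * (a\<^sup>2)\<^sup>2 + 2 * (b\<^sup>2)\<^sup>2 - (a\<^sup>2 - b\<^sup>2)\<^sup>2" by (simp add: power2_eq_square algebra_simps)
    also have "\<dots> \<le> 2 * a^4 + 2 * b^4" by (simp add: power_mult[symmetric])
    finally show ?thesis .
  qed
  have "integrable (hnormal \<Otimes>\<^sub>M hnormal) (\<lambda>x. (cmod (Complex (fst x) (snd x)))^4)"
  proof (rule Bochner_Integration.integrable_bound)
    show "integrable (hnormal \<Otimes>\<^sub>M hnormal) (\<lambda>x. 2 * (fst x)^4 + 2 * (snd x)^4)"
      using F[OF m(5)] by auto
    show "AE x in hnormal \<Otimes>\<^sub>M hnormal. norm ((cmod (Complex (fst x) (snd x)))^4) \<le> norm (2 * (fst x)^4 + 2 * (snd x)^4)"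
      using 4 by (auto simp del: complex_norm)
  qed (auto simp: Complex_eq)
  then show "integrable cgauss (\<lambda>z. (cmod z)^4)" by (subst D) auto
qed

section \<open>Product measures\<close>

text \<open>Chebyshev's inequality for the centred sum. By independence the mixed products of
  centred variables have expectation 0, and each variance is at most the second moment, hence at
  most \<open>V\<close>.\<close>

lemma (in prob_space) indep_sum_lower_tail:
  fixes X :: "'i \<Rightarrow> 'a \<Rightarrow> real"
  assumes S: "finite S" and ind: "indep_vars (\<lambda>_. borel) X S"
    and sq: "\<And>l. l \<in> S \<Longrightarrow> integrable M (\<lambda>x. (X l x)\<^sup>2)"
    and V: "\<And>l. l \<in> S \<Longrightarrow> expectation (\<lambda>x. (X l x)\<^sup>2) \<le> V"
    and c: "0 < c"
  shows "prob {x \<in> space M. (\<Sum>l\<in>S. X l x) \<le> (\<Sum>l\<in>S. expectation (X l)) - c} \<le> real (card S) * V / c\<^sup>2"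
proof -
  have rv[measurable]: "\<And>l. l \<in> S \<Longrightarrow> X l \<in> borel_measurable M"
    using ind by (auto simp: indep_vars_def)
  have int: "integrable M (X l)" if "l \<in> S" for l
    using square_integrable_imp_integrable[OF rv sq] that by auto
  define Y where "Y l x = X l x - expectation (X l)" for l x
  have intY: "integrable M (Y l)" if "l \<in> S" for l using int[OF that] by (simp add: Y_def[abs_def])
  have EY: "expectation (Y l) = 0" if "l \<in> S" for l using int[OF that] by (simp add: Y_def[abs_def] prob_space)
  have YYi: "integrable M (\<lambda>x. Y l x * Y m x)" and YY: "expectation (\<lambda>x. Y l x * Y m x) \<le> (if l = m then V else 0)" if lm: "l \<in> S" "m \<in> S" for l m
  proof -
    have "integrable M (\<lambda>x. Y l x * Y m x) \<and> expectation (\<lambda>x. Y l x * Y m x) \<le> (if l = m then V else 0)"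
    proof (cases "l = m")
      case True
      have eq: "(\<lambda>x. Y l x * Y l x) = (\<lambda>x. (X l x)\<^sup>2 - (2 * expectation (X l)) * X l x + (expectation (X l))\<^sup>2)"
        by (simp add: Y_def power2_eq_square algebra_simps)
      have "integrable M (\<lambda>x. Y l x * Y l x)" unfolding eq using lm int sq by auto
      moreover have "expectation (\<lambda>x. Y l x * Y l x) = expectation (\<lambda>x. (X l x)\<^sup>2) - (expectation (X l))\<^sup>2"
        unfolding eq using lm int sq by (simp add: prob_space power2_eq_square)
      ultimately show ?thesis using True by (auto intro!: order_trans[OF _ V[OF lm(2)]])
    next
      case False
      have "indep_vars (\<lambda>_. borel) X {l, m}" using ind lm by (auto intro: indep_vars_subset)
      then have iv: "indep_vars (\<lambda>_. borel) Y {l, m}"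
        unfolding Y_def[abs_def] by (rule indep_vars_compose2) auto
      have "integrable M (\<lambda>x. \<Prod>i\<in>{l,m}. Y i x)" using intY lm by (intro indep_vars_integrable iv) auto
      moreover have "expectation (\<lambda>x. \<Prod>i\<in>{l,m}. Y i x) = (\<Prod>i\<in>{l,m}. expectation (Y i))"
        using intY lm by (intro indep_vars_lebesgue_integral iv) auto
      ultimately show ?thesis using False EY lm by simp
    qed
    then show "integrable M (\<lambda>x. Y l x * Y m x)" "expectation (\<lambda>x. Y l x * Y m x) \<le> (if l = m then V else 0)" by auto
  qed
  let ?W = "\<lambda>x. \<Sum>l\<in>S. Y l x"
  have W2: "(\<lambda>x. (?W x)\<^sup>2) = (\<lambda>x. \<Sum>l\<in>S. \<Sum>m\<in>S. Y l x * Y m x)"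
    by (simp add: power2_eq_square sum_product)
  have iW: "integrable M (\<lambda>x. (?W x)\<^sup>2)" unfolding W2 by (intro Bochner_Integration.integrable_sum YYi)
  have "expectation (\<lambda>x. (?W x)\<^sup>2) = (\<Sum>l\<in>S. \<Sum>m\<in>S. expectation (\<lambda>x. Y l x * Y m x))"
    unfolding W2 using YYi by (subst Bochner_Integration.integral_sum; auto)+
  also have "\<dots> \<le> (\<Sum>l\<in>S. \<Sum>m\<in>S. if l = m then V else 0)" by (intro sum_mono YY)
  also have "\<dots> = real (card S) * V" using S by simp
  finally have EW2: "expectation (\<lambda>x. (?W x)\<^sup>2) \<le> real (card S) * V" .
  have EW: "expectation ?W = 0" using intY EY by (subst Bochner_Integration.integral_sum) auto
  have mW: "?W \<in> borel_measurable M" unfolding Y_def by measurable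
  have "prob {x \<in> space M. (\<Sum>l\<in>S. X l x) \<le> (\<Sum>l\<in>S. expectation (X l)) - c} \<le> prob {x \<in> space M. \<bar>?W x - expectation ?W\<bar> \<ge> c}"
    unfolding EW using mW by (intro finite_measure_mono) (auto simp: Y_def sum_subtractf)
  also have "\<dots> \<le> expectation (\<lambda>x. (?W x)\<^sup>2) / c\<^sup>2"
    using Chebyshev_inequality[OF mW iW c] by (simp add: EW)
  also have "\<dots> \<le> real (card S) * V / c\<^sup>2" using EW2 by (intro divide_right_mono) auto
  finally show ?thesis .
qed

text \<open>Functions of disjoint blocks of independent coordinates are independent, so the previous
  bound applies to them. Over an empty index set the space is a single point, where the sum is at
  least \<open>card S * m\<close>, and the event is empty.\<close>

lemma PiM_block_lower_tail:
  fixes f :: "'l \<Rightarrow> ('i \<Rightarrow> 'a) \<Rightarrow> real"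
  assumes "finite S" and M: "\<And>i. i \<in> I \<Longrightarrow> prob_space (M i)"
    and J: "\<And>l. l \<in> S \<Longrightarrow> J l \<subseteq> I" and disj: "disjoint_family_on J S"
    and f: "\<And>l. l \<in> S \<Longrightarrow> f l \<in> borel_measurable (PiM (J l) M)"
    and sq: "\<And>l. l \<in> S \<Longrightarrow> integrable (PiM I M) (\<lambda>x. (f l (restrict x (J l)))\<^sup>2)"
    and V: "\<And>l. l \<in> S \<Longrightarrow> (\<integral>x. (f l (restrict x (J l)))\<^sup>2 \<partial>PiM I M) \<le> V"
    and m: "\<And>l. l \<in> S \<Longrightarrow> m \<le> (\<integral>x. f l (restrict x (J l)) \<partial>PiM I M)"
    and c: "0 < c"
  shows "measure (PiM I M) {x \<in> space (PiM I M). (\<Sum>l\<in>S. f l (restrict x (J l))) \<le> real (card S) * m - c} \<le> real (card S) * V / c\<^sup>2"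
proof (cases "I = {}")
  case False
  interpret prob_space "PiM I M" by (intro prob_space_PiM M)
  have "indep_vars M (\<lambda>i x. x i) I" by (intro indep_vars_PiM_coordinates M False)
  then have "indep_vars (\<lambda>l. PiM (J l) M) (\<lambda>l x. restrict (\<lambda>i. x i) (J l)) S"
    by (rule indep_vars_restrict) (use J disj in auto)
  then have ind: "indep_vars (\<lambda>_. borel) (\<lambda>l x. f l (restrict x (J l))) S"
    by (rule indep_vars_compose2) (use f in auto)
  then have [measurable]: "\<And>l. l \<in> S \<Longrightarrow> (\<lambda>x. f l (restrict x (J l))) \<in> borel_measurable (PiM I M)"
    by (auto simp: indep_vars_def)
  have "real (card S) * m \<le> (\<Sum>l\<in>S. expectation (\<lambda>x. f l (restrict x (J l))))"
    using sum_mono[of S "\<lambda>_. m", OF m] by simp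
  then have "measure (PiM I M) {x \<in> space (PiM I M). (\<Sum>l\<in>S. f l (restrict x (J l))) \<le> real (card S) * m - c}
    \<le> measure (PiM I M) {x \<in> space (PiM I M). (\<Sum>l\<in>S. f l (restrict x (J l))) \<le> (\<Sum>l\<in>S. expectation (\<lambda>x. f l (restrict x (J l)))) - c}"
    by (intro finite_measure_mono) auto
  also have "\<dots> \<le> real (card S) * V / c\<^sup>2"
    by (intro indep_sum_lower_tail ind sq V c \<open>finite S\<close>)
  finally show ?thesis .
next
  case True
  then have J0: "J l = {}" if "l \<in> S" for l using J that by auto
  interpret prob_space "PiM I M" by (intro prob_space_PiM M)
  have sp: "space (PiM I M) = {\<lambda>_. undefined}" using True by (simp add: space_PiM)
  have E: "(\<integral>x. g x \<partial>PiM I M) = g (\<lambda>_. undefined)" for g :: "('i \<Rightarrow> 'a) \<Rightarrow> real"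
  proof -
    have "(\<integral>x. g x \<partial>PiM I M) = (\<integral>x. g (\<lambda>_. undefined) \<partial>PiM I M)"
      by (intro Bochner_Integration.integral_cong) (auto simp: sp)
    then show ?thesis by (simp add: prob_space)
  qed
  have "real (card S) * m \<le> (\<Sum>l\<in>S. f l (\<lambda>_. undefined))"
    using sum_mono[of S "\<lambda>_. m" "\<lambda>l. f l (\<lambda>_. undefined)"] m by (simp add: E J0 restrict_def prob_space)
  then have e: "{x \<in> space (PiM I M). (\<Sum>l\<in>S. f l (restrict x (J l))) \<le> real (card S) * m - c} = {}"
    using c by (auto simp: sp J0 restrict_def)
  have "0 \<le> V" if "l \<in> S" for l using V[OF that] by (simp add: E prob_space) (meson order_trans zero_le_power2)
  then have "0 \<le> real (card S) * V" by (cases "S = {}") auto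
  then show ?thesis unfolding e by simp
qed

text \<open>A rectangle pulls back to a product of two rectangles: the old coordinates in
  \<open>J\<close> become free and their constraints pass to the new ones, which have the same laws.
  In this way real messages and phases are planted into a simulated network without disturbing its
  law.\<close>

lemma distr_PiM_replace:
  assumes I: "finite I" and A: "finite A" and M: "\<And>i. i \<in> I \<Longrightarrow> prob_space (M i)" and P: "\<And>a. a \<in> A \<Longrightarrow> prob_space (P a)"
    and J: "J \<subseteq> I" and \<sigma>: "inj_on \<sigma> J" "\<sigma> ` J \<subseteq> A" "\<And>i. i \<in> J \<Longrightarrow> P (\<sigma> i) = M i"
  defines "r \<equiv> (\<lambda>(x, y). \<lambda>i\<in>I. if i \<in> J then y (\<sigma> i) else x i)"
  shows "r \<in> measurable (PiM I M \<Otimes>\<^sub>M PiM A P) (PiM I M)"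
    and "distr (PiM I M \<Otimes>\<^sub>M PiM A P) (PiM I M) r = PiM I M"
proof -
  interpret Pa: prob_space "PiM A P" by (intro prob_space_PiM P)
  have c: "(\<lambda>z. if i \<in> J then snd z (\<sigma> i) else fst z i) \<in> measurable (PiM I M \<Otimes>\<^sub>M PiM A P) (M i)" if "i \<in> I" for i
  proof (cases "i \<in> J")
    case True
    have "(\<lambda>z. snd z (\<sigma> i)) \<in> measurable (PiM I M \<Otimes>\<^sub>M PiM A P) (P (\<sigma> i))"
      using True \<sigma> by (intro measurable_compose[OF measurable_snd measurable_component_singleton]) auto
    then show ?thesis using True \<sigma>(3)[OF True] by simp
  qed (use that in \<open>simp add: measurable_compose[OF measurable_fst measurable_component_singleton]\<close>)
  show rm: "r \<in> measurable (PiM I M \<Otimes>\<^sub>M PiM A P) (PiM I M)"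
    unfolding r_def split_beta' by (intro measurable_restrict c)
  show "distr (PiM I M \<Otimes>\<^sub>M PiM A P) (PiM I M) r = PiM I M"
  proof (rule PiM_eqI_prob[OF I M])
    fix E assume E: "\<And>i. i \<in> I \<Longrightarrow> E i \<in> sets (M i)"
    define E1 where "E1 i = (if i \<in> J then space (M i) else E i)" for i
    define E2 where "E2 a = (if a \<in> \<sigma> ` J then E (the_inv_into J \<sigma> a) else space (P a))" for a
    have inv: "the_inv_into J \<sigma> (\<sigma> i) = i" if "i \<in> J" for i using that \<sigma> by (simp add: the_inv_into_f_f)
    have E2J: "E2 (\<sigma> i) = E i" if "i \<in> J" for i using that by (simp add: E2_def inv)
    have E1s: "E1 i \<in> sets (M i)" if "i \<in> I" for i using E that by (auto simp: E1_def)
    have E2s: "E2 a \<in> sets (P a)" if "a \<in> A" for a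
      using E J \<sigma> that inv by (auto simp: E2_def)
    have vim: "r -` Pi\<^sub>E I E \<inter> space (PiM I M \<Otimes>\<^sub>M PiM A P) = Pi\<^sub>E I E1 \<times> Pi\<^sub>E A E2"
    proof (intro set_eqI iffI)
      fix z assume z: "z \<in> r -` Pi\<^sub>E I E \<inter> space (PiM I M \<Otimes>\<^sub>M PiM A P)"
      obtain x y where [simp]: "z = (x, y)" by (cases z)
      have *: "(if i \<in> J then y (\<sigma> i) else x i) \<in> E i" if "i \<in> I" for i
        using z that by (auto simp: r_def PiE_iff)
      have "x i \<in> E1 i" if "i \<in> I" for i using z *[OF that] that by (auto simp: space_pair_measure space_PiM PiE_iff E1_def)
      then have "x \<in> Pi\<^sub>E I E1" using z by (auto simp: space_pair_measure space_PiM PiE_iff)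
      moreover have "y \<in> Pi\<^sub>E A E2"
      proof -
        have "y a \<in> E2 a" if "a \<in> A" for a
        proof (cases "a \<in> \<sigma> ` J")
          case True then obtain i where i: "i \<in> J" "a = \<sigma> i" by auto
          then show ?thesis using *[of i] J by (auto simp: E2J)
        qed (use z that in \<open>auto simp: space_pair_measure space_PiM PiE_iff E2_def\<close>)
        then show ?thesis using z by (auto simp: space_pair_measure space_PiM PiE_iff)
      qed
      ultimately show "z \<in> Pi\<^sub>E I E1 \<times> Pi\<^sub>E A E2" by simp
    next
      fix z assume z: "z \<in> Pi\<^sub>E I E1 \<times> Pi\<^sub>E A E2"
      obtain x y where [simp]: "z = (x, y)" by (cases z)
      have "(if i \<in> J then y (\<sigma> i) else x i) \<in> E i" if "i \<in> I" for i
      proof (cases "i \<in> J")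
        case True
        then have "\<sigma> i \<in> A" using \<sigma> by auto
        then show ?thesis using z True E2J[OF True] by (auto simp: PiE_iff)
      next
        case False then show ?thesis using z that by (auto simp: PiE_iff E1_def dest!: bspec[of I _ i])
      qed
      moreover have "x \<in> space (PiM I M)" "y \<in> space (PiM A P)"
        using z E1s[THEN sets.sets_into_space] E2s[THEN sets.sets_into_space] by (auto simp: space_PiM PiE_iff subset_eq)
      ultimately show "z \<in> r -` Pi\<^sub>E I E \<inter> space (PiM I M \<Otimes>\<^sub>M PiM A P)"
        by (auto simp: r_def PiE_iff space_pair_measure)
    qed
    have "emeasure (distr (PiM I M \<Otimes>\<^sub>M PiM A P) (PiM I M) r) (Pi\<^sub>E I E) = emeasure (PiM I M) (Pi\<^sub>E I E1) * emeasure (PiM A P) (Pi\<^sub>E A E2)"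
      using E E1s E2s I A by (subst emeasure_distr[OF rm]) (auto simp: vim Pa.emeasure_pair_measure_Times intro!: sets_PiM_I_finite)
    also have "emeasure (PiM I M) (Pi\<^sub>E I E1) = (\<Prod>i\<in>I. emeasure (M i) (E1 i))"
      by (rule emeasure_PiM_PiE[OF I M E1s])
    also have "\<dots> = (\<Prod>i\<in>I - J. emeasure (M i) (E1 i)) * (\<Prod>i\<in>J. emeasure (M i) (E1 i))"
      using I J by (simp add: prod.subset_diff)
    also have "(\<Prod>i\<in>J. emeasure (M i) (E1 i)) = 1"
      using M J by (intro prod.neutral) (auto simp: E1_def prob_space.emeasure_space_1)
    also have "(\<Prod>i\<in>I - J. emeasure (M i) (E1 i)) = (\<Prod>i\<in>I - J. emeasure (M i) (E i))"
      by (intro prod.cong) (auto simp: E1_def)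
    also have "emeasure (PiM A P) (Pi\<^sub>E A E2) = (\<Prod>a\<in>A. emeasure (P a) (E2 a))"
      by (rule emeasure_PiM_PiE[OF A P E2s])
    also have "\<dots> = (\<Prod>a\<in>\<sigma> ` J. emeasure (P a) (E2 a))"
      using A \<sigma> P by (intro prod.mono_neutral_right) (auto simp: E2_def prob_space.emeasure_space_1)
    also have "\<dots> = (\<Prod>i\<in>J. emeasure (M i) (E i))"
      using \<sigma> by (subst prod.reindex) (auto intro!: prod.cong simp: E2J)
    finally show "emeasure (distr (PiM I M \<Otimes>\<^sub>M PiM A P) (PiM I M) r) (Pi\<^sub>E I E) = (\<Prod>i\<in>I. emeasure (M i) (E i))"
      using I J by (simp add: prod.subset_diff[of J I])
  qed auto
qed

lemma nn_integral_PiM_replace: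
  assumes I: "finite I" and A: "finite A" and M: "\<And>i. i \<in> I \<Longrightarrow> prob_space (M i)" and P: "\<And>a. a \<in> A \<Longrightarrow> prob_space (P a)"
    and J: "J \<subseteq> I" and \<sigma>: "inj_on \<sigma> J" "\<sigma> ` J \<subseteq> A" "\<And>i. i \<in> J \<Longrightarrow> P (\<sigma> i) = M i"
    and h[measurable]: "h \<in> borel_measurable (PiM I M)"
  shows "(\<integral>\<^sup>+x. \<integral>\<^sup>+y. h (\<lambda>i\<in>I. if i \<in> J then y (\<sigma> i) else x i) \<partial>PiM A P \<partial>PiM I M) = (\<integral>\<^sup>+x. h x \<partial>PiM I M)"
    and "(\<integral>\<^sup>+y. \<integral>\<^sup>+x. h (\<lambda>i\<in>I. if i \<in> J then y (\<sigma> i) else x i) \<partial>PiM I M \<partial>PiM A P) = (\<integral>\<^sup>+x. h x \<partial>PiM I M)"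
proof -
  interpret Pa: prob_space "PiM A P" by (intro prob_space_PiM P)
  interpret Pi: prob_space "PiM I M" by (intro prob_space_PiM M)
  interpret PP: pair_sigma_finite "PiM I M" "PiM A P" ..
  note r = distr_PiM_replace[where I=I and A=A and M=M and P=P and J=J and \<sigma>=\<sigma>, OF I A M P J \<sigma>]
  let ?r = "\<lambda>(x, y). \<lambda>i\<in>I. if i \<in> J then y (\<sigma> i) else x i"
  have hr: "(\<lambda>z. h (?r z)) \<in> borel_measurable (PiM I M \<Otimes>\<^sub>M PiM A P)"
    by (rule measurable_compose[OF r(1) h])
  have "(\<integral>\<^sup>+x. h x \<partial>PiM I M) = (\<integral>\<^sup>+z. h (?r z) \<partial>(PiM I M \<Otimes>\<^sub>M PiM A P))"
    using nn_integral_distr[OF r(1), of h] r(2) by simp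
  then show "(\<integral>\<^sup>+x. \<integral>\<^sup>+y. h (\<lambda>i\<in>I. if i \<in> J then y (\<sigma> i) else x i) \<partial>PiM A P \<partial>PiM I M) = (\<integral>\<^sup>+x. h x \<partial>PiM I M)"
    and "(\<integral>\<^sup>+y. \<integral>\<^sup>+x. h (\<lambda>i\<in>I. if i \<in> J then y (\<sigma> i) else x i) \<partial>PiM I M \<partial>PiM A P) = (\<integral>\<^sup>+x. h x \<partial>PiM I M)"
    using Pa.nn_integral_fst[OF hr] PP.nn_integral_snd[OF hr] by simp_all
qed

text \<open>The seed \<open>x p\<close> is independent of the remaining coordinates, and so is
  everything simulated from it. Both orders of integration occur: the reduction to the Z channel has
  the simulated part outermost, the analysis of the aligned code has the phases outermost.\<close>

lemma nn_integral_PiM_split_off: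
  assumes I: "finite I" "p \<in> I" and M: "prob_space M" and g: "g \<in> measurable M \<nu>" "distr M \<nu> g = \<nu>"
    and H[measurable]: "case_prod H \<in> borel_measurable (\<nu> \<Otimes>\<^sub>M PiM (I - {p}) (\<lambda>_. M))"
  shows "(\<integral>\<^sup>+x. H (g (x p)) (restrict x (I - {p})) \<partial>PiM I (\<lambda>_. M)) = (\<integral>\<^sup>+u. \<integral>\<^sup>+x. H u x \<partial>PiM (I - {p}) (\<lambda>_. M) \<partial>\<nu>)"
    and "(\<integral>\<^sup>+x. H (g (x p)) (restrict x (I - {p})) \<partial>PiM I (\<lambda>_. M)) = (\<integral>\<^sup>+x. \<integral>\<^sup>+u. H u x \<partial>\<nu> \<partial>PiM (I - {p}) (\<lambda>_. M))"
proof -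
  interpret M: prob_space M by (rule M)
  interpret product_prob_space "\<lambda>_. M" "I - {p}" by (intro product_prob_spaceI M)
  interpret \<nu>: prob_space \<nu> using M.prob_space_distr[OF g(1)] g(2) by simp
  interpret Q: prob_space "PiM (I - {p}) (\<lambda>_. M)" by (intro prob_space_PiM M)
  interpret PP: pair_sigma_finite \<nu> "PiM (I - {p}) (\<lambda>_. M)" ..
  have ins: "insert p (I - {p}) = I" using I by auto
  note g(1)[measurable]
  have mf: "(\<lambda>x. H (g (x p)) (restrict x (I - {p}))) \<in> borel_measurable (PiM I (\<lambda>_. M))"
  proof -
    have "(\<lambda>x. (g (x p), restrict x (I - {p}))) \<in> measurable (PiM I (\<lambda>_. M)) (\<nu> \<Otimes>\<^sub>M PiM (I - {p}) (\<lambda>_. M))"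
      using I by (intro measurable_Pair measurable_compose[OF measurable_component_singleton[of p I "\<lambda>_. M"] g(1)] measurable_restrict_subset) auto
    from measurable_compose[OF this H] show ?thesis by simp
  qed
  have "(\<integral>\<^sup>+x. H (g (x p)) (restrict x (I - {p})) \<partial>PiM I (\<lambda>_. M)) =
    (\<integral>\<^sup>+y. \<integral>\<^sup>+x. H (g ((x(p := y)) p)) (restrict (x(p := y)) (I - {p})) \<partial>PiM (I - {p}) (\<lambda>_. M) \<partial>M)"
    using product_nn_integral_insert_rev[of "I - {p}" p "\<lambda>x. H (g (x p)) (restrict x (I - {p}))"] mf I unfolding ins by simp
  also have "\<dots> = (\<integral>\<^sup>+y. \<integral>\<^sup>+x. H (g y) x \<partial>PiM (I - {p}) (\<lambda>_. M) \<partial>M)"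
  proof (intro nn_integral_cong)
    fix y x assume "x \<in> space (PiM (I - {p}) (\<lambda>_. M))"
    then have "restrict (x(p := y)) (I - {p}) = x" by (auto simp: space_PiM PiE_iff extensional_def fun_eq_iff)
    then show "H (g ((x(p := y)) p)) (restrict (x(p := y)) (I - {p})) = H (g y) x" by simp
  qed
  also have "\<dots> = (\<integral>\<^sup>+u. \<integral>\<^sup>+x. H u x \<partial>PiM (I - {p}) (\<lambda>_. M) \<partial>distr M \<nu> g)"
    using P.borel_measurable_nn_integral_fst[OF H] by (subst nn_integral_distr[OF g(1)]) (auto simp: g(2))
  finally show 1: "(\<integral>\<^sup>+x. H (g (x p)) (restrict x (I - {p})) \<partial>PiM I (\<lambda>_. M)) = (\<integral>\<^sup>+u. \<integral>\<^sup>+x. H u x \<partial>PiM (I - {p}) (\<lambda>_. M) \<partial>\<nu>)"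
    unfolding g(2) .
  show "(\<integral>\<^sup>+x. H (g (x p)) (restrict x (I - {p})) \<partial>PiM I (\<lambda>_. M)) = (\<integral>\<^sup>+x. \<integral>\<^sup>+u. H u x \<partial>\<nu> \<partial>PiM (I - {p}) (\<lambda>_. M))"
    unfolding 1 using PP.Fubini'[OF H] by simp
qed

text \<open>Codebook and noise are both i.i.d. standard Gaussian. Over the disjoint sum of their
  index sets they become a single Gaussian family, to which the moment bounds for linear forms
  apply.\<close>

lemma nn_integral_PiM_Plus:
  assumes A: "finite A" and B: "finite B" and Q: "prob_space Q"
    and h[measurable]: "case_prod h \<in> borel_measurable (PiM A (\<lambda>_. Q) \<Otimes>\<^sub>M PiM B (\<lambda>_. Q))"
  shows "(\<integral>\<^sup>+x. \<integral>\<^sup>+y. h x y \<partial>PiM B (\<lambda>_. Q) \<partial>PiM A (\<lambda>_. Q)) =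
     (\<integral>\<^sup>+z. h (\<lambda>a\<in>A. z (Inl a)) (\<lambda>b\<in>B. z (Inr b)) \<partial>PiM (A <+> B) (\<lambda>_. Q))"
proof -
  interpret Pb: prob_space "PiM B (\<lambda>_. Q)" by (intro prob_space_PiM Q)
  let ?r = "\<lambda>(x, y). \<lambda>i\<in>A <+> B. case i of Inl a \<Rightarrow> x a | Inr b \<Rightarrow> y b"
  let ?PP = "PiM A (\<lambda>_. Q) \<Otimes>\<^sub>M PiM B (\<lambda>_. Q)"
  let ?R = "PiM (A <+> B) (\<lambda>_. Q)"
  have rm: "?r \<in> measurable ?PP ?R"
    unfolding split_beta' by (intro measurable_restrict)
     (auto split: sum.split intro!: measurable_compose[OF measurable_fst] measurable_compose[OF measurable_snd] measurable_component_singleton)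
  have eq: "distr ?PP ?R ?r = ?R"
  proof (rule PiM_eqI_prob)
    fix E assume E: "\<And>i. i \<in> A <+> B \<Longrightarrow> E i \<in> sets Q"
    have vim: "?r -` Pi\<^sub>E (A <+> B) E \<inter> space ?PP = Pi\<^sub>E A (\<lambda>a. E (Inl a)) \<times> Pi\<^sub>E B (\<lambda>b. E (Inr b))"
      using E[THEN sets.sets_into_space]
      by (auto simp: space_pair_measure space_PiM PiE_iff split: sum.splits) blast+
    have "emeasure (distr ?PP ?R ?r) (Pi\<^sub>E (A <+> B) E) = (\<Prod>a\<in>A. emeasure Q (E (Inl a))) * (\<Prod>b\<in>B. emeasure Q (E (Inr b)))"
    proof -
      have "Pi\<^sub>E A (\<lambda>a. E (Inl a)) \<in> sets (PiM A (\<lambda>_. Q))" "Pi\<^sub>E B (\<lambda>b. E (Inr b)) \<in> sets (PiM B (\<lambda>_. Q))"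
        using E A B by (auto intro!: sets_PiM_I_finite)
      moreover have "Pi\<^sub>E (A <+> B) E \<in> sets ?R" using E A B by (intro sets_PiM_I_finite) auto
      ultimately show ?thesis
        using E A B Q by (subst emeasure_distr[OF rm])
          (auto simp: vim Pb.emeasure_pair_measure_Times intro!: arg_cong2[where f="(*)"] emeasure_PiM_PiE)
    qed
    also have "\<dots> = (\<Prod>i\<in>A <+> B. emeasure Q (E i))"
      using A B by (simp add: prod.Plus)
    finally show "emeasure (distr ?PP ?R ?r) (Pi\<^sub>E (A <+> B) E) = \<dots>" .
  qed (use A B Q in auto)
  have m: "(\<lambda>z. h (\<lambda>a\<in>A. z (Inl a)) (\<lambda>b\<in>B. z (Inr b))) \<in> borel_measurable ?R"
  proof -
    have "(\<lambda>z. (\<lambda>a\<in>A. z (Inl a), \<lambda>b\<in>B. z (Inr b))) \<in> measurable ?R ?PP"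
      by (intro measurable_Pair measurable_restrict measurable_component_singleton) auto
    from measurable_compose[OF this h] show ?thesis by simp
  qed
  have "(\<integral>\<^sup>+z. h (\<lambda>a\<in>A. z (Inl a)) (\<lambda>b\<in>B. z (Inr b)) \<partial>?R) = (\<integral>\<^sup>+z. h (\<lambda>a\<in>A. z (Inl a)) (\<lambda>b\<in>B. z (Inr b)) \<partial>distr ?PP ?R ?r)"
    unfolding eq ..
  also have "\<dots> = (\<integral>\<^sup>+z. h (\<lambda>a\<in>A. ?r z (Inl a)) (\<lambda>b\<in>B. ?r z (Inr b)) \<partial>?PP)"
    by (rule nn_integral_distr[OF rm]) (use m in simp)
  also have "\<dots> = (\<integral>\<^sup>+z. h (fst z) (snd z) \<partial>?PP)"
  proof (intro nn_integral_cong)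
    fix z assume "z \<in> space ?PP"
    then have "(\<lambda>a\<in>A. ?r z (Inl a)) = fst z" "(\<lambda>b\<in>B. ?r z (Inr b)) = snd z"
      by (auto simp: space_pair_measure space_PiM PiE_iff extensional_def fun_eq_iff)
    then show "h (\<lambda>a\<in>A. ?r z (Inl a)) (\<lambda>b\<in>B. ?r z (Inr b)) = h (fst z) (snd z)" by simp
  qed
  also have "\<dots> = (\<integral>\<^sup>+x. \<integral>\<^sup>+y. h x y \<partial>PiM B (\<lambda>_. Q) \<partial>PiM A (\<lambda>_. Q))"
    using Pb.nn_integral_fst[OF h] by (simp add: split_beta')
  finally show ?thesis ..
qed

section \<open>A bound on all achievable rates\<close>

abbreviation msg_space :: "nat \<Rightarrow> (nat \<Rightarrow> nat) \<Rightarrow> msgs measure" where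
  "msg_space K M \<equiv> PiM {..<K} (\<lambda>k. uniform_count_measure {..<M k})"
abbreviation phase_space :: "nat \<Rightarrow> nat \<Rightarrow> phases measure" where
  "phase_space K N \<equiv> PiM ({..<N} \<times> {..<K} \<times> {..<K}) (\<lambda>_. phase_dist)"
abbreviation noise_space :: "nat \<Rightarrow> nat \<Rightarrow> noises measure" where
  "noise_space K N \<equiv> PiM ({..<N} \<times> {..<K}) (\<lambda>_. cgauss)"

lemma prob_space_msg: "(\<And>k. k < K \<Longrightarrow> 0 < M k) \<Longrightarrow> prob_space (msg_space K M)"
  by (intro prob_space_PiM prob_space_uniform_count_measure) auto

lemma prob_space_phase: "prob_space (PiM I (\<lambda>_. phase_dist))"
  by (intro prob_space_PiM prob_space_phase_dist)

lemma prob_space_noise: "prob_space (PiM I (\<lambda>_. cgauss))"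
  by (intro prob_space_PiM prob_space_cgauss)

lemma prob_space_code_space: "(\<And>k. k < K \<Longrightarrow> 0 < M k) \<Longrightarrow> prob_space (code_space K N M)"
  unfolding code_space_def
  by (intro prob_space_pair prob_space_msg prob_space_phase prob_space_noise) auto

lemma nn_integral_code_space:
  assumes f: "f \<in> borel_measurable (code_space K N M)"
  shows "(\<integral>\<^sup>+\<omega>. f \<omega> \<partial>code_space K N M) =
    (\<integral>\<^sup>+w. \<integral>\<^sup>+\<phi>. \<integral>\<^sup>+z. f (w, \<phi>, z) \<partial>noise_space K N \<partial>phase_space K N \<partial>msg_space K M)"
proof -
  interpret P: prob_space "phase_space K N" by (rule prob_space_phase)
  interpret Z: prob_space "noise_space K N" by (rule prob_space_noise)
  interpret PZ: prob_space "phase_space K N \<Otimes>\<^sub>M noise_space K N"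
    by (intro prob_space_pair prob_space_phase prob_space_noise)
  have "(\<integral>\<^sup>+\<omega>. f \<omega> \<partial>code_space K N M) = (\<integral>\<^sup>+w. \<integral>\<^sup>+x. f (w, x) \<partial>(phase_space K N \<Otimes>\<^sub>M noise_space K N) \<partial>msg_space K M)"
    using PZ.nn_integral_fst[OF f[unfolded code_space_def]] by (simp add: code_space_def)
  also have "\<dots> = (\<integral>\<^sup>+w. \<integral>\<^sup>+\<phi>. \<integral>\<^sup>+z. f (w, \<phi>, z) \<partial>noise_space K N \<partial>phase_space K N \<partial>msg_space K M)"
  proof (intro nn_integral_cong)
    fix w assume w: "w \<in> space (msg_space K M)"
    have "(\<lambda>x. f (w, x)) \<in> borel_measurable (phase_space K N \<Otimes>\<^sub>M noise_space K N)"
      using w f[unfolded code_space_def] by (intro measurable_compose[OF measurable_Pair1' f[unfolded code_space_def]])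
    from Z.nn_integral_fst[OF this]
    show "(\<integral>\<^sup>+x. f (w, x) \<partial>(phase_space K N \<Otimes>\<^sub>M noise_space K N)) = (\<integral>\<^sup>+\<phi>. \<integral>\<^sup>+z. f (w, \<phi>, z) \<partial>noise_space K N \<partial>phase_space K N)"
      by simp
  qed
  finally show ?thesis .
qed

lemma nn_integral_uniform_count:
  assumes "finite A" "A \<noteq> {}"
  shows "(\<integral>\<^sup>+x. f x \<partial>uniform_count_measure A) = (\<Sum>x\<in>A. f x) / of_nat (card A)"
proof -
  have "(\<integral>\<^sup>+x. f x \<partial>uniform_count_measure A) = (\<Sum>x\<in>A. ennreal (1 / card A) * f x)"
    using assms unfolding uniform_count_measure_def by (subst nn_integral_point_measure_finite) auto
  also have "\<dots> = (\<Sum>x\<in>A. f x) * ennreal (1 / card A)"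
    by (simp add: sum_distrib_right mult.commute)
  also have "ennreal (1 / card A) = inverse (of_nat (card A))"
    using assms by (simp add: inverse_ennreal[symmetric] ennreal_of_nat_eq_real_of_nat card_gt_0_iff divide_inverse)
  finally show ?thesis by (simp add: divide_ennreal_def)
qed

text \<open>The message space is finite and discrete: its sigma-algebra consists of all
  subsets.\<close>

lemma measurable_msg_any:
  assumes "\<And>w. w \<in> Pi\<^sub>E {..<K} (\<lambda>k. {..<M k}) \<Longrightarrow> h w \<in> space N"
  shows "h \<in> measurable (msg_space K M) N"
proof -
  have "sets (msg_space K M) = sets (PiM {..<K} (\<lambda>k. count_space {..<M k}))"
    by (intro sets_PiM_cong) (auto simp: sets_uniform_count_measure_count_space)
  also have "\<dots> = sets (count_space (Pi\<^sub>E {..<K} (\<lambda>k. {..<M k})))"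
    by (subst count_space_PiM_finite) auto
  finally have eq: "sets (msg_space K M) = sets (count_space (Pi\<^sub>E {..<K} (\<lambda>k. {..<M k})))" .
  show ?thesis unfolding measurable_cong_sets[OF eq refl] using assms by auto
qed

text \<open>With the other messages held fixed, the average over message \<open>k\<close> becomes an
  explicit sum over its values. The disjointness of decoding sets can be used inside such a
  sum.\<close>

lemma nn_integral_msg_resample:
  assumes M: "\<And>k. k < K \<Longrightarrow> 0 < M k" and k: "k < K"
  shows "(\<integral>\<^sup>+w. h w \<partial>msg_space K M) = (\<integral>\<^sup>+w. (\<Sum>v<M k. h (w(k := v))) / of_nat (M k) \<partial>msg_space K M)"
proof -
  let ?U = "\<lambda>k. uniform_count_measure {..<M k}"
  have pU: "\<And>k. k < K \<Longrightarrow> prob_space (?U k)" using M by (intro prob_space_uniform_count_measure) auto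
  have "(\<integral>\<^sup>+w. h w \<partial>msg_space K M) = (\<integral>\<^sup>+w. \<integral>\<^sup>+y. h (\<lambda>i\<in>{..<K}. if i \<in> {k} then y (id i) else w i) \<partial>PiM {k} ?U \<partial>msg_space K M)"
    using k pU by (intro nn_integral_PiM_replace(1)[symmetric] measurable_msg_any) auto
  also have "\<dots> = (\<integral>\<^sup>+w. \<integral>\<^sup>+y. h (w(k := y k)) \<partial>PiM {k} ?U \<partial>msg_space K M)"
  proof (intro nn_integral_cong)
    fix w y assume "w \<in> space (msg_space K M)"
    then have "(\<lambda>i\<in>{..<K}. if i \<in> {k} then y (id i) else w i) = w(k := y k)"
      using k by (auto simp: space_PiM PiE_iff extensional_def fun_eq_iff)
    then show "h (\<lambda>i\<in>{..<K}. if i \<in> {k} then y (id i) else w i) = h (w(k := y k))" by simp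
  qed
  also have "\<dots> = (\<integral>\<^sup>+w. \<integral>\<^sup>+v. h (w(k := v)) \<partial>?U k \<partial>msg_space K M)"
  proof (intro nn_integral_cong)
    fix w
    have "?U k = distr (PiM {k} ?U) (?U k) (\<lambda>y. y k)"
      using pU k by (subst distr_PiM_component) auto
    then show "(\<integral>\<^sup>+y. h (w(k := y k)) \<partial>PiM {k} ?U) = (\<integral>\<^sup>+v. h (w(k := v)) \<partial>?U k)"
      using nn_integral_distr[of "\<lambda>y. y k" "PiM {k} ?U" "?U k" "\<lambda>v. h (w(k := v))"]
      by (auto simp: measurable_cong_sets[OF sets_uniform_count_measure_count_space refl])
  qed
  also have "\<dots> = (\<integral>\<^sup>+w. (\<Sum>v<M k. h (w(k := v))) / of_nat (M k) \<partial>msg_space K M)"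
    using M[OF k] by (subst nn_integral_uniform_count) auto
  finally show ?thesis .
qed

section \<open>Change of measure to a wider Gaussian\<close>

definition cgauss2 :: "complex measure" where
  "cgauss2 = density lborel (\<lambda>z. ennreal (exp (- (cmod z)\<^sup>2 / 2) / (2 * pi)))"

lemma sets_cgauss2[measurable_cong, simp]: "sets cgauss2 = sets borel" and space_cgauss2[simp]: "space cgauss2 = UNIV"
  by (auto simp: cgauss2_def)

lemma prob_space_cgauss2: "prob_space cgauss2"
proof
  define a :: real where "a = 1/2"
  have a: "0 < a" "a * (1 / a) = 1" by (auto simp: a_def)
  have "exp (- (cmod z)\<^sup>2 / 2) / (2 * pi) = a * (exp (- a * (cmod (z - 0))\<^sup>2) / pi)" for z
    by (simp add: a_def)
  then have "emeasure cgauss2 (space cgauss2) = (\<integral>\<^sup>+z. ennreal a * ennreal (exp (- a * (cmod (z - 0))\<^sup>2) / pi) \<partial>lborel)"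
    unfolding cgauss2_def using a by (subst emeasure_density) (auto simp: ennreal_mult[symmetric] intro!: nn_integral_cong)
  also have "\<dots> = ennreal a * (\<integral>\<^sup>+z. ennreal (exp (- a * (cmod (z - 0))\<^sup>2) / pi) \<partial>lborel)"
    by (rule nn_integral_cmult) measurable
  also have "\<dots> = ennreal a * ennreal (1 / a)"
    by (simp only: nn_integral_gauss_shift[OF a(1)])
  also have "\<dots> = 1" using a by (simp add: ennreal_mult[symmetric])
  finally show "emeasure cgauss2 (space cgauss2) = 1" .
qed

text \<open>Change of measure: the density of a unit Gaussian centred at \<open>s\<close> is at most \<open>2 exp |s|\<^sup>2\<close>
  times that of a centred Gaussian of variance 2.\<close>
lemma cgauss_shift_le:
  assumes [measurable]: "h \<in> borel_measurable borel"
  shows "(\<integral>\<^sup>+z. h z \<partial>cgauss) \<le> ennreal (2 * exp ((cmod s)\<^sup>2)) * (\<integral>\<^sup>+z. h (z - s) \<partial>cgauss2)"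
proof -
  have lb: "(lborel :: complex measure) = distr lborel borel (\<lambda>x. - s + x)"
    using lborel_affine[of 1 "- s"] by (simp add: density_1)
  have "(\<integral>\<^sup>+z. h z \<partial>cgauss) = (\<integral>\<^sup>+z. ennreal (exp (- (cmod z)\<^sup>2) / pi) * h z \<partial>lborel)"
    unfolding cgauss_def by (subst nn_integral_density) auto
  also have "\<dots> = (\<integral>\<^sup>+z. ennreal (exp (- (cmod (z - s))\<^sup>2) / pi) * h (z - s) \<partial>lborel)"
    by (subst lb, subst nn_integral_distr) auto
  also have "\<dots> \<le> (\<integral>\<^sup>+z. ennreal (2 * exp ((cmod s)\<^sup>2)) * (ennreal (exp (- (cmod z)\<^sup>2 / 2) / (2 * pi)) * h (z - s)) \<partial>lborel)"
  proof (intro nn_integral_mono)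
    fix z :: complex
    \<comment> \<open>The last term is a square and is dropped. The factor 2 below is the ratio of
      the two normalising constants.\<close>
    have "- (cmod (z - s))\<^sup>2 = (cmod s)\<^sup>2 - (cmod z)\<^sup>2 / 2 - (cmod (z - 2 * s))\<^sup>2 / 2"
      by (simp add: cmod_power2) (simp add: power2_eq_square field_simps)
    also have "\<dots> \<le> (cmod s)\<^sup>2 - (cmod z)\<^sup>2 / 2" by simp
    finally have "exp (- (cmod (z - s))\<^sup>2) / pi \<le> exp ((cmod s)\<^sup>2 - (cmod z)\<^sup>2 / 2) / pi"
      by (intro divide_right_mono) auto
    also have "\<dots> = 2 * exp ((cmod s)\<^sup>2) * (exp (- (cmod z)\<^sup>2 / 2) / (2 * pi))"
      by (simp add: diff_conv_add_uminus exp_add del: add_uminus_conv_diff)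
    finally have "ennreal (exp (- (cmod (z - s))\<^sup>2) / pi) \<le> ennreal (2 * exp ((cmod s)\<^sup>2)) * ennreal (exp (- (cmod z)\<^sup>2 / 2) / (2 * pi))"
      by (simp add: ennreal_mult[symmetric])
    then show "ennreal (exp (- (cmod (z - s))\<^sup>2) / pi) * h (z - s) \<le> ennreal (2 * exp ((cmod s)\<^sup>2)) * (ennreal (exp (- (cmod z)\<^sup>2 / 2) / (2 * pi)) * h (z - s))"
      by (simp add: mult.assoc[symmetric] mult_right_mono)
  qed
  also have "\<dots> = ennreal (2 * exp ((cmod s)\<^sup>2)) * (\<integral>\<^sup>+z. h (z - s) \<partial>cgauss2)"
    unfolding cgauss2_def by (subst nn_integral_cmult) (auto simp: nn_integral_density)
  finally show ?thesis .
qed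

text \<open>The inequality for single coordinates multiplies up along the product. Each coordinate
  has its own reference law, shift and constant, so that the noise of one receiver can be changed
  while that of the others stays as it is.\<close>

lemma PiM_shift_le:
  fixes s :: "'i \<Rightarrow> complex"
  assumes I: "finite I" and Q: "\<And>i. prob_space (Q i)" "\<And>i. sets (Q i) = sets borel"
    and Q': "\<And>i. prob_space (Q' i)" "\<And>i. sets (Q' i) = sets borel"
    and le: "\<And>i h. i \<in> I \<Longrightarrow> h \<in> borel_measurable borel \<Longrightarrow> (\<integral>\<^sup>+z. h z \<partial>Q i) \<le> c i * (\<integral>\<^sup>+z. h (z - s i) \<partial>Q' i)"
    and h: "h \<in> borel_measurable (PiM I Q)"
  shows "(\<integral>\<^sup>+x. h x \<partial>PiM I Q) \<le> (\<Prod>i\<in>I. c i) * (\<integral>\<^sup>+x. h (\<lambda>i\<in>I. x i - s i) \<partial>PiM I Q')"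
  using I le h
proof (induction I arbitrary: h)
  case empty
  interpret Q: product_prob_space Q "{}" by (intro product_prob_spaceI Q)
  interpret Q': product_prob_space Q' "{}" by (intro product_prob_spaceI Q')
  show ?case by (simp add: Q.nn_integral_empty Q'.nn_integral_empty restrict_def Q'.P.emeasure_space_1)
next
  case (insert i I)
  interpret Q: product_prob_space Q I by (intro product_prob_spaceI Q)
  interpret Q': product_prob_space Q' I by (intro product_prob_spaceI Q')
  note [measurable_cong] = Q(2) Q'(2)
  note h[measurable] = insert.prems(2)
  have sp: "space (Q j) = UNIV" "space (Q' j) = UNIV" for j using sets_eq_imp_space_eq[OF Q(2)] sets_eq_imp_space_eq[OF Q'(2)] by auto
  have upd: "(\<lambda>z. (fst z)(i := snd z - s i)) \<in> measurable (PiM I Q \<Otimes>\<^sub>M Q' i) (PiM (insert i I) Q)"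
  proof -
    have "(\<lambda>z. snd z - s i) \<in> measurable (PiM I Q \<Otimes>\<^sub>M Q' i) (Q i)" by measurable
    then show ?thesis
      by (intro measurable_fun_upd[of _ I]) (auto intro: measurable_fst)
  qed
  have hm: "(\<lambda>(x, y). h (x(i := y - s i))) \<in> borel_measurable (PiM I Q \<Otimes>\<^sub>M Q' i)"
    using measurable_compose[OF upd h] by (simp add: split_beta')
  have inner: "(\<lambda>x. \<integral>\<^sup>+y. h (x(i := y - s i)) \<partial>Q' i) \<in> borel_measurable (PiM I Q)"
    using Q'.M.borel_measurable_nn_integral_fst[OF hm] by simp
  have shift: "(\<lambda>x. \<lambda>j\<in>insert i I. x j - s j) \<in> measurable (PiM (insert i I) Q') (PiM (insert i I) Q)"
    by (intro measurable_restrict) measurable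
  have "(\<integral>\<^sup>+x. h x \<partial>PiM (insert i I) Q) = (\<integral>\<^sup>+x. \<integral>\<^sup>+y. h (x(i := y)) \<partial>Q i \<partial>PiM I Q)"
    using insert by (intro Q.product_nn_integral_insert) auto
  also have "\<dots> \<le> (\<integral>\<^sup>+x. c i * (\<integral>\<^sup>+y. h (x(i := y - s i)) \<partial>Q' i) \<partial>PiM I Q)"
  proof (intro nn_integral_mono insert.prems(1))
    fix x assume x: "x \<in> space (PiM I Q)"
    show "(\<lambda>y. h (x(i := y))) \<in> borel_measurable borel"
      using measurable_compose[OF measurable_component_update[OF x insert(2)] h]
      unfolding measurable_cong_sets[OF Q(2) refl] .
  qed auto
  also have "\<dots> = c i * (\<integral>\<^sup>+x. \<integral>\<^sup>+y. h (x(i := y - s i)) \<partial>Q' i \<partial>PiM I Q)"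
    by (intro nn_integral_cmult inner)
  also have "\<dots> \<le> c i * ((\<Prod>j\<in>I. c j) * (\<integral>\<^sup>+x. \<integral>\<^sup>+y. h ((\<lambda>j\<in>I. x j - s j)(i := y - s i)) \<partial>Q' i \<partial>PiM I Q'))"
    using insert.prems(1) by (intro mult_left_mono insert.IH inner) auto
  also have "(\<integral>\<^sup>+x. \<integral>\<^sup>+y. h ((\<lambda>j\<in>I. x j - s j)(i := y - s i)) \<partial>Q' i \<partial>PiM I Q') =
    (\<integral>\<^sup>+x. \<integral>\<^sup>+y. h (\<lambda>j\<in>insert i I. (x(i := y)) j - s j) \<partial>Q' i \<partial>PiM I Q')"
    using insert(2) by (intro nn_integral_cong arg_cong[where f=h]) (auto simp: fun_eq_iff)
  also have "\<dots> = (\<integral>\<^sup>+x. h (\<lambda>j\<in>insert i I. x j - s j) \<partial>PiM (insert i I) Q')"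
    using insert measurable_compose[OF shift h] by (intro Q'.product_nn_integral_insert[symmetric]) auto
  finally show ?case by (simp only: prod.insert[OF insert(1,2)] mult.assoc)
qed

text \<open>Given the phases and all other messages, the decoding sets of receiver \<open>k\<close> for the different
  messages \<open>v\<close>, translated by the signal of transmitter \<open>k\<close>, are disjoint, so the changes of
  measure cost at most one unit of mass in total.\<close>
lemma sum_correct_le:
  fixes K N :: nat and M :: "nat \<Rightarrow> nat"
  assumes SNR: "0 < SNR"
    and code: "is_code K SNR INR N M enc dec" and k: "k < K"
    and w: "w \<in> space (msg_space K M)" and \<phi>: "\<phi> \<in> space (phase_space K N)"
  defines "F \<equiv> space (code_space K N M) - error_event K SNR INR N M enc dec"
  shows "(\<Sum>v<M k. indicator {v. SNR * (\<Sum>n<N. (cmod (enc k v \<phi> n))\<^sup>2) \<le> A} v * (\<integral>\<^sup>+z. indicator F (w(k := v), \<phi>, z) \<partial>noise_space K N))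
     \<le> ennreal (2 ^ N * exp A)"
proof -
  define s where "s v n = complex_of_real (sqrt SNR) * cis (\<phi> (n, k, k)) * enc k v \<phi> n" for v n
  have cmods: "(cmod (s v n))\<^sup>2 = SNR * (cmod (enc k v \<phi> n))\<^sup>2" for v n
    using SNR by (simp add: s_def norm_mult power_mult_distrib)
  let ?I = "{..<N} \<times> {..<K}" and ?J = "{..<N} \<times> {k}"
  \<comment> \<open>Only the noise of receiver \<open>k\<close> is widened and shifted; all other
    coordinates keep their law, with shift 0 and constant 1.\<close>
  let ?Q' = "\<lambda>i :: nat \<times> nat. if snd i = k then cgauss2 else cgauss"
  let ?s = "\<lambda>v i. if snd i = k then s v (fst i) else 0"
  let ?sh = "\<lambda>v z. \<lambda>i\<in>?I. z i - ?s v i"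
  interpret Q': prob_space "PiM ?I ?Q'" by (intro prob_space_PiM) (auto simp: prob_space_cgauss prob_space_cgauss2)
  have Fm: "F \<in> sets (code_space K N M)" using code by (auto simp: F_def is_code_def)
  have wv: "w(k := v) \<in> space (msg_space K M)" if "v < M k" for v
    using w k that by (auto simp: space_PiM PiE_iff extensional_def space_uniform_count_measure)
  have sec: "(\<lambda>z. indicator F (w(k := v), \<phi>, z) :: ennreal) \<in> borel_measurable (noise_space K N)" if "v < M k" for v
  proof -
    have "(\<lambda>z. (w(k := v), \<phi>, z)) \<in> measurable (noise_space K N) (code_space K N M)"
      unfolding code_space_def using wv[OF that] \<phi> by measurable
    from measurable_compose[OF this borel_measurable_indicator[OF Fm]] show ?thesis by simp
  qed
  have Q's: "sets (PiM ?I ?Q') = sets (noise_space K N)" by (intro sets_PiM_cong) auto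
  have shm: "?sh v \<in> measurable (PiM ?I ?Q') (noise_space K N)" for v
    unfolding measurable_cong_sets[OF Q's refl] by (intro measurable_restrict) measurable
  have secsh: "(\<lambda>z. indicator F (w(k := v), \<phi>, ?sh v z) :: ennreal) \<in> borel_measurable (PiM ?I ?Q')" if "v < M k" for v
    by (rule measurable_compose[OF shm sec[OF that]])
  have one: "indicator {v. SNR * (\<Sum>n<N. (cmod (enc k v \<phi> n))\<^sup>2) \<le> A} v * (\<integral>\<^sup>+z. indicator F (w(k := v), \<phi>, z) \<partial>noise_space K N)
     \<le> ennreal (2 ^ N * exp A) * (\<integral>\<^sup>+z. indicator F (w(k := v), \<phi>, ?sh v z) \<partial>PiM ?I ?Q')" if v: "v < M k" for v
  proof (cases "SNR * (\<Sum>n<N. (cmod (enc k v \<phi> n))\<^sup>2) \<le> A")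
    case True
    let ?c = "\<lambda>i::nat \<times> nat. if snd i = k then ennreal (2 * exp ((cmod (s v (fst i)))\<^sup>2)) else 1"
    have "(\<integral>\<^sup>+z. indicator F (w(k := v), \<phi>, z) \<partial>noise_space K N)
       \<le> (\<Prod>i\<in>?I. ?c i) * (\<integral>\<^sup>+z. indicator F (w(k := v), \<phi>, ?sh v z) \<partial>PiM ?I ?Q')"
      by (rule PiM_shift_le[OF _ _ _ _ _ _ sec[OF v]])
         (auto simp: prob_space_cgauss prob_space_cgauss2 intro: cgauss_shift_le)
    also have "(\<Prod>i\<in>?I. ?c i) = (\<Prod>i\<in>?J. ?c i)"
      using k by (intro prod.mono_neutral_right) auto
    also have "\<dots> = (\<Prod>n<N. ennreal (2 * exp ((cmod (s v n))\<^sup>2)))"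
      by (rule prod.reindex_bij_witness[of _ "\<lambda>n. (n, k)" fst]) auto
    also have "\<dots> = ennreal (\<Prod>n<N. 2 * exp ((cmod (s v n))\<^sup>2))"
      by (rule prod_ennreal) simp
    also have "(\<Prod>n<N. 2 * exp ((cmod (s v n))\<^sup>2)) = 2 ^ N * exp (SNR * (\<Sum>n<N. (cmod (enc k v \<phi> n))\<^sup>2))"
      by (simp add: prod.distrib exp_sum cmods sum_distrib_left)
    finally have le: "(\<integral>\<^sup>+z. indicator F (w(k := v), \<phi>, z) \<partial>noise_space K N)
       \<le> ennreal (2 ^ N * exp (SNR * (\<Sum>n<N. (cmod (enc k v \<phi> n))\<^sup>2))) * (\<integral>\<^sup>+z. indicator F (w(k := v), \<phi>, ?sh v z) \<partial>PiM ?I ?Q')" .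
    have le2: "ennreal (2 ^ N * exp (SNR * (\<Sum>n<N. (cmod (enc k v \<phi> n))\<^sup>2))) \<le> ennreal (2 ^ N * exp A)"
      using True by (intro ennreal_leI mult_left_mono) auto
    have ind: "indicator {v. SNR * (\<Sum>n<N. (cmod (enc k v \<phi> n))\<^sup>2) \<le> A} v = (1 :: ennreal)" using True by simp
    show ?thesis unfolding ind mult_1 by (rule order_trans[OF le mult_right_mono[OF le2]]) simp
  qed simp
  have disj: "(\<Sum>v<M k. indicator F (w(k := v), \<phi>, ?sh v z)) \<le> (1 :: ennreal)" if z: "z \<in> space (PiM ?I ?Q')" for z
  proof -
    \<comment> \<open>\<open>y\<close> is the observation of receiver \<open>k\<close>. It is the
      same for every \<open>v\<close>, because the shift cancels the signal of transmitter
      \<open>k\<close> and the other transmitters do not know \<open>v\<close>.\<close>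
    define y where "y n = (\<Sum>t\<in>{..<K} - {k}. chan_coeff SNR INR k t (\<phi> (n, k, t)) * enc t (w t) \<phi> n) + z (n, k)" for n
    have dec: "dec k (\<lambda>n. if n < N then y n else 0) \<phi> = v" if v: "v < M k" "(w(k := v), \<phi>, ?sh v z) \<in> F" for v
    proof -
      have r: "received K SNR INR enc (w(k := v), \<phi>, ?sh v z) k n = y n" if "n < N" for n
      proof -
        have "(\<Sum>t<K. chan_coeff SNR INR k t (\<phi> (n, k, t)) * enc t ((w(k := v)) t) \<phi> n) =
          chan_coeff SNR INR k k (\<phi> (n, k, k)) * enc k v \<phi> n + (\<Sum>t\<in>{..<K} - {k}. chan_coeff SNR INR k t (\<phi> (n, k, t)) * enc t ((w(k := v)) t) \<phi> n)"
          using k by (subst sum.remove[of _ k]) auto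
        also have "(\<Sum>t\<in>{..<K} - {k}. chan_coeff SNR INR k t (\<phi> (n, k, t)) * enc t ((w(k := v)) t) \<phi> n) = (\<Sum>t\<in>{..<K} - {k}. chan_coeff SNR INR k t (\<phi> (n, k, t)) * enc t (w t) \<phi> n)"
          by (intro sum.cong) auto
        finally show ?thesis using that k
          by (simp add: received_def tx_symbol_def y_def chan_coeff_def s_def)
      qed
      have "dec k (\<lambda>n. if n < N then received K SNR INR enc (w(k := v), \<phi>, ?sh v z) k n else 0) \<phi> = v"
        using v k by (auto simp: F_def error_event_def)
      then show ?thesis using r by (simp cong: if_cong)
    qed
    have "(\<Sum>v<M k. indicator F (w(k := v), \<phi>, ?sh v z)) \<le> (\<Sum>v<M k. if v = dec k (\<lambda>n. if n < N then y n else 0) \<phi> then 1 else (0 :: ennreal))"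
      using dec by (intro sum_mono) (auto simp: indicator_def)
    also have "\<dots> \<le> 1" by simp
    finally show ?thesis .
  qed
  have "(\<Sum>v<M k. indicator {v. SNR * (\<Sum>n<N. (cmod (enc k v \<phi> n))\<^sup>2) \<le> A} v * (\<integral>\<^sup>+z. indicator F (w(k := v), \<phi>, z) \<partial>noise_space K N))
    \<le> (\<Sum>v<M k. ennreal (2 ^ N * exp A) * (\<integral>\<^sup>+z. indicator F (w(k := v), \<phi>, ?sh v z) \<partial>PiM ?I ?Q'))"
    using one by (intro sum_mono) auto
  also have "\<dots> = ennreal (2 ^ N * exp A) * (\<integral>\<^sup>+z. (\<Sum>v<M k. indicator F (w(k := v), \<phi>, ?sh v z)) \<partial>PiM ?I ?Q')"
    using secsh by (subst nn_integral_sum) (auto simp: sum_distrib_left)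
  also have "\<dots> \<le> ennreal (2 ^ N * exp A) * (\<integral>\<^sup>+z. 1 \<partial>PiM ?I ?Q')"
    using disj by (intro mult_left_mono nn_integral_mono) auto
  also have "\<dots> = ennreal (2 ^ N * exp A)" by (simp add: Q'.emeasure_space_1)
  finally show ?thesis .
qed

lemma is_codeD:
  assumes "is_code K SNR INR N M enc dec"
  shows "\<And>k. k < K \<Longrightarrow> 0 < M k"
    and "\<And>k n. k < K \<Longrightarrow> n < N \<Longrightarrow> (\<lambda>\<omega>. tx_symbol enc \<omega> k n) \<in> borel_measurable (code_space K N M)"
    and "\<And>k n. k < K \<Longrightarrow> n < N \<Longrightarrow> integrable (code_space K N M) (\<lambda>\<omega>. (cmod (tx_symbol enc \<omega> k n))\<^sup>2)"
    and "\<And>k n. k < K \<Longrightarrow> n < N \<Longrightarrow> (\<integral>\<omega>. (cmod (tx_symbol enc \<omega> k n))\<^sup>2 \<partial>code_space K N M) \<le> 1"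
    and "error_event K SNR INR N M enc dec \<in> sets (code_space K N M)"
  using assms by (auto simp: is_code_def)

text \<open>Success is split by the received energy of transmitter \<open>k\<close>. Energy above
  \<open>a N\<close> has probability at most \<open>SNR / a\<close> by Markov's inequality; below
  it, all \<open>M k\<close> equally likely messages share the factor
  \<open>2 ^ N * exp (a N)\<close> of the change of measure.\<close>

lemma correct_prob_le:
  fixes K N :: nat and M :: "nat \<Rightarrow> nat"
  assumes SNR: "0 < SNR" and code: "is_code K SNR INR N M enc dec" and k: "k < K" and a: "0 < a" and N: "0 < N"
  shows "1 - error_prob K SNR INR N M enc dec \<le> SNR / a + 2 ^ N * exp (a * real N) / real (M k)"
proof -
  note M = is_codeD(1)[OF code]
  interpret prob_space "code_space K N M" by (rule prob_space_code_space[OF M])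
  let ?P = "code_space K N M"
  note tx[measurable] = is_codeD(2)[OF code k]
  let ?S = "\<lambda>\<omega>. SNR * (\<Sum>n<N. (cmod (tx_symbol enc \<omega> k n))\<^sup>2)"
  define F where "F = space ?P - error_event K SNR INR N M enc dec"
  define B where "B = {\<omega> \<in> space ?P. a * real N \<le> ?S \<omega>}"
  define G where "G = F \<inter> {\<omega> \<in> space ?P. ?S \<omega> \<le> a * real N}"
  have Fm[measurable]: "F \<in> sets ?P" using is_codeD(5)[OF code] by (simp add: F_def)
  have Bm: "B \<in> sets ?P" unfolding B_def by measurable
  have Gm[measurable]: "G \<in> sets ?P" unfolding G_def by measurable
  have intS: "integrable ?P ?S" using is_codeD(3)[OF code k] by auto
  have "prob B \<le> expectation ?S / (a * real N)"
    unfolding B_def using a N SNR intS by (intro integral_Markov_inequality_measure[where A="{}"]) (auto intro!: mult_nonneg_nonneg sum_nonneg)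
  also have "expectation ?S = SNR * (\<Sum>n<N. expectation (\<lambda>\<omega>. (cmod (tx_symbol enc \<omega> k n))\<^sup>2))"
    using is_codeD(3)[OF code k] by (simp add: Bochner_Integration.integral_sum)
  also have "\<dots> \<le> SNR * (\<Sum>n<N. 1)"
    using is_codeD(4)[OF code k] SNR by (intro mult_left_mono sum_mono) auto
  finally have PB: "prob B \<le> SNR / a" using a N by (simp add: divide_right_mono field_simps)
  have "emeasure ?P G = (\<integral>\<^sup>+\<omega>. indicator G \<omega> \<partial>?P)" by simp
  also have "\<dots> = (\<integral>\<^sup>+w. \<integral>\<^sup>+\<phi>. \<integral>\<^sup>+z. indicator G (w, \<phi>, z) \<partial>noise_space K N \<partial>phase_space K N \<partial>msg_space K M)"
    by (rule nn_integral_code_space) measurable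
  also have "\<dots> = (\<integral>\<^sup>+w. (\<Sum>v<M k. \<integral>\<^sup>+\<phi>. \<integral>\<^sup>+z. indicator G (w(k := v), \<phi>, z) \<partial>noise_space K N \<partial>phase_space K N) / of_nat (M k) \<partial>msg_space K M)"
    by (rule nn_integral_msg_resample[OF M k])
  also have "\<dots> \<le> (\<integral>\<^sup>+w. ennreal (2 ^ N * exp (a * real N)) / of_nat (M k) \<partial>msg_space K M)"
  proof (intro nn_integral_mono divide_right_mono_ennreal)
    fix w assume w: "w \<in> space (msg_space K M)"
    interpret P: prob_space "phase_space K N" by (rule prob_space_phase)
    interpret Z: prob_space "noise_space K N" by (rule prob_space_noise)
    have wv: "w(k := v) \<in> space (msg_space K M)" if "v < M k" for v
      using w k that by (auto simp: space_PiM PiE_iff extensional_def space_uniform_count_measure)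
    have mG: "(\<lambda>\<phi>. \<integral>\<^sup>+z. indicator G (w(k := v), \<phi>, z) \<partial>noise_space K N) \<in> borel_measurable (phase_space K N)" if "v < M k" for v
    proof -
      have "(\<lambda>x. (w(k := v), x)) \<in> measurable (phase_space K N \<Otimes>\<^sub>M noise_space K N) ?P"
        unfolding code_space_def using wv[OF that] by measurable
      from measurable_compose[OF this borel_measurable_indicator[OF Gm]]
      have "(\<lambda>(\<phi>, z). indicator G (w(k := v), \<phi>, z) :: ennreal) \<in> borel_measurable (phase_space K N \<Otimes>\<^sub>M noise_space K N)"
        by (simp add: split_beta')
      from Z.borel_measurable_nn_integral_fst[OF this] show ?thesis by simp
    qed
    have "(\<Sum>v<M k. \<integral>\<^sup>+\<phi>. \<integral>\<^sup>+z. indicator G (w(k := v), \<phi>, z) \<partial>noise_space K N \<partial>phase_space K N)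
       = (\<integral>\<^sup>+\<phi>. (\<Sum>v<M k. \<integral>\<^sup>+z. indicator G (w(k := v), \<phi>, z) \<partial>noise_space K N) \<partial>phase_space K N)"
      using mG by (intro nn_integral_sum[symmetric]) auto
    also have "\<dots> \<le> (\<integral>\<^sup>+\<phi>. ennreal (2 ^ N * exp (a * real N)) \<partial>phase_space K N)"
    proof (intro nn_integral_mono)
      fix \<phi> assume \<phi>: "\<phi> \<in> space (phase_space K N)"
      have "(\<Sum>v<M k. \<integral>\<^sup>+z. indicator G (w(k := v), \<phi>, z) \<partial>noise_space K N) =
        (\<Sum>v<M k. indicator {v. SNR * (\<Sum>n<N. (cmod (enc k v \<phi> n))\<^sup>2) \<le> a * real N} v * (\<integral>\<^sup>+z. indicator F (w(k := v), \<phi>, z) \<partial>noise_space K N))"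
        by (intro sum.cong refl) (auto simp: G_def F_def tx_symbol_def indicator_def intro!: nn_integral_cong)
      also have "\<dots> \<le> ennreal (2 ^ N * exp (a * real N))"
        unfolding F_def by (rule sum_correct_le[OF SNR code k w \<phi>])
      finally show "(\<Sum>v<M k. \<integral>\<^sup>+z. indicator G (w(k := v), \<phi>, z) \<partial>noise_space K N) \<le> ennreal (2 ^ N * exp (a * real N))" .
    qed
    also have "\<dots> = ennreal (2 ^ N * exp (a * real N))" by (simp add: P.emeasure_space_1)
    finally show "(\<Sum>v<M k. \<integral>\<^sup>+\<phi>. \<integral>\<^sup>+z. indicator G (w(k := v), \<phi>, z) \<partial>noise_space K N \<partial>phase_space K N) \<le> ennreal (2 ^ N * exp (a * real N))" .
  qed
  also have "\<dots> = ennreal (2 ^ N * exp (a * real N)) / of_nat (M k)"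
    using prob_space.emeasure_space_1[OF prob_space_msg[OF M]] by simp
  also have "\<dots> = ennreal (2 ^ N * exp (a * real N) / real (M k))"
    using M[OF k] by (simp add: divide_ennreal ennreal_of_nat_eq_real_of_nat)
  finally have PG: "prob G \<le> 2 ^ N * exp (a * real N) / real (M k)"
    by (simp add: emeasure_eq_measure)
  have "1 - error_prob K SNR INR N M enc dec = prob F"
    unfolding F_def error_prob_def using is_codeD(5)[OF code] by (simp add: prob_compl)
  also have "\<dots> \<le> prob (B \<union> G)" using Bm Gm by (intro finite_measure_mono) (auto simp: B_def G_def F_def)
  also have "\<dots> \<le> prob B + prob G" by (rule measure_Un_le[OF Bm Gm])
  finally show ?thesis using PB PG by linarith
qed

text \<open>At energy level \<open>a = 4 SNR\<close> the Markov term is 1/4 and the change of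
  measure costs the factor \<open>2 exp (4 SNR)\<close> per channel use, whose logarithm this
  is.\<close>

definition rate_bound :: "real \<Rightarrow> real" where "rate_bound SNR = log 2 (2 * exp (4 * SNR))"

text \<open>Above the bound the number of messages outgrows the cost of the change of measure. For
  large \<open>N\<close> the success probability is then at most 1/4 + 1/4, whereas an error
  probability of 1/4 calls for 3/4.\<close>

lemma achievable_le_rate_bound:
  assumes SNR: "0 < SNR" and R: "achievable K SNR INR R" and k: "k < K"
  shows "R k \<le> rate_bound SNR"
proof (rule ccontr)
  assume "\<not> ?thesis"
  then have d: "0 < R k - rate_bound SNR" by simp
  let ?d = "R k - rate_bound SNR"
  obtain N0 where N0: "\<And>N. N \<ge> N0 \<Longrightarrow> \<exists>enc dec. is_code K SNR INR N (msg_sizes N R) enc dec \<and> error_prob K SNR INR N (msg_sizes N R) enc dec \<le> 1/4"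
    using R unfolding achievable_def by (metis zero_less_divide_1_iff zero_less_numeral)
  define N where "N = max (max N0 1) (nat \<lceil>2 / ?d\<rceil>)"
  have N: "N \<ge> N0" "N > 0" "2 / ?d \<le> real N" by (auto simp: N_def) linarith
  then have dN: "2 \<le> real N * ?d" using d by (simp add: field_simps)
  obtain enc dec where code: "is_code K SNR INR N (msg_sizes N R) enc dec" and err: "error_prob K SNR INR N (msg_sizes N R) enc dec \<le> 1/4"
    using N0[OF N(1)] by blast
  have M: "2 powr (real N * R k) \<le> real (msg_sizes N R k)"
    unfolding msg_sizes_def using powr_gt_zero[of 2 "real N * R k"] by linarith
  have "1 - 1/4 \<le> SNR / (4 * SNR) + 2 ^ N * exp (4 * SNR * real N) / real (msg_sizes N R k)"
    using correct_prob_le[OF SNR code k, of "4 * SNR"] SNR N err by linarith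
  also have "2 ^ N * exp (4 * SNR * real N) / real (msg_sizes N R k) \<le> 2 ^ N * exp (4 * SNR * real N) / 2 powr (real N * R k)"
    using M is_codeD(1)[OF code k] by (intro divide_left_mono) auto
  also have "2 ^ N * exp (4 * SNR * real N) = 2 powr (real N * rate_bound SNR)"
  proof -
    have "2 powr (real N * rate_bound SNR) = (2 powr rate_bound SNR) powr real N"
      by (simp add: powr_powr mult.commute)
    also have "2 powr rate_bound SNR = 2 * exp (4 * SNR)" by (simp add: rate_bound_def)
    also have "(2 * exp (4 * SNR)) powr real N = (2 * exp (4 * SNR)) ^ N" by (simp add: powr_realpow)
    also have "\<dots> = 2 ^ N * exp (4 * SNR * real N)"
      by (simp add: power_mult_distrib exp_of_nat_mult[symmetric] mult.commute)
    finally show ?thesis by simp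
  qed
  also have "2 powr (real N * rate_bound SNR) / 2 powr (real N * R k) = 2 powr (- (real N * ?d))"
    by (simp add: powr_diff[symmetric] algebra_simps)
  also have "\<dots> \<le> 2 powr (- 2)" using dN by (intro powr_mono) auto
  also have "\<dots> = 1/4" by (simp add: powr_minus)
  finally show False using SNR by simp
qed

section \<open>Reduction to the Z channel\<close>

lemma measurable_cis[measurable]: "cis \<in> borel_measurable borel"
  by (intro borel_measurable_continuous_onI continuous_on_cis continuous_on_id)

lemma measurable_chan_coeff[measurable]: "chan_coeff s G a b \<in> borel_measurable borel"
  unfolding chan_coeff_def[abs_def] by measurable

abbreviation rx_block :: "nat \<Rightarrow> real \<Rightarrow> (nat \<times> nat \<Rightarrow> real) \<Rightarrow> nat \<Rightarrow> (nat \<Rightarrow> nat \<Rightarrow> phases \<Rightarrow> nat \<Rightarrow> complex)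
    \<Rightarrow> msgs \<times> phases \<times> noises \<Rightarrow> nat \<Rightarrow> nat \<Rightarrow> complex" where
  "rx_block K SNR INR N enc \<omega> k \<equiv> (\<lambda>n. if n < N then received K SNR INR enc \<omega> k n else 0)"

text \<open>Choosing the least accepted message makes the decision a Boolean combination of the
  tests, so that measurable tests yield the measurable error event which \<open>is_code\<close>
  demands. Both the Z channel code and the aligned code decode in this way.\<close>

definition test_decoder :: "(nat \<Rightarrow> nat) \<Rightarrow> (nat \<Rightarrow> nat \<Rightarrow> (nat \<Rightarrow> complex) \<Rightarrow> phases \<Rightarrow> bool)
    \<Rightarrow> nat \<Rightarrow> (nat \<Rightarrow> complex) \<Rightarrow> phases \<Rightarrow> nat" where
  "test_decoder M Q k y \<phi> = (if \<exists>v<M k. Q k v y \<phi> then LEAST v. v < M k \<and> Q k v y \<phi> else 0)"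

lemma test_decoder_eq_iff:
  assumes "w < M k"
  shows "test_decoder M Q k y \<phi> = w \<longleftrightarrow>
    (Q k w y \<phi> \<and> (\<forall>u<w. \<not> Q k u y \<phi>)) \<or> (w = 0 \<and> (\<forall>u<M k. \<not> Q k u y \<phi>))"
proof (cases "\<exists>v<M k. Q k v y \<phi>")
  case True
  let ?L = "LEAST v. v < M k \<and> Q k v y \<phi>"
  have L: "?L < M k \<and> Q k ?L y \<phi>" using True by (metis (mono_tags, lifting) LeastI_ex)
  have L2: "\<not> (u < M k \<and> Q k u y \<phi>)" if "u < ?L" for u using not_less_Least[OF that] .
  have "?L = w \<longleftrightarrow> Q k w y \<phi> \<and> (\<forall>u<w. \<not> Q k u y \<phi>)"
  proof
    assume "?L = w" then show "Q k w y \<phi> \<and> (\<forall>u<w. \<not> Q k u y \<phi>)" using L L2 assms by auto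
  next
    assume "Q k w y \<phi> \<and> (\<forall>u<w. \<not> Q k u y \<phi>)" then show "?L = w" using L L2 assms by (metis linorder_neqE_nat)
  qed
  then show ?thesis using True by (auto simp: test_decoder_def)
next
  case False then show ?thesis using assms by (auto simp: test_decoder_def)
qed

lemma test_decoder_error_sets:
  assumes Q: "\<And>k v. k < K \<Longrightarrow> v < M k \<Longrightarrow>
    {\<omega> \<in> space (code_space K N M). Q k v (rx_block K SNR INR N enc \<omega> k) (fst (snd \<omega>))} \<in> sets (code_space K N M)"
  shows "error_event K SNR INR N M enc (test_decoder M Q) \<in> sets (code_space K N M)"
proof -
  let ?P = "code_space K N M"
  \<comment> \<open>The range conditions are built into \<open>q\<close> and \<open>m\<close>, so
    that the quantifiers over users and messages below run over all natural numbers and are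
    countable.\<close>
  define q where "q k v \<omega> \<longleftrightarrow> k < K \<and> v < M k \<and> Q k v (rx_block K SNR INR N enc \<omega> k) (fst (snd \<omega>))" for k v \<omega>
  define m where "m k v \<omega> \<longleftrightarrow> k < K \<and> fst \<omega> k = v" for k v and \<omega> :: "msgs \<times> phases \<times> noises"
  have [measurable]: "Measurable.pred ?P (q k v)" for k v
  proof (cases "k < K \<and> v < M k")
    case True
    then have "{\<omega> \<in> space ?P. q k v \<omega>} = {\<omega> \<in> space ?P. Q k v (rx_block K SNR INR N enc \<omega> k) (fst (snd \<omega>))}"
      by (simp add: q_def)
    then show ?thesis unfolding pred_def using Q[of k v] True by (simp only:)
  next
    case False
    then have "q k v = (\<lambda>_. False)" unfolding q_def by (auto simp: fun_eq_iff)
    then show ?thesis by simp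
  qed
  have [measurable]: "Measurable.pred ?P (m k v)" for k v
  proof (cases "k < K")
    case True
    have "(\<lambda>\<omega>. fst \<omega> k) \<in> measurable ?P (uniform_count_measure {..<M k})"
      unfolding code_space_def using True by (intro measurable_compose[OF measurable_fst] measurable_component_singleton) auto
    then have "(\<lambda>\<omega>. fst \<omega> k) \<in> measurable ?P (count_space {..<M k})"
      by (simp add: measurable_cong_sets[OF refl sets_uniform_count_measure_count_space])
    from measurable_compose[OF this, of "\<lambda>x. x = v" "count_space UNIV"] True show ?thesis
      unfolding m_def[abs_def] by simp
  qed (simp add: m_def[abs_def])
  have lt: "fst \<omega> k < M k" if "\<omega> \<in> space ?P" "k < K" for \<omega> k
    using that by (auto simp: code_space_def space_pair_measure space_PiM PiE_iff space_uniform_count_measure)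
  have "error_event K SNR INR N M enc (test_decoder M Q) =
    {\<omega> \<in> space ?P. \<exists>k v. m k v \<omega> \<and> \<not> ((q k v \<omega> \<and> (\<forall>u. u < v \<longrightarrow> \<not> q k u \<omega>)) \<or> (v = 0 \<and> (\<forall>u. \<not> q k u \<omega>)))}"
    unfolding error_event_def
  proof (rule Collect_cong, rule conj_cong[OF refl])
    fix \<omega> assume w: "\<omega> \<in> space ?P"
    have "test_decoder M Q k (rx_block K SNR INR N enc \<omega> k) (fst (snd \<omega>)) = fst \<omega> k \<longleftrightarrow>
      (q k (fst \<omega> k) \<omega> \<and> (\<forall>u. u < fst \<omega> k \<longrightarrow> \<not> q k u \<omega>)) \<or> (fst \<omega> k = 0 \<and> (\<forall>u. \<not> q k u \<omega>))" if "k < K" for k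
      using lt[OF w that] that by (subst test_decoder_eq_iff) (auto simp: q_def)
    then show "(\<exists>k<K. test_decoder M Q k (rx_block K SNR INR N enc \<omega> k) (fst (snd \<omega>)) \<noteq> fst \<omega> k) \<longleftrightarrow>
      (\<exists>k v. m k v \<omega> \<and> \<not> ((q k v \<omega> \<and> (\<forall>u. u < v \<longrightarrow> \<not> q k u \<omega>)) \<or> (v = 0 \<and> (\<forall>u. \<not> q k u \<omega>))))"
      unfolding m_def by blast
  qed
  also have "\<dots> \<in> sets ?P" by measurable
  finally show ?thesis .
qed

lemma test_decoder_error_subset:
  "error_event K SNR INR N M enc (test_decoder M Q) \<subseteq>
    {\<omega> \<in> space (code_space K N M). \<exists>k<K. \<not> Q k (fst \<omega> k) (rx_block K SNR INR N enc \<omega> k) (fst (snd \<omega>)) \<or>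
       (\<exists>v<M k. v \<noteq> fst \<omega> k \<and> Q k v (rx_block K SNR INR N enc \<omega> k) (fst (snd \<omega>)))}"
proof -
  have lt: "fst \<omega> k < M k" if "\<omega> \<in> space (code_space K N M)" "k < K" for \<omega> k
    using that by (auto simp: code_space_def space_pair_measure space_PiM PiE_iff space_uniform_count_measure)
  show ?thesis
  proof
    fix \<omega> assume "\<omega> \<in> error_event K SNR INR N M enc (test_decoder M Q)"
    then obtain k where sp: "\<omega> \<in> space (code_space K N M)" and k: "k < K"
      and ne: "test_decoder M Q k (rx_block K SNR INR N enc \<omega> k) (fst (snd \<omega>)) \<noteq> fst \<omega> k"
      unfolding error_event_def by blast
    let ?q = "\<lambda>v. Q k v (rx_block K SNR INR N enc \<omega> k) (fst (snd \<omega>))"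
    have "\<not> (?q (fst \<omega> k) \<and> (\<forall>u<fst \<omega> k. \<not> ?q u))"
      using ne unfolding test_decoder_eq_iff[where M=M and k=k and w="fst \<omega> k", OF lt[OF sp k]] by (rule contrapos_nn) (rule disjI1)
    then have "\<not> ?q (fst \<omega> k) \<or> (\<exists>v<fst \<omega> k. ?q v)" by blast
    moreover have "v < M k \<and> v \<noteq> fst \<omega> k" if "v < fst \<omega> k" for v
      using that lt[OF sp k] by simp
    ultimately have "\<not> ?q (fst \<omega> k) \<or> (\<exists>v<M k. v \<noteq> fst \<omega> k \<and> ?q v)"
      by blast
    then show "\<omega> \<in> {\<omega> \<in> space (code_space K N M). \<exists>k<K. \<not> Q k (fst \<omega> k) (rx_block K SNR INR N enc \<omega> k) (fst (snd \<omega>)) \<or>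
       (\<exists>v<M k. v \<noteq> fst \<omega> k \<and> Q k v (rx_block K SNR INR N enc \<omega> k) (fst (snd \<omega>)))}"
      using sp k by blast
  qed
qed

text \<open>Only the joint error event of a code is known to be measurable, not the individual decoders.
  The conditional probability \<open>cond_good k\<close> of joint success given what receiver \<open>k\<close> observes is
  measurable, and the sets where it is positive for the different messages of user \<open>k\<close> are
  disjoint; they replace the decoding sets, at no loss in error probability.\<close>
locale net_code =
  fixes K :: nat and SNR :: real and INR :: "nat \<times> nat \<Rightarrow> real" and N :: nat and M :: "nat \<Rightarrow> nat"
    and enc :: "nat \<Rightarrow> nat \<Rightarrow> phases \<Rightarrow> nat \<Rightarrow> complex" and dec :: "nat \<Rightarrow> (nat \<Rightarrow> complex) \<Rightarrow> phases \<Rightarrow> nat"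
  assumes code: "is_code K SNR INR N M enc dec"
begin

definition good where "good = space (code_space K N M) - error_event K SNR INR N M enc dec"
definition own :: "nat \<Rightarrow> (nat \<times> nat) set" where "own k = {..<N} \<times> {k}"
definition others :: "nat \<Rightarrow> (nat \<times> nat) set" where "others k = {..<N} \<times> ({..<K} - {k})"
definition cond_good :: "nat \<Rightarrow> msgs \<times> phases \<times> noises \<Rightarrow> ennreal" where
  "cond_good k x = (\<integral>\<^sup>+z. indicator good (fst x, fst (snd x), merge (own k) (others k) (snd (snd x), z)) \<partial>PiM (others k) (\<lambda>_. cgauss))"
definition signal :: "nat \<Rightarrow> msgs \<Rightarrow> phases \<Rightarrow> nat \<Rightarrow> complex" where
  "signal k w \<phi> n = (\<Sum>t<K. chan_coeff SNR INR k t (\<phi> (n, k, t)) * enc t (w t) \<phi> n)"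
text \<open>The receiver knows \<open>y\<close> and the phases only. It asks whether some message
  tuple with entry \<open>v\<close> at \<open>k\<close> is compatible with them; once a tuple is
  guessed, the noise is what remains of \<open>y\<close> after its signal is subtracted.\<close>

definition dtest :: "nat \<Rightarrow> nat \<Rightarrow> (nat \<Rightarrow> complex) \<Rightarrow> phases \<Rightarrow> bool" where
  "dtest k v y \<phi> \<longleftrightarrow> (\<exists>w\<in>Pi\<^sub>E {..<K} (\<lambda>k. {..<M k}). w k = v \<and>
      0 < cond_good k (w, \<phi>, \<lambda>i\<in>own k. y (fst i) - signal k w \<phi> (fst i)))"
definition own_space :: "nat \<Rightarrow> (msgs \<times> phases \<times> noises) measure" where
  "own_space k = msg_space K M \<Otimes>\<^sub>M (phase_space K N \<Otimes>\<^sub>M PiM (own k) (\<lambda>_. cgauss))"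

lemma space_msg: "space (msg_space K M) = Pi\<^sub>E {..<K} (\<lambda>k. {..<M k})"
  by (simp add: space_PiM space_uniform_count_measure)

lemma M_pos: "k < K \<Longrightarrow> 0 < M k" using is_codeD(1)[OF code] .

lemma good_sets[measurable]: "good \<in> sets (code_space K N M)"
  using is_codeD(5)[OF code] by (simp add: good_def)

lemma own_Un: "k < K \<Longrightarrow> own k \<union> others k = {..<N} \<times> {..<K}" and own_Int: "own k \<inter> others k = {}"
  and finite_own[simp]: "finite (own k)" "finite (others k)"
  by (auto simp: own_def others_def)

lemma measurable_merge_own:
  assumes k: "k < K"
  shows "(\<lambda>p. (fst (fst p), fst (snd (fst p)), merge (own k) (others k) (snd (snd (fst p)), snd p)))
    \<in> measurable (own_space k \<Otimes>\<^sub>M PiM (others k) (\<lambda>_. cgauss)) (code_space K N M)"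
proof -
  have "(\<lambda>p. merge (own k) (others k) (snd (snd (fst p)), snd p)) \<in> measurable (own_space k \<Otimes>\<^sub>M PiM (others k) (\<lambda>_. cgauss)) (PiM (own k \<union> others k) (\<lambda>_. cgauss))"
    unfolding own_space_def by (rule measurable_compose[OF _ measurable_merge]) measurable
  then show ?thesis unfolding code_space_def own_Un[OF k] unfolding own_space_def by measurable
qed

lemma measurable_cond_good[measurable]:
  assumes k: "k < K"
  shows "cond_good k \<in> borel_measurable (own_space k)"
proof -
  interpret Z: prob_space "PiM (others k) (\<lambda>_. cgauss)" by (rule prob_space_noise)
  have "(\<lambda>(x, z). indicator good (fst x, fst (snd x), merge (own k) (others k) (snd (snd x), z)) :: ennreal) \<in> borel_measurable (own_space k \<Otimes>\<^sub>M PiM (others k) (\<lambda>_. cgauss))"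
    using measurable_compose[OF measurable_merge_own[OF k] borel_measurable_indicator[OF good_sets]] by (simp add: split_beta')
  from Z.borel_measurable_nn_integral_fst[OF this] show ?thesis
    by (simp add: cond_good_def[abs_def])
qed

text \<open>A positive conditional probability yields some noise of the other receivers for which
  the original code succeeds. There \<open>dec k\<close> returns \<open>w k\<close>, and its
  arguments are just \<open>y\<close> and the phases, which do not depend on the tuple
  chosen.\<close>

lemma dtest_unique:
  assumes k: "k < K" and "dtest k v y \<phi>"
  shows "dec k (\<lambda>n. if n < N then y n else 0) \<phi> = v"
proof -
  obtain w where w: "w k = v" "0 < cond_good k (w, \<phi>, \<lambda>i\<in>own k. y (fst i) - signal k w \<phi> (fst i))"
    using assms by (auto simp: dtest_def)
  let ?m = "\<lambda>z. merge (own k) (others k) (\<lambda>i\<in>own k. y (fst i) - signal k w \<phi> (fst i), z)"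
  have "\<exists>z. (w, \<phi>, ?m z) \<in> good"
  proof (rule ccontr)
    assume "\<not> ?thesis"
    then have "cond_good k (w, \<phi>, \<lambda>i\<in>own k. y (fst i) - signal k w \<phi> (fst i)) = 0"
      by (simp add: cond_good_def)
    with w show False by simp
  qed
  then obtain z where z: "(w, \<phi>, ?m z) \<in> good" by blast
  have "received K SNR INR enc (w, \<phi>, ?m z) k n = y n" if "n < N" for n
    using that by (simp add: received_def tx_symbol_def signal_def merge_def own_def)
  moreover have "dec k (rx_block K SNR INR N enc (w, \<phi>, ?m z) k) \<phi> = w k"
  proof -
    from z have "(w, \<phi>, ?m z) \<in> space (code_space K N M)" "(w, \<phi>, ?m z) \<notin> error_event K SNR INR N M enc dec"
      unfolding good_def by blast+
    then show ?thesis using k unfolding error_event_def mem_Collect_eq fst_conv snd_conv by blast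
  qed
  ultimately show ?thesis using w by (simp cong: if_cong)
qed

lemma nn_integral_own_space:
  assumes f: "f \<in> borel_measurable (own_space k)"
  shows "(\<integral>\<^sup>+x. f x \<partial>own_space k) =
    (\<integral>\<^sup>+w. \<integral>\<^sup>+\<phi>. \<integral>\<^sup>+z. f (w, \<phi>, z) \<partial>PiM (own k) (\<lambda>_. cgauss) \<partial>phase_space K N \<partial>msg_space K M)"
proof -
  interpret P: prob_space "phase_space K N" by (rule prob_space_phase)
  interpret Z: prob_space "PiM (own k) (\<lambda>_. cgauss)" by (rule prob_space_noise)
  interpret PZ: prob_space "phase_space K N \<Otimes>\<^sub>M PiM (own k) (\<lambda>_. cgauss)"
    by (intro prob_space_pair prob_space_phase prob_space_noise)
  have "(\<integral>\<^sup>+x. f x \<partial>own_space k) = (\<integral>\<^sup>+w. \<integral>\<^sup>+x. f (w, x) \<partial>(phase_space K N \<Otimes>\<^sub>M PiM (own k) (\<lambda>_. cgauss)) \<partial>msg_space K M)"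
    using PZ.nn_integral_fst[OF f[unfolded own_space_def]] by (simp add: own_space_def)
  also have "\<dots> = (\<integral>\<^sup>+w. \<integral>\<^sup>+\<phi>. \<integral>\<^sup>+z. f (w, \<phi>, z) \<partial>PiM (own k) (\<lambda>_. cgauss) \<partial>phase_space K N \<partial>msg_space K M)"
  proof (intro nn_integral_cong)
    fix w assume w: "w \<in> space (msg_space K M)"
    have "(\<lambda>x. f (w, x)) \<in> borel_measurable (phase_space K N \<Otimes>\<^sub>M PiM (own k) (\<lambda>_. cgauss))"
      using w f[unfolded own_space_def] by (intro measurable_compose[OF measurable_Pair1' f[unfolded own_space_def]])
    from Z.nn_integral_fst[OF this]
    show "(\<integral>\<^sup>+x. f (w, x) \<partial>(phase_space K N \<Otimes>\<^sub>M PiM (own k) (\<lambda>_. cgauss))) = (\<integral>\<^sup>+\<phi>. \<integral>\<^sup>+z. f (w, \<phi>, z) \<partial>PiM (own k) (\<lambda>_. cgauss) \<partial>phase_space K N)"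
      by simp
  qed
  finally show ?thesis .
qed

lemma prob_space_own_space: "prob_space (own_space k)"
  unfolding own_space_def
  by (intro prob_space_pair prob_space_msg prob_space_phase prob_space_noise) (auto intro: M_pos)

text \<open>\<open>cond_good k\<close> is at most 1 and integrates to the success probability, so
  its zero set has at most the mass that is missing from 1.\<close>

lemma cond_good_zero_prob:
  assumes k: "k < K"
  shows "(\<integral>\<^sup>+x. indicator {x. cond_good k x = 0} x \<partial>own_space k) \<le> ennreal (error_prob K SNR INR N M enc dec)"
proof -
  let ?P = "code_space K N M"
  interpret C: prob_space ?P by (rule prob_space_code_space) (auto intro: M_pos)
  interpret O: prob_space "own_space k" by (rule prob_space_own_space)
  interpret Z: prob_space "PiM (others k) (\<lambda>_. cgauss)" by (rule prob_space_noise)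
  interpret product_prob_space "\<lambda>_. cgauss" "UNIV :: (nat \<times> nat) set" by (intro product_prob_spaceI prob_space_cgauss)
  note cgm[measurable] = measurable_cond_good[OF k]
  have "emeasure ?P good = (\<integral>\<^sup>+\<omega>. indicator good \<omega> \<partial>?P)" by simp
  also have "\<dots> = (\<integral>\<^sup>+w. \<integral>\<^sup>+\<phi>. \<integral>\<^sup>+z. indicator good (w, \<phi>, z) \<partial>noise_space K N \<partial>phase_space K N \<partial>msg_space K M)"
    by (rule nn_integral_code_space) measurable
  also have "\<dots> = (\<integral>\<^sup>+w. \<integral>\<^sup>+\<phi>. \<integral>\<^sup>+z. cond_good k (w, \<phi>, z) \<partial>PiM (own k) (\<lambda>_. cgauss) \<partial>phase_space K N \<partial>msg_space K M)"
  proof (intro nn_integral_cong)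
    fix w \<phi> assume w: "w \<in> space (msg_space K M)" and \<phi>: "\<phi> \<in> space (phase_space K N)"
    have "(\<lambda>z. (w, \<phi>, z)) \<in> measurable (noise_space K N) ?P"
      unfolding code_space_def using w \<phi> by measurable
    from measurable_compose[OF this borel_measurable_indicator[OF good_sets]]
    have m: "(\<lambda>z. indicator good (w, \<phi>, z) :: ennreal) \<in> borel_measurable (PiM (own k \<union> others k) (\<lambda>_. cgauss))"
      by (simp add: own_Un[OF k])
    show "(\<integral>\<^sup>+z. indicator good (w, \<phi>, z) \<partial>noise_space K N) = (\<integral>\<^sup>+z. cond_good k (w, \<phi>, z) \<partial>PiM (own k) (\<lambda>_. cgauss))"
      using product_nn_integral_fold[OF own_Int _ _ m] by (simp add: cond_good_def own_Un[OF k])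
  qed
  also have "\<dots> = (\<integral>\<^sup>+x. cond_good k x \<partial>own_space k)"
    by (rule nn_integral_own_space[symmetric, OF cgm])
  finally have G: "emeasure ?P good = (\<integral>\<^sup>+x. cond_good k x \<partial>own_space k)" .
  have le1: "cond_good k x \<le> 1" for x
  proof -
    have "cond_good k x \<le> (\<integral>\<^sup>+z. 1 \<partial>PiM (others k) (\<lambda>_. cgauss))"
      unfolding cond_good_def by (intro nn_integral_mono) (auto simp: indicator_def)
    then show ?thesis by (simp add: Z.emeasure_space_1)
  qed
  have mi: "indicator {x. cond_good k x = 0} \<in> borel_measurable (own_space k)"
  proof -
    have "(\<lambda>x. if cond_good k x = 0 then 1 else 0 :: ennreal) \<in> borel_measurable (own_space k)" by measurable
    then show ?thesis by (simp add: indicator_def[abs_def])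
  qed
  have "(\<integral>\<^sup>+x. indicator {x. cond_good k x = 0} x \<partial>own_space k) + emeasure ?P good = (\<integral>\<^sup>+x. indicator {x. cond_good k x = 0} x + cond_good k x \<partial>own_space k)"
    unfolding G using mi by (simp add: nn_integral_add)
  also have "\<dots> \<le> (\<integral>\<^sup>+x. 1 \<partial>own_space k)"
    using le1 by (intro nn_integral_mono) (auto simp: indicator_def)
  also have "\<dots> = 1" by (simp add: O.emeasure_space_1)
  finally have 1: "(\<integral>\<^sup>+x. indicator {x. cond_good k x = 0} x \<partial>own_space k) + ennreal (measure ?P good) \<le> 1"
    by (simp add: C.emeasure_eq_measure)
  have 2: "measure ?P good = 1 - error_prob K SNR INR N M enc dec"
    unfolding good_def error_prob_def using is_codeD(5)[OF code] by (simp add: C.prob_compl)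
  have e1: "0 \<le> error_prob K SNR INR N M enc dec" "error_prob K SNR INR N M enc dec \<le> 1" by (auto simp: error_prob_def)
  obtain a where a: "(\<integral>\<^sup>+x. indicator {x. cond_good k x = 0} x \<partial>own_space k) = ennreal a" "0 \<le> a"
  proof -
    have "(\<integral>\<^sup>+x. indicator {x. cond_good k x = 0} x \<partial>own_space k) \<noteq> \<infinity>" using 1 by (auto simp: top_unique)
    then show ?thesis using that by (cases "(\<integral>\<^sup>+x. indicator {x. cond_good k x = 0} x \<partial>own_space k)") auto
  qed
  show ?thesis using 1 e1 a unfolding 2 a(1) by (simp add: ennreal_plus[symmetric] ennreal_le_1 ennreal_leI del: ennreal_plus)
qed

text \<open>A transmitted symbol does not involve the noise, so measurability on the code space
  descends to the section where the noise is 0.\<close>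

lemma measurable_enc:
  assumes "k < K" "n < N"
  shows "(\<lambda>x. enc k (fst x k) (snd x) n) \<in> borel_measurable (msg_space K M \<Otimes>\<^sub>M phase_space K N)"
proof -
  have "(\<lambda>x. (fst x, snd x, (\<lambda>i\<in>{..<N} \<times> {..<K}. 0))) \<in> measurable (msg_space K M \<Otimes>\<^sub>M phase_space K N) (code_space K N M)"
    unfolding code_space_def by measurable (auto simp: space_PiM)
  from measurable_compose[OF this is_codeD(2)[OF code assms]] show ?thesis
    by (simp add: tx_symbol_def)
qed

lemma nn_integral_power_own_space:
  assumes "k < K" "n < N"
  shows "(\<integral>\<^sup>+x. ennreal ((cmod (enc k (fst x k) (fst (snd x)) n))\<^sup>2) \<partial>own_space j) \<le> 1"
proof -
  interpret C: prob_space "code_space K N M" by (rule prob_space_code_space) (auto intro: M_pos)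
  have m: "(\<lambda>x. enc k (fst x k) (fst (snd x)) n) \<in> borel_measurable (own_space j)"
    using measurable_compose[OF _ measurable_enc[OF assms], of "\<lambda>x. (fst x, fst (snd x))" "own_space j"]
    unfolding own_space_def by simp
  have "(\<integral>\<^sup>+x. ennreal ((cmod (enc k (fst x k) (fst (snd x)) n))\<^sup>2) \<partial>own_space j) =
    (\<integral>\<^sup>+w. \<integral>\<^sup>+\<phi>. ennreal ((cmod (enc k (w k) \<phi> n))\<^sup>2) \<partial>phase_space K N \<partial>msg_space K M)"
    using m by (subst nn_integral_own_space) (auto simp: prob_space.emeasure_space_1[OF prob_space_noise])
  also have "\<dots> = (\<integral>\<^sup>+\<omega>. ennreal ((cmod (tx_symbol enc \<omega> k n))\<^sup>2) \<partial>code_space K N M)"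
    using is_codeD(2)[OF code assms] by (subst nn_integral_code_space)
      (auto simp: tx_symbol_def prob_space.emeasure_space_1[OF prob_space_noise])
  also have "\<dots> = ennreal (\<integral>\<omega>. (cmod (tx_symbol enc \<omega> k n))\<^sup>2 \<partial>code_space K N M)"
    using is_codeD(3)[OF code assms] by (intro nn_integral_eq_integral) auto
  also have "\<dots> \<le> 1" using is_codeD(4)[OF code assms] by (simp add: ennreal_le_1)
  finally show ?thesis .
qed

end

text \<open>The phase of the dead link \<open>1 \<rightarrow> 2\<close> of the Z channel in the first channel use supplies, through
  \<open>g\<close>, the messages and phases of the rest of the network as common randomness. Receiver 2 also
  uses it to simulate the interference caused by transmitter 1.\<close>
locale z_reduction = net_code +
  fixes r t :: nat and g :: "real \<Rightarrow> msgs \<times> phases"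
  assumes r: "r < K" and t: "t < K" and rt: "r \<noteq> t" and N: "0 < N"
    and g: "g \<in> measurable phase_dist (msg_space K M \<Otimes>\<^sub>M phase_space K N)"
    and g_law: "distr phase_dist (msg_space K M \<Otimes>\<^sub>M phase_space K N) g = msg_space K M \<Otimes>\<^sub>M phase_space K N"
begin

definition usr :: "nat \<Rightarrow> nat" where "usr c = (if c = 0 then r else t)"
definition ix :: "nat \<Rightarrow> nat" where "ix i = (if i = r then 0 else 1)"
definition M2 :: "nat \<Rightarrow> nat" where "M2 c = M (usr c)"
definition Zinr :: "nat \<times> nat \<Rightarrow> real" where "Zinr p = (if p = (0, 1) then INR (r, t) else 0)"
definition src :: "nat \<times> nat \<times> nat" where "src = (0, 1, 0)"
definition I2 :: "(nat \<times> nat \<times> nat) set" where "I2 = {..<N} \<times> {..<2} \<times> {..<2}"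
definition IK :: "(nat \<times> nat \<times> nat) set" where "IK = {..<N} \<times> {..<K} \<times> {..<K}"
text \<open>The links whose phases are taken over from the Z channel: the two direct ones and the
  cross link from \<open>t\<close> to \<open>r\<close>. The phase from \<open>r\<close> to
  \<open>t\<close> is simulated like all the others, because the Z channel has no such link.\<close>

definition JP :: "(nat \<times> nat \<times> nat) set" where "JP = {..<N} \<times> {(r, r), (r, t), (t, t)}"
definition ixp :: "nat \<times> nat \<times> nat \<Rightarrow> nat \<times> nat \<times> nat" where "ixp = (\<lambda>(n, a, b). (n, ix a, ix b))"
text \<open>Receiver 0 hears both real transmitters. Receiver 1 does not hear transmitter 0, so for
  it the message of \<open>r\<close> is a simulated one, independent of the real message, and the
  resulting interference is part of \<open>fake\<close>.\<close>

definition JW :: "nat \<Rightarrow> nat set" where "JW c = (if c = 0 then {r, t} else {t})"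

definition ph_of :: "phases \<Rightarrow> phases \<Rightarrow> phases" where
  "ph_of \<phi>U x = (\<lambda>i\<in>IK. if i \<in> JP then x (ixp i) else \<phi>U i)"
definition msg_of :: "nat \<Rightarrow> msgs \<Rightarrow> msgs \<Rightarrow> msgs" where
  "msg_of c wU w' = (\<lambda>i\<in>{..<K}. if i \<in> JW c then w' (ix i) else wU i)"
definition nz_of :: "nat \<Rightarrow> noises \<Rightarrow> noises" where
  "nz_of c z' = (\<lambda>i\<in>own (usr c). z' (fst i, c))"
definition sim_ph :: "phases \<Rightarrow> phases" where "sim_ph \<phi>' = ph_of (snd (g (\<phi>' src))) \<phi>'"
definition sim_msg :: "nat \<Rightarrow> msgs \<Rightarrow> phases \<Rightarrow> msgs" where "sim_msg c w' \<phi>' = msg_of c (fst (g (\<phi>' src))) w'"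
text \<open>The state of the network that receiver \<open>c\<close> of the Z channel pretends to be
  in. The two receivers pretend different states; each of these has the right law by itself, and
  nothing is claimed about them jointly.\<close>

definition sim :: "nat \<Rightarrow> msgs \<times> phases \<times> noises \<Rightarrow> msgs \<times> phases \<times> noises" where
  "sim c \<omega> = (sim_msg c (fst \<omega>) (fst (snd \<omega>)), sim_ph (fst (snd \<omega>)), nz_of c (snd (snd \<omega>)))"

definition enc2 :: "nat \<Rightarrow> nat \<Rightarrow> phases \<Rightarrow> nat \<Rightarrow> complex" where
  "enc2 c v \<phi>' n = enc (usr c) v (sim_ph \<phi>') n"
text \<open>Interference of the transmitters that the Z channel does not supply. Their messages come
  from the seed, so it is a function of the phases alone, and the receiver can add it to its
  observation.\<close>

definition fake :: "nat \<Rightarrow> phases \<Rightarrow> nat \<Rightarrow> complex" where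
  "fake c \<phi>' n = (\<Sum>j\<in>{..<K} - JW c. chan_coeff SNR INR (usr c) j (sim_ph \<phi>' (n, usr c, j)) * enc j (fst (g (\<phi>' src)) j) (sim_ph \<phi>') n)"
definition test2 :: "nat \<Rightarrow> nat \<Rightarrow> (nat \<Rightarrow> complex) \<Rightarrow> phases \<Rightarrow> bool" where
  "test2 c v y \<phi>' \<longleftrightarrow> dtest (usr c) v (\<lambda>n. y n + fake c \<phi>' n) (sim_ph \<phi>')"

abbreviation "CS2 \<equiv> code_space 2 N M2"

lemma usr_lt: "usr c < K" using r t by (simp add: usr_def)
lemma M2_pos: "0 < M2 c" using M_pos[OF usr_lt] by (simp add: M2_def)
lemma ix_lt: "ix i < 2" by (simp add: ix_def)
lemma M2_ix: "i \<in> {r, t} \<Longrightarrow> M2 (ix i) = M i" by (auto simp: M2_def ix_def usr_def rt)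
lemma src_I2: "src \<in> I2" using N by (simp add: src_def I2_def)
lemma finite_I2: "finite I2" and finite_IK: "finite IK" by (auto simp: I2_def IK_def)
lemma JP_IK: "JP \<subseteq> IK" using r t by (auto simp: JP_def IK_def)
lemma inj_ixp: "inj_on ixp JP" using rt by (auto simp: inj_on_def JP_def ixp_def ix_def)
lemma ixp_JP: "ixp ` JP \<subseteq> I2 - {src}" using rt by (auto simp: JP_def ixp_def ix_def I2_def src_def)
lemma phase_space_IK: "phase_space K N = PiM IK (\<lambda>_. phase_dist)" by (simp add: IK_def)
lemma phase_space_I2: "phase_space 2 N = PiM I2 (\<lambda>_. phase_dist)" by (simp add: I2_def)
lemma JW_sub: "JW c \<subseteq> {..<K}" using r t by (auto simp: JW_def)
lemma JW_rt: "JW c \<subseteq> {r, t}" by (auto simp: JW_def)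

lemma measurable_g_comp:
  "(\<lambda>\<phi>'. g (\<phi>' src)) \<in> measurable (phase_space 2 N) (msg_space K M \<Otimes>\<^sub>M phase_space K N)"
  unfolding phase_space_I2
  by (rule measurable_compose[OF measurable_component_singleton[OF src_I2] g])

lemma measurable_ph_of:
  assumes "I2 - {src} \<subseteq> A"
  shows "(\<lambda>p. ph_of (fst p) (snd p)) \<in> measurable (phase_space K N \<Otimes>\<^sub>M PiM A (\<lambda>_. phase_dist)) (phase_space K N)"
  unfolding ph_of_def phase_space_IK
proof (rule measurable_restrict)
  fix i assume i: "i \<in> IK"
  show "(\<lambda>p. if i \<in> JP then snd p (ixp i) else fst p i) \<in> measurable (PiM IK (\<lambda>_. phase_dist) \<Otimes>\<^sub>M PiM A (\<lambda>_. phase_dist)) phase_dist"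
  proof (cases "i \<in> JP")
    case True
    then have "ixp i \<in> A" using ixp_JP assms by auto
    then show ?thesis using True by (simp add: measurable_compose[OF measurable_snd measurable_component_singleton])
  qed (use i in \<open>simp add: measurable_compose[OF measurable_fst measurable_component_singleton]\<close>)
qed

lemma measurable_sim_ph: "sim_ph \<in> measurable (phase_space 2 N) (phase_space K N)"
proof -
  have "(\<lambda>\<phi>'. (snd (g (\<phi>' src)), \<phi>')) \<in> measurable (phase_space 2 N) (phase_space K N \<Otimes>\<^sub>M PiM I2 (\<lambda>_. phase_dist))"
    by (intro measurable_Pair measurable_compose[OF measurable_g_comp measurable_snd]) (simp add: phase_space_I2)
  from measurable_compose[OF this measurable_ph_of] show ?thesis
    by (simp add: sim_ph_def[abs_def])
qed

lemma measurable_msg_of: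
  "(\<lambda>p. msg_of c (fst p) (snd p)) \<in> measurable (msg_space K M \<Otimes>\<^sub>M msg_space 2 M2) (msg_space K M)"
  unfolding msg_of_def
proof (rule measurable_restrict)
  fix i assume i: "i \<in> {..<K}"
  show "(\<lambda>p. if i \<in> JW c then snd p (ix i) else fst p i) \<in> measurable (msg_space K M \<Otimes>\<^sub>M msg_space 2 M2) (uniform_count_measure {..<M i})"
  proof (cases "i \<in> JW c")
    case True
    then have "M2 (ix i) = M i" using JW_rt M2_ix by blast
    moreover have "(\<lambda>p. snd p (ix i)) \<in> measurable (msg_space K M \<Otimes>\<^sub>M msg_space 2 M2) (uniform_count_measure {..<M2 (ix i)})"
      using ix_lt by (intro measurable_compose[OF measurable_snd] measurable_component_singleton) auto
    ultimately show ?thesis using True by simp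
  next
    case False
    have "(\<lambda>p. fst p i) \<in> measurable (msg_space K M \<Otimes>\<^sub>M msg_space 2 M2) (uniform_count_measure {..<M i})"
      using i by (intro measurable_compose[OF measurable_fst] measurable_component_singleton) auto
    then show ?thesis using False by simp
  qed
qed

lemma measurable_sim_msg:
  "(\<lambda>p. sim_msg c (fst p) (snd p)) \<in> measurable (msg_space 2 M2 \<Otimes>\<^sub>M phase_space 2 N) (msg_space K M)"
proof -
  have "(\<lambda>p. (fst (g (snd p src)), fst p)) \<in> measurable (msg_space 2 M2 \<Otimes>\<^sub>M phase_space 2 N) (msg_space K M \<Otimes>\<^sub>M msg_space 2 M2)"
    by (intro measurable_Pair measurable_fst measurable_compose[OF measurable_compose[OF measurable_snd measurable_g_comp] measurable_fst])
  from measurable_compose[OF this measurable_msg_of] show ?thesis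
    by (simp add: sim_msg_def)
qed

lemma measurable_nz_of:
  assumes "c < 2" shows "nz_of c \<in> measurable (noise_space 2 N) (PiM (own (usr c)) (\<lambda>_. cgauss))"
  unfolding nz_of_def using assms by (intro measurable_restrict measurable_component_singleton) (auto simp: own_def)

lemma measurable_sim:
  assumes "c < 2" shows "sim c \<in> measurable CS2 (own_space (usr c))"
  unfolding own_space_def code_space_def sim_def[abs_def]
proof (intro measurable_Pair)
  let ?S = "msg_space 2 M2 \<Otimes>\<^sub>M (phase_space 2 N \<Otimes>\<^sub>M noise_space 2 N)"
  have "(\<lambda>\<omega>. (fst \<omega>, fst (snd \<omega>))) \<in> measurable ?S (msg_space 2 M2 \<Otimes>\<^sub>M phase_space 2 N)" by measurable
  from measurable_compose[OF this measurable_sim_msg]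
  show "(\<lambda>\<omega>. sim_msg c (fst \<omega>) (fst (snd \<omega>))) \<in> measurable ?S (msg_space K M)" by simp
  show "(\<lambda>\<omega>. sim_ph (fst (snd \<omega>))) \<in> measurable ?S (phase_space K N)"
    by (intro measurable_compose[OF _ measurable_sim_ph]) measurable
  show "(\<lambda>\<omega>. nz_of c (snd (snd \<omega>))) \<in> measurable ?S (PiM (own (usr c)) (\<lambda>_. cgauss))"
    by (intro measurable_compose[OF _ measurable_nz_of[OF assms]]) measurable
qed

text \<open>Every replacement preserves the law: the noise of receiver \<open>c\<close> is
  reindexed, the seed is split off, the live phases overwrite simulated ones, and the real messages
  overwrite simulated ones. The target is \<open>own_space\<close>, since only the noise of one
  receiver is present.\<close>

lemma sim_law:
  assumes c: "c < 2" and h: "h \<in> borel_measurable (own_space (usr c))"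
  shows "(\<integral>\<^sup>+\<omega>. h (sim c \<omega>) \<partial>CS2) = (\<integral>\<^sup>+x. h x \<partial>own_space (usr c))"
proof -
  let ?O = "PiM (own (usr c)) (\<lambda>_. cgauss)"
  interpret Z: prob_space ?O by (rule prob_space_noise)
  interpret PK: prob_space "phase_space K N" by (rule prob_space_phase)
  define H1 where "H1 p = (\<integral>\<^sup>+\<zeta>. h (fst p, snd p, \<zeta>) \<partial>?O)" for p
  have hm: "(\<lambda>(p, \<zeta>). h (fst p, snd p, \<zeta>)) \<in> borel_measurable ((msg_space K M \<Otimes>\<^sub>M phase_space K N) \<Otimes>\<^sub>M ?O)"
  proof -
    have "(\<lambda>q. (fst (fst q), snd (fst q), snd q)) \<in> measurable ((msg_space K M \<Otimes>\<^sub>M phase_space K N) \<Otimes>\<^sub>M ?O) (own_space (usr c))"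
      unfolding own_space_def by measurable
    from measurable_compose[OF this h] show ?thesis by (simp add: split_beta')
  qed
  have H1: "H1 \<in> borel_measurable (msg_space K M \<Otimes>\<^sub>M phase_space K N)"
    using Z.borel_measurable_nn_integral_fst[OF hm] by (simp add: H1_def[abs_def])
  have nz_law: "distr (noise_space 2 N) ?O (nz_of c) = ?O"
    unfolding nz_of_def using c
    by (intro distr_PiM_reindex[of "{..<N} \<times> {..<2}" "\<lambda>_. cgauss" "\<lambda>i. (fst i, c)" "own (usr c)"])
       (auto simp: prob_space_cgauss own_def inj_on_def)
  have "(\<integral>\<^sup>+\<omega>. h (sim c \<omega>) \<partial>CS2) = (\<integral>\<^sup>+w'. \<integral>\<^sup>+\<phi>'. \<integral>\<^sup>+z'. h (sim c (w', \<phi>', z')) \<partial>noise_space 2 N \<partial>phase_space 2 N \<partial>msg_space 2 M2)"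
    by (rule nn_integral_code_space[OF measurable_compose[OF measurable_sim[OF c] h]])
  also have "\<dots> = (\<integral>\<^sup>+w'. \<integral>\<^sup>+\<phi>'. H1 (sim_msg c w' \<phi>', sim_ph \<phi>') \<partial>phase_space 2 N \<partial>msg_space 2 M2)"
  proof (intro nn_integral_cong)
    fix w' \<phi>' assume w': "w' \<in> space (msg_space 2 M2)" and \<phi>': "\<phi>' \<in> space (phase_space 2 N)"
    have a: "sim_msg c w' \<phi>' \<in> space (msg_space K M)"
      using measurable_space[OF measurable_sim_msg, of "(w', \<phi>')" c] w' \<phi>' by (simp add: space_pair_measure)
    have b: "sim_ph \<phi>' \<in> space (phase_space K N)" using measurable_space[OF measurable_sim_ph \<phi>'] .
    have "(\<lambda>\<zeta>. (sim_msg c w' \<phi>', sim_ph \<phi>', \<zeta>)) \<in> measurable ?O (own_space (usr c))"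
      unfolding own_space_def using a b by measurable
    from measurable_compose[OF this h] have m: "(\<lambda>\<zeta>. h (sim_msg c w' \<phi>', sim_ph \<phi>', \<zeta>)) \<in> borel_measurable ?O" .
    have "(\<integral>\<^sup>+z'. h (sim_msg c w' \<phi>', sim_ph \<phi>', nz_of c z') \<partial>noise_space 2 N) =
        (\<integral>\<^sup>+\<zeta>. h (sim_msg c w' \<phi>', sim_ph \<phi>', \<zeta>) \<partial>distr (noise_space 2 N) ?O (nz_of c))"
      using m by (subst nn_integral_distr[OF measurable_nz_of[OF c]]) auto
    then show "(\<integral>\<^sup>+z'. h (sim c (w', \<phi>', z')) \<partial>noise_space 2 N) = H1 (sim_msg c w' \<phi>', sim_ph \<phi>')"
      unfolding nz_law by (simp add: sim_def H1_def)
  qed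
  also have "\<dots> = (\<integral>\<^sup>+w'. \<integral>\<^sup>+wU. \<integral>\<^sup>+\<phi>. H1 (msg_of c wU w', \<phi>) \<partial>phase_space K N \<partial>msg_space K M \<partial>msg_space 2 M2)"
  proof (intro nn_integral_cong)
    fix w' assume w': "w' \<in> space (msg_space 2 M2)"
    define H where "H u x = H1 (msg_of c (fst u) w', ph_of (snd u) x)" for u x
    have Hm: "case_prod H \<in> borel_measurable ((msg_space K M \<Otimes>\<^sub>M phase_space K N) \<Otimes>\<^sub>M PiM (I2 - {src}) (\<lambda>_. phase_dist))"
    proof -
      let ?S = "(msg_space K M \<Otimes>\<^sub>M phase_space K N) \<Otimes>\<^sub>M PiM (I2 - {src}) (\<lambda>_. phase_dist)"
      have 1: "(\<lambda>q. msg_of c (fst (fst q)) w') \<in> measurable ?S (msg_space K M)"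
      proof -
        have "(\<lambda>q. (fst (fst q), w')) \<in> measurable ?S (msg_space K M \<Otimes>\<^sub>M msg_space 2 M2)" using w' by measurable
        from measurable_compose[OF this measurable_msg_of] show ?thesis by simp
      qed
      have 2: "(\<lambda>q. ph_of (snd (fst q)) (snd q)) \<in> measurable ?S (phase_space K N)"
      proof -
        have "(\<lambda>q. (snd (fst q), snd q)) \<in> measurable ?S (phase_space K N \<Otimes>\<^sub>M PiM (I2 - {src}) (\<lambda>_. phase_dist))" by measurable
        from measurable_compose[OF this measurable_ph_of] show ?thesis by simp
      qed
      from measurable_compose[OF measurable_Pair[OF 1 2] H1] show ?thesis by (simp add: H_def split_beta')
    qed
    have "(\<integral>\<^sup>+\<phi>'. H1 (sim_msg c w' \<phi>', sim_ph \<phi>') \<partial>phase_space 2 N) = (\<integral>\<^sup>+\<phi>'. H (g (\<phi>' src)) (restrict \<phi>' (I2 - {src})) \<partial>PiM I2 (\<lambda>_. phase_dist))"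
    proof -
      \<comment> \<open>\<open>ixp\<close> maps the copied links away from \<open>src\<close>, so
        the copied phases never read the seed and are independent of what is simulated from
        it.\<close>
      have "ph_of \<phi>U (restrict \<phi>' (I2 - {src})) = ph_of \<phi>U \<phi>'" for \<phi>U \<phi>'
        using ixp_JP by (auto simp: ph_of_def fun_eq_iff)
      then show ?thesis by (simp add: phase_space_I2 H_def sim_ph_def sim_msg_def)
    qed
    also have "\<dots> = (\<integral>\<^sup>+u. \<integral>\<^sup>+x. H u x \<partial>PiM (I2 - {src}) (\<lambda>_. phase_dist) \<partial>(msg_space K M \<Otimes>\<^sub>M phase_space K N))"
      by (rule nn_integral_PiM_split_off(1)[OF finite_I2 src_I2 prob_space_phase_dist g g_law Hm])
    also have "\<dots> = (\<integral>\<^sup>+wU. \<integral>\<^sup>+\<phi>U. \<integral>\<^sup>+x. H (wU, \<phi>U) x \<partial>PiM (I2 - {src}) (\<lambda>_. phase_dist) \<partial>phase_space K N \<partial>msg_space K M)"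
    proof -
      interpret X: prob_space "PiM (I2 - {src}) (\<lambda>_. phase_dist)" by (rule prob_space_phase)
      have "(\<lambda>u. \<integral>\<^sup>+x. H u x \<partial>PiM (I2 - {src}) (\<lambda>_. phase_dist)) \<in> borel_measurable (msg_space K M \<Otimes>\<^sub>M phase_space K N)"
        using X.borel_measurable_nn_integral_fst[OF Hm] by simp
      from PK.nn_integral_fst[OF this] show ?thesis by simp
    qed
    also have "\<dots> = (\<integral>\<^sup>+wU. \<integral>\<^sup>+\<phi>. H1 (msg_of c wU w', \<phi>) \<partial>phase_space K N \<partial>msg_space K M)"
    proof (rule nn_integral_cong)
      fix wU assume wU: "wU \<in> space (msg_space K M)"
      have a: "msg_of c wU w' \<in> space (msg_space K M)"
        using measurable_space[OF measurable_msg_of, of "(wU, w')" c] w' wU by (simp add: space_pair_measure)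
      have m: "(\<lambda>\<phi>. H1 (msg_of c wU w', \<phi>)) \<in> borel_measurable (PiM IK (\<lambda>_. phase_dist))"
        using measurable_compose[OF measurable_Pair1'[OF a] H1] by (simp add: phase_space_IK)
      have f: "finite (I2 - {src})" using finite_I2 by simp
      show "(\<integral>\<^sup>+\<phi>U. \<integral>\<^sup>+x. H (wU, \<phi>U) x \<partial>PiM (I2 - {src}) (\<lambda>_. phase_dist) \<partial>phase_space K N) = (\<integral>\<^sup>+\<phi>. H1 (msg_of c wU w', \<phi>) \<partial>phase_space K N)"
        using nn_integral_PiM_replace(1)[where I=IK and A="I2 - {src}" and M="\<lambda>_. phase_dist" and P="\<lambda>_. phase_dist" and J=JP and \<sigma>=ixp,
            OF finite_IK f prob_space_phase_dist prob_space_phase_dist JP_IK inj_ixp ixp_JP refl m]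
        by (simp add: phase_space_IK H_def ph_of_def)
    qed
    finally show "(\<integral>\<^sup>+\<phi>'. H1 (sim_msg c w' \<phi>', sim_ph \<phi>') \<partial>phase_space 2 N) = \<dots>" .
  qed
  also have "\<dots> = (\<integral>\<^sup>+w. \<integral>\<^sup>+\<phi>. H1 (w, \<phi>) \<partial>phase_space K N \<partial>msg_space K M)"
  proof -
    let ?U = "\<lambda>k. uniform_count_measure {..<M k}" and ?U2 = "\<lambda>k. uniform_count_measure {..<M2 k}"
    have 1: "\<And>i. i \<in> {..<K} \<Longrightarrow> prob_space (?U i)" using M_pos by (intro prob_space_uniform_count_measure) auto
    have 2: "\<And>i. i \<in> {..<2} \<Longrightarrow> prob_space (?U2 i)" using M2_pos by (intro prob_space_uniform_count_measure) auto
    have 3: "inj_on ix (JW c)" using rt by (auto simp: inj_on_def ix_def JW_def)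
    have 4: "ix ` JW c \<subseteq> {..<2}" using ix_lt by auto
    have 5: "\<And>i. i \<in> JW c \<Longrightarrow> ?U2 (ix i) = ?U i" using M2_ix JW_rt by (metis subsetD)
    show ?thesis
      using nn_integral_PiM_replace(2)[where I="{..<K}" and A="{..<2}" and M="?U" and P="?U2" and J="JW c" and \<sigma>=ix and h="\<lambda>w. \<integral>\<^sup>+\<phi>. H1 (w, \<phi>) \<partial>phase_space K N",
        OF _ _ 1 2 JW_sub 3 4 5 measurable_msg_any] by (simp add: msg_of_def)
  qed
  also have "\<dots> = (\<integral>\<^sup>+x. h x \<partial>own_space (usr c))"
    by (simp add: nn_integral_own_space[OF h] H1_def)
  finally show ?thesis .
qed

lemma sim_ph_apply:
  assumes "n < N"
  shows "sim_ph \<phi>' (n, r, r) = \<phi>' (n, 0, 0)" "sim_ph \<phi>' (n, r, t) = \<phi>' (n, 0, 1)" "sim_ph \<phi>' (n, t, t) = \<phi>' (n, 1, 1)"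
  using assms r t rt by (auto simp: sim_ph_def ph_of_def IK_def JP_def ixp_def ix_def)

text \<open>The network signal at \<open>usr c\<close> is a sum over transmitters. Those in
  \<open>JW c\<close> are supplied physically, with the same gains and phases as in the Z channel;
  all others are supplied by \<open>fake\<close>.\<close>

lemma received2_add_fake:
  assumes c: "c < 2" and n: "n < N"
  shows "received 2 SNR Zinr enc2 \<omega> c n + fake c (fst (snd \<omega>)) n =
    signal (usr c) (fst (sim c \<omega>)) (fst (snd (sim c \<omega>))) n + snd (snd \<omega>) (n, c)"
proof -
  obtain w' \<phi>' z' where [simp]: "\<omega> = (w', \<phi>', z')" by (cases \<omega>)
  have "signal (usr c) (sim_msg c w' \<phi>') (sim_ph \<phi>') n =
    (\<Sum>j\<in>JW c. chan_coeff SNR INR (usr c) j (sim_ph \<phi>' (n, usr c, j)) * enc j (sim_msg c w' \<phi>' j) (sim_ph \<phi>') n) +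
    (\<Sum>j\<in>{..<K} - JW c. chan_coeff SNR INR (usr c) j (sim_ph \<phi>' (n, usr c, j)) * enc j (sim_msg c w' \<phi>' j) (sim_ph \<phi>') n)"
    unfolding signal_def using sum.subset_diff[OF JW_sub] by (simp add: add.commute)
  also have "(\<Sum>j\<in>{..<K} - JW c. chan_coeff SNR INR (usr c) j (sim_ph \<phi>' (n, usr c, j)) * enc j (sim_msg c w' \<phi>' j) (sim_ph \<phi>') n) = fake c \<phi>' n"
    unfolding fake_def by (intro sum.cong) (auto simp: sim_msg_def msg_of_def)
  also have "(\<Sum>j\<in>JW c. chan_coeff SNR INR (usr c) j (sim_ph \<phi>' (n, usr c, j)) * enc j (sim_msg c w' \<phi>' j) (sim_ph \<phi>') n) =
     (\<Sum>j<2. chan_coeff SNR Zinr c j (\<phi>' (n, c, j)) * enc2 j (w' j) \<phi>' n)"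
  proof -
    have s2: "{..<2::nat} = {0, 1}" by auto
    have "c = 0 \<or> c = 1" using c by auto
    then show ?thesis
      using r t rt n by (auto simp: s2 JW_def usr_def sim_msg_def msg_of_def sim_ph_apply enc2_def chan_coeff_def Zinr_def ix_def)
  qed
  finally show ?thesis by (simp add: received_def tx_symbol_def sim_def)
qed

text \<open>The pretended message tuple is itself a candidate in \<open>dtest\<close>: subtracting
  its signal leaves exactly the real noise. The test at the true message can therefore fail only if
  \<open>cond_good\<close> vanishes at the pretended state.\<close>

lemma not_test2_imp:
  assumes \<omega>: "\<omega> \<in> space CS2" and c: "c < 2"
    and nt: "\<not> test2 c (fst \<omega> c) (rx_block 2 SNR Zinr N enc2 \<omega> c) (fst (snd \<omega>))"
  shows "cond_good (usr c) (sim c \<omega>) = 0"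
proof (rule ccontr)
  assume ne: "cond_good (usr c) (sim c \<omega>) \<noteq> 0"
  have sp: "fst (sim c \<omega>) \<in> Pi\<^sub>E {..<K} (\<lambda>k. {..<M k})"
    using measurable_space[OF measurable_sim[OF c] \<omega>] by (simp only: own_space_def space_pair_measure space_msg mem_Times_iff)
  have c01: "c = 0 \<or> c = 1" using c by auto
  then have v: "fst (sim c \<omega>) (usr c) = fst \<omega> c"
    using r t rt by (auto simp: sim_def sim_msg_def msg_of_def usr_def JW_def ix_def)
  let ?y = "\<lambda>n. rx_block 2 SNR Zinr N enc2 \<omega> c n + fake c (fst (snd \<omega>)) n"
  have z: "(\<lambda>i\<in>own (usr c). ?y (fst i) - signal (usr c) (fst (sim c \<omega>)) (fst (snd (sim c \<omega>))) (fst i)) = snd (snd (sim c \<omega>))"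
  proof
    fix i
    show "(\<lambda>i\<in>own (usr c). ?y (fst i) - signal (usr c) (fst (sim c \<omega>)) (fst (snd (sim c \<omega>))) (fst i)) i = snd (snd (sim c \<omega>)) i"
      using received2_add_fake[OF c, of "fst i" \<omega>]
      by (cases "i \<in> own (usr c)") (auto simp: own_def sim_def[of c \<omega>] nz_of_def)
  qed
  have "dtest (usr c) (fst \<omega> c) ?y (sim_ph (fst (snd \<omega>)))"
    unfolding dtest_def
  proof (intro bexI[OF _ sp] conjI v)
    have s: "sim_ph (fst (snd \<omega>)) = fst (snd (sim c \<omega>))" by (simp add: sim_def)
    show "0 < cond_good (usr c) (fst (sim c \<omega>), sim_ph (fst (snd \<omega>)), \<lambda>i\<in>own (usr c). ?y (fst i) - signal (usr c) (fst (sim c \<omega>)) (sim_ph (fst (snd \<omega>))) (fst i))"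
      unfolding s z using ne by (simp add: zero_less_iff_neq_zero)
  qed
  with nt show False by (simp add: test2_def)
qed

lemma measurable_sim_ph2: "(\<lambda>\<omega>. sim_ph (fst (snd \<omega>))) \<in> measurable CS2 (phase_space K N)"
  unfolding code_space_def by (intro measurable_compose[OF _ measurable_sim_ph]) measurable

lemma measurable_src2: "(\<lambda>\<omega>. g (fst (snd \<omega>) src)) \<in> measurable CS2 (msg_space K M \<Otimes>\<^sub>M phase_space K N)"
  unfolding code_space_def by (intro measurable_compose[OF _ measurable_g_comp]) measurable

lemma measurable_sim_ph2_apply:
  assumes "n < N" "a < K" "b < K"
  shows "(\<lambda>\<omega>. sim_ph (fst (snd \<omega>)) (n, a, b)) \<in> borel_measurable CS2"
proof -
  have "(\<lambda>x. x (n, a, b)) \<in> measurable (phase_space K N) phase_dist"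
    using assms by (intro measurable_component_singleton) auto
  from measurable_compose[OF measurable_sim_ph2 this] show ?thesis
    by (simp add: measurable_cong_sets[OF refl sets_phase_dist])
qed

lemma measurable_enc_sim:
  assumes jn: "j < K" "n < N" and W: "W \<in> measurable CS2 (msg_space K M)"
  shows "(\<lambda>\<omega>. enc j (W \<omega> j) (sim_ph (fst (snd \<omega>))) n) \<in> borel_measurable CS2"
  using measurable_compose[OF measurable_Pair[OF W measurable_sim_ph2] measurable_enc[OF jn]] by simp

text \<open>In \<open>sim 0\<close> the messages of both \<open>r\<close> and \<open>t\<close> are
  the real ones, so the law of this single state settles measurability and power for both
  transmitters.\<close>

lemma measurable_tx2:
  assumes c: "c < 2" and n: "n < N"
  shows "(\<lambda>\<omega>. tx_symbol enc2 \<omega> c n) \<in> borel_measurable CS2"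
    and "tx_symbol enc2 \<omega> c n = enc (usr c) (fst (sim 0 \<omega>) (usr c)) (fst (snd (sim 0 \<omega>))) n"
proof -
  have c01: "c = 0 \<or> c = 1" using c by auto
  then show eq: "tx_symbol enc2 \<omega> c n = enc (usr c) (fst (sim 0 \<omega>) (usr c)) (fst (snd (sim 0 \<omega>))) n" for \<omega>
    using r t rt by (auto simp: tx_symbol_def enc2_def sim_def sim_msg_def msg_of_def usr_def JW_def ix_def)
  have W: "(\<lambda>\<omega>. fst (sim 0 \<omega>)) \<in> measurable CS2 (msg_space K M)"
    using measurable_compose[OF measurable_sim[of 0, unfolded own_space_def] measurable_fst] by simp
  show "(\<lambda>\<omega>. tx_symbol enc2 \<omega> c n) \<in> borel_measurable CS2"
    using measurable_enc_sim[OF usr_lt n W] by (simp add: eq sim_def)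
qed

lemma measurable_received2:
  assumes c: "c < 2" and n: "n < N"
  shows "(\<lambda>\<omega>. received 2 SNR Zinr enc2 \<omega> c n) \<in> borel_measurable CS2"
  unfolding received_def
proof (intro borel_measurable_add borel_measurable_sum borel_measurable_times measurable_tx2)
  fix j :: nat assume j: "j \<in> {..<2}"
  have "(\<lambda>\<omega>. fst (snd \<omega>) (n, c, j)) \<in> measurable CS2 phase_dist"
    unfolding code_space_def using c n j by (intro measurable_compose[OF measurable_snd] measurable_compose[OF measurable_fst] measurable_component_singleton) auto
  then show "(\<lambda>\<omega>. chan_coeff SNR Zinr c j (fst (snd \<omega>) (n, c, j))) \<in> borel_measurable CS2"
    by (intro measurable_compose[OF _ measurable_chan_coeff]) (simp add: measurable_cong_sets[OF refl sets_phase_dist])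
  show "j < 2" using j by simp
next
  have "(\<lambda>\<omega>. snd (snd \<omega>) (n, c)) \<in> measurable CS2 cgauss"
    unfolding code_space_def using c n by (intro measurable_compose[OF measurable_snd] measurable_compose[OF measurable_snd] measurable_component_singleton) auto
  then show "(\<lambda>\<omega>. snd (snd \<omega>) (n, c)) \<in> borel_measurable CS2"
    by (simp add: measurable_cong_sets[OF refl cgauss_sets])
qed (use n in auto)

text \<open>The tuples over which \<open>dtest\<close> quantifies form a finite set, so acceptance
  is a finite union of events on which a measurable function is positive.\<close>

lemma test2_sets:
  assumes c: "c < 2"
  shows "{\<omega> \<in> space CS2. test2 c v (rx_block 2 SNR Zinr N enc2 \<omega> c) (fst (snd \<omega>))} \<in> sets CS2"
proof -
  let ?W = "Pi\<^sub>E {..<K} (\<lambda>k. {..<M k})"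
  let ?y = "\<lambda>\<omega> n. rx_block 2 SNR Zinr N enc2 \<omega> c n + fake c (fst (snd \<omega>)) n"
  let ?x = "\<lambda>w \<omega>. (w, sim_ph (fst (snd \<omega>)), \<lambda>i\<in>own (usr c). ?y \<omega> (fst i) - signal (usr c) w (sim_ph (fst (snd \<omega>))) (fst i))"
  have W: "(\<lambda>\<omega>. fst (g (fst (snd \<omega>) src))) \<in> measurable CS2 (msg_space K M)"
    by (rule measurable_compose[OF measurable_src2 measurable_fst])
  have fake: "(\<lambda>\<omega>. fake c (fst (snd \<omega>)) n) \<in> borel_measurable CS2" if n: "n < N" for n
    unfolding fake_def using n usr_lt
    by (intro borel_measurable_sum borel_measurable_times measurable_enc_sim[OF _ n W] measurable_compose[OF measurable_sim_ph2_apply measurable_chan_coeff]) auto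
  have sig: "(\<lambda>\<omega>. signal (usr c) w (sim_ph (fst (snd \<omega>))) n) \<in> borel_measurable CS2" if n: "n < N" and w: "w \<in> ?W" for n w
    unfolding signal_def using n usr_lt w
    by (intro borel_measurable_sum borel_measurable_times measurable_enc_sim[OF _ n] measurable_compose[OF measurable_sim_ph2_apply measurable_chan_coeff]) (auto simp: space_msg)
  have x: "?x w \<in> measurable CS2 (own_space (usr c))" if w: "w \<in> ?W" for w
    unfolding own_space_def
  proof (intro measurable_Pair measurable_const measurable_sim_ph2 measurable_restrict)
    show "w \<in> space (msg_space K M)" using w by (simp add: space_msg)
    fix i assume "i \<in> own (usr c)"
    then have n: "fst i < N" by (auto simp: own_def)
    show "(\<lambda>\<omega>. ?y \<omega> (fst i) - signal (usr c) w (sim_ph (fst (snd \<omega>))) (fst i)) \<in> measurable CS2 cgauss"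
      unfolding measurable_cong_sets[OF refl cgauss_sets]
      using n measurable_received2[OF c n] by (intro borel_measurable_diff borel_measurable_add fake sig w) auto
  qed
  have "{\<omega> \<in> space CS2. test2 c v (rx_block 2 SNR Zinr N enc2 \<omega> c) (fst (snd \<omega>))} =
    (\<Union>w\<in>{w \<in> ?W. w (usr c) = v}. {\<omega> \<in> space CS2. 0 < cond_good (usr c) (?x w \<omega>)})"
    unfolding test2_def dtest_def by auto
  also have "\<dots> \<in> sets CS2"
  proof (intro sets.finite_UN)
    show "finite {w \<in> ?W. w (usr c) = v}" by (rule finite_subset[of _ ?W]) (auto intro!: finite_PiE)
    fix w assume "w \<in> {w \<in> ?W. w (usr c) = v}"
    then have "(\<lambda>\<omega>. cond_good (usr c) (?x w \<omega>)) \<in> borel_measurable CS2"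
      by (intro measurable_compose[OF x measurable_cond_good[OF usr_lt]]) auto
    then show "{\<omega> \<in> space CS2. 0 < cond_good (usr c) (?x w \<omega>)} \<in> sets CS2" by measurable
  qed
  finally show ?thesis .
qed

text \<open>At time \<open>m\<close> the pretended phases read real phases of time \<open>m\<close>
  and the seed, and the seed belongs to time 0.\<close>

lemma enc2_causal:
  assumes "\<forall>m\<le>n. \<forall>a<2. \<forall>b<2. \<phi> (m, a, b) = \<phi>' (m, a, b)"
  shows "enc2 c w \<phi> n = enc2 c w \<phi>' n"
proof -
  have s: "\<phi> src = \<phi>' src" using assms by (simp add: src_def)
  have "sim_ph \<phi> (m, a, b) = sim_ph \<phi>' (m, a, b)" if m: "m \<le> n" for m a b
  proof -
    have "\<phi> (ixp (m, a, b)) = \<phi>' (ixp (m, a, b))"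
      using assms m ix_lt by (simp add: ixp_def)
    then show ?thesis by (simp add: sim_ph_def ph_of_def s)
  qed
  then show ?thesis using code usr_lt unfolding is_code_def enc2_def by blast
qed

lemma is_code2: "is_code 2 SNR Zinr N M2 enc2 (test_decoder M2 test2)"
  unfolding is_code_def
proof (intro conjI allI impI)
  interpret prob_space CS2 by (rule prob_space_code_space) (rule M2_pos)
  show "0 < M2 k" for k by (rule M2_pos)
  show "enc2 k w \<phi> n = enc2 k w \<phi>' n" if "\<forall>m\<le>n. \<forall>r<2. \<forall>t<2. \<phi> (m, r, t) = \<phi>' (m, r, t)" for k w n \<phi> \<phi>'
    by (rule enc2_causal[OF that])
  show "error_event 2 SNR Zinr N M2 enc2 (test_decoder M2 test2) \<in> sets CS2"
    by (intro test_decoder_error_sets test2_sets)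
  fix c n :: nat assume c: "c < 2" and n: "n < N"
  note m[measurable] = measurable_tx2(1)[OF c n]
  show "(\<lambda>\<omega>. tx_symbol enc2 \<omega> c n) \<in> borel_measurable CS2" by (rule m)
  let ?h = "\<lambda>x. ennreal ((cmod (enc (usr c) (fst x (usr c)) (fst (snd x)) n))\<^sup>2)"
  have hm: "?h \<in> borel_measurable (own_space (usr 0))"
  proof -
    have "(\<lambda>x. (fst x, fst (snd x))) \<in> measurable (own_space (usr 0)) (msg_space K M \<Otimes>\<^sub>M phase_space K N)"
      unfolding own_space_def by measurable
    from measurable_compose[OF this measurable_enc[OF usr_lt n]] show ?thesis by simp
  qed
  have "(\<integral>\<^sup>+\<omega>. ennreal ((cmod (tx_symbol enc2 \<omega> c n))\<^sup>2) \<partial>CS2) = (\<integral>\<^sup>+\<omega>. ?h (sim 0 \<omega>) \<partial>CS2)"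
    by (simp add: measurable_tx2(2)[OF c n])
  also have "\<dots> = (\<integral>\<^sup>+x. ?h x \<partial>own_space (usr 0))" by (rule sim_law[OF _ hm]) simp
  also have "\<dots> \<le> 1" by (rule nn_integral_power_own_space[OF usr_lt n])
  finally have le: "(\<integral>\<^sup>+\<omega>. ennreal ((cmod (tx_symbol enc2 \<omega> c n))\<^sup>2) \<partial>CS2) \<le> 1" .
  show i: "integrable CS2 (\<lambda>\<omega>. (cmod (tx_symbol enc2 \<omega> c n))\<^sup>2)"
    using le by (intro integrableI_nonneg) (auto simp: le_less_trans)
  show "(\<integral>\<omega>. (cmod (tx_symbol enc2 \<omega> c n))\<^sup>2 \<partial>CS2) \<le> 1"
    using le nn_integral_eq_integral[OF i] by (simp add: ennreal_le_1)
qed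

text \<open>By \<open>dtest_unique\<close> a receiver never accepts two messages, so an error means
  that the true one is rejected. By the law of the pretended state this is no more likely than an
  error of the original code; the factor 2 is the union bound over the receivers.\<close>

lemma error_prob2: "error_prob 2 SNR Zinr N M2 enc2 (test_decoder M2 test2) \<le> 2 * error_prob K SNR INR N M enc dec"
proof -
  interpret prob_space CS2 by (rule prob_space_code_space) (rule M2_pos)
  let ?B = "\<lambda>c. {\<omega> \<in> space CS2. cond_good (usr c) (sim c \<omega>) = 0}"
  have B: "?B c \<in> sets CS2" if "c < 2" for c
    using measurable_compose[OF measurable_sim[OF that] measurable_cond_good[OF usr_lt]] by measurable
  have PB: "prob (?B c) \<le> error_prob K SNR INR N M enc dec" if c: "c < 2" for c
  proof -
    have mi: "indicator {x. cond_good (usr c) x = 0} \<in> borel_measurable (own_space (usr c))"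
    proof -
      note [measurable] = measurable_cond_good[OF usr_lt]
      have "(\<lambda>x. if cond_good (usr c) x = 0 then 1 else 0 :: ennreal) \<in> borel_measurable (own_space (usr c))" by measurable
      then show ?thesis by (simp add: indicator_def[abs_def])
    qed
    have "emeasure CS2 (?B c) = (\<integral>\<^sup>+\<omega>. indicator (?B c) \<omega> \<partial>CS2)" using B[OF c] by simp
    also have "\<dots> = (\<integral>\<^sup>+\<omega>. indicator {x. cond_good (usr c) x = 0} (sim c \<omega>) \<partial>CS2)"
      by (intro nn_integral_cong) (auto simp: indicator_def)
    also have "\<dots> = (\<integral>\<^sup>+x. indicator {x. cond_good (usr c) x = 0} x \<partial>own_space (usr c))"
      by (rule sim_law[OF c mi])
    also have "\<dots> \<le> ennreal (error_prob K SNR INR N M enc dec)" by (rule cond_good_zero_prob[OF usr_lt])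
    finally show ?thesis by (simp add: emeasure_eq_measure error_prob_def)
  qed
  have "error_event 2 SNR Zinr N M2 enc2 (test_decoder M2 test2) \<subseteq> ?B 0 \<union> ?B 1"
  proof
    fix \<omega> assume e: "\<omega> \<in> error_event 2 SNR Zinr N M2 enc2 (test_decoder M2 test2)"
    let ?q = "\<lambda>c v. test2 c v (rx_block 2 SNR Zinr N enc2 \<omega> c) (fst (snd \<omega>))"
    obtain c where \<omega>: "\<omega> \<in> space CS2" and c: "c < 2" and or: "\<not> ?q c (fst \<omega> c) \<or> (\<exists>v<M2 c. v \<noteq> fst \<omega> c \<and> ?q c v)"
      using subsetD[OF test_decoder_error_subset e] by blast
    have "v = v'" if "?q c v" "?q c v'" for v v'
      using dtest_unique[OF usr_lt that(1)[unfolded test2_def]] dtest_unique[OF usr_lt that(2)[unfolded test2_def]] by simp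
    with or have "\<not> ?q c (fst \<omega> c)" by blast
    then have "\<omega> \<in> ?B c" using not_test2_imp[OF \<omega> c] \<omega> by simp
    moreover have "c = 0 \<or> c = 1" using c by auto
    ultimately show "\<omega> \<in> ?B 0 \<union> ?B 1" by blast
  qed
  then have "error_prob 2 SNR Zinr N M2 enc2 (test_decoder M2 test2) \<le> prob (?B 0 \<union> ?B 1)"
    unfolding error_prob_def using B[of 0] B[of 1] by (intro finite_measure_mono) auto
  also have "\<dots> \<le> prob (?B 0) + prob (?B 1)" using B[of 0] B[of 1] by (intro measure_Un_le) auto
  finally show ?thesis using PB[of 0] PB[of 1] by simp
qed

end

lemma achievable_Z:
  assumes R: "achievable K SNR INR R" and rt: "r < K" "t < K" "r \<noteq> t"
  shows "achievable 2 SNR (\<lambda>p. if p = (0, 1) then INR (r, t) else 0) (\<lambda>c. if c = 0 then R r else R t)"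
  unfolding achievable_def
proof (intro conjI allI impI)
  let ?R = "\<lambda>c::nat. if c = 0 then R r else R t"
  let ?G = "\<lambda>p. if p = (0, 1) then INR (r, t) else 0"
  show "0 \<le> ?R k" for k using R rt by (simp add: achievable_def)
  fix e :: real assume "0 < e"
  \<comment> \<open>The reduction doubles the error probability.\<close>
  then have "0 < e / 2" by simp
  then obtain N0 where N0: "\<And>N. N \<ge> N0 \<Longrightarrow> \<exists>enc dec. is_code K SNR INR N (msg_sizes N R) enc dec \<and> error_prob K SNR INR N (msg_sizes N R) enc dec \<le> e / 2"
    using R unfolding achievable_def by meson
  show "\<exists>N0. \<forall>N\<ge>N0. \<exists>enc dec. is_code 2 SNR ?G N (msg_sizes N ?R) enc dec \<and> error_prob 2 SNR ?G N (msg_sizes N ?R) enc dec \<le> e"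
  \<comment> \<open>The seed belongs to channel use 0, so the block must be nonempty.\<close>
  proof (intro exI[of _ "max N0 1"] allI impI)
    fix N assume N: "max N0 1 \<le> N"
    then obtain enc dec where c: "is_code K SNR INR N (msg_sizes N R) enc dec" and err: "error_prob K SNR INR N (msg_sizes N R) enc dec \<le> e / 2"
      using N0[of N] by auto
    let ?M = "msg_sizes N R"
    have "simulable (msg_space K ?M \<Otimes>\<^sub>M phase_space K N)"
      by (intro simulable_pair simulable_PiM simulable_uniform_count is_codeD(1)[OF c])
         (auto simp: simulable_def distr_id2 intro!: bexI[of _ "\<lambda>x. x"])
    then obtain g where g: "g \<in> measurable phase_dist (msg_space K ?M \<Otimes>\<^sub>M phase_space K N)"
      "distr phase_dist (msg_space K ?M \<Otimes>\<^sub>M phase_space K N) g = msg_space K ?M \<Otimes>\<^sub>M phase_space K N"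
      unfolding simulable_def by blast
    interpret z_reduction K SNR INR N ?M enc dec r t g
      using c rt N g by unfold_locales auto
    have M2: "M2 = msg_sizes N ?R" by (auto simp: M2_def usr_def msg_sizes_def fun_eq_iff)
    have G: "Zinr = ?G" by (auto simp: Zinr_def fun_eq_iff)
    show "\<exists>enc dec. is_code 2 SNR ?G N (msg_sizes N ?R) enc dec \<and> error_prob 2 SNR ?G N (msg_sizes N ?R) enc dec \<le> e"
      using is_code2 error_prob2 err unfolding M2 G by (intro exI conjI) auto
  qed
qed

section \<open>Scores of Gaussian codewords\<close>

lemma integral_PiM_component:
  fixes f :: "'a \<Rightarrow> 'b :: {banach, second_countable_topology}"
  assumes Q: "prob_space Q" and i: "i \<in> I" and f: "f \<in> borel_measurable Q"
  shows "integrable (PiM I (\<lambda>_. Q)) (\<lambda>x. f (x i)) \<longleftrightarrow> integrable Q f"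
    and "(\<integral>x. f (x i) \<partial>PiM I (\<lambda>_. Q)) = (\<integral>x. f x \<partial>Q)"
proof -
  have eq: "distr (PiM I (\<lambda>_. Q)) Q (\<lambda>x. x i) = Q"
    using Q i by (intro distr_PiM_component) auto
  have m: "(\<lambda>x. x i) \<in> measurable (PiM I (\<lambda>_. Q)) Q" using i by simp
  show "integrable (PiM I (\<lambda>_. Q)) (\<lambda>x. f (x i)) \<longleftrightarrow> integrable Q f"
    using integrable_distr_eq[OF m f] by (simp add: eq)
  show "(\<integral>x. f (x i) \<partial>PiM I (\<lambda>_. Q)) = (\<integral>x. f x \<partial>Q)"
    using integral_distr[OF m f] by (simp add: eq)
qed

lemma measurable_cnj[measurable]: "cnj \<in> borel_measurable borel"
  by (intro borel_measurable_continuous_onI continuous_on_cnj continuous_on_id)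

lemma cgauss_orthogonal:
  assumes ij: "i \<in> I" "j \<in> I" "i \<noteq> j"
  shows "integrable (PiM I (\<lambda>_. cgauss)) (\<lambda>x. x i * cnj (x j))" "(\<integral>x. x i * cnj (x j) \<partial>PiM I (\<lambda>_. cgauss)) = 0"
proof -
  interpret prob_space "PiM I (\<lambda>_. cgauss)" by (rule prob_space_noise)
  let ?Y = "\<lambda>k x. if k = i then x i else cnj (x k) :: complex"
  have "indep_vars (\<lambda>_. cgauss) (\<lambda>k x. x k) I"
    using ij by (intro indep_vars_PiM_coordinates prob_space_cgauss) auto
  then have 0: "indep_vars (\<lambda>_. cgauss) (\<lambda>k x. x k) {i, j}" by (rule indep_vars_subset) (use ij in auto)
  have iv: "indep_vars (\<lambda>_. borel) (\<lambda>k x. (\<lambda>k z. if k = i then z else cnj z) k (x k)) {i, j}"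
    by (rule indep_vars_compose2[OF 0]) (use ij in \<open>auto simp: measurable_cong_sets[OF cgauss_sets refl]\<close>)
  have cn: "integrable cgauss cnj" "integral\<^sup>L cgauss cnj = 0"
    using cgauss_moments(1,2) integrable_bounded_linear[OF bounded_linear_cnj, of cgauss "\<lambda>z. z"]
      integral_bounded_linear[OF bounded_linear_cnj, of cgauss "\<lambda>z. z"] by auto
  have int: "integrable (PiM I (\<lambda>_. cgauss)) (\<lambda>x. if k = i then x k else cnj (x k))" if "k \<in> {i, j}" for k
  proof -
    have k: "k \<in> I" using that ij by auto
    have 1: "(\<lambda>z. z) \<in> borel_measurable cgauss" "cnj \<in> borel_measurable cgauss" by auto
    show ?thesis
      using integral_PiM_component(1)[OF prob_space_cgauss k 1(1)] integral_PiM_component(1)[OF prob_space_cgauss k 1(2)] cgauss_moments(1) cn(1)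
      by (cases "k = i") simp_all
  qed
  have "integrable (PiM I (\<lambda>_. cgauss)) (\<lambda>x. \<Prod>k\<in>{i,j}. if k = i then x k else cnj (x k))"
    by (rule indep_vars_integrable[OF _ iv int]) auto
  then show "integrable (PiM I (\<lambda>_. cgauss)) (\<lambda>x. x i * cnj (x j))" using ij by simp
  have "(\<integral>x. (\<Prod>k\<in>{i,j}. if k = i then x k else cnj (x k)) \<partial>PiM I (\<lambda>_. cgauss)) = (\<Prod>k\<in>{i,j}. \<integral>x. (if k = i then x k else cnj (x k)) \<partial>PiM I (\<lambda>_. cgauss))"
    by (rule indep_vars_lebesgue_integral[OF _ iv int]) auto
  also have "\<dots> = 0"
  proof -
    have 1: "(\<lambda>z. z) \<in> borel_measurable cgauss" by auto
    show ?thesis using ij integral_PiM_component(2)[OF prob_space_cgauss ij(1) 1] cgauss_moments(2) by simp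
  qed
  finally show "(\<integral>x. x i * cnj (x j) \<partial>PiM I (\<lambda>_. cgauss)) = 0" using ij by simp
qed

lemma cgauss_linear_second_moment:
  assumes D: "finite D" "D \<subseteq> I"
  shows "integrable (PiM I (\<lambda>_. cgauss)) (\<lambda>x. (cmod (\<Sum>i\<in>D. \<beta> i * x i))\<^sup>2)"
    and "(\<integral>x. (cmod (\<Sum>i\<in>D. \<beta> i * x i))\<^sup>2 \<partial>PiM I (\<lambda>_. cgauss)) = (\<Sum>i\<in>D. (cmod (\<beta> i))\<^sup>2)"
proof -
  let ?P = "PiM I (\<lambda>_. cgauss)"
  have ij: "has_bochner_integral ?P (\<lambda>x. \<beta> i * x i * cnj (\<beta> j * x j)) (if i = j then complex_of_real ((cmod (\<beta> i))\<^sup>2) else 0)"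
    if "i \<in> D" "j \<in> D" for i j
  proof (cases "i = j")
    case True
    have i: "i \<in> I" using that D by auto
    have "has_bochner_integral ?P (\<lambda>x. (cmod (x i))\<^sup>2) 1"
      using integral_PiM_component[OF prob_space_cgauss i, of "\<lambda>z. (cmod z)\<^sup>2"] cgauss_moments(3,4)
      by (auto simp: has_bochner_integral_iff measurable_cong_sets[OF cgauss_sets refl])
    then have "has_bochner_integral ?P (\<lambda>x. complex_of_real ((cmod (\<beta> i))\<^sup>2) * complex_of_real ((cmod (x i))\<^sup>2)) (complex_of_real ((cmod (\<beta> i))\<^sup>2) * complex_of_real 1)"
      by (intro has_bochner_integral_mult_right has_bochner_integral_of_real)
    moreover have "\<beta> i * z * cnj (\<beta> i * z) = complex_of_real ((cmod (\<beta> i))\<^sup>2) * complex_of_real ((cmod z)\<^sup>2)" for z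
      unfolding complex_norm_square by (simp add: algebra_simps)
    ultimately show ?thesis using True by simp
  next
    case False
    have "has_bochner_integral ?P (\<lambda>x. x i * cnj (x j)) 0"
      using cgauss_orthogonal[of i I j] that D False by (auto simp: has_bochner_integral_iff)
    then have "has_bochner_integral ?P (\<lambda>x. (\<beta> i * cnj (\<beta> j)) * (x i * cnj (x j))) ((\<beta> i * cnj (\<beta> j)) * 0)"
      by (rule has_bochner_integral_mult_right)
    then show ?thesis using False by (simp add: algebra_simps)
  qed
  have "has_bochner_integral ?P (\<lambda>x. \<Sum>i\<in>D. \<Sum>j\<in>D. \<beta> i * x i * cnj (\<beta> j * x j)) (\<Sum>i\<in>D. \<Sum>j\<in>D. if i = j then complex_of_real ((cmod (\<beta> i))\<^sup>2) else 0)"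
    by (intro has_bochner_integral_sum ij)
  moreover have "(\<Sum>i\<in>D. \<Sum>j\<in>D. \<beta> i * x i * cnj (\<beta> j * x j)) = complex_of_real ((cmod (\<Sum>i\<in>D. \<beta> i * x i))\<^sup>2)" for x
    unfolding complex_norm_square cnj_sum sum_product ..
  moreover have "(\<Sum>i\<in>D. \<Sum>j\<in>D. if i = j then complex_of_real ((cmod (\<beta> i))\<^sup>2) else 0) = complex_of_real (\<Sum>i\<in>D. (cmod (\<beta> i))\<^sup>2)"
    using D by simp
  ultimately have "has_bochner_integral ?P (\<lambda>x. complex_of_real ((cmod (\<Sum>i\<in>D. \<beta> i * x i))\<^sup>2)) (complex_of_real (\<Sum>i\<in>D. (cmod (\<beta> i))\<^sup>2))"
    by (simp only:)
  then have "has_bochner_integral ?P (\<lambda>x. (cmod (\<Sum>i\<in>D. \<beta> i * x i))\<^sup>2) (\<Sum>i\<in>D. (cmod (\<beta> i))\<^sup>2)"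
    unfolding has_bochner_integral_iff integral_complex_of_real of_real_eq_iff by (simp only: complex_of_real_integrable_eq)
  then show "integrable ?P (\<lambda>x. (cmod (\<Sum>i\<in>D. \<beta> i * x i))\<^sup>2)"
    and "(\<integral>x. (cmod (\<Sum>i\<in>D. \<beta> i * x i))\<^sup>2 \<partial>?P) = (\<Sum>i\<in>D. (cmod (\<beta> i))\<^sup>2)"
    by (auto simp: has_bochner_integral_iff)
qed

text \<open>Every term is at most the largest one, whose fourth power is among the summands on the
  right.\<close>

lemma sum_power4_le:
  fixes a :: "'i \<Rightarrow> real"
  assumes "finite D" "\<And>i. i \<in> D \<Longrightarrow> 0 \<le> a i"
  shows "(\<Sum>i\<in>D. a i)^4 \<le> real (card D)^4 * (\<Sum>i\<in>D. a i^4)"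
proof (cases "D = {}")
  case False
  define m where "m = Max (a ` D)"
  have "m \<in> a ` D" unfolding m_def using assms False by (intro Max_in) auto
  then obtain i where i: "i \<in> D" "a i = m" by blast
  have "(\<Sum>i\<in>D. a i) \<le> real (card D) * m"
    using assms by (intro sum_bounded_above[of D a m, simplified]) (auto simp: m_def)
  then have "(\<Sum>i\<in>D. a i)^4 \<le> (real (card D) * m)^4" using assms by (intro power_mono sum_nonneg) auto
  also have "\<dots> = real (card D)^4 * a i^4" by (simp add: power_mult_distrib i)
  also have "\<dots> \<le> real (card D)^4 * (\<Sum>i\<in>D. a i^4)"
    using assms i by (intro mult_left_mono member_le_sum) auto
  finally show ?thesis .
qed simp

definition m4 :: real where "m4 = (\<integral>z. (cmod z)^4 \<partial>cgauss)"

lemma m4_nonneg: "0 \<le> m4" by (simp add: m4_def)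

text \<open>Of the factor \<open>n^5\<close>, \<open>n^4\<close> stems from the power inequality and
  one more \<open>n\<close> from the number of summands. In the application \<open>n\<close> depends
  on the number of users and not on the block length.\<close>

lemma cgauss_linear_fourth_moment:
  assumes D: "finite D" "D \<subseteq> I" "card D \<le> n" and A: "\<And>i. i \<in> D \<Longrightarrow> cmod (\<beta> i) \<le> A" "0 \<le> A"
  shows "integrable (PiM I (\<lambda>_. cgauss)) (\<lambda>x. (cmod (\<Sum>i\<in>D. \<beta> i * x i))^4)"
    and "(\<integral>x. (cmod (\<Sum>i\<in>D. \<beta> i * x i))^4 \<partial>PiM I (\<lambda>_. cgauss)) \<le> A^4 * real n^5 * m4"
proof -
  let ?P = "PiM I (\<lambda>_. cgauss)"
  have i4: "integrable ?P (\<lambda>x. (cmod (x i))^4)" "(\<integral>x. (cmod (x i))^4 \<partial>?P) = m4" if "i \<in> D" for i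
    using integral_PiM_component[OF prob_space_cgauss, of i I "\<lambda>z. (cmod z)^4"] cgauss_moments(5) that D
    by (auto simp: m4_def measurable_cong_sets[OF cgauss_sets refl])
  let ?g = "\<lambda>x. A^4 * (real n^4 * (\<Sum>i\<in>D. (cmod (x i))^4))"
  have gi: "integrable ?P ?g" using i4 by auto
  have le: "(cmod (\<Sum>i\<in>D. \<beta> i * x i))^4 \<le> ?g x" for x
  proof -
    have "cmod (\<Sum>i\<in>D. \<beta> i * x i) \<le> (\<Sum>i\<in>D. A * cmod (x i))"
      using A by (intro order_trans[OF norm_sum] sum_mono) (auto simp: norm_mult intro!: mult_right_mono)
    then have "(cmod (\<Sum>i\<in>D. \<beta> i * x i))^4 \<le> (A * (\<Sum>i\<in>D. cmod (x i)))^4"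
      by (intro power_mono) (auto simp: sum_distrib_left)
    also have "\<dots> = A^4 * (\<Sum>i\<in>D. cmod (x i))^4" by (simp add: power_mult_distrib)
    also have "\<dots> \<le> A^4 * (real (card D)^4 * (\<Sum>i\<in>D. (cmod (x i))^4))"
      using D by (intro mult_left_mono sum_power4_le) auto
    also have "\<dots> \<le> ?g x" using D by (intro mult_left_mono mult_right_mono power_mono sum_nonneg) auto
    finally show ?thesis .
  qed
  have meas: "(\<lambda>x. (cmod (\<Sum>i\<in>D. \<beta> i * x i))^4) \<in> borel_measurable ?P"
  proof -
    have "(\<lambda>x. ((cmod (\<Sum>i\<in>D. \<beta> i * x i))\<^sup>2)\<^sup>2) \<in> borel_measurable ?P"
      using borel_measurable_integrable[OF cgauss_linear_second_moment(1)[OF D(1,2), of \<beta>]] by measurable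
    then show ?thesis by (simp add: power_mult[symmetric])
  qed
  show int: "integrable ?P (\<lambda>x. (cmod (\<Sum>i\<in>D. \<beta> i * x i))^4)"
    by (rule Bochner_Integration.integrable_bound[OF gi meas]) (use le in \<open>auto intro!: AE_I2 simp: abs_of_nonneg sum_nonneg\<close>)
  have "(\<integral>x. (cmod (\<Sum>i\<in>D. \<beta> i * x i))^4 \<partial>?P) \<le> (\<integral>x. ?g x \<partial>?P)"
    by (intro integral_mono int gi le)
  also have "\<dots> = A^4 * (real n^4 * (real (card D) * m4))"
    using i4 by (simp add: Bochner_Integration.integral_sum)
  also have "\<dots> \<le> A^4 * (real n^4 * (real n * m4))"
    using D m4_nonneg by (intro mult_left_mono mult_right_mono) auto
  finally show "(\<integral>x. (cmod (\<Sum>i\<in>D. \<beta> i * x i))^4 \<partial>?P) \<le> A^4 * real n^5 * m4"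
    by (simp add: power_Suc2[symmetric] mult.assoc[symmetric] eval_nat_numeral)
qed

text \<open>\<open>score c t x\<close> is, up to an additive constant, the log-likelihood ratio of \<open>t = c x + v\<close> with
  \<open>v\<close> Gaussian of variance 2 against a Gaussian \<open>t\<close> independent of \<open>x\<close>.\<close>
definition score :: "real \<Rightarrow> complex \<Rightarrow> complex \<Rightarrow> real" where
  "score c t x = (cmod t)\<^sup>2 / (2 + c\<^sup>2) - (cmod (t - c * x))\<^sup>2 / 2"

lemma measurable_score[measurable (raw)]:
  assumes [measurable]: "f \<in> borel_measurable M" "g \<in> borel_measurable M"
  shows "(\<lambda>x. score c (f x) (g x)) \<in> borel_measurable M"
  unfolding score_def by measurable

text \<open>If the part of a block other than \<open>b l\<close> has variance \<open>v\<close>, the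
  score has mean \<open>c^2 (2 - v) / (2 (2 + c^2))\<close>, which is 0 at \<open>v = 2\<close> and
  at least \<open>- \<eta> / 2\<close> for \<open>v\<close> up to \<open>2 + \<eta>\<close>. The
  other half of the threshold is left to Chebyshev's inequality; fourth moments of the linear forms
  bound second moments of the scores.\<close>

lemma score_tail:
  fixes J :: "'l \<Rightarrow> 'i set" and \<alpha> :: "'l \<Rightarrow> 'i \<Rightarrow> complex"
  assumes I: "finite I" and S: "finite S" and J: "\<And>l. l \<in> S \<Longrightarrow> J l \<subseteq> I" "disjoint_family_on J S"
    and b: "\<And>l. l \<in> S \<Longrightarrow> b l \<in> J l" "\<And>l. l \<in> S \<Longrightarrow> \<alpha> l (b l) = complex_of_real c"
    and card: "\<And>l. l \<in> S \<Longrightarrow> card (J l) \<le> n" and A: "\<And>l i. l \<in> S \<Longrightarrow> i \<in> J l \<Longrightarrow> cmod (\<alpha> l i) \<le> A" "0 \<le> A"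
    and v: "\<And>l. l \<in> S \<Longrightarrow> (\<Sum>i\<in>J l - {b l}. (cmod (\<alpha> l i))\<^sup>2) \<le> 2 + \<eta>" and \<eta>: "0 < \<eta>" and S0: "S \<noteq> {}"
  shows "measure (PiM I (\<lambda>_. cgauss)) {x \<in> space (PiM I (\<lambda>_. cgauss)). (\<Sum>l\<in>S. score c (\<Sum>i\<in>J l. \<alpha> l i * x i) (x (b l))) \<le> - \<eta> * real (card S)}
     \<le> 8 * A^4 * real n^5 * m4 / (\<eta>\<^sup>2 * real (card S))"
proof -
  let ?P = "PiM I (\<lambda>_. cgauss)"
  let ?T = "\<lambda>l x. \<Sum>i\<in>J l. \<alpha> l i * x i" and ?V = "\<lambda>l x. \<Sum>i\<in>J l - {b l}. \<alpha> l i * x i"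
  define U where "U l x = score c (\<Sum>i\<in>J l. \<alpha> l i * x i) (x (b l))" for l x
  have fin: "finite (J l)" if "l \<in> S" for l using J(1)[OF that] I finite_subset by blast
  have c2: "0 < 2 + c\<^sup>2" by (simp add: add_pos_nonneg)
  have Ueq: "U l x = (cmod (?T l x))\<^sup>2 / (2 + c\<^sup>2) - (cmod (?V l x))\<^sup>2 / 2" if "l \<in> S" for l x
    using sum.remove[OF fin[OF that] b(1)[OF that], of "\<lambda>i. \<alpha> l i * x i"] b(2)[OF that]
    by (simp add: U_def score_def)
  have restr: "U l (restrict x (J l)) = U l x" if "l \<in> S" for l x
    using b(1)[OF that] by (simp add: U_def)
  have sqT: "integrable ?P (\<lambda>x. (cmod (?T l x))\<^sup>2)" "(\<integral>x. (cmod (?T l x))\<^sup>2 \<partial>?P) = (\<Sum>i\<in>J l. (cmod (\<alpha> l i))\<^sup>2)"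
    and sqV: "integrable ?P (\<lambda>x. (cmod (?V l x))\<^sup>2)" "(\<integral>x. (cmod (?V l x))\<^sup>2 \<partial>?P) = (\<Sum>i\<in>J l - {b l}. (cmod (\<alpha> l i))\<^sup>2)"
    if "l \<in> S" for l using J(1)[OF that] fin[OF that] by (auto intro!: cgauss_linear_second_moment)
  have cV: "card (J l - {b l}) \<le> n" if "l \<in> S" for l using card[OF that] card_Diff1_le[of "J l" "b l"] by linarith
  have foT: "integrable ?P (\<lambda>x. (cmod (?T l x))^4)" "(\<integral>x. (cmod (?T l x))^4 \<partial>?P) \<le> A^4 * real n^5 * m4"
    if "l \<in> S" for l using J(1)[OF that] fin[OF that] card[OF that] A that by (auto intro!: cgauss_linear_fourth_moment)
  have foV: "integrable ?P (\<lambda>x. (cmod (?V l x))^4)" "(\<integral>x. (cmod (?V l x))^4 \<partial>?P) \<le> A^4 * real n^5 * m4"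
    if "l \<in> S" for l using J(1)[OF that] fin[OF that] cV[OF that] A that by (auto intro!: cgauss_linear_fourth_moment)
  have Ule: "(U l x)\<^sup>2 \<le> (cmod (?T l x))^4 + (cmod (?V l x))^4" if "l \<in> S" for l x
  proof -
    define p where "p = (cmod (?T l x))\<^sup>2" define q where "q = (cmod (?V l x))\<^sup>2"
    have pq: "0 \<le> p" "0 \<le> q" by (auto simp: p_def q_def)
    have p': "0 \<le> p / (2 + c\<^sup>2)" "p / (2 + c\<^sup>2) \<le> p" using pq c2 by (auto simp: field_simps)
    have "\<bar>p / (2 + c\<^sup>2) - q / 2\<bar> \<le> max p q" using p' pq by linarith
    then have "\<bar>p / (2 + c\<^sup>2) - q / 2\<bar>\<^sup>2 \<le> (max p q)\<^sup>2" by (intro power_mono) auto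
    also have "\<dots> \<le> p\<^sup>2 + q\<^sup>2" by (simp add: max_def)
    finally show ?thesis by (simp add: Ueq[OF that] p_def q_def power_mult[symmetric])
  qed
  have Uint: "integrable ?P (U l)" "(\<integral>x. U l x \<partial>?P) \<ge> - \<eta> / 2" if l: "l \<in> S" for l
  proof -
    let ?v = "\<Sum>i\<in>J l - {b l}. (cmod (\<alpha> l i))\<^sup>2"
    have s: "(\<Sum>i\<in>J l. (cmod (\<alpha> l i))\<^sup>2) = c\<^sup>2 + ?v"
      using sum.remove[OF fin[OF l] b(1)[OF l], of "\<lambda>i. (cmod (\<alpha> l i))\<^sup>2"] b(2)[OF l] by simp
    show "integrable ?P (U l)" unfolding Ueq[OF l, abs_def] using sqT[OF l] sqV[OF l] by auto
    have "(\<integral>x. U l x \<partial>?P) = (c\<^sup>2 + ?v) / (2 + c\<^sup>2) - ?v / 2"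
      unfolding Ueq[OF l] using sqT[OF l] sqV[OF l] by (simp add: s)
    also have "\<dots> = c\<^sup>2 * (2 - ?v) / (2 * (2 + c\<^sup>2))" using c2 by (simp add: divide_simps) (simp add: algebra_simps)
    also have "\<dots> \<ge> c\<^sup>2 * (- \<eta>) / (2 * (2 + c\<^sup>2))"
      using v[OF l] c2 by (intro divide_right_mono mult_left_mono) auto
    also have "c\<^sup>2 * (- \<eta>) / (2 * (2 + c\<^sup>2)) \<ge> - \<eta> / 2" using c2 \<eta> by (simp add: divide_simps)
    finally show "(\<integral>x. U l x \<partial>?P) \<ge> - \<eta> / 2" by simp
  qed
  have U2: "integrable ?P (\<lambda>x. (U l x)\<^sup>2)" "(\<integral>x. (U l x)\<^sup>2 \<partial>?P) \<le> 2 * (A^4 * real n^5 * m4)" if l: "l \<in> S" for l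
  proof -
    have ib: "integrable ?P (\<lambda>x. (cmod (?T l x))^4 + (cmod (?V l x))^4)" using foT(1)[OF l] foV(1)[OF l] by simp
    show i: "integrable ?P (\<lambda>x. (U l x)\<^sup>2)"
      by (rule Bochner_Integration.integrable_bound[OF ib])
         (use Ule[OF l] borel_measurable_integrable[OF Uint(1)[OF l]] in \<open>auto\<close>)
    have "(\<integral>x. (U l x)\<^sup>2 \<partial>?P) \<le> (\<integral>x. (cmod (?T l x))^4 + (cmod (?V l x))^4 \<partial>?P)" by (intro integral_mono i ib Ule[OF l])
    also have "\<dots> = (\<integral>x. (cmod (?T l x))^4 \<partial>?P) + (\<integral>x. (cmod (?V l x))^4 \<partial>?P)"
      using foT(1)[OF l] foV(1)[OF l] by simp
    finally show "(\<integral>x. (U l x)\<^sup>2 \<partial>?P) \<le> 2 * (A^4 * real n^5 * m4)"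
      using foT(2)[OF l] foV(2)[OF l] by linarith
  qed
  have Um: "U l \<in> borel_measurable (PiM (J l) (\<lambda>_. cgauss))" if l: "l \<in> S" for l
  proof -
    have "(\<lambda>x. x i) \<in> borel_measurable (PiM (J l) (\<lambda>_. cgauss))" if "i \<in> J l" for i
      using measurable_component_singleton[OF that, of "\<lambda>_. cgauss"] by (simp add: measurable_cong_sets[OF refl cgauss_sets])
    with b(1)[OF l] show ?thesis unfolding U_def[abs_def] by (intro measurable_score borel_measurable_sum borel_measurable_times) auto
  qed
  let ?n = "real (card S)"
  have n0: "0 < ?n" using S S0 by (simp add: card_gt_0_iff)
  have "measure ?P {x \<in> space ?P. (\<Sum>l\<in>S. U l (restrict x (J l))) \<le> ?n * (- \<eta> / 2) - \<eta> / 2 * ?n} \<le> ?n * (2 * (A^4 * real n^5 * m4)) / (\<eta> / 2 * ?n)\<^sup>2"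
    by (rule PiM_block_lower_tail[OF S prob_space_cgauss J Um])
       (use U2 Uint(2) restr n0 \<eta> in auto)
  also have "?n * (2 * (A^4 * real n^5 * m4)) / (\<eta> / 2 * ?n)\<^sup>2 = 8 * A^4 * real n^5 * m4 / (\<eta>\<^sup>2 * ?n)"
    using n0 \<eta> by (simp add: field_simps power2_eq_square)
  also have "{x \<in> space ?P. (\<Sum>l\<in>S. U l (restrict x (J l))) \<le> ?n * (- \<eta> / 2) - \<eta> / 2 * ?n} =
      {x \<in> space ?P. (\<Sum>l\<in>S. score c (\<Sum>i\<in>J l. \<alpha> l i * x i) (x (b l))) \<le> - \<eta> * ?n}"
  proof -
    have "(\<Sum>l\<in>S. U l (restrict x (J l))) = (\<Sum>l\<in>S. score c (\<Sum>i\<in>J l. \<alpha> l i * x i) (x (b l)))" for x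
      using restr by (simp add: U_def)
    moreover have "?n * (- \<eta> / 2) - \<eta> / 2 * ?n = - \<eta> * ?n" by (simp add: field_simps)
    ultimately show ?thesis by simp
  qed
  finally show ?thesis .
qed

text \<open>Markov's inequality for the exponential of the total score. Given all variables outside
  the image of \<open>d\<close>, the observations \<open>T l\<close> are constants and the symbols
  of the wrong codeword are independent Gaussians, so by \<open>cgauss_exp_quadratic\<close> each
  position contributes the same factor whatever was observed.\<close>

lemma score_wrong_codeword:
  fixes d :: "'l \<Rightarrow> 'i" and T :: "'l \<Rightarrow> ('i \<Rightarrow> complex) \<Rightarrow> complex"
  assumes I: "finite I" and S: "finite S" and d: "inj_on d S" "d ` S \<subseteq> I"
    and T: "\<And>l. l \<in> S \<Longrightarrow> T l \<in> borel_measurable (PiM I (\<lambda>_. cgauss))"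
    and indep: "\<And>l x y. l \<in> S \<Longrightarrow> (\<And>i. i \<in> I - d ` S \<Longrightarrow> x i = y i) \<Longrightarrow> T l x = T l y"
  shows "measure (PiM I (\<lambda>_. cgauss)) {x \<in> space (PiM I (\<lambda>_. cgauss)). - \<theta> \<le> (\<Sum>l\<in>S. score c (T l x) (x (d l)))}
    \<le> exp \<theta> * (1 / (1 + c\<^sup>2 / 2)) ^ card S"
proof -
  let ?P = "PiM I (\<lambda>_. cgauss)" and ?D = "d ` S"
  interpret PI: prob_space ?P by (rule prob_space_noise)
  interpret product_prob_space "\<lambda>_. cgauss" "UNIV :: 'i set" by (intro product_prob_spaceI prob_space_cgauss)
  have comp: "(\<lambda>x. x (d l)) \<in> borel_measurable ?P" if "l \<in> S" for l
    using measurable_component_singleton[of "d l" I "\<lambda>_. cgauss"] d that by (auto simp: measurable_cong_sets[OF refl cgauss_sets])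
  define F where "F x = ennreal (exp (\<Sum>l\<in>S. score c (T l x) (x (d l))))" for x
  have sm: "(\<lambda>x. \<Sum>l\<in>S. score c (T l x) (x (d l))) \<in> borel_measurable ?P"
    by (intro borel_measurable_sum measurable_score T comp)
  then have Fm: "F \<in> borel_measurable ?P" unfolding F_def by measurable
  have split: "(I - ?D) \<union> ?D = I" "(I - ?D) \<inter> ?D = {}" using d by auto
  have "(\<integral>\<^sup>+x. F x \<partial>?P) = (\<integral>\<^sup>+x. \<integral>\<^sup>+y. F (merge (I - ?D) ?D (x, y)) \<partial>PiM ?D (\<lambda>_. cgauss) \<partial>PiM (I - ?D) (\<lambda>_. cgauss))"
    using product_nn_integral_fold[OF split(2), of F] Fm I S unfolding split(1) by simp
  also have "\<dots> = (\<integral>\<^sup>+x. ennreal (1 / (1 + c\<^sup>2 / 2)) ^ card S \<partial>PiM (I - ?D) (\<lambda>_. cgauss))"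
  proof (rule nn_integral_cong)
    fix x assume "x \<in> space (PiM (I - ?D) (\<lambda>_. cgauss))"
    let ?m = "\<lambda>y. merge (I - ?D) ?D (x, y)"
    define \<tau> where "\<tau> l = T l (?m undefined)" for l
    have Tm: "T l (?m y) = \<tau> l" if "l \<in> S" for l y
      unfolding \<tau>_def using that by (intro indep) (auto simp: merge_def)
    have inv: "the_inv_into S d (d l) = l" if "l \<in> S" for l using d(1) that by (rule the_inv_into_f_f)
    have "F (?m y) = (\<Prod>i\<in>?D. ennreal (exp (score c (\<tau> (the_inv_into S d i)) (y i))))" for y
    proof -
      have "F (?m y) = ennreal (\<Prod>l\<in>S. exp (score c (\<tau> l) (y (d l))))"
      proof -
        have "?m y (d l) = y (d l)" if "l \<in> S" for l using that by (simp add: merge_def)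
        then show ?thesis unfolding F_def exp_sum[OF S] using Tm by simp
      qed
      also have "\<dots> = (\<Prod>l\<in>S. ennreal (exp (score c (\<tau> l) (y (d l)))))" by (simp add: prod_ennreal)
      also have "\<dots> = (\<Prod>i\<in>?D. ennreal (exp (score c (\<tau> (the_inv_into S d i)) (y i))))"
        using d(1) by (simp add: prod.reindex inv)
      finally show ?thesis .
    qed
    then have "(\<integral>\<^sup>+y. F (?m y) \<partial>PiM ?D (\<lambda>_. cgauss)) = (\<integral>\<^sup>+y. (\<Prod>i\<in>?D. ennreal (exp (score c (\<tau> (the_inv_into S d i)) (y i)))) \<partial>PiM ?D (\<lambda>_. cgauss))"
      by simp
    also have "\<dots> = (\<Prod>i\<in>?D. \<integral>\<^sup>+y. ennreal (exp (score c (\<tau> (the_inv_into S d i)) y)) \<partial>cgauss)"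
      using S by (intro product_nn_integral_prod) (auto simp: score_def measurable_cong_sets[OF cgauss_sets refl])
    also have "\<dots> = ennreal (1 / (1 + c\<^sup>2 / 2)) ^ card ?D"
      unfolding score_def cgauss_exp_quadratic by simp
    finally show "(\<integral>\<^sup>+y. F (?m y) \<partial>PiM ?D (\<lambda>_. cgauss)) = ennreal (1 / (1 + c\<^sup>2 / 2)) ^ card S"
      using d(1) by (simp add: card_image)
  qed
  also have "\<dots> = ennreal ((1 / (1 + c\<^sup>2 / 2)) ^ card S)"
    using prob_space.emeasure_space_1[OF prob_space_noise[of "I - ?D"]] by (simp add: ennreal_power add_pos_nonneg)
  finally have EF: "(\<integral>\<^sup>+x. F x \<partial>?P) = ennreal ((1 / (1 + c\<^sup>2 / 2)) ^ card S)" .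
  let ?E = "{x \<in> space ?P. - \<theta> \<le> (\<Sum>l\<in>S. score c (T l x) (x (d l)))}"
  have Em: "?E \<in> sets ?P" using sm by measurable
  have "emeasure ?P ?E = (\<integral>\<^sup>+x. indicator ?E x \<partial>?P)" using Em by simp
  also have "\<dots> \<le> (\<integral>\<^sup>+x. ennreal (exp \<theta>) * F x \<partial>?P)"
  proof (intro nn_integral_mono)
    fix x
    show "indicator ?E x \<le> ennreal (exp \<theta>) * F x"
      by (auto simp: indicator_def F_def ennreal_mult[symmetric] mult_exp_exp)
  qed
  also have "\<dots> = ennreal (exp \<theta> * (1 / (1 + c\<^sup>2 / 2)) ^ card S)"
    using Fm by (subst nn_integral_cmult) (auto simp: EF ennreal_mult add_nonneg_nonneg)
  finally show ?thesis by (simp add: PI.emeasure_eq_measure add_nonneg_nonneg)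
qed

section \<open>Ergodic alignment\<close>

definition rank_in :: "nat set \<Rightarrow> nat \<Rightarrow> nat" where "rank_in A a = card {x \<in> A. x < a}"

lemma rank_in_bij:
  assumes A: "finite A"
  shows "bij_betw (rank_in A) A {..<card A}"
proof -
  have mono: "rank_in A a < rank_in A b" if "a \<in> A" "b \<in> A" "a < b" for a b
    unfolding rank_in_def using A that by (intro psubset_card_mono) auto
  have inj: "inj_on (rank_in A) A"
    by (rule inj_onI) (metis mono less_irrefl linorder_neqE_nat)
  have "rank_in A a < card A" if "a \<in> A" for a
    unfolding rank_in_def using A that by (intro psubset_card_mono) auto
  then have sub: "rank_in A ` A \<subseteq> {..<card A}" by auto
  have "rank_in A ` A = {..<card A}"
    using sub card_image[OF inj] by (intro card_subset_eq) auto
  with inj show ?thesis by (simp add: bij_betw_def)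
qed

text \<open>Channel uses \<open>1..L\<close> carry fresh symbols; a use \<open>m\<close> in \<open>L+1..2L\<close> repeats the symbol of the use
  \<open>i\<close> whose type is complementary and which has the same rank among the uses of its type.\<close>
definition uses1 :: "nat \<Rightarrow> (nat \<Rightarrow> 'q) \<Rightarrow> 'q \<Rightarrow> nat set" where "uses1 L s \<tau> = {i \<in> {1..L}. s i = \<tau>}"
definition uses2 :: "nat \<Rightarrow> (nat \<Rightarrow> 'q) \<Rightarrow> 'q \<Rightarrow> nat set" where "uses2 L s \<tau> = {m \<in> {L+1..2*L}. s m = \<tau>}"
definition paired :: "nat \<Rightarrow> ('q \<Rightarrow> 'q) \<Rightarrow> (nat \<Rightarrow> 'q) \<Rightarrow> nat \<Rightarrow> nat \<Rightarrow> bool" where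
  "paired L cp s i m \<longleftrightarrow> i \<in> {1..L} \<and> m \<in> {L+1..2*L} \<and> s m = cp (s i) \<and>
     rank_in (uses1 L s (s i)) i = rank_in (uses2 L s (s m)) m"
definition symbol_index :: "nat \<Rightarrow> ('q \<Rightarrow> 'q) \<Rightarrow> (nat \<Rightarrow> 'q) \<Rightarrow> nat \<Rightarrow> nat option" where
  "symbol_index L cp s n = (if n \<in> {1..L} then Some n
     else if \<exists>i. paired L cp s i n then Some (THE i. paired L cp s i n) else None)"
definition matched :: "nat \<Rightarrow> ('q \<Rightarrow> 'q) \<Rightarrow> (nat \<Rightarrow> 'q) \<Rightarrow> nat set" where
  "matched L cp s = {i. \<exists>m. paired L cp s i m}"
definition mate :: "nat \<Rightarrow> ('q \<Rightarrow> 'q) \<Rightarrow> (nat \<Rightarrow> 'q) \<Rightarrow> nat \<Rightarrow> nat" where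
  "mate L cp s i = (THE m. paired L cp s i m)"

lemma finite_uses: "finite (uses1 L s \<tau>)" "finite (uses2 L s \<tau>)"
  by (auto simp: uses1_def uses2_def)

lemma paired_right_unique:
  assumes "paired L cp s i m" "paired L cp s i m'" shows "m = m'"
proof -
  have "m \<in> uses2 L s (s m)" "m' \<in> uses2 L s (s m)" "rank_in (uses2 L s (s m)) m = rank_in (uses2 L s (s m)) m'"
    using assms by (auto simp: paired_def uses2_def)
  then show ?thesis using inj_onD[OF bij_betw_imp_inj_on[OF rank_in_bij[OF finite_uses(2)[of L s "s m"]]], of m m'] by simp
qed

lemma paired_left_unique:
  assumes "paired L cp s i m" "paired L cp s i' m" and inj: "inj_on cp (s ` {1..L})" shows "i = i'"
proof -
  have "cp (s i) = cp (s i')" "i \<in> {1..L}" "i' \<in> {1..L}" using assms by (auto simp: paired_def)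
  then have eq: "s i' = s i" using inj by (auto dest: inj_onD)
  then have "i \<in> uses1 L s (s i)" "i' \<in> uses1 L s (s i)" "rank_in (uses1 L s (s i)) i = rank_in (uses1 L s (s i)) i'"
    using assms by (auto simp: paired_def uses1_def)
  then show ?thesis using inj_onD[OF bij_betw_imp_inj_on[OF rank_in_bij[OF finite_uses(1)[of L s "s i"]]], of i i'] by simp
qed

lemma mate_eq: "paired L cp s i m \<Longrightarrow> mate L cp s i = m"
  unfolding mate_def by (blast intro: paired_right_unique)

lemma paired_mate: "i \<in> matched L cp s \<Longrightarrow> paired L cp s i (mate L cp s i)"
  using mate_eq by (fastforce simp: matched_def)

lemma matched_sub: "matched L cp s \<subseteq> {1..L}" by (auto simp: matched_def paired_def)

lemma finite_matched: "finite (matched L cp s)" by (rule finite_subset[OF matched_sub]) simp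

lemma mate_range: "i \<in> matched L cp s \<Longrightarrow> mate L cp s i \<in> {L+1..2*L}"
  using paired_mate by (auto simp: paired_def)

lemma symbol_index_mate:
  assumes i: "i \<in> matched L cp s" and inj: "inj_on cp (s ` {1..L})"
  shows "symbol_index L cp s (mate L cp s i) = Some i"
proof -
  note p = paired_mate[OF i]
  have "(THE i'. paired L cp s i' (mate L cp s i)) = i"
    using p paired_left_unique[OF _ p inj] by blast
  then show ?thesis using p mate_range[OF i] by (auto simp: symbol_index_def)
qed

lemma symbol_index_first: "i \<in> matched L cp s \<Longrightarrow> symbol_index L cp s i = Some i"
  using subsetD[OF matched_sub, of i L cp s] by (simp add: symbol_index_def)

lemma inj_on_mate:
  assumes inj: "inj_on cp (s ` {1..L})" shows "inj_on (mate L cp s) (matched L cp s)"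
  by (rule inj_onI) (metis symbol_index_mate[OF _ inj] option.inject)

lemma symbol_index_range:
  assumes "symbol_index L cp s n = Some i" and inj: "inj_on cp (s ` {1..L})" shows "i \<in> {1..L}"
proof (cases "n \<in> {1..L}")
  case False
  then have ex: "\<exists>i. paired L cp s i n" and i: "i = (THE i. paired L cp s i n)"
    using assms(1) by (auto simp: symbol_index_def split: if_splits)
  then have "paired L cp s i n" using paired_left_unique[OF _ _ inj] by (metis (no_types, lifting) the_equality)
  then show ?thesis by (simp add: paired_def)
qed (use assms in \<open>auto simp: symbol_index_def\<close>)

text \<open>Ranks count earlier uses only, so whether use \<open>n\<close> repeats the symbol of
  \<open>i\<close> is decided by the types up to time \<open>n\<close>. This makes the encoder
  causal.\<close>

lemma paired_cong:
  assumes "\<And>m. 1 \<le> m \<Longrightarrow> m \<le> n \<Longrightarrow> s m = s' m"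
  shows "paired L cp s i n \<longleftrightarrow> paired L cp s' i n"
proof (cases "i \<in> {1..L} \<and> n \<in> {L+1..2*L}")
  case True
  have 1: "s i = s' i" "s n = s' n" using assms True by auto
  have 2: "{x \<in> uses1 L s \<tau>. x < i} = {x \<in> uses1 L s' \<tau>. x < i}" for \<tau> using assms True by (auto simp: uses1_def)
  have 3: "{x \<in> uses2 L s \<tau>. x < n} = {x \<in> uses2 L s' \<tau>. x < n}" for \<tau> using assms True by (auto simp: uses2_def)
  show ?thesis by (simp add: paired_def rank_in_def 1 2 3)
qed (auto simp: paired_def)

lemma symbol_index_cong:
  assumes "\<And>m. 1 \<le> m \<Longrightarrow> m \<le> n \<Longrightarrow> s m = s' m"
  shows "symbol_index L cp s n = symbol_index L cp s' n"
  using paired_cong[of n s s' L cp] assms by (simp add: symbol_index_def)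

text \<open>Within a type, every rank that occurs both among the first uses and among the
  complementary second uses yields a pair; summing over the types, which are disjoint, gives the
  total.\<close>

lemma card_matched_ge:
  fixes q :: real
  assumes fin: "finite Q" and q: "\<And>\<tau>. \<tau> \<in> Q \<Longrightarrow> q \<le> real (card (uses1 L s \<tau>))" "\<And>\<tau>. \<tau> \<in> Q \<Longrightarrow> q \<le> real (card (uses2 L s (cp \<tau>)))"
  shows "real (card Q) * q \<le> real (card (matched L cp s))"
proof -
  have "q \<le> real (card (matched L cp s \<inter> uses1 L s \<tau>))" if \<tau>: "\<tau> \<in> Q" for \<tau>
  proof -
    let ?A = "uses1 L s \<tau>" and ?B = "uses2 L s (cp \<tau>)"
    let ?n = "min (card ?A) (card ?B)"
    have bA: "bij_betw (rank_in ?A) ?A {..<card ?A}" and bB: "bij_betw (rank_in ?B) ?B {..<card ?B}"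
      by (intro rank_in_bij finite_uses)+
    have "{..<?n} \<subseteq> rank_in ?A ` (matched L cp s \<inter> ?A)"
    proof
      fix j assume "j \<in> {..<?n}"
      then have jA: "j \<in> rank_in ?A ` ?A" and jB: "j \<in> rank_in ?B ` ?B" using bA bB by (auto simp: bij_betw_def)
      then obtain i m where i: "i \<in> ?A" "rank_in ?A i = j" and m: "m \<in> ?B" "rank_in ?B m = j" by auto
      have si: "s i = \<tau>" "s m = cp \<tau>" using i m by (auto simp: uses1_def uses2_def)
      have "paired L cp s i m" using i m unfolding paired_def si by (auto simp: uses1_def uses2_def)
      then show "j \<in> rank_in ?A ` (matched L cp s \<inter> ?A)" using i by (auto simp: matched_def)
    qed
    then have "card {..<?n} \<le> card (rank_in ?A ` (matched L cp s \<inter> ?A))"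
      by (intro card_mono finite_imageI) (auto simp: finite_uses)
    also have "\<dots> \<le> card (matched L cp s \<inter> ?A)" by (intro card_image_le) (auto simp: finite_uses)
    finally have "?n \<le> card (matched L cp s \<inter> ?A)" by simp
    moreover have "q \<le> real ?n" using q[OF \<tau>] by (simp add: min_def)
    ultimately show ?thesis by linarith
  qed
  then have "(\<Sum>\<tau>\<in>Q. q) \<le> (\<Sum>\<tau>\<in>Q. real (card (matched L cp s \<inter> uses1 L s \<tau>)))" by (intro sum_mono)
  also have "\<dots> = real (card (\<Union>\<tau>\<in>Q. matched L cp s \<inter> uses1 L s \<tau>))"
    using fin by (subst card_UN_disjoint) (auto simp: finite_uses uses1_def)
  also have "\<dots> \<le> real (card (matched L cp s))" by (intro of_nat_mono card_mono finite_matched) auto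
  finally show ?thesis by simp
qed

section \<open>Quantisation of phases\<close>

lemma cmod_cis_diff_le: "cmod (cis a - cis b) \<le> \<bar>a - b\<bar>"
proof -
  have "cmod (cis a - cis b) = cmod (cis b) * cmod (cis (a - b) - 1)"
    by (subst norm_mult[symmetric]) (simp add: algebra_simps cis_mult)
  also have "\<dots> = cmod (cis (a - b) - 1)" by simp
  also have "\<dots> \<le> \<bar>a - b\<bar>"
  proof -
    define x where "x = a - b"
    have "(cmod (cis x - 1))\<^sup>2 = 2 - 2 * cos x"
      using sin_cos_squared_add3[of x] by (simp add: cmod_power2) (simp add: power2_eq_square algebra_simps)
    also have "\<dots> = 4 * (sin (x / 2))\<^sup>2" using cos_double_sin[of "x / 2"] by simp
    also have "\<dots> \<le> 4 * (x / 2)\<^sup>2"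
      by (intro mult_left_mono abs_le_square_iff[THEN iffD1] abs_sin_x_le_abs_x) simp
    finally have "(cmod (cis x - 1))\<^sup>2 \<le> x\<^sup>2" by (simp add: power_divide)
    then show ?thesis using abs_le_square_iff[of "cmod (cis x - 1)" x] by (simp add: x_def)
  qed
  finally show ?thesis .
qed

text \<open>Reduction modulo \<open>B\<close> makes the bin a function of the point on the unit
  circle, so that \<open>bin_approx\<close> holds for every real \<open>x\<close>.\<close>

definition bin :: "nat \<Rightarrow> real \<Rightarrow> nat" where "bin B x = nat (\<lfloor>x * real B / (2 * pi)\<rfloor> mod int B)"

lemma bin_less: "0 < B \<Longrightarrow> bin B x < B"
  unfolding bin_def by (simp add: nat_less_iff)

lemma bin_approx:
  assumes B: "0 < B"
  shows "cmod (cis x - cis (2 * pi * real (bin B x) / real B)) \<le> 2 * pi / real B"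
proof -
  define f where "f = \<lfloor>x * real B / (2 * pi)\<rfloor>"
  have f: "real_of_int f \<le> x * real B / (2 * pi)" "x * real B / (2 * pi) < real_of_int f + 1" unfolding f_def by linarith+
  have "int (bin B x) = f mod int B" using B by (simp add: bin_def f_def)
  then have "f = int (bin B x) + int B * (f div int B)" by simp
  then have fe: "real_of_int f = real (bin B x) + real B * real_of_int (f div int B)" by (metis of_int_add of_int_mult of_int_of_nat_eq)
  have "2 * pi * real_of_int f / real B = 2 * pi * real (bin B x) / real B + 2 * pi * real_of_int (f div int B)"
    unfolding fe using B by (simp add: field_simps)
  then have "cis (2 * pi * real_of_int f / real B) = cis (2 * pi * real (bin B x) / real B)"
    by (simp add: cis_mult[symmetric] cis_multiple_2pi)
  then have "cmod (cis x - cis (2 * pi * real (bin B x) / real B)) \<le> \<bar>x - 2 * pi * real_of_int f / real B\<bar>"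
    using cmod_cis_diff_le[of x "2 * pi * real_of_int f / real B"] by simp
  also have "\<dots> \<le> 2 * pi / real B"
  proof -
    have "2 * pi * real_of_int f \<le> x * real B" "x * real B < 2 * pi * real_of_int f + 2 * pi"
      using f by (auto simp: field_simps)
    then have "\<bar>x * real B - 2 * pi * real_of_int f\<bar> \<le> 2 * pi" by linarith
    then have "\<bar>x * real B - 2 * pi * real_of_int f\<bar> / real B \<le> 2 * pi / real B" by (rule divide_right_mono) simp
    moreover have "x - 2 * pi * real_of_int f / real B = (x * real B - 2 * pi * real_of_int f) / real B" using B by (simp add: field_simps)
    ultimately show ?thesis by simp
  qed
  finally show ?thesis .
qed

lemma bin_same:
  assumes "0 < B" "bin B x = bin B y" shows "cmod (cis x - cis y) \<le> 4 * pi / real B"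
  using bin_approx[OF assms(1), of x] bin_approx[OF assms(1), of y] assms(2)
    norm_triangle_ineq4[of "cis x - cis (2 * pi * real (bin B x) / real B)" "cis y - cis (2 * pi * real (bin B x) / real B)"]
  by simp

text \<open>The number of bins is even so that a shift by \<open>h\<close> bins is a half turn,
  which negates the point representing the bin.\<close>

lemma bin_opposite:
  assumes h: "0 < h" and "bin (2 * h) y = (bin (2 * h) x + h) mod (2 * h)" shows "cmod (cis x + cis y) \<le> 4 * pi / real (2 * h)"
proof -
  let ?B = "2 * h"
  have B: "0 < ?B" using h by simp
  let ?b = "bin ?B x"
  have "cis (2 * pi * real ((?b + h) mod ?B) / real ?B) = - cis (2 * pi * real ?b / real ?B)"
  proof -
    have "real (?b + h) = real ((?b + h) mod ?B) + real ?B * real ((?b + h) div ?B)"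
      by (metis mod_mult_div_eq of_nat_add of_nat_mult)
    then have "2 * pi * real (?b + h) / real ?B = 2 * pi * real ((?b + h) mod ?B) / real ?B + 2 * pi * real ((?b + h) div ?B)"
      using h by (simp add: field_simps)
    then have "cis (2 * pi * real (?b + h) / real ?B) = cis (2 * pi * real ((?b + h) mod ?B) / real ?B)"
      using cis_multiple_2pi[of "real ((?b + h) div ?B)"] by (simp add: cis_mult[symmetric])
    moreover have "2 * pi * real (?b + h) / real ?B = 2 * pi * real ?b / real ?B + pi"
      using h by (simp add: field_simps)
    ultimately show ?thesis by (simp add: cis_mult[symmetric])
  qed
  then show ?thesis
    using bin_approx[OF B, of x] bin_approx[OF B, of y] assms(2)
      norm_triangle_ineq[of "cis x - cis (2 * pi * real ?b / real ?B)" "cis y + cis (2 * pi * real ?b / real ?B)"]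
    by simp
qed

lemma measurable_bin[measurable]: "bin B \<in> measurable borel (count_space UNIV)"
  unfolding bin_def by measurable

lemma bin_prob:
  assumes B: "0 < B" and b: "b < B"
  shows "measure phase_dist {x. bin B x = b} = 1 / real B"
proof -
  have "emeasure phase_dist {x. bin B x = b} = emeasure lborel ({0..<2 * pi} \<inter> {x. bin B x = b}) / ennreal (2 * pi)"
    unfolding phase_dist_def by (subst emeasure_uniform_measure) auto
  also have "{0..<2 * pi} \<inter> {x. bin B x = b} = {2 * pi * real b / real B ..< 2 * pi * (real b + 1) / real B}"
  proof (rule set_eqI)
    fix x :: real
    have lo: "0 \<le> 2 * pi * real b / real B" by simp
    have "2 * pi * (real b + 1) \<le> 2 * pi * real B" using b by (intro mult_left_mono) auto
    then have hi: "2 * pi * (real b + 1) / real B \<le> 2 * pi" using B by (simp add: divide_le_eq)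
    have fl: "\<lfloor>x * real B / (2 * pi)\<rfloor> = int b \<longleftrightarrow> 2 * pi * real b / real B \<le> x \<and> x < 2 * pi * (real b + 1) / real B"
      using B by (subst floor_eq_iff) (auto simp: field_simps)
    have "bin B x = b \<longleftrightarrow> \<lfloor>x * real B / (2 * pi)\<rfloor> = int b" if "0 \<le> x" "x < 2 * pi"
    proof -
      have "0 \<le> \<lfloor>x * real B / (2 * pi)\<rfloor>" using that by simp
      moreover have "\<lfloor>x * real B / (2 * pi)\<rfloor> < int B"
      proof -
        have "x * real B < real B * (2 * pi)" using that B by (simp add: mult.commute)
        then have "x * real B / (2 * pi) < real B" by (simp add: pos_divide_less_eq)
        then show ?thesis by (simp add: floor_less_iff)
      qed
      ultimately show ?thesis by (auto simp: bin_def)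
    qed
    then show "x \<in> {0..<2 * pi} \<inter> {x. bin B x = b} \<longleftrightarrow> x \<in> {2 * pi * real b / real B ..< 2 * pi * (real b + 1) / real B}"
      using fl order_trans[OF lo, of x] order_less_le_trans[OF _ hi, of x]
      unfolding Int_iff atLeastLessThan_iff mem_Collect_eq by blast
  qed
  also have "emeasure lborel \<dots> = ennreal (2 * pi / real B)"
    using B by (subst emeasure_lborel_Ico) (auto simp: field_simps)
  also have "\<dots> / ennreal (2 * pi) = ennreal (1 / real B)"
    using B by (subst divide_ennreal) auto
  finally show ?thesis by (simp add: measure_def)
qed

text \<open>Use 0 carries the seed and is followed by \<open>L\<close> fresh uses and
  \<open>L\<close> uses for repetitions, hence \<open>2 * L < N\<close>. Phases fall into
  \<open>2 * h\<close> bins, and \<open>\<eta>\<close> is the slack in the decoding threshold.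
  Condition \<open>small\<close> says that the interference power left over by the quantisation is
  at most \<open>\<eta>\<close> at each receiver.\<close>

locale ergodic_code =
  fixes K :: nat and SNR :: real and INR :: "nat \<times> nat \<Rightarrow> real" and N L h :: nat and M :: "nat \<Rightarrow> nat"
    and g :: "real \<Rightarrow> nat \<times> nat \<times> nat \<Rightarrow> complex" and \<eta> :: real
  assumes SNR: "0 < SNR" and K: "0 < K" and M: "\<And>k. k < K \<Longrightarrow> 0 < M k" and N: "2 * L < N" and L: "0 < L" and h: "0 < h"
    and \<eta>: "0 < \<eta>"
    and g: "g \<in> measurable phase_dist (PiM {(k, v, i). k < K \<and> v < M k \<and> i \<in> {1..L}} (\<lambda>_. cgauss))"
    and g_law: "distr phase_dist (PiM {(k, v, i). k < K \<and> v < M k \<and> i \<in> {1..L}} (\<lambda>_. cgauss)) g =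
       PiM {(k, v, i). k < K \<and> v < M k \<and> i \<in> {1..L}} (\<lambda>_. cgauss)"
    and small: "\<And>k. k < K \<Longrightarrow> (\<Sum>t<K. \<bar>INR (k, t)\<bar>) * (4 * pi / real h)\<^sup>2 \<le> \<eta>"
begin

definition CI :: "(nat \<times> nat \<times> nat) set" where "CI = {(k, v, i). k < K \<and> v < M k \<and> i \<in> {1..L}}"
definition IK :: "(nat \<times> nat \<times> nat) set" where "IK = {..<N} \<times> {..<K} \<times> {..<K}"
text \<open>Use 0 is idle: \<open>symbol_index\<close> is \<open>None\<close> there and the decoder
  does not look at it. The phase of a direct link in this use can thus be spent as the seed.\<close>

definition src :: "nat \<times> nat \<times> nat" where "src = (0, 0, 0)"
definition KK :: "(nat \<times> nat) set" where "KK = {..<K} \<times> {..<K}"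
definition stype :: "phases \<Rightarrow> nat \<Rightarrow> nat \<times> nat \<Rightarrow> nat" where
  "stype \<phi> n = (\<lambda>p\<in>KK. bin (2 * h) (\<phi> (n, fst p, snd p)))"
definition Ty :: "(nat \<times> nat \<Rightarrow> nat) set" where "Ty = Pi\<^sub>E KK (\<lambda>_. {..<2 * h})"
definition cp :: "(nat \<times> nat \<Rightarrow> nat) \<Rightarrow> nat \<times> nat \<Rightarrow> nat" where
  "cp \<tau> = (\<lambda>p\<in>KK. if fst p = snd p then \<tau> p else (\<tau> p + h) mod (2 * h))"
text \<open>Use 0 is left out, so the type sequence is independent of the seed, and it takes only
  finitely many values.\<close>

definition tseq :: "phases \<Rightarrow> nat \<Rightarrow> nat \<times> nat \<Rightarrow> nat" where "tseq \<phi> = (\<lambda>n\<in>{1..2 * L}. stype \<phi> n)"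
definition FS :: "(nat \<Rightarrow> nat \<times> nat \<Rightarrow> nat) set" where "FS = Pi\<^sub>E {1..2 * L} (\<lambda>_. Ty)"
text \<open>Two coherent copies of the direct gain \<open>sqrt SNR\<close>. Against the variance 2
  of two noises this is the signal-to-noise ratio \<open>c\<^sup>2 / 2 = 2 SNR\<close>.\<close>

definition c :: real where "c = 2 * sqrt SNR"
abbreviation "S s \<equiv> matched L cp s"
abbreviation "mt s i \<equiv> mate L cp s i"
definition xsym :: "(nat \<times> nat \<times> nat \<Rightarrow> complex) \<Rightarrow> (nat \<Rightarrow> nat \<times> nat \<Rightarrow> nat) \<Rightarrow> nat \<Rightarrow> nat \<Rightarrow> nat \<Rightarrow> complex" where
  "xsym C s k v n = (case symbol_index L cp s n of Some i \<Rightarrow> C (k, v, i) | None \<Rightarrow> 0)"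
definition encA :: "nat \<Rightarrow> nat \<Rightarrow> phases \<Rightarrow> nat \<Rightarrow> complex" where
  "encA k v \<phi> n = xsym (g (\<phi> src)) (tseq \<phi>) k v n"
text \<open>Each observation is turned back by its direct phase before the two are added, so that
  the wanted symbol adds up coherently.\<close>

definition comb :: "(nat \<Rightarrow> nat \<times> nat \<Rightarrow> nat) \<Rightarrow> nat \<Rightarrow> (nat \<Rightarrow> complex) \<Rightarrow> phases \<Rightarrow> nat \<Rightarrow> complex" where
  "comb s k y \<phi> i = y i * cis (- \<phi> (i, k, k)) + y (mt s i) * cis (- \<phi> (mt s i, k, k))"
definition tscore :: "(nat \<times> nat \<times> nat \<Rightarrow> complex) \<Rightarrow> (nat \<Rightarrow> nat \<times> nat \<Rightarrow> nat) \<Rightarrow> nat \<Rightarrow> nat \<Rightarrow> (nat \<Rightarrow> complex) \<Rightarrow> phases \<Rightarrow> real" where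
  "tscore C s k v y \<phi> = (\<Sum>i\<in>S s. score c (comb s k y \<phi> i) (C (k, v, i)))"
definition testA :: "nat \<Rightarrow> nat \<Rightarrow> (nat \<Rightarrow> complex) \<Rightarrow> phases \<Rightarrow> bool" where
  "testA k v y \<phi> \<longleftrightarrow> - \<eta> * real (card (S (tseq \<phi>))) < tscore (g (\<phi> src)) (tseq \<phi>) k v y \<phi>"
definition yrec :: "msgs \<Rightarrow> (nat \<times> nat \<times> nat \<Rightarrow> complex) \<Rightarrow> (nat \<Rightarrow> nat \<times> nat \<Rightarrow> nat) \<Rightarrow> phases \<Rightarrow> noises \<Rightarrow> nat \<Rightarrow> nat \<Rightarrow> complex" where
  "yrec w C s \<phi> z k n = (\<Sum>t<K. chan_coeff SNR INR k t (\<phi> (n, k, t)) * xsym C s t (w t) n) + z (n, k)"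
text \<open>Codebook, remaining phases and noise: three independent components, which together with
  the messages determine all that the analysis needs.\<close>

definition proj :: "msgs \<times> phases \<times> noises \<Rightarrow> ((nat \<times> nat \<times> nat \<Rightarrow> complex) \<times> phases) \<times> noises" where
  "proj \<omega> = ((g (fst (snd \<omega>) src), restrict (fst (snd \<omega>)) (IK - {src})), snd (snd \<omega>))"

abbreviation "CSA \<equiv> code_space K N M"
abbreviation "CB \<equiv> PiM CI (\<lambda>_. cgauss)"
abbreviation "PH \<equiv> PiM (IK - {src}) (\<lambda>_. phase_dist)"
abbreviation "NZ \<equiv> noise_space K N"

lemmas g' = g[folded CI_def] and g_law' = g_law[folded CI_def]

lemma finite_CI: "finite CI"
proof -
  have "CI \<subseteq> (SIGMA k:{..<K}. {..<M k} \<times> {1..L})" by (auto simp: CI_def)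
  then show ?thesis by (rule finite_subset) auto
qed

lemma finite_IK: "finite IK" and finite_KK: "finite KK" and finite_Ty: "finite Ty" and finite_FS: "finite FS"
  unfolding FS_def Ty_def IK_def KK_def by (auto intro!: finite_PiE)

lemma src_IK: "src \<in> IK" using N K by (simp add: src_def IK_def)
lemma phase_space_IK: "phase_space K N = PiM IK (\<lambda>_. phase_dist)" by (simp add: IK_def)

lemma cp_Ty: "\<tau> \<in> Ty \<Longrightarrow> cp \<tau> \<in> Ty"
  using h by (auto simp: Ty_def cp_def PiE_iff)

lemma inj_on_cp: "inj_on cp Ty"
proof (rule inj_onI)
  fix \<tau> \<tau>' assume t: "\<tau> \<in> Ty" "\<tau>' \<in> Ty" and eq: "cp \<tau> = cp \<tau>'"
  show "\<tau> = \<tau>'"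
  proof
    fix p
    show "\<tau> p = \<tau>' p"
    proof (cases "p \<in> KK")
      case True
      have lt: "\<tau> p < 2 * h" "\<tau>' p < 2 * h" using t True by (auto simp: Ty_def PiE_iff)
      have "cp \<tau> p = cp \<tau>' p" using eq by simp
      then show ?thesis
      proof (cases "fst p = snd p")
        case False
        then have "(\<tau> p + h) mod (2 * h) = (\<tau>' p + h) mod (2 * h)" using \<open>cp \<tau> p = cp \<tau>' p\<close> True by (simp add: cp_def)
        moreover have "(a + h) mod (2 * h) = (if a < h then a + h else a - h)" if "a < 2 * h" for a
          using that by (auto simp: le_mod_geq)
        ultimately show ?thesis using lt by (auto split: if_splits)
      qed (use True in \<open>simp add: cp_def\<close>)
    qed (use t in \<open>simp add: Ty_def PiE_arb[of _ KK]\<close>)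
  qed
qed

lemma stype_Ty: "stype \<phi> n \<in> Ty" using h bin_less by (auto simp: stype_def Ty_def)
lemma tseq_FS: "tseq \<phi> \<in> FS" using stype_Ty by (auto simp: tseq_def FS_def)
lemma inj_cp_FS: "s \<in> FS \<Longrightarrow> inj_on cp (s ` {1..L})"
  by (rule inj_on_subset[OF inj_on_cp]) (auto simp: FS_def PiE_iff)

lemma tseq_restrict: "tseq (restrict \<phi> (IK - {src})) = tseq \<phi>"
  using N by (auto simp: tseq_def stype_def fun_eq_iff IK_def src_def KK_def restrict_def)

lemma S_range: "i \<in> S s \<Longrightarrow> 1 \<le> i \<and> i \<le> L" using matched_sub[of L cp s] by auto
lemma mt_range: "i \<in> S s \<Longrightarrow> L < mt s i \<and> mt s i \<le> 2 * L" using mate_range[of i L cp s] by auto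

lemma xsym_index: "s \<in> FS \<Longrightarrow> symbol_index L cp s n = Some i \<Longrightarrow> 1 \<le> i \<and> i \<le> L"
  using symbol_index_range[OF _ inj_cp_FS] by fastforce

section \<open>Measurability of symbols, observations and scores\<close>

lemma measurable_phase_comp:
  "p \<in> A \<Longrightarrow> (\<lambda>\<phi>. \<phi> p) \<in> borel_measurable (PiM A (\<lambda>_. phase_dist))"
  using measurable_component_singleton[of p A "\<lambda>_. phase_dist"] by (simp add: measurable_cong_sets[OF refl sets_phase_dist])
lemma measurable_gauss_comp:
  "p \<in> A \<Longrightarrow> (\<lambda>\<phi>. \<phi> p) \<in> borel_measurable (PiM A (\<lambda>_. cgauss))"
  using measurable_component_singleton[of p A "\<lambda>_. cgauss"] by (simp add: measurable_cong_sets[OF refl cgauss_sets])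

lemma measurable_tseq: "tseq \<in> measurable PH (count_space FS)"
proof (subst measurable_count_space_eq2[OF finite_FS])
  show "tseq \<in> space PH \<rightarrow> FS \<and> (\<forall>s\<in>FS. tseq -` {s} \<inter> space PH \<in> sets PH)"
  proof (intro conjI ballI)
    fix s assume s: "s \<in> FS"
    have "tseq -` {s} \<inter> space PH = {\<phi> \<in> space PH. \<forall>n\<in>{1..2*L}. \<forall>p\<in>KK. bin (2 * h) (\<phi> (n, fst p, snd p)) = s n p}"
    proof -
      have "tseq \<phi> = s \<longleftrightarrow> (\<forall>n\<in>{1..2*L}. \<forall>p\<in>KK. bin (2 * h) (\<phi> (n, fst p, snd p)) = s n p)" for \<phi>
      proof
        assume r: "\<forall>n\<in>{1..2*L}. \<forall>p\<in>KK. bin (2 * h) (\<phi> (n, fst p, snd p)) = s n p"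
        show "tseq \<phi> = s"
        proof
          fix n show "tseq \<phi> n = s n"
          proof (cases "n \<in> {1..2*L}")
            case True
            then have "s n \<in> extensional KK" using s by (auto simp: FS_def Ty_def PiE_iff)
            then show ?thesis using True r by (auto simp: tseq_def stype_def fun_eq_iff extensional_def)
          qed (use s in \<open>auto simp: tseq_def FS_def PiE_iff extensional_def\<close>)
        qed
      qed (auto simp: tseq_def stype_def)
      then show ?thesis by auto
    qed
    also have "\<dots> \<in> sets PH"
    proof (intro sets.sets_Collect_finite_All finite_KK)
      fix n p assume "n \<in> {1..2*L}" "p \<in> KK"
      then have "(n, fst p, snd p) \<in> IK - {src}" using N by (auto simp: IK_def KK_def src_def)
      from measurable_compose[OF measurable_phase_comp[OF this] measurable_bin]
      have [measurable]: "(\<lambda>\<phi>. bin (2 * h) (\<phi> (n, fst p, snd p))) \<in> measurable PH (count_space UNIV)" .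
      show "{\<phi> \<in> space PH. bin (2 * h) (\<phi> (n, fst p, snd p)) = s n p} \<in> sets PH" by measurable
    qed auto
    finally show "tseq -` {s} \<inter> space PH \<in> sets PH" .
  qed (use tseq_FS in auto)
qed

lemma measurable_tseq':
  assumes f: "f \<in> measurable Q PH"
  shows "(\<lambda>x. tseq (f x)) \<in> measurable Q (count_space FS)"
  by (rule measurable_compose[OF f measurable_tseq])

text \<open>Type sequences are finite in number, so measurability may be checked with the type
  sequence frozen; then indices such as mates and matched positions are constants.\<close>

lemma measurable_by_tseq:
  assumes f: "f \<in> measurable Q PH" and F: "\<And>s. s \<in> FS \<Longrightarrow> (\<lambda>x. F s x) \<in> measurable Q R"
  shows "(\<lambda>x. F (tseq (f x)) x) \<in> measurable Q R"
  by (rule measurable_compose_countable'[OF F measurable_tseq'[OF f]]) (auto intro: countable_finite finite_FS)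

lemma measurable_xsym:
  assumes C: "C \<in> measurable Q CB" and s: "s \<in> FS" and k: "k < K" "v < M k"
  shows "(\<lambda>x. xsym (C x) s k v n) \<in> borel_measurable Q"
proof (cases "symbol_index L cp s n")
  case (Some i)
  then have "(k, v, i) \<in> CI" using xsym_index[OF s Some] k by (auto simp: CI_def)
  from measurable_compose[OF C measurable_gauss_comp[OF this]] show ?thesis using Some by (simp add: xsym_def)
qed (simp add: xsym_def)

lemma measurable_yrec:
  assumes C: "C \<in> measurable Q CB" and \<phi>: "\<phi> \<in> measurable Q PH" and z: "z \<in> measurable Q NZ"
    and s: "s \<in> FS" and k: "k < K" and n: "1 \<le> n" "n < N" and w: "w \<in> Pi\<^sub>E {..<K} (\<lambda>k. {..<M k})"
  shows "(\<lambda>x. yrec w (C x) s (\<phi> x) (z x) k n) \<in> borel_measurable Q"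
  unfolding yrec_def
proof (intro borel_measurable_add borel_measurable_sum borel_measurable_times)
  fix t assume t: "t \<in> {..<K}"
  have "(n, k, t) \<in> IK - {src}" using n k t by (auto simp: IK_def src_def)
  from measurable_compose[OF \<phi> measurable_phase_comp[OF this]]
  show "(\<lambda>x. chan_coeff SNR INR k t (\<phi> x (n, k, t))) \<in> borel_measurable Q"
    by (rule measurable_compose[OF _ measurable_chan_coeff])
  show "(\<lambda>x. xsym (C x) s t (w t) n) \<in> borel_measurable Q"
    using t w by (intro measurable_xsym[OF C s]) auto
next
  have "(n, k) \<in> {..<N} \<times> {..<K}" using n k by auto
  from measurable_compose[OF z measurable_gauss_comp[OF this]]
  show "(\<lambda>x. z x (n, k)) \<in> borel_measurable Q" .
qed

lemma measurable_cis_phase: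
  assumes \<phi>: "\<phi> \<in> measurable Q PH" and p: "p \<in> IK - {src}"
  shows "(\<lambda>x. cis (- \<phi> x p)) \<in> borel_measurable Q"
  by (intro measurable_compose[OF borel_measurable_uminus[OF measurable_compose[OF \<phi> measurable_phase_comp[OF p]]] measurable_cis])

lemma measurable_tscore:
  assumes C: "C \<in> measurable Q CB" and \<phi>: "\<phi> \<in> measurable Q PH" and z: "z \<in> measurable Q NZ"
    and s: "s \<in> FS" and k: "k < K" "v < M k" and w: "w \<in> Pi\<^sub>E {..<K} (\<lambda>k. {..<M k})"
  shows "(\<lambda>x. tscore (C x) s k v (yrec w (C x) s (\<phi> x) (z x) k) (\<phi> x)) \<in> borel_measurable Q"
  unfolding tscore_def comb_def
proof (intro borel_measurable_sum measurable_score borel_measurable_add borel_measurable_times)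
  fix i assume i: "i \<in> S s"
  note i' = S_range[OF i] mt_range[OF i]
  show "(\<lambda>x. yrec w (C x) s (\<phi> x) (z x) k i) \<in> borel_measurable Q"
    using i' N by (intro measurable_yrec[OF C \<phi> z s k(1) _ _ w]) auto
  show "(\<lambda>x. yrec w (C x) s (\<phi> x) (z x) k (mt s i)) \<in> borel_measurable Q"
    using i' N by (intro measurable_yrec[OF C \<phi> z s k(1) _ _ w]) auto
  show "(\<lambda>x. cis (- \<phi> x (i, k, k))) \<in> borel_measurable Q"
    using i' N k by (intro measurable_cis_phase[OF \<phi>]) (auto simp: IK_def src_def)
  show "(\<lambda>x. cis (- \<phi> x (mt s i, k, k))) \<in> borel_measurable Q"
    using i' N k by (intro measurable_cis_phase[OF \<phi>]) (auto simp: IK_def src_def)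
  have "(k, v, i) \<in> CI" using i' k by (auto simp: CI_def)
  from measurable_compose[OF C measurable_gauss_comp[OF this]]
  show "(\<lambda>x. C x (k, v, i)) \<in> borel_measurable Q" .
qed

lemma measurable_proj: "proj \<in> measurable CSA ((CB \<Otimes>\<^sub>M PH) \<Otimes>\<^sub>M NZ)"
  unfolding proj_def code_space_def
proof (intro measurable_Pair)
  let ?Q = "msg_space K M \<Otimes>\<^sub>M (phase_space K N \<Otimes>\<^sub>M NZ)"
  have 1: "(\<lambda>\<omega>. fst (snd \<omega>)) \<in> measurable ?Q (PiM IK (\<lambda>_. phase_dist))" unfolding phase_space_IK by measurable
  show "(\<lambda>\<omega>. g (fst (snd \<omega>) src)) \<in> measurable ?Q CB"
    by (rule measurable_compose[OF measurable_compose[OF 1 measurable_component_singleton[OF src_IK]] g'])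
  show "(\<lambda>\<omega>. restrict (fst (snd \<omega>)) (IK - {src})) \<in> measurable ?Q PH"
    by (rule measurable_compose[OF 1 measurable_restrict_subset]) auto
qed measurable

lemma measurable_by_msg:
  assumes f: "\<And>w. w \<in> Pi\<^sub>E {..<K} (\<lambda>k. {..<M k}) \<Longrightarrow> f w \<in> measurable ((CB \<Otimes>\<^sub>M PH) \<Otimes>\<^sub>M NZ) R"
  shows "(\<lambda>\<omega>. f (fst \<omega>) (proj \<omega>)) \<in> measurable CSA R"
proof (rule measurable_compose_countable'[where I="Pi\<^sub>E {..<K} (\<lambda>k. {..<M k})" and f="\<lambda>w \<omega>. f w (proj \<omega>)" and g=fst])
  show "(\<lambda>\<omega>. f w (proj \<omega>)) \<in> measurable CSA R" if "w \<in> Pi\<^sub>E {..<K} (\<lambda>k. {..<M k})" for w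
    by (rule measurable_compose[OF measurable_proj f[OF that]])
  have "(\<lambda>w. w) \<in> measurable (msg_space K M) (count_space (Pi\<^sub>E {..<K} (\<lambda>k. {..<M k})))"
    by (rule measurable_msg_any) auto
  then show "fst \<in> measurable CSA (count_space (Pi\<^sub>E {..<K} (\<lambda>k. {..<M k})))"
    unfolding code_space_def by (rule measurable_compose[OF measurable_fst])
qed (auto intro!: countable_finite finite_PiE)

text \<open>The phases stand outside codebook and noise, so that errors can be bounded conditionally
  on the phases, where the set of matched positions is fixed.\<close>

lemma nn_integral_proj:
  assumes f: "\<And>w. w \<in> Pi\<^sub>E {..<K} (\<lambda>k. {..<M k}) \<Longrightarrow> f w \<in> borel_measurable ((CB \<Otimes>\<^sub>M PH) \<Otimes>\<^sub>M NZ)"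
  shows "(\<integral>\<^sup>+\<omega>. f (fst \<omega>) (proj \<omega>) \<partial>CSA) =
     (\<integral>\<^sup>+w. \<integral>\<^sup>+\<phi>. \<integral>\<^sup>+C. \<integral>\<^sup>+z. f w ((C, \<phi>), z) \<partial>NZ \<partial>CB \<partial>PH \<partial>msg_space K M)"
proof -
  interpret Z: prob_space NZ by (rule prob_space_noise)
  have "(\<integral>\<^sup>+\<omega>. f (fst \<omega>) (proj \<omega>) \<partial>CSA) = (\<integral>\<^sup>+w. \<integral>\<^sup>+\<phi>. \<integral>\<^sup>+z. f w (proj (w, \<phi>, z)) \<partial>NZ \<partial>phase_space K N \<partial>msg_space K M)"
    using nn_integral_code_space[OF measurable_by_msg[OF f]] by simp
  also have "\<dots> = (\<integral>\<^sup>+w. \<integral>\<^sup>+\<phi>. \<integral>\<^sup>+C. \<integral>\<^sup>+z. f w ((C, \<phi>), z) \<partial>NZ \<partial>CB \<partial>PH \<partial>msg_space K M)"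
  proof (rule nn_integral_cong)
    fix w assume "w \<in> space (msg_space K M)"
    then have w: "w \<in> Pi\<^sub>E {..<K} (\<lambda>k. {..<M k})" by (simp add: space_PiM space_uniform_count_measure)
    define H where "H C \<phi> = (\<integral>\<^sup>+z. f w ((C, \<phi>), z) \<partial>NZ)" for C \<phi>
    have Hm: "case_prod H \<in> borel_measurable (CB \<Otimes>\<^sub>M PH)"
      using Z.borel_measurable_nn_integral_fst[OF f[OF w]] by (simp add: H_def split_beta')
    show "(\<integral>\<^sup>+\<phi>. \<integral>\<^sup>+z. f w (proj (w, \<phi>, z)) \<partial>NZ \<partial>phase_space K N) = (\<integral>\<^sup>+\<phi>. \<integral>\<^sup>+C. \<integral>\<^sup>+z. f w ((C, \<phi>), z) \<partial>NZ \<partial>CB \<partial>PH)"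
      using nn_integral_PiM_split_off(2)[OF finite_IK src_IK prob_space_phase_dist g' g_law' Hm]
      by (simp add: phase_space_IK proj_def H_def)
  qed
  finally show ?thesis .
qed

definition TS :: "nat \<Rightarrow> nat \<Rightarrow> msgs \<Rightarrow> ((nat \<times> nat \<times> nat \<Rightarrow> complex) \<times> phases) \<times> noises \<Rightarrow> real" where
  "TS k v w x = tscore (fst (fst x)) (tseq (snd (fst x))) k v (yrec w (fst (fst x)) (tseq (snd (fst x))) (snd (fst x)) (snd x) k) (snd (fst x))"
definition thr :: "((nat \<times> nat \<times> nat \<Rightarrow> complex) \<times> phases) \<times> noises \<Rightarrow> real" where
  "thr x = - \<eta> * real (card (S (tseq (snd (fst x)))))"

lemma measurable_TS:
  assumes "k < K" "v < M k" "w \<in> Pi\<^sub>E {..<K} (\<lambda>k. {..<M k})"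
  shows "TS k v w \<in> borel_measurable ((CB \<Otimes>\<^sub>M PH) \<Otimes>\<^sub>M NZ)"
  unfolding TS_def
  by (rule measurable_by_tseq[where f="\<lambda>x. snd (fst x)"], measurable, rule measurable_tscore) (use assms in auto)

lemma measurable_thr: "thr \<in> borel_measurable ((CB \<Otimes>\<^sub>M PH) \<Otimes>\<^sub>M NZ)"
  unfolding thr_def
  by (rule measurable_by_tseq[where f="\<lambda>x. snd (fst x)"]) auto

text \<open>The test reads observations between uses 1 and \<open>2 * L\<close> only, where the
  phases without the seed are the full phases; the seed acts solely through the codebook.\<close>

lemma testA_iff:
  assumes \<omega>: "\<omega> \<in> space CSA" and k: "k < K"
  shows "testA k v (rx_block K SNR INR N encA \<omega> k) (fst (snd \<omega>)) \<longleftrightarrow> thr (proj \<omega>) < TS k v (fst \<omega>) (proj \<omega>)"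
proof -
  obtain w \<phi> z where [simp]: "\<omega> = (w, \<phi>, z)" by (cases \<omega>)
  let ?\<phi> = "restrict \<phi> (IK - {src})" and ?s = "tseq \<phi>"
  have ph: "?\<phi> (n, a, b) = \<phi> (n, a, b)" if "1 \<le> n" "n < N" "a < K" "b < K" for n a b
    using that by (auto simp: IK_def src_def)
  have y: "rx_block K SNR INR N encA \<omega> k n = yrec w (g (\<phi> src)) ?s ?\<phi> z k n" if "1 \<le> n" "n < N" for n
  proof -
    have "(\<Sum>t<K. chan_coeff SNR INR k t (\<phi> (n, k, t)) * encA t (w t) \<phi> n) = (\<Sum>t<K. chan_coeff SNR INR k t (?\<phi> (n, k, t)) * xsym (g (\<phi> src)) ?s t (w t) n)"
      by (rule sum.cong[OF refl]) (use that k ph in \<open>simp only: encA_def lessThan_iff\<close>)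
    then show ?thesis using that by (simp add: received_def tx_symbol_def yrec_def)
  qed
  have "comb ?s k (rx_block K SNR INR N encA \<omega> k) \<phi> i = comb ?s k (yrec w (g (\<phi> src)) ?s ?\<phi> z k) ?\<phi> i" if i: "i \<in> S ?s" for i
  proof -
    have r: "1 \<le> i" "i < N" "1 \<le> mt ?s i" "mt ?s i < N" using S_range[OF i] mt_range[OF i] N by auto
    show ?thesis unfolding comb_def by (simp only: y[OF r(1,2)] y[OF r(3,4)] ph[OF r(1,2) k k] ph[OF r(3,4) k k])
  qed
  then have "tscore (g (\<phi> src)) ?s k v (rx_block K SNR INR N encA \<omega> k) \<phi> = tscore (g (\<phi> src)) ?s k v (yrec w (g (\<phi> src)) ?s ?\<phi> z k) ?\<phi>"
    unfolding tscore_def by (intro sum.cong) auto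
  then show ?thesis by (simp add: testA_def thr_def TS_def proj_def tseq_restrict)
qed

lemma testA_sets:
  assumes k: "k < K" "v < M k"
  shows "{\<omega> \<in> space CSA. testA k v (rx_block K SNR INR N encA \<omega> k) (fst (snd \<omega>))} \<in> sets CSA"
proof -
  have [measurable]: "(\<lambda>\<omega>. TS k v (fst \<omega>) (proj \<omega>)) \<in> borel_measurable CSA"
    by (rule measurable_by_msg) (rule measurable_TS[OF k])
  have [measurable]: "(\<lambda>\<omega>. thr (proj \<omega>)) \<in> borel_measurable CSA"
    by (rule measurable_compose[OF measurable_proj measurable_thr])
  have "{\<omega> \<in> space CSA. testA k v (rx_block K SNR INR N encA \<omega> k) (fst (snd \<omega>))} = {\<omega> \<in> space CSA. thr (proj \<omega>) < TS k v (fst \<omega>) (proj \<omega>)}"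
    using testA_iff[OF _ k(1)] by auto
  also have "\<dots> \<in> sets CSA" by measurable
  finally show ?thesis .
qed

lemma encA_causal:
  assumes "\<forall>m\<le>n. \<forall>a<K. \<forall>b<K. \<phi> (m, a, b) = \<phi>' (m, a, b)"
  shows "encA k v \<phi> n = encA k v \<phi>' n"
proof -
  have s: "\<phi> src = \<phi>' src" using assms K by (simp add: src_def)
  have "tseq \<phi> m = tseq \<phi>' m" if "m \<le> n" for m
    using assms that by (auto simp: tseq_def stype_def KK_def fun_eq_iff restrict_def)
  then have "symbol_index L cp (tseq \<phi>) n = symbol_index L cp (tseq \<phi>') n"
    by (intro symbol_index_cong) auto
  then show ?thesis by (simp add: encA_def xsym_def s)
qed

text \<open>For the power: given the messages and the other phases, the symbol sent is either 0 or
  one entry of the codebook, and averaging over the seed gives such an entry power 1.\<close>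

lemma is_codeA: "is_code K SNR INR N M encA (test_decoder M testA)"
  unfolding is_code_def
proof (intro conjI allI impI)
  interpret prob_space CSA by (rule prob_space_code_space) (rule M)
  show "0 < M k" if "k < K" for k by (rule M[OF that])
  show "encA k w \<phi> n = encA k w \<phi>' n" if "\<forall>m\<le>n. \<forall>r<K. \<forall>t<K. \<phi> (m, r, t) = \<phi>' (m, r, t)" for k w n \<phi> \<phi>'
    by (rule encA_causal[OF that])
  show "error_event K SNR INR N M encA (test_decoder M testA) \<in> sets CSA"
    by (intro test_decoder_error_sets testA_sets)
  fix k n :: nat assume k: "k < K" and n: "n < N"
  let ?f = "\<lambda>w x. xsym (fst (fst x)) (tseq (snd (fst x))) k (w k) n"
  have fm: "?f w \<in> borel_measurable ((CB \<Otimes>\<^sub>M PH) \<Otimes>\<^sub>M NZ)" if "w \<in> Pi\<^sub>E {..<K} (\<lambda>k. {..<M k})" for w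
    by (rule measurable_by_tseq[where f="\<lambda>x. snd (fst x)"], measurable, rule measurable_xsym) (use that k in auto)
  have eq: "tx_symbol encA \<omega> k n = ?f (fst \<omega>) (proj \<omega>)" for \<omega>
    by (simp add: tx_symbol_def encA_def proj_def tseq_restrict)
  show m: "(\<lambda>\<omega>. tx_symbol encA \<omega> k n) \<in> borel_measurable CSA"
    unfolding eq by (rule measurable_by_msg[OF fm])
  have fm2: "(\<lambda>x. ennreal ((cmod (?f w x))\<^sup>2)) \<in> borel_measurable ((CB \<Otimes>\<^sub>M PH) \<Otimes>\<^sub>M NZ)" if "w \<in> Pi\<^sub>E {..<K} (\<lambda>k. {..<M k})" for w
    using fm[OF that] by measurable
  have "(\<integral>\<^sup>+\<omega>. ennreal ((cmod (tx_symbol encA \<omega> k n))\<^sup>2) \<partial>CSA) =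
      (\<integral>\<^sup>+w. \<integral>\<^sup>+\<phi>. \<integral>\<^sup>+C. \<integral>\<^sup>+z. ennreal ((cmod (?f w ((C, \<phi>), z)))\<^sup>2) \<partial>NZ \<partial>CB \<partial>PH \<partial>msg_space K M)"
    unfolding eq by (rule nn_integral_proj[OF fm2])
  also have "\<dots> \<le> (\<integral>\<^sup>+w. \<integral>\<^sup>+\<phi>. 1 \<partial>PH \<partial>msg_space K M)"
  proof (rule nn_integral_mono, rule nn_integral_mono)
    fix w \<phi> assume "w \<in> space (msg_space K M)"
    then have w: "w \<in> Pi\<^sub>E {..<K} (\<lambda>k. {..<M k})" by (simp add: space_PiM space_uniform_count_measure)
    have "(\<integral>\<^sup>+C. \<integral>\<^sup>+z. ennreal ((cmod (?f w ((C, \<phi>), z)))\<^sup>2) \<partial>NZ \<partial>CB) = (\<integral>\<^sup>+C. ennreal ((cmod (xsym C (tseq \<phi>) k (w k) n))\<^sup>2) \<partial>CB)"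
      by (simp add: prob_space.emeasure_space_1[OF prob_space_noise])
    also have "\<dots> \<le> 1"
    proof (cases "symbol_index L cp (tseq \<phi>) n")
      case (Some i)
      then have ci: "(k, w k, i) \<in> CI" using xsym_index[OF tseq_FS Some] k w by (auto simp: CI_def)
      have 1: "(\<lambda>z. (cmod z)\<^sup>2) \<in> borel_measurable cgauss" by (simp add: measurable_cong_sets[OF cgauss_sets refl])
      have "integrable CB (\<lambda>C. (cmod (C (k, w k, i)))\<^sup>2)" "(\<integral>C. (cmod (C (k, w k, i)))\<^sup>2 \<partial>CB) = 1"
        using integral_PiM_component[OF prob_space_cgauss ci 1] cgauss_moments(3,4) by simp_all
      then have "(\<integral>\<^sup>+C. ennreal ((cmod (C (k, w k, i)))\<^sup>2) \<partial>CB) = 1"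
        by (subst nn_integral_eq_integral) auto
      then show ?thesis using Some by (simp add: xsym_def)
    qed (simp add: xsym_def)
    finally show "(\<integral>\<^sup>+C. \<integral>\<^sup>+z. ennreal ((cmod (?f w ((C, \<phi>), z)))\<^sup>2) \<partial>NZ \<partial>CB) \<le> 1" .
  qed
  also have "\<dots> = 1"
    using prob_space.emeasure_space_1[OF prob_space_phase[of "IK - {src}"]] prob_space.emeasure_space_1[OF prob_space_msg[OF M]] by simp
  finally have le: "(\<integral>\<^sup>+\<omega>. ennreal ((cmod (tx_symbol encA \<omega> k n))\<^sup>2) \<partial>CSA) \<le> 1" .
  note [measurable] = m
  show i: "integrable CSA (\<lambda>\<omega>. (cmod (tx_symbol encA \<omega> k n))\<^sup>2)"
    using le by (intro integrableI_nonneg) (auto simp: le_less_trans)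
  show "(\<integral>\<omega>. (cmod (tx_symbol encA \<omega> k n))\<^sup>2 \<partial>CSA) \<le> 1"
    using le nn_integral_eq_integral[OF i] by (simp add: ennreal_le_1)
qed

section \<open>Combined observations as linear forms in Gaussian variables\<close>

definition gain :: "phases \<Rightarrow> (nat \<Rightarrow> nat \<times> nat \<Rightarrow> nat) \<Rightarrow> nat \<Rightarrow> nat \<Rightarrow> nat \<Rightarrow> complex" where
  "gain \<phi> s k i t = chan_coeff SNR INR k t (\<phi> (i, k, t)) * cis (- \<phi> (i, k, k)) +
     chan_coeff SNR INR k t (\<phi> (mt s i, k, t)) * cis (- \<phi> (mt s i, k, k))"
definition coef :: "phases \<Rightarrow> (nat \<Rightarrow> nat \<times> nat \<Rightarrow> nat) \<Rightarrow> nat \<Rightarrow> nat \<Rightarrow> (nat \<times> nat \<times> nat) + (nat \<times> nat) \<Rightarrow> complex" where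
  "coef \<phi> s k i b = (case b of Inl p \<Rightarrow> gain \<phi> s k i (fst p) | Inr q \<Rightarrow> cis (- \<phi> (fst q, k, k)))"
text \<open>The Gaussian variables that enter the combined observation of position \<open>i\<close>:
  one symbol of each transmitter and two noises. Blocks of different positions are disjoint, and
  from this the scores get their independence.\<close>

definition blk :: "msgs \<Rightarrow> (nat \<Rightarrow> nat \<times> nat \<Rightarrow> nat) \<Rightarrow> nat \<Rightarrow> nat \<Rightarrow> ((nat \<times> nat \<times> nat) + (nat \<times> nat)) set" where
  "blk w s k i = (\<lambda>t. Inl (t, w t, i)) ` {..<K} \<union> {Inr (i, k), Inr (mt s i, k)}"
text \<open>A uniform bound on all coefficients. It depends neither on the block length nor on the
  quantisation, and enters only the constant of Chebyshev's inequality.\<close>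

definition amp :: real where "amp = 2 + 2 * sqrt SNR + 2 * (\<Sum>p\<in>KK. \<bar>sqrt (INR p)\<bar>)"
abbreviation "XI \<equiv> CI <+> ({..<N} \<times> {..<K})"

lemma sum_blk:
  assumes i: "i \<in> S s"
  shows "(\<Sum>b\<in>blk w s k i. f b) = (\<Sum>t<K. f (Inl (t, w t, i))) + f (Inr (i, k)) + f (Inr (mt s i, k))"
proof -
  have ne: "i \<noteq> mt s i" using S_range[OF i] mt_range[OF i] by auto
  have "(\<Sum>b\<in>blk w s k i. f b) = (\<Sum>b\<in>(\<lambda>t. Inl (t, w t, i)) ` {..<K}. f b) + (\<Sum>b\<in>{Inr (i, k), Inr (mt s i, k)}. f b)"
    unfolding blk_def by (intro sum.union_disjoint) auto
  also have "(\<Sum>b\<in>(\<lambda>t. Inl (t, w t, i)) ` {..<K}. f b) = (\<Sum>t<K. f (Inl (t, w t, i)))"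
    by (subst sum.reindex) (auto simp: inj_on_def)
  finally show ?thesis using ne by (simp add: add.assoc)
qed

text \<open>Every transmitter sends the same symbol in use \<open>i\<close> and in its mate, since
  types are common to all users; so the two gains of each transmitter merge into one.\<close>

lemma comb_yrec:
  assumes s: "s \<in> FS" and i: "i \<in> S s"
  shows "comb s k (yrec w C s \<phi> z k) \<phi> i = (\<Sum>b\<in>blk w s k i. coef \<phi> s k i b * case_sum C z b)"
proof -
  have x: "xsym C s t v i = C (t, v, i)" "xsym C s t v (mt s i) = C (t, v, i)" for t v
    using symbol_index_first[OF i] symbol_index_mate[OF i inj_cp_FS[OF s]] by (auto simp: xsym_def)
  have "comb s k (yrec w C s \<phi> z k) \<phi> i = (\<Sum>t<K. gain \<phi> s k i t * C (t, w t, i)) + cis (- \<phi> (i, k, k)) * z (i, k) + cis (- \<phi> (mt s i, k, k)) * z (mt s i, k)"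
    by (simp add: comb_def yrec_def x gain_def sum_distrib_right sum_distrib_left algebra_simps sum.distrib)
  then show ?thesis by (simp add: sum_blk[OF i] coef_def)
qed

lemma gain_own: "gain \<phi> s k i k = complex_of_real c"
  by (simp add: gain_def chan_coeff_def c_def cis_mult mult.assoc)

lemma blk_sub:
  assumes i: "i \<in> S s" and k: "k < K" and w: "w \<in> Pi\<^sub>E {..<K} (\<lambda>k. {..<M k})"
  shows "blk w s k i \<subseteq> XI"
  using S_range[OF i] mt_range[OF i] N k w by (auto simp: blk_def CI_def PiE_iff)

lemma blk_disjoint:
  assumes s: "s \<in> FS" shows "disjoint_family_on (blk w s k) (S s)"
  unfolding disjoint_family_on_def
proof (intro ballI impI)
  fix i j assume ij: "i \<in> S s" "j \<in> S s" "i \<noteq> j"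
  have "mt s i \<noteq> mt s j" using inj_on_mate[OF inj_cp_FS[OF s]] ij by (auto dest: inj_onD)
  moreover have "i \<noteq> mt s j" "j \<noteq> mt s i" using S_range[OF ij(1)] S_range[OF ij(2)] mt_range[OF ij(1)] mt_range[OF ij(2)] by auto
  ultimately show "blk w s k i \<inter> blk w s k j = {}" using ij by (auto simp: blk_def)
qed

lemma card_blk: "card (blk w s k i) \<le> K + 2"
proof -
  have "card (blk w s k i) \<le> card ((\<lambda>t. Inl (t, w t, i) :: (nat \<times> nat \<times> nat) + (nat \<times> nat)) ` {..<K}) + card {Inr (i, k), Inr (mt s i, k) :: (nat \<times> nat \<times> nat) + (nat \<times> nat)}"
    unfolding blk_def by (rule card_Un_le)
  also have "\<dots> \<le> K + 2" using card_image_le[of "{..<K}"] by (intro add_mono) (auto simp: card_insert_if)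
  finally show ?thesis .
qed

lemma amp_nonneg: "0 \<le> amp" using SNR by (simp add: amp_def sum_nonneg)

lemma coef_le:
  assumes k: "k < K" and b: "b \<in> blk w s k i" shows "cmod (coef \<phi> s k i b) \<le> amp"
proof -
  have s0: "0 \<le> (\<Sum>p\<in>KK. \<bar>sqrt (INR p)\<bar>)" by (intro sum_nonneg) auto
  have g: "cmod (gain \<phi> s k i t) \<le> amp" if t: "t < K" for t
  proof -
    have ch: "cmod (chan_coeff SNR INR k t x) \<le> sqrt SNR + (\<Sum>p\<in>KK. \<bar>sqrt (INR p)\<bar>)" for x
    proof -
      have "\<bar>sqrt (INR (k, t))\<bar> \<le> (\<Sum>p\<in>KK. \<bar>sqrt (INR p)\<bar>)"
        using k t finite_KK by (intro member_le_sum[of "(k, t)" KK "\<lambda>p. \<bar>sqrt (INR p)\<bar>"]) (auto simp: KK_def)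
      then show ?thesis using SNR s0 by (auto simp: chan_coeff_def norm_mult add_increasing)
    qed
    have "cmod (gain \<phi> s k i t) \<le> cmod (chan_coeff SNR INR k t (\<phi> (i, k, t))) + cmod (chan_coeff SNR INR k t (\<phi> (mt s i, k, t)))"
      unfolding gain_def by (rule order_trans[OF norm_triangle_ineq]) (simp add: norm_mult)
    also have "\<dots> \<le> amp" using ch[of "\<phi> (i, k, t)"] ch[of "\<phi> (mt s i, k, t)"] by (simp add: amp_def)
    finally show ?thesis .
  qed
  have "1 \<le> amp" using SNR s0 by (simp add: amp_def)
  then show ?thesis using b g by (auto simp: blk_def coef_def)
qed

text \<open>In a pair of complementary uses the direct gains add up and the cross gains nearly cancel.\<close>
lemma gain_cross_le:
  assumes i: "i \<in> S (tseq \<phi>)" and k: "k < K" and t: "t < K" "t \<noteq> k"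
  shows "(cmod (gain \<phi> (tseq \<phi>) k i t))\<^sup>2 \<le> \<bar>INR (k, t)\<bar> * (4 * pi / real h)\<^sup>2"
proof -
  let ?s = "tseq \<phi>" let ?m = "mt ?s i"
  have p: "paired L cp ?s i ?m" by (rule paired_mate[OF i])
  have ty: "stype \<phi> ?m = cp (stype \<phi> i)"
  proof -
    have "i \<in> {1..2*L}" "?m \<in> {1..2*L}" using S_range[OF i] mt_range[OF i] by auto
    then show ?thesis using p by (simp add: paired_def tseq_def)
  qed
  have kk: "(k, k) \<in> KK" "(k, t) \<in> KK" using k t by (auto simp: KK_def)
  have d: "bin (2 * h) (\<phi> (i, k, k)) = bin (2 * h) (\<phi> (?m, k, k))"
    using fun_cong[OF ty, of "(k, k)"] kk by (simp add: stype_def cp_def)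
  have o: "bin (2 * h) (\<phi> (?m, k, t)) = (bin (2 * h) (\<phi> (i, k, t)) + h) mod (2 * h)"
    using fun_cong[OF ty, of "(k, t)"] kk t by (simp add: stype_def cp_def)
  define e1 e2 f1 f2 where "e1 = cis (\<phi> (i, k, t))" "e2 = cis (\<phi> (?m, k, t))" "f1 = cis (- \<phi> (i, k, k))" "f2 = cis (- \<phi> (?m, k, k))"
  note defs = this
  have n: "cmod e1 = 1" "cmod e2 = 1" "cmod f1 = 1" "cmod f2 = 1" by (auto simp: defs)
  have e: "cmod (e1 + e2) \<le> 4 * pi / real (2 * h)" unfolding defs by (rule bin_opposite[OF h o])
  have f: "cmod (f1 - f2) \<le> 4 * pi / real (2 * h)"
  proof -
    have "f1 - f2 = cnj (cis (\<phi> (i, k, k)) - cis (\<phi> (?m, k, k)))" by (simp add: defs cis_cnj)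
    then have "cmod (f1 - f2) = cmod (cis (\<phi> (i, k, k)) - cis (\<phi> (?m, k, k)))" by (simp only: complex_mod_cnj)
    then show ?thesis using bin_same[OF _ d] h by simp
  qed
  \<comment> \<open>This separates the two quantisation errors: cross phases that are not exactly
    opposite, and direct phases that are not exactly equal. Each costs at most
    \<open>4 * pi / real (2 * h)\<close>.\<close>
  have "e1 * f1 + e2 * f2 = (e1 + e2) * f1 - e2 * (f1 - f2)" by (simp add: algebra_simps)
  then have "cmod (e1 * f1 + e2 * f2) \<le> cmod ((e1 + e2) * f1) + cmod (e2 * (f1 - f2))" by (metis norm_triangle_ineq4)
  also have "\<dots> = cmod (e1 + e2) + cmod (f1 - f2)" by (simp only: norm_mult n mult_1 mult_1_right)
  also have "\<dots> \<le> 4 * pi / real (2 * h) + 4 * pi / real (2 * h)" by (rule add_mono[OF e f])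
  also have "\<dots> = 4 * pi / real h" using h by (simp add: field_simps)
  finally have le: "cmod (e1 * f1 + e2 * f2) \<le> 4 * pi / real h" .
  have "gain \<phi> ?s k i t = complex_of_real (sqrt (INR (k, t))) * (e1 * f1 + e2 * f2)"
    using t by (simp add: gain_def chan_coeff_def defs algebra_simps)
  then have "(cmod (gain \<phi> ?s k i t))\<^sup>2 = (sqrt (INR (k, t)))\<^sup>2 * (cmod (e1 * f1 + e2 * f2))\<^sup>2"
    by (simp add: norm_mult power_mult_distrib)
  \<comment> \<open>\<open>sqrt\<close> is an odd function in HOL, so this square is the absolute
    value for either sign.\<close>
  also have "(sqrt (INR (k, t)))\<^sup>2 = \<bar>INR (k, t)\<bar>"
    by (metis real_sqrt_abs2 power2_eq_square real_sqrt_mult)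
  also have "\<bar>INR (k, t)\<bar> * (cmod (e1 * f1 + e2 * f2))\<^sup>2 \<le> \<bar>INR (k, t)\<bar> * (4 * pi / real h)\<^sup>2"
    using le by (intro mult_left_mono power_mono) auto
  finally show ?thesis .
qed

text \<open>The two noises contribute exactly 2, and by \<open>small\<close> the cross gains
  contribute at most \<open>\<eta>\<close> together.\<close>

lemma interference_le:
  assumes i: "i \<in> S (tseq \<phi>)" and k: "k < K"
  shows "(\<Sum>b\<in>blk w (tseq \<phi>) k i - {Inl (k, w k, i)}. (cmod (coef \<phi> (tseq \<phi>) k i b))\<^sup>2) \<le> 2 + \<eta>"
proof -
  let ?s = "tseq \<phi>"
  let ?f = "\<lambda>b. (cmod (coef \<phi> ?s k i b))\<^sup>2"
  have fin: "finite (blk w ?s k i)" by (simp add: blk_def)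
  have inb: "Inl (k, w k, i) \<in> blk w ?s k i" using k by (auto simp: blk_def)
  have "(\<Sum>b\<in>blk w ?s k i - {Inl (k, w k, i)}. ?f b) = (\<Sum>b\<in>blk w ?s k i. ?f b) - ?f (Inl (k, w k, i))"
    using sum.remove[OF fin inb, of ?f] by simp
  also have "(\<Sum>b\<in>blk w ?s k i. ?f b) = (\<Sum>t<K. (cmod (gain \<phi> ?s k i t))\<^sup>2) + 2"
    by (simp add: sum_blk[OF i] coef_def)
  also have "(\<Sum>t<K. (cmod (gain \<phi> ?s k i t))\<^sup>2) = (cmod (gain \<phi> ?s k i k))\<^sup>2 + (\<Sum>t\<in>{..<K} - {k}. (cmod (gain \<phi> ?s k i t))\<^sup>2)"
    using k by (intro sum.remove) auto
  also have "(\<Sum>t\<in>{..<K} - {k}. (cmod (gain \<phi> ?s k i t))\<^sup>2) \<le> (\<Sum>t\<in>{..<K} - {k}. \<bar>INR (k, t)\<bar> * (4 * pi / real h)\<^sup>2)"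
    using gain_cross_le[OF i k] by (intro sum_mono) auto
  also have "\<dots> \<le> (\<Sum>t<K. \<bar>INR (k, t)\<bar> * (4 * pi / real h)\<^sup>2)" by (intro sum_mono2) auto
  also have "\<dots> \<le> \<eta>" using small[OF k] by (simp add: sum_distrib_right)
  finally show ?thesis by (simp add: coef_def)
qed

lemma TS_eq:
  "TS k v w ((C, \<phi>), z) = (\<Sum>i\<in>S (tseq \<phi>). score c (\<Sum>b\<in>blk w (tseq \<phi>) k i. coef \<phi> (tseq \<phi>) k i b * case_sum C z b) (C (k, v, i)))"
  by (simp add: TS_def tscore_def comb_yrec[OF tseq_FS])

lemma case_sum_restrict: "b \<in> XI \<Longrightarrow> case_sum (\<lambda>a\<in>CI. x (Inl a)) (\<lambda>q\<in>{..<N} \<times> {..<K}. x (Inr q)) b = x b"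
  by (auto split: sum.split)

text \<open>With the phases fixed, codebook and noise form one Gaussian family over
  \<open>XI\<close>. \<open>score_tail\<close> applies with the blocks \<open>blk\<close>, the sent
  symbols as distinguished variables with gain \<open>c\<close>, and residual variance at most
  \<open>2 + \<eta>\<close>.\<close>

lemma missed_le:
  assumes k: "k < K" and w: "w \<in> Pi\<^sub>E {..<K} (\<lambda>k. {..<M k})" and \<phi>: "\<phi> \<in> space PH" and ne: "S (tseq \<phi>) \<noteq> {}"
  shows "(\<integral>\<^sup>+C. \<integral>\<^sup>+z. indicator {x. TS k (w k) w x \<le> thr x} ((C, \<phi>), z) \<partial>NZ \<partial>CB)
    \<le> ennreal (8 * amp^4 * real (K + 2)^5 * m4 / (\<eta>\<^sup>2 * real (card (S (tseq \<phi>)))))"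
proof -
  let ?s = "tseq \<phi>"
  let ?P = "PiM XI (\<lambda>_. cgauss)"
  have wk: "w k < M k" using w k by auto
  note [measurable] = measurable_TS[OF k wk w] measurable_thr
  have mm: "(\<lambda>x. indicator {x. TS k (w k) w x \<le> thr x} x :: ennreal) \<in> borel_measurable ((CB \<Otimes>\<^sub>M PH) \<Otimes>\<^sub>M NZ)"
  proof -
    have "(\<lambda>x. if TS k (w k) w x \<le> thr x then 1 else 0 :: ennreal) \<in> borel_measurable ((CB \<Otimes>\<^sub>M PH) \<Otimes>\<^sub>M NZ)" by measurable
    then show ?thesis by (simp add: indicator_def)
  qed
  have "(\<lambda>q. ((fst q, \<phi>), snd q)) \<in> measurable (CB \<Otimes>\<^sub>M NZ) ((CB \<Otimes>\<^sub>M PH) \<Otimes>\<^sub>M NZ)" using \<phi> by measurable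
  from measurable_compose[OF this mm]
  have mm2: "case_prod (\<lambda>C z. indicator {x. TS k (w k) w x \<le> thr x} ((C, \<phi>), z) :: ennreal) \<in> borel_measurable (CB \<Otimes>\<^sub>M NZ)"
    by (simp add: split_beta')
  let ?E = "{x \<in> space ?P. (\<Sum>i\<in>S ?s. score c (\<Sum>b\<in>blk w ?s k i. coef \<phi> ?s k i b * x b) (x (Inl (k, w k, i)))) \<le> - \<eta> * real (card (S ?s))}"
  have "(\<integral>\<^sup>+C. \<integral>\<^sup>+z. indicator {x. TS k (w k) w x \<le> thr x} ((C, \<phi>), z) \<partial>NZ \<partial>CB) =
    (\<integral>\<^sup>+x. indicator {x. TS k (w k) w x \<le> thr x} ((\<lambda>a\<in>CI. x (Inl a), \<phi>), \<lambda>q\<in>{..<N} \<times> {..<K}. x (Inr q)) \<partial>?P)"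
    by (rule nn_integral_PiM_Plus[OF finite_CI _ prob_space_cgauss mm2]) simp
  also have "\<dots> = (\<integral>\<^sup>+x. indicator ?E x \<partial>?P)"
  proof (rule nn_integral_cong)
    fix x assume x: "x \<in> space ?P"
    have "TS k (w k) w ((\<lambda>a\<in>CI. x (Inl a), \<phi>), \<lambda>q\<in>{..<N} \<times> {..<K}. x (Inr q)) =
      (\<Sum>i\<in>S ?s. score c (\<Sum>b\<in>blk w ?s k i. coef \<phi> ?s k i b * x b) (x (Inl (k, w k, i))))"
      unfolding TS_eq
    proof (rule sum.cong[OF refl])
      fix i assume i: "i \<in> S ?s"
      have "(k, w k, i) \<in> CI" using S_range[OF i] k wk by (auto simp: CI_def)
      moreover have "(\<Sum>b\<in>blk w ?s k i. coef \<phi> ?s k i b * case_sum (\<lambda>a\<in>CI. x (Inl a)) (\<lambda>q\<in>{..<N} \<times> {..<K}. x (Inr q)) b) = (\<Sum>b\<in>blk w ?s k i. coef \<phi> ?s k i b * x b)"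
        using blk_sub[OF i k w] by (intro sum.cong refl arg_cong2[where f="(*)"] case_sum_restrict) auto
      ultimately show "score c (\<Sum>b\<in>blk w ?s k i. coef \<phi> ?s k i b * case_sum (\<lambda>a\<in>CI. x (Inl a)) (\<lambda>q\<in>{..<N} \<times> {..<K}. x (Inr q)) b) ((\<lambda>a\<in>CI. x (Inl a)) (k, w k, i)) =
         score c (\<Sum>b\<in>blk w ?s k i. coef \<phi> ?s k i b * x b) (x (Inl (k, w k, i)))" by simp
    qed
    then show "indicator {x. TS k (w k) w x \<le> thr x} ((\<lambda>a\<in>CI. x (Inl a), \<phi>), \<lambda>q\<in>{..<N} \<times> {..<K}. x (Inr q)) = (indicator ?E x :: ennreal)"
      using x by (simp add: indicator_def thr_def)
  qed
  also have "\<dots> = emeasure ?P ?E"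
  proof (rule nn_integral_indicator)
    have c1: "(\<lambda>x. x b) \<in> borel_measurable ?P" if "b \<in> XI" for b by (rule measurable_gauss_comp[OF that])
    have "(\<lambda>x. \<Sum>i\<in>S ?s. score c (\<Sum>b\<in>blk w ?s k i. coef \<phi> ?s k i b * x b) (x (Inl (k, w k, i)))) \<in> borel_measurable ?P"
      using blk_sub[OF _ k w] S_range k wk by (intro borel_measurable_sum measurable_score borel_measurable_times borel_measurable_const c1) (auto simp: CI_def)
    then show "?E \<in> sets ?P" by measurable
  qed
  also have "\<dots> = ennreal (measure ?P ?E)"
    using prob_space.finite_measure[OF prob_space_noise[of XI]] by (simp add: finite_measure.emeasure_eq_measure)
  also have "\<dots> \<le> ennreal (8 * amp^4 * real (K + 2)^5 * m4 / (\<eta>\<^sup>2 * real (card (S ?s))))"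
  proof (rule ennreal_leI)
    show "measure ?P ?E \<le> 8 * amp^4 * real (K + 2)^5 * m4 / (\<eta>\<^sup>2 * real (card (S ?s)))"
    proof (rule score_tail)
      show "finite XI" using finite_CI by auto
      show "finite (S ?s)" by (rule finite_matched)
      show "blk w ?s k i \<subseteq> XI" if "i \<in> S ?s" for i by (rule blk_sub[OF that k w])
      show "disjoint_family_on (blk w ?s k) (S ?s)" by (rule blk_disjoint[OF tseq_FS])
      show "Inl (k, w k, i) \<in> blk w ?s k i" for i using k by (auto simp: blk_def)
      show "coef \<phi> ?s k i (Inl (k, w k, i)) = complex_of_real c" for i by (simp add: coef_def gain_own)
      show "card (blk w ?s k i) \<le> K + 2" for i by (rule card_blk)
      show "cmod (coef \<phi> ?s k i b) \<le> amp" if "b \<in> blk w ?s k i" for i b by (rule coef_le[OF k that])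
      show "(\<Sum>b\<in>blk w ?s k i - {Inl (k, w k, i)}. (cmod (coef \<phi> ?s k i b))\<^sup>2) \<le> 2 + \<eta>" if "i \<in> S ?s" for i
        by (rule interference_le[OF that k])
    qed (use amp_nonneg \<eta> ne in auto)
  qed
  finally show ?thesis .
qed

text \<open>The symbols of a message \<open>v\<close> other than \<open>w k\<close> were not sent,
  so the combined observations do not involve them and \<open>score_wrong_codeword\<close> applies,
  with \<open>c\<^sup>2 / 2 = 2 * SNR\<close>.\<close>

lemma false_alarm_le:
  assumes k: "k < K" and v: "v < M k" and w: "w \<in> Pi\<^sub>E {..<K} (\<lambda>k. {..<M k})" and vw: "v \<noteq> w k" and \<phi>: "\<phi> \<in> space PH"
  shows "(\<integral>\<^sup>+C. \<integral>\<^sup>+z. indicator {x. thr x \<le> TS k v w x} ((C, \<phi>), z) \<partial>NZ \<partial>CB)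
    \<le> ennreal (exp (\<eta> * real (card (S (tseq \<phi>)))) * (1 / (1 + 2 * SNR)) ^ card (S (tseq \<phi>)))"
proof -
  let ?s = "tseq \<phi>"
  let ?P = "PiM XI (\<lambda>_. cgauss)"
  note [measurable] = measurable_TS[OF k v w] measurable_thr
  have mm: "(\<lambda>x. indicator {x. thr x \<le> TS k v w x} x :: ennreal) \<in> borel_measurable ((CB \<Otimes>\<^sub>M PH) \<Otimes>\<^sub>M NZ)"
  proof -
    have "(\<lambda>x. if thr x \<le> TS k v w x then 1 else 0 :: ennreal) \<in> borel_measurable ((CB \<Otimes>\<^sub>M PH) \<Otimes>\<^sub>M NZ)" by measurable
    then show ?thesis by (simp add: indicator_def)
  qed
  have "(\<lambda>q. ((fst q, \<phi>), snd q)) \<in> measurable (CB \<Otimes>\<^sub>M NZ) ((CB \<Otimes>\<^sub>M PH) \<Otimes>\<^sub>M NZ)" using \<phi> by measurable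
  from measurable_compose[OF this mm]
  have mm2: "case_prod (\<lambda>C z. indicator {x. thr x \<le> TS k v w x} ((C, \<phi>), z) :: ennreal) \<in> borel_measurable (CB \<Otimes>\<^sub>M NZ)"
    by (simp add: split_beta')
  define T where "T i x = (\<Sum>b\<in>blk w ?s k i. coef \<phi> ?s k i b * x b)" for i and x :: "_ \<Rightarrow> complex"
  let ?d = "\<lambda>i. Inl (k, v, i) :: (nat \<times> nat \<times> nat) + (nat \<times> nat)"
  let ?E = "{x \<in> space ?P. - (\<eta> * real (card (S ?s))) \<le> (\<Sum>i\<in>S ?s. score c (T i x) (x (?d i)))}"
  have c1: "(\<lambda>x. x b) \<in> borel_measurable ?P" if "b \<in> XI" for b by (rule measurable_gauss_comp[OF that])
  have dXI: "?d ` S ?s \<subseteq> XI" using S_range k v by (auto simp: CI_def)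
  have Tm: "T i \<in> borel_measurable ?P" if "i \<in> S ?s" for i
    unfolding T_def using blk_sub[OF that k w] by (intro borel_measurable_sum borel_measurable_times borel_measurable_const c1) auto
  have "(\<integral>\<^sup>+C. \<integral>\<^sup>+z. indicator {x. thr x \<le> TS k v w x} ((C, \<phi>), z) \<partial>NZ \<partial>CB) =
    (\<integral>\<^sup>+x. indicator {x. thr x \<le> TS k v w x} ((\<lambda>a\<in>CI. x (Inl a), \<phi>), \<lambda>q\<in>{..<N} \<times> {..<K}. x (Inr q)) \<partial>?P)"
    by (rule nn_integral_PiM_Plus[OF finite_CI _ prob_space_cgauss mm2]) simp
  also have "\<dots> = (\<integral>\<^sup>+x. indicator ?E x \<partial>?P)"
  proof (rule nn_integral_cong)
    fix x assume x: "x \<in> space ?P"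
    have "TS k v w ((\<lambda>a\<in>CI. x (Inl a), \<phi>), \<lambda>q\<in>{..<N} \<times> {..<K}. x (Inr q)) = (\<Sum>i\<in>S ?s. score c (T i x) (x (?d i)))"
      unfolding TS_eq T_def
    proof (rule sum.cong[OF refl])
      fix i assume i: "i \<in> S ?s"
      have "(k, v, i) \<in> CI" using S_range[OF i] k v by (auto simp: CI_def)
      moreover have "(\<Sum>b\<in>blk w ?s k i. coef \<phi> ?s k i b * case_sum (\<lambda>a\<in>CI. x (Inl a)) (\<lambda>q\<in>{..<N} \<times> {..<K}. x (Inr q)) b) = (\<Sum>b\<in>blk w ?s k i. coef \<phi> ?s k i b * x b)"
        using blk_sub[OF i k w] by (intro sum.cong refl arg_cong2[where f="(*)"] case_sum_restrict) auto
      ultimately show "score c (\<Sum>b\<in>blk w ?s k i. coef \<phi> ?s k i b * case_sum (\<lambda>a\<in>CI. x (Inl a)) (\<lambda>q\<in>{..<N} \<times> {..<K}. x (Inr q)) b) ((\<lambda>a\<in>CI. x (Inl a)) (k, v, i)) =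
         score c (\<Sum>b\<in>blk w ?s k i. coef \<phi> ?s k i b * x b) (x (?d i))" by simp
    qed
    then show "indicator {x. thr x \<le> TS k v w x} ((\<lambda>a\<in>CI. x (Inl a), \<phi>), \<lambda>q\<in>{..<N} \<times> {..<K}. x (Inr q)) = (indicator ?E x :: ennreal)"
      using x by (simp add: indicator_def thr_def)
  qed
  also have "\<dots> = emeasure ?P ?E"
  proof (rule nn_integral_indicator)
    have "(\<lambda>x. \<Sum>i\<in>S ?s. score c (T i x) (x (?d i))) \<in> borel_measurable ?P"
      using dXI by (intro borel_measurable_sum measurable_score Tm c1) auto
    then show "?E \<in> sets ?P" by measurable
  qed
  also have "\<dots> = ennreal (measure ?P ?E)"
    using prob_space.finite_measure[OF prob_space_noise[of XI]] by (simp add: finite_measure.emeasure_eq_measure)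
  also have "\<dots> \<le> ennreal (exp (\<eta> * real (card (S ?s))) * (1 / (1 + c\<^sup>2 / 2)) ^ card (S ?s))"
  proof (rule ennreal_leI, rule score_wrong_codeword)
    show "finite XI" using finite_CI by auto
    show "finite (S ?s)" by (rule finite_matched)
    show "inj_on ?d (S ?s)" by (auto simp: inj_on_def)
    show "?d ` S ?s \<subseteq> XI" by (rule dXI)
    show "T i \<in> borel_measurable ?P" if "i \<in> S ?s" for i by (rule Tm[OF that])
    fix i and x y :: "(nat \<times> nat \<times> nat) + (nat \<times> nat) \<Rightarrow> complex"
    assume i: "i \<in> S ?s" and eq: "\<And>b. b \<in> XI - ?d ` S ?s \<Longrightarrow> x b = y b"
    have "x b = y b" if b: "b \<in> blk w ?s k i" for b
    proof (rule eq)
      have "b \<notin> ?d ` S ?s" using b vw by (auto simp: blk_def)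
      then show "b \<in> XI - ?d ` S ?s" using b blk_sub[OF i k w] by blast
    qed
    then show "T i x = T i y" unfolding T_def by (intro sum.cong) auto
  qed
  also have "1 + c\<^sup>2 / 2 = 1 + 2 * SNR" using SNR by (simp add: c_def power_mult_distrib)
  finally show ?thesis .
qed

section \<open>Frequencies of the phase types\<close>

abbreviation "nT \<equiv> real (card Ty)"

lemma card_Ty: "real (card Ty) = real (2 * h) ^ card KK"
  unfolding Ty_def using finite_KK by (simp add: card_PiE)

lemma nT_pos: "0 < nT" using h by (simp add: card_Ty)

text \<open>The bins of the \<open>K * K\<close> phases of a use are independent and uniform, so all
  types are equally likely. In particular a type and its complement have the same frequency, which
  is why almost all symbols find a partner.\<close>

lemma stype_prob:
  assumes n: "1 \<le> n" "n < N" and \<tau>: "\<tau> \<in> Ty"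
  shows "measure PH {\<phi> \<in> space PH. stype \<phi> n = \<tau>} = 1 / nT"
proof -
  interpret prob_space PH by (rule prob_space_phase)
  let ?J = "{n} \<times> {..<K} \<times> {..<K}"
  let ?A = "\<lambda>p :: nat \<times> nat \<times> nat. {x. bin (2 * h) x = \<tau> (snd p)}"
  have J: "finite ?J" "?J \<subseteq> IK - {src}" using n by (auto simp: IK_def src_def)
  have A: "?A p \<in> sets phase_dist" for p by simp
  have "{\<phi> \<in> space PH. stype \<phi> n = \<tau>} = prod_emb (IK - {src}) (\<lambda>_. phase_dist) ?J (Pi\<^sub>E ?J ?A)"
  proof -
    have "stype \<phi> n = \<tau> \<longleftrightarrow> (\<forall>a<K. \<forall>b<K. bin (2 * h) (\<phi> (n, a, b)) = \<tau> (a, b))" for \<phi>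
    proof -
      have "stype \<phi> n = \<tau> \<longleftrightarrow> (\<forall>p\<in>KK. bin (2 * h) (\<phi> (n, fst p, snd p)) = \<tau> p)"
        using \<tau> by (auto simp: stype_def Ty_def PiE_iff fun_eq_iff restrict_def extensional_def)
      also have "\<dots> \<longleftrightarrow> (\<forall>a<K. \<forall>b<K. bin (2 * h) (\<phi> (n, a, b)) = \<tau> (a, b))" by (auto simp: KK_def)
      finally show ?thesis .
    qed
    then show ?thesis using J by (auto simp: prod_emb_iff space_PiM PiE_iff)
  qed
  then have "emeasure PH {\<phi> \<in> space PH. stype \<phi> n = \<tau>} = (\<Prod>p\<in>?J. emeasure phase_dist (?A p))"
    using J A by (simp add: emeasure_PiM_emb prob_space_phase_dist)
  also have "\<dots> = (\<Prod>p\<in>?J. ennreal (1 / real (2 * h)))"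
  proof (rule prod.cong[OF refl])
    fix p assume "p \<in> ?J"
    then have "\<tau> (snd p) < 2 * h" using \<tau> by (auto simp: Ty_def KK_def PiE_iff)
    then show "emeasure phase_dist (?A p) = ennreal (1 / real (2 * h))"
      using bin_prob[of "2 * h" "\<tau> (snd p)"] h prob_space.finite_measure[OF prob_space_phase_dist]
      by (simp add: finite_measure.emeasure_eq_measure)
  qed
  also have "\<dots> = ennreal ((1 / real (2 * h)) ^ (K * K))"
    by (simp add: ennreal_power card_cartesian_product)
  also have "(1 / real (2 * h)) ^ (K * K) = 1 / nT"
    by (simp add: card_Ty KK_def power_one_over card_cartesian_product)
  finally show ?thesis by (simp add: emeasure_eq_measure nT_pos less_imp_le)
qed

text \<open>The types of different uses depend on disjoint sets of phases. The block bound applies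
  to the indicators of \<open>\<tau>\<close>, whose mean is \<open>1 / nT\<close> and whose second
  moment is at most 1.\<close>

lemma count_tail:
  assumes A: "A \<subseteq> {1..2 * L}" "card A = L" and \<tau>: "\<tau> \<in> Ty" and \<delta>: "0 < \<delta>"
  shows "measure PH {\<phi> \<in> space PH. real (card {n \<in> A. tseq \<phi> n = \<tau>}) \<le> real L * (1 / nT) - \<delta> * real L} \<le> 1 / (\<delta>\<^sup>2 * real L)"
    and "{\<phi> \<in> space PH. real (card {n \<in> A. tseq \<phi> n = \<tau>}) \<le> real L * (1 / nT) - \<delta> * real L} \<in> sets PH"
proof -
  interpret prob_space PH by (rule prob_space_phase)
  have fA: "finite A" using A finite_subset by auto
  let ?J = "\<lambda>n. {n} \<times> {..<K} \<times> {..<K} :: (nat \<times> nat \<times> nat) set"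
  let ?f = "\<lambda>n \<phi>. if stype \<phi> n = \<tau> then 1 else 0 :: real"
  have nr: "1 \<le> n" "n < N" if "n \<in> A" for n using A N that by auto
  have Jsub: "?J n \<subseteq> IK - {src}" if "n \<in> A" for n using nr[OF that] by (auto simp: IK_def src_def)
  have fr: "?f n (restrict x (?J n)) = ?f n x" for n x
  proof -
    have "stype (restrict x (?J n)) n = stype x n" by (auto simp: stype_def KK_def fun_eq_iff restrict_def)
    then show ?thesis by simp
  qed
  have stm: "Measurable.pred (PiM B (\<lambda>_. phase_dist)) (\<lambda>\<phi>. stype \<phi> n = \<tau>)" if B: "?J n \<subseteq> B" for n B
  proof -
    have "(\<lambda>\<phi>. stype \<phi> n = \<tau>) = (\<lambda>\<phi>. \<forall>p\<in>KK. bin (2 * h) (\<phi> (n, fst p, snd p)) = \<tau> p)"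
      using \<tau> by (auto simp: stype_def Ty_def PiE_iff fun_eq_iff restrict_def extensional_def)
    moreover have "Measurable.pred (PiM B (\<lambda>_. phase_dist)) \<dots>"
    proof (rule pred_intros_finite(3)[OF finite_KK])
      fix p assume "p \<in> KK"
      then have "(n, fst p, snd p) \<in> B" using B by (auto simp: KK_def)
      from measurable_compose[OF measurable_phase_comp[OF this] measurable_bin]
      have [measurable]: "(\<lambda>\<phi>. bin (2 * h) (\<phi> (n, fst p, snd p))) \<in> measurable (PiM B (\<lambda>_. phase_dist)) (count_space UNIV)" .
      show "Measurable.pred (PiM B (\<lambda>_. phase_dist)) (\<lambda>\<phi>. bin (2 * h) (\<phi> (n, fst p, snd p)) = \<tau> p)" by measurable
    qed
    ultimately show ?thesis by simp
  qed
  have fm: "?f n \<in> borel_measurable (PiM B (\<lambda>_. phase_dist))" if B: "?J n \<subseteq> B" for n B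
    using stm[OF B] by measurable
  have fi: "integrable PH (?f n)" if "n \<in> A" for n
    by (rule integrable_const_bound[where B=1]) (use fm[OF Jsub[OF that]] in auto)
  have Ef: "(\<integral>x. ?f n x \<partial>PH) = 1 / nT" if "n \<in> A" for n
  proof -
    have "(\<integral>x. ?f n x \<partial>PH) = (\<integral>x. indicator {\<phi> \<in> space PH. stype \<phi> n = \<tau>} x \<partial>PH)"
      by (intro Bochner_Integration.integral_cong) (auto simp: indicator_def)
    also have "\<dots> = measure PH ({\<phi> \<in> space PH. stype \<phi> n = \<tau>} \<inter> space PH)" by simp
    also have "{\<phi> \<in> space PH. stype \<phi> n = \<tau>} \<inter> space PH = {\<phi> \<in> space PH. stype \<phi> n = \<tau>}" by auto
    also have "measure PH \<dots> = 1 / nT" by (rule stype_prob[OF nr[OF that] \<tau>])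
    finally show ?thesis .
  qed
  have cnt: "(\<Sum>n\<in>A. ?f n (restrict \<phi> (?J n))) = real (card {n \<in> A. tseq \<phi> n = \<tau>})" for \<phi>
  proof -
    have "(\<Sum>n\<in>A. ?f n \<phi>) = (\<Sum>n\<in>{n \<in> A. tseq \<phi> n = \<tau>}. 1)"
      using A fA by (subst sum.inter_filter) (auto intro!: sum.cong simp: tseq_def)
    then show ?thesis by (simp only: fr) simp
  qed
  have "measure PH {x \<in> space PH. (\<Sum>n\<in>A. ?f n (restrict x (?J n))) \<le> real (card A) * (1 / nT) - \<delta> * real L} \<le> real (card A) * 1 / (\<delta> * real L)\<^sup>2"
  proof (rule PiM_block_lower_tail[OF fA])
    show "prob_space phase_dist" by (rule prob_space_phase_dist)
    show "?J n \<subseteq> IK - {src}" if "n \<in> A" for n by (rule Jsub[OF that])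
    show "disjoint_family_on ?J A" by (auto simp: disjoint_family_on_def)
    show "?f n \<in> borel_measurable (PiM (?J n) (\<lambda>_. phase_dist))" for n by (rule fm) simp
    have sq: "(?f n x)\<^sup>2 = ?f n x" for n x by simp
    show "integrable PH (\<lambda>x. (?f n (restrict x (?J n)))\<^sup>2)" if "n \<in> A" for n
      unfolding fr sq by (rule fi[OF that])
    show "(\<integral>x. (?f n (restrict x (?J n)))\<^sup>2 \<partial>PH) \<le> 1" if "n \<in> A" for n
      unfolding fr sq Ef[OF that] using nT_pos by (simp add: Suc_le_eq)
    show "1 / nT \<le> (\<integral>x. ?f n (restrict x (?J n)) \<partial>PH)" if "n \<in> A" for n
      unfolding fr Ef[OF that] by simp
    show "0 < \<delta> * real L" using \<delta> L by simp
  qed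
  also have "real (card A) * 1 / (\<delta> * real L)\<^sup>2 = 1 / (\<delta>\<^sup>2 * real L)"
    using A L by (simp add: power2_eq_square field_simps)
  finally show "measure PH {\<phi> \<in> space PH. real (card {n \<in> A. tseq \<phi> n = \<tau>}) \<le> real L * (1 / nT) - \<delta> * real L} \<le> 1 / (\<delta>\<^sup>2 * real L)"
    unfolding cnt A(2) .
  have "(\<lambda>\<phi>. real (card {n \<in> A. tseq \<phi> n = \<tau>})) \<in> borel_measurable PH"
    unfolding cnt[symmetric] fr using Jsub by (intro borel_measurable_sum fm) auto
  then show "{\<phi> \<in> space PH. real (card {n \<in> A. tseq \<phi> n = \<tau>}) \<le> real L * (1 / nT) - \<delta> * real L} \<in> sets PH"
    by measurable
qed

text \<open>A shortfall of \<open>\<delta> * L\<close> in each of the \<open>nT\<close> types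
  amounts to the fraction \<open>nT * \<delta>\<close> of all \<open>L\<close> symbols.\<close>

definition bad_phase :: "real \<Rightarrow> phases set" where
  "bad_phase \<delta> = {\<phi> \<in> space PH. real (card (S (tseq \<phi>))) < real L * (1 - nT * \<delta>)}"

lemma bad_phase_sets: "bad_phase \<delta> \<in> sets PH"
proof -
  have "(\<lambda>\<phi>. real (card (S (tseq \<phi>)))) \<in> borel_measurable PH"
    by (rule measurable_by_tseq[where f="\<lambda>x. x"]) auto
  then show ?thesis unfolding bad_phase_def by measurable
qed

text \<open>If every type is frequent enough in the first half and its complement in the second,
  \<open>card_matched_ge\<close> provides enough matches. Otherwise one of \<open>2 * nT\<close>
  rare events occurs, each bounded by \<open>count_tail\<close>.\<close>

lemma bad_phase_prob:
  assumes \<delta>: "0 < \<delta>"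
  shows "measure PH (bad_phase \<delta>) \<le> 2 * nT / (\<delta>\<^sup>2 * real L)"
proof -
  interpret prob_space PH by (rule prob_space_phase)
  let ?E = "\<lambda>A \<tau>. {\<phi> \<in> space PH. real (card {n \<in> A. tseq \<phi> n = \<tau>}) \<le> real L * (1 / nT) - \<delta> * real L}"
  let ?A1 = "{1..L}" and ?A2 = "{L+1..2*L}"
  have A1: "?A1 \<subseteq> {1..2 * L}" "card ?A1 = L" and A2: "?A2 \<subseteq> {1..2 * L}" "card ?A2 = L" by auto
  have "bad_phase \<delta> \<subseteq> (\<Union>\<tau>\<in>Ty. ?E ?A1 \<tau>) \<union> (\<Union>\<tau>\<in>Ty. ?E ?A2 (cp \<tau>))"
  proof
    fix \<phi> assume b: "\<phi> \<in> bad_phase \<delta>"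
    show "\<phi> \<in> (\<Union>\<tau>\<in>Ty. ?E ?A1 \<tau>) \<union> (\<Union>\<tau>\<in>Ty. ?E ?A2 (cp \<tau>))"
    proof (rule ccontr)
      assume n: "\<phi> \<notin> (\<Union>\<tau>\<in>Ty. ?E ?A1 \<tau>) \<union> (\<Union>\<tau>\<in>Ty. ?E ?A2 (cp \<tau>))"
      have "nT * (real L * (1 / nT) - \<delta> * real L) \<le> real (card (S (tseq \<phi>)))"
        by (rule card_matched_ge[OF finite_Ty]) (use n b in \<open>auto simp: uses1_def uses2_def bad_phase_def\<close>)
      moreover have "nT * (real L * (1 / nT) - \<delta> * real L) = real L * (1 - nT * \<delta>)"
        using nT_pos by (simp add: algebra_simps)
      ultimately show False using b by (simp add: bad_phase_def)
    qed
  qed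
  moreover note E1 = count_tail(2)[OF A1 _ \<delta>] and E2 = count_tail(2)[OF A2 cp_Ty \<delta>]
  have U1: "(\<Union>\<tau>\<in>Ty. ?E ?A1 \<tau>) \<in> sets PH" and U2: "(\<Union>\<tau>\<in>Ty. ?E ?A2 (cp \<tau>)) \<in> sets PH"
    by (intro sets.finite_UN finite_Ty E1 E2; assumption)+
  ultimately have "prob (bad_phase \<delta>) \<le> prob ((\<Union>\<tau>\<in>Ty. ?E ?A1 \<tau>) \<union> (\<Union>\<tau>\<in>Ty. ?E ?A2 (cp \<tau>)))"
    by (intro finite_measure_mono sets.Un U1 U2)
  also have "\<dots> \<le> prob (\<Union>\<tau>\<in>Ty. ?E ?A1 \<tau>) + prob (\<Union>\<tau>\<in>Ty. ?E ?A2 (cp \<tau>))"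
    by (rule measure_Un_le[OF U1 U2])
  also have "\<dots> \<le> (\<Sum>\<tau>\<in>Ty. prob (?E ?A1 \<tau>)) + (\<Sum>\<tau>\<in>Ty. prob (?E ?A2 (cp \<tau>)))"
    by (intro add_mono measure_UNION_le finite_Ty E1 E2; assumption)
  also have "\<dots> \<le> (\<Sum>\<tau>\<in>Ty. 1 / (\<delta>\<^sup>2 * real L)) + (\<Sum>\<tau>\<in>Ty. 1 / (\<delta>\<^sup>2 * real L))"
    by (intro add_mono sum_mono count_tail(1)[OF A1 _ \<delta>] count_tail(1)[OF A2 cp_Ty \<delta>])
  finally show ?thesis by (simp add: mult.commute)
qed

text \<open>Outside \<open>bad_phase \<delta>\<close> at least
  \<open>L * (1 - nT * \<delta>)\<close> symbols are matched; this makes a miss unlikely, and each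
  wrong message pays \<open>ln (1 + 2 * SNR) - \<eta>\<close> in the exponent per matched symbol,
  that is per two channel uses.\<close>

lemma error_probA:
  assumes \<delta>: "0 < \<delta>" "nT * \<delta> < 1" and \<eta>S: "\<eta> < ln (1 + 2 * SNR)"
  shows "error_prob K SNR INR N M encA (test_decoder M testA) \<le> 2 * nT / (\<delta>\<^sup>2 * real L) +
    (\<Sum>k<K. 8 * amp^4 * real (K + 2)^5 * m4 / (\<eta>\<^sup>2 * (real L * (1 - nT * \<delta>))) +
       real (M k) * exp (- (ln (1 + 2 * SNR) - \<eta>) * (real L * (1 - nT * \<delta>))))"
proof -
  interpret CSp: prob_space CSA by (rule prob_space_code_space) (rule M)
  interpret PHp: prob_space PH by (rule prob_space_phase)
  let ?W = "Pi\<^sub>E {..<K} (\<lambda>k. {..<M k})"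
  define lm where "lm = real L * (1 - nT * \<delta>)"
  have lm: "0 < lm" using \<delta> L by (simp add: lm_def)
  define b1 where "b1 = 8 * amp^4 * real (K + 2)^5 * m4 / (\<eta>\<^sup>2 * lm)"
  define b2 where "b2 = exp (- (ln (1 + 2 * SNR) - \<eta>) * lm)"
  have b0: "0 \<le> b1" "0 \<le> b2" using lm amp_nonneg m4_nonneg by (auto simp: b1_def b2_def)
  let ?m = "\<lambda>k w. {x. TS k (w k) w x \<le> thr x}" and ?a = "\<lambda>k v w. {x. thr x \<le> TS k v w x}"
  define f :: "msgs \<Rightarrow> ((nat \<times> nat \<times> nat \<Rightarrow> complex) \<times> phases) \<times> noises \<Rightarrow> ennreal"
    where "f w x = (\<Sum>k<K. indicator (?m k w) x + (\<Sum>v\<in>{..<M k} - {w k}. indicator (?a k v w) x))" for w x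
  have mi: "indicator (?m k w) \<in> borel_measurable ((CB \<Otimes>\<^sub>M PH) \<Otimes>\<^sub>M NZ)" if k: "k < K" and w: "w \<in> ?W" for k w
  proof -
    have "w k < M k" using w k by auto
    note [measurable] = measurable_TS[OF k this w] measurable_thr
    have "(\<lambda>x. if TS k (w k) w x \<le> thr x then 1 else 0 :: ennreal) \<in> borel_measurable ((CB \<Otimes>\<^sub>M PH) \<Otimes>\<^sub>M NZ)" by measurable
    then show ?thesis by (simp add: indicator_def[abs_def])
  qed
  have ai: "indicator (?a k v w) \<in> borel_measurable ((CB \<Otimes>\<^sub>M PH) \<Otimes>\<^sub>M NZ)" if k: "k < K" and v: "v < M k" and w: "w \<in> ?W" for k v w
  proof -
    note [measurable] = measurable_TS[OF k v w] measurable_thr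
    have "(\<lambda>x. if thr x \<le> TS k v w x then 1 else 0 :: ennreal) \<in> borel_measurable ((CB \<Otimes>\<^sub>M PH) \<Otimes>\<^sub>M NZ)" by measurable
    then show ?thesis by (simp add: indicator_def[abs_def])
  qed
  have fm: "f w \<in> borel_measurable ((CB \<Otimes>\<^sub>M PH) \<Otimes>\<^sub>M NZ)" if w: "w \<in> ?W" for w
    unfolding f_def by (intro borel_measurable_sum borel_measurable_add mi ai w) auto
  \<comment> \<open>The union bound is capped at 1, so that bad phases cost no more than their
    probability.\<close>
  define g where "g w x = min 1 (f w x)" for w x
  have gm: "g w \<in> borel_measurable ((CB \<Otimes>\<^sub>M PH) \<Otimes>\<^sub>M NZ)" if w: "w \<in> ?W" for w
    unfolding g_def using fm[OF w] by measurable
  have sub: "indicator (error_event K SNR INR N M encA (test_decoder M testA)) \<omega> \<le> g (fst \<omega>) (proj \<omega>)" if \<omega>: "\<omega> \<in> space CSA" for \<omega>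
  proof (cases "\<omega> \<in> error_event K SNR INR N M encA (test_decoder M testA)")
    case True
    let ?q = "\<lambda>k v. testA k v (rx_block K SNR INR N encA \<omega> k) (fst (snd \<omega>))"
    obtain k where k: "k < K" and or: "\<not> ?q k (fst \<omega> k) \<or> (\<exists>v<M k. v \<noteq> fst \<omega> k \<and> ?q k v)"
      using subsetD[OF test_decoder_error_subset True] by blast
    let ?w = "fst \<omega>" and ?x = "proj \<omega>"
    have "1 \<le> indicator (?m k ?w) ?x + (\<Sum>v\<in>{..<M k} - {?w k}. indicator (?a k v ?w) ?x :: ennreal)"
    proof (cases "?q k (fst \<omega> k)")
      case True
      then obtain v where v: "v \<in> {..<M k} - {?w k}" "?q k v" using or by auto
      then have "1 = (indicator (?a k v ?w) ?x :: ennreal)" using testA_iff[OF \<omega> k, of v] by simp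
      also have "\<dots> \<le> (\<Sum>v\<in>{..<M k} - {?w k}. indicator (?a k v ?w) ?x)"
        using v by (intro member_le_sum) auto
      finally show ?thesis by (simp add: add_increasing)
    next
      case False
      then have "(indicator (?m k ?w) ?x :: ennreal) = 1" using testA_iff[OF \<omega> k, of "?w k"] by simp
      then show ?thesis by simp
    qed
    also have "\<dots> \<le> f ?w ?x" unfolding f_def using k by (intro member_le_sum[of k "{..<K}" "\<lambda>k. indicator (?m k ?w) ?x + (\<Sum>v\<in>{..<M k} - {?w k}. indicator (?a k v ?w) ?x)"]) auto
    finally show ?thesis using True by (simp add: g_def)
  qed simp
  have "emeasure CSA (error_event K SNR INR N M encA (test_decoder M testA)) = (\<integral>\<^sup>+\<omega>. indicator (error_event K SNR INR N M encA (test_decoder M testA)) \<omega> \<partial>CSA)"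
    using is_codeD(5)[OF is_codeA] by simp
  also have "\<dots> \<le> (\<integral>\<^sup>+\<omega>. g (fst \<omega>) (proj \<omega>) \<partial>CSA)" by (rule nn_integral_mono[OF sub])
  also have "\<dots> = (\<integral>\<^sup>+w. \<integral>\<^sup>+\<phi>. \<integral>\<^sup>+C. \<integral>\<^sup>+z. g w ((C, \<phi>), z) \<partial>NZ \<partial>CB \<partial>PH \<partial>msg_space K M)"
    by (rule nn_integral_proj[OF gm])
  also have "\<dots> \<le> (\<integral>\<^sup>+w. \<integral>\<^sup>+\<phi>. indicator (bad_phase \<delta>) \<phi> + ennreal (\<Sum>k<K. b1 + real (M k) * b2) \<partial>PH \<partial>msg_space K M)"
  proof (rule nn_integral_mono, rule nn_integral_mono)
    fix w \<phi> assume "w \<in> space (msg_space K M)" and \<phi>: "\<phi> \<in> space PH"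
    then have w: "w \<in> ?W" by (simp add: space_PiM space_uniform_count_measure)
    let ?I = "\<lambda>u. \<integral>\<^sup>+C. \<integral>\<^sup>+z. u ((C, \<phi>), z) \<partial>NZ \<partial>CB"
    interpret NZp: prob_space NZ by (rule prob_space_noise)
    interpret CBp: prob_space CB by (rule prob_space_noise)
    have sec: "(\<lambda>q. u ((fst q, \<phi>), snd q)) \<in> borel_measurable (CB \<Otimes>\<^sub>M NZ)" if "u \<in> borel_measurable ((CB \<Otimes>\<^sub>M PH) \<Otimes>\<^sub>M NZ)" for u :: "_ \<Rightarrow> ennreal"
      by (rule measurable_compose[OF _ that]) (use \<phi> in measurable)
    have I2: "?I u = (\<integral>\<^sup>+q. u ((fst q, \<phi>), snd q) \<partial>(CB \<Otimes>\<^sub>M NZ))" if "u \<in> borel_measurable ((CB \<Otimes>\<^sub>M PH) \<Otimes>\<^sub>M NZ)" for u :: "_ \<Rightarrow> ennreal"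
      using NZp.nn_integral_fst[OF sec[OF that]] by simp
    show "?I (g w) \<le> indicator (bad_phase \<delta>) \<phi> + ennreal (\<Sum>k<K. b1 + real (M k) * b2)"
    proof (cases "\<phi> \<in> bad_phase \<delta>")
      case True
      have "?I (g w) \<le> (\<integral>\<^sup>+C. \<integral>\<^sup>+z. 1 \<partial>NZ \<partial>CB)" by (intro nn_integral_mono) (auto simp: g_def)
      also have "\<dots> = 1" by (simp add: NZp.emeasure_space_1 CBp.emeasure_space_1)
      finally show ?thesis using True by (simp add: add_increasing2)
    next
      case False
      let ?n = "card (S (tseq \<phi>))"
      have n: "lm \<le> real ?n" using False \<phi> by (simp add: bad_phase_def lm_def not_less)
      then have ne: "S (tseq \<phi>) \<noteq> {}" using lm by auto
      have m1: "?I (indicator (?m k w)) \<le> ennreal b1" if k: "k < K" for k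
      proof -
        have "?I (indicator (?m k w)) \<le> ennreal (8 * amp^4 * real (K + 2)^5 * m4 / (\<eta>\<^sup>2 * real ?n))"
          by (rule missed_le[OF k w \<phi> ne])
        also have "\<dots> \<le> ennreal b1"
          unfolding b1_def using n lm \<eta> amp_nonneg m4_nonneg by (intro ennreal_leI divide_left_mono mult_left_mono) auto
        finally show ?thesis .
      qed
      have a1: "?I (indicator (?a k v w)) \<le> ennreal b2" if k: "k < K" and v: "v < M k" "v \<noteq> w k" for k v
      proof -
        have "exp (\<eta> * real ?n) * (1 / (1 + 2 * SNR)) ^ ?n = exp (- (ln (1 + 2 * SNR) - \<eta>) * real ?n)"
        proof -
          have "1 / (1 + 2 * SNR) = exp (- ln (1 + 2 * SNR))" using SNR by (simp add: exp_minus inverse_eq_divide)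
          then have "(1 / (1 + 2 * SNR)) ^ ?n = exp (real ?n * - ln (1 + 2 * SNR))" by (simp only: exp_of_nat_mult)
          then show ?thesis by (simp add: mult_exp_exp algebra_simps)
        qed
        also have "\<dots> \<le> b2" unfolding b2_def using n \<eta>S by (simp add: mult_left_mono)
        finally show ?thesis using false_alarm_le[OF k v(1) w v(2) \<phi>] by (meson ennreal_leI order_trans)
      qed
      have "?I (g w) \<le> ?I (f w)" by (intro nn_integral_mono) (auto simp: g_def)
      also have "\<dots> = (\<Sum>k<K. ?I (indicator (?m k w)) + (\<Sum>v\<in>{..<M k} - {w k}. ?I (indicator (?a k v w))))"
      proof -
        have "?I (f w) = (\<integral>\<^sup>+q. (\<Sum>k<K. indicator (?m k w) ((fst q, \<phi>), snd q) + (\<Sum>v\<in>{..<M k} - {w k}. indicator (?a k v w) ((fst q, \<phi>), snd q))) \<partial>(CB \<Otimes>\<^sub>M NZ))"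
          using I2[OF fm[OF w]] by (simp add: f_def)
        also have "\<dots> = (\<Sum>k<K. (\<integral>\<^sup>+q. indicator (?m k w) ((fst q, \<phi>), snd q) \<partial>(CB \<Otimes>\<^sub>M NZ)) + (\<Sum>v\<in>{..<M k} - {w k}. \<integral>\<^sup>+q. indicator (?a k v w) ((fst q, \<phi>), snd q) \<partial>(CB \<Otimes>\<^sub>M NZ)))"
          using sec[OF mi[OF _ w]] sec[OF ai[OF _ _ w]]
          by (subst nn_integral_sum, force, intro sum.cong refl, subst nn_integral_add, force, force, subst nn_integral_sum) auto
        finally show ?thesis using I2[OF mi[OF _ w]] I2[OF ai[OF _ _ w]] by simp
      qed
      also have "\<dots> \<le> (\<Sum>k<K. ennreal b1 + (\<Sum>v\<in>{..<M k} - {w k}. ennreal b2))"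
        using m1 a1 by (intro sum_mono add_mono) auto
      also have "\<dots> \<le> (\<Sum>k<K. ennreal (b1 + real (M k) * b2))"
      proof (intro sum_mono)
        fix k
        have "(\<Sum>v\<in>{..<M k} - {w k}. ennreal b2) = ennreal (real (card ({..<M k} - {w k})) * b2)"
          using b0 by (simp add: ennreal_mult ennreal_of_nat_eq_real_of_nat)
        also have "\<dots> \<le> ennreal (real (M k) * b2)"
          using b0 card_Diff1_le[of "{..<M k}" "w k"] by (intro ennreal_leI mult_right_mono) auto
        finally show "ennreal b1 + (\<Sum>v\<in>{..<M k} - {w k}. ennreal b2) \<le> ennreal (b1 + real (M k) * b2)"
          using b0 by (simp add: add_left_mono)
      qed
      also have "\<dots> = ennreal (\<Sum>k<K. b1 + real (M k) * b2)" using b0 by (intro sum_ennreal) auto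
      finally show ?thesis by (simp add: add_increasing)
    qed
  qed
  also have "\<dots> = emeasure PH (bad_phase \<delta>) + ennreal (\<Sum>k<K. b1 + real (M k) * b2)"
    using prob_space.emeasure_space_1[OF prob_space_msg[OF M]] bad_phase_sets[of \<delta>]
    by (subst nn_integral_add) (auto simp: PHp.emeasure_space_1)
  also have "\<dots> = ennreal (measure PH (bad_phase \<delta>) + (\<Sum>k<K. b1 + real (M k) * b2))"
    using b0 by (simp add: PHp.emeasure_eq_measure sum_nonneg)
  finally have "ennreal (error_prob K SNR INR N M encA (test_decoder M testA)) \<le> ennreal (measure PH (bad_phase \<delta>) + (\<Sum>k<K. b1 + real (M k) * b2))"
    unfolding error_prob_def CSp.emeasure_eq_measure .
  then have "error_prob K SNR INR N M encA (test_decoder M testA) \<le> measure PH (bad_phase \<delta>) + (\<Sum>k<K. b1 + real (M k) * b2)"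
    by (rule ennreal_le_iff[THEN iffD1, rotated]) (use b0 in \<open>auto intro!: add_nonneg_nonneg sum_nonneg\<close>)
  then show ?thesis using bad_phase_prob[OF \<delta>(1)] unfolding b1_def b2_def lm_def by linarith
qed

end

section \<open>Convergence of the normalised sum capacity\<close>

lemma achievable_symmetric:
  assumes SNR: "0 < SNR" and K: "0 < K" and R: "0 \<le> R" "2 * R * ln 2 < ln (1 + 2 * SNR)"
  shows "achievable K SNR INR (\<lambda>_. R)"
  unfolding achievable_def
proof (intro conjI allI impI R)
  fix e :: real assume e: "0 < e"
  define l where "l = ln (1 + 2 * SNR)"
  \<comment> \<open>\<open>\<rho>\<close> is the rate in nats per pair of channel uses. The slack
    \<open>l - \<rho>\<close> is divided: a quarter goes to the threshold through
    \<open>\<eta>\<close>, a quarter to the unmatched fraction \<open>\<gamma>\<close>, and half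
    remains as the exponent \<open>\<kappa>\<close>.\<close>
  define \<rho> where "\<rho> = 2 * R * ln 2"
  have \<rho>: "0 \<le> \<rho>" "\<rho> < l" using R by (auto simp: \<rho>_def l_def)
  define \<eta> where "\<eta> = (l - \<rho>) / 4"
  define \<gamma> where "\<gamma> = (l - \<rho>) / (4 * l)"
  define \<kappa> where "\<kappa> = (l - \<rho>) / 2"
  have pos: "0 < \<eta>" "\<eta> < l" "0 < \<gamma>" "\<gamma> < 1" "0 < \<kappa>"
    using \<rho> by (auto simp: \<eta>_def \<gamma>_def \<kappa>_def field_simps)
  have expo: "\<rho> + \<kappa> \<le> (l - \<eta>) * (1 - \<gamma>)"
  proof -
    have "(l - \<eta>) * \<gamma> \<le> l * \<gamma>" using pos by (intro mult_right_mono) auto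
    also have "\<dots> = (l - \<rho>) / 4" using \<rho> by (simp add: \<gamma>_def)
    finally show ?thesis by (simp add: \<eta>_def \<kappa>_def algebra_simps) (simp add: field_simps)
  qed
  define T where "T = (\<Sum>p\<in>{..<K} \<times> {..<K}. \<bar>INR p\<bar>)"
  have T0: "0 \<le> T" by (simp add: T_def sum_nonneg)
  \<comment> \<open>Large enough that \<open>T * (4 * pi)\<^sup>2 / h\<close> is at most
    \<open>\<eta>\<close>. The summand 1 ensures that \<open>h\<close> is at least 1, so that
    \<open>h\<^sup>2\<close> may be replaced by \<open>h\<close> in the denominator.\<close>
  define h where "h = nat \<lceil>1 + T * (4 * pi)\<^sup>2 / \<eta>\<rceil>"
  have hr: "1 + T * (4 * pi)\<^sup>2 / \<eta> \<le> real h" unfolding h_def by linarith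
  have TT: "0 \<le> T * (4 * pi)\<^sup>2 / \<eta>" using T0 pos by simp
  have h1: "1 \<le> real h" using hr TT by linarith
  then have h: "0 < h" by simp
  have small: "(\<Sum>t<K. \<bar>INR (k, t)\<bar>) * (4 * pi / real h)\<^sup>2 \<le> \<eta>" if "k < K" for k
  proof -
    have "(\<Sum>t<K. \<bar>INR (k, t)\<bar>) = (\<Sum>p\<in>{k} \<times> {..<K}. \<bar>INR p\<bar>)"
      by (rule sum.reindex_bij_witness[of _ snd "\<lambda>t. (k, t)"]) auto
    also have "\<dots> \<le> T" unfolding T_def using that by (intro sum_mono2) auto
    finally have "(\<Sum>t<K. \<bar>INR (k, t)\<bar>) * (4 * pi / real h)\<^sup>2 \<le> T * (4 * pi / real h)\<^sup>2" by (intro mult_right_mono) auto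
    also have "\<dots> = T * (4 * pi)\<^sup>2 / (real h)\<^sup>2" by (simp add: power_divide)
    also have "\<dots> \<le> T * (4 * pi)\<^sup>2 / real h"
      using T0 h1 by (intro divide_left_mono) (auto simp: power2_eq_square mult_le_cancel_left1)
    also have "\<dots> \<le> \<eta>"
    proof -
      have "T * (4 * pi)\<^sup>2 / \<eta> \<le> real h" using hr by linarith
      then have "T * (4 * pi)\<^sup>2 \<le> \<eta> * real h" using pos by (simp add: pos_divide_le_eq mult.commute)
      then show ?thesis using h1 by (simp add: pos_divide_le_eq)
    qed
    finally show ?thesis .
  qed
  \<comment> \<open>The number of types and the amplitude bound do not depend on \<open>L\<close>,
    so they can be fixed before the limit in \<open>L\<close> is taken.\<close>
  define nT where "nT = real (card (ergodic_code.Ty K h))"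
  define \<delta> where "\<delta> = \<gamma> / nT"
  define b where "b = 8 * ergodic_code.amp K SNR INR ^ 4 * real (K + 2) ^ 5 * m4"
  define F where "F L = 2 * nT / (\<delta>\<^sup>2 * L) + real K * (b / (\<eta>\<^sup>2 * (L * (1 - \<gamma>))) + 2 * exp \<rho> * exp (- \<kappa> * L))" for L :: real
  have "(F \<longlongrightarrow> 2 * nT / \<delta>\<^sup>2 * 0 + real K * (b / (\<eta>\<^sup>2 * (1 - \<gamma>)) * 0 + 2 * exp \<rho> * 0)) at_top"
  proof -
    have i: "((\<lambda>L::real. 1 / L) \<longlongrightarrow> 0) at_top"
      using tendsto_inverse_0_at_top[OF filterlim_ident] by (simp add: inverse_eq_divide)
    have x: "((\<lambda>L::real. exp (- \<kappa> * L)) \<longlongrightarrow> 0) at_top"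
    proof -
      have "filterlim (\<lambda>L::real. - \<kappa> * L) at_bot at_top"
        using filterlim_tendsto_neg_mult_at_bot[OF tendsto_const[of "- \<kappa>"] _ filterlim_ident] pos by simp
      then show ?thesis by (rule filterlim_compose[OF exp_at_bot])
    qed
    have "((\<lambda>L. 2 * nT / \<delta>\<^sup>2 * (1 / L) + real K * (b / (\<eta>\<^sup>2 * (1 - \<gamma>)) * (1 / L) + 2 * exp \<rho> * exp (- \<kappa> * L))) \<longlongrightarrow> 2 * nT / \<delta>\<^sup>2 * 0 + real K * (b / (\<eta>\<^sup>2 * (1 - \<gamma>)) * 0 + 2 * exp \<rho> * 0)) at_top"
      by (intro tendsto_intros i x)
    then show ?thesis by (simp add: F_def[abs_def] mult.commute mult.assoc mult.left_commute)
  qed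
  then have "(F \<longlongrightarrow> 0) at_top" by simp
  then have "eventually (\<lambda>L. F L < e) at_top" using e by (rule order_tendstoD(2))
  then obtain L0 where L0: "\<And>L. L \<ge> L0 \<Longrightarrow> F L < e" by (auto simp: eventually_at_top_linorder)
  show "\<exists>N0. \<forall>N\<ge>N0. \<exists>enc dec. is_code K SNR INR N (msg_sizes N (\<lambda>_. R)) enc dec \<and> error_prob K SNR INR N (msg_sizes N (\<lambda>_. R)) enc dec \<le> e"
  proof (intro exI[of _ "2 * nat \<lceil>L0\<rceil> + 3"] allI impI)
    fix N assume N: "2 * nat \<lceil>L0\<rceil> + 3 \<le> N"
    \<comment> \<open>Use 0 is reserved for the seed; the rest is halved, which leaves at most one
      idle use at the end.\<close>
    define L where "L = (N - 1) div 2"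
    have L: "0 < L" "2 * L < N" "N \<le> 2 * L + 2" "nat \<lceil>L0\<rceil> \<le> L" using N unfolding L_def by linarith+
    have LL0: "L0 \<le> real L" using L(4) by linarith
    let ?M = "msg_sizes N (\<lambda>_. R)"
    have Mpos: "0 < ?M k" for k unfolding msg_sizes_def using powr_gt_zero[of 2 "real N * R"] by linarith
    \<comment> \<open>The factor 2 absorbs the rounding up in \<open>msg_sizes\<close>, and
      \<open>exp \<rho>\<close> absorbs the at most two uses by which \<open>N\<close> exceeds
      \<open>2 * L\<close>.\<close>
    have Mle: "real (?M k) \<le> 2 * exp \<rho> * exp (\<rho> * real L)" for k
    proof -
      have "1 \<le> 2 powr (real N * R)" using R by (intro ge_one_powr_ge_zero) auto
      moreover have "real (?M k) \<le> 2 powr (real N * R) + 1"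
        unfolding msg_sizes_def using powr_gt_zero[of 2 "real N * R"] by linarith
      ultimately have "real (?M k) \<le> 2 * 2 powr (real N * R)" by linarith
      also have "\<dots> \<le> 2 * 2 powr ((2 * real L + 2) * R)"
      proof -
        have "real N \<le> 2 * real L + 2" using L(3) by linarith
        then show ?thesis using R by (intro mult_left_mono powr_mono mult_right_mono) auto
      qed
      also have "2 powr ((2 * real L + 2) * R) = exp (\<rho> + \<rho> * real L)"
        by (simp add: powr_def \<rho>_def algebra_simps)
      finally show ?thesis by (simp add: exp_add)
    qed
    let ?CI = "{(k, v, i). k < K \<and> v < ?M k \<and> i \<in> {1..L}}"
    have "?CI \<subseteq> (SIGMA k:{..<K}. {..<?M k} \<times> {1..L})" by auto
    then have "finite ?CI" by (rule finite_subset) auto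
    then have "simulable (PiM ?CI (\<lambda>_. cgauss))" by (intro simulable_PiM simulable_cgauss)
    then obtain g where g: "g \<in> measurable phase_dist (PiM ?CI (\<lambda>_. cgauss))" "distr phase_dist (PiM ?CI (\<lambda>_. cgauss)) g = PiM ?CI (\<lambda>_. cgauss)"
      unfolding simulable_def by blast
    interpret E: ergodic_code K SNR INR N L h ?M g \<eta>
      using SNR K Mpos L h pos g small by unfold_locales auto
    have nTeq: "nT = real (card E.Ty)" and beq: "b = 8 * E.amp ^ 4 * real (K + 2) ^ 5 * m4"
      by (simp_all add: nT_def b_def)
    have nT: "0 < nT" using E.nT_pos by (simp add: nTeq)
    have \<delta>: "0 < \<delta>" "nT * \<delta> = \<gamma>" using nT pos by (auto simp: \<delta>_def)
    have "error_prob K SNR INR N ?M E.encA (test_decoder ?M E.testA) \<le> 2 * nT / (\<delta>\<^sup>2 * real L) +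
      (\<Sum>k<K. b / (\<eta>\<^sup>2 * (real L * (1 - \<gamma>))) + real (?M k) * exp (- (l - \<eta>) * (real L * (1 - \<gamma>))))"
      using E.error_probA[of \<delta>] \<delta> pos unfolding nTeq[symmetric] beq[symmetric] l_def[symmetric] by simp
    also have "\<dots> \<le> 2 * nT / (\<delta>\<^sup>2 * real L) + (\<Sum>k<K. b / (\<eta>\<^sup>2 * (real L * (1 - \<gamma>))) + 2 * exp \<rho> * exp (- \<kappa> * real L))"
    proof (intro add_left_mono sum_mono)
      fix k
      have "(\<rho> + \<kappa>) * real L \<le> (l - \<eta>) * (1 - \<gamma>) * real L" using expo by (intro mult_right_mono) auto
      then have "- (l - \<eta>) * (real L * (1 - \<gamma>)) \<le> - (\<rho> + \<kappa>) * real L" by (simp add: algebra_simps)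
      then have "real (?M k) * exp (- (l - \<eta>) * (real L * (1 - \<gamma>))) \<le> (2 * exp \<rho> * exp (\<rho> * real L)) * exp (- (\<rho> + \<kappa>) * real L)"
        using Mle[of k] by (intro mult_mono) auto
      also have "\<dots> = 2 * exp \<rho> * exp (- \<kappa> * real L)" by (simp add: mult_exp_exp algebra_simps)
      finally show "real (?M k) * exp (- (l - \<eta>) * (real L * (1 - \<gamma>))) \<le> 2 * exp \<rho> * exp (- \<kappa> * real L)" .
    qed
    also have "\<dots> = F (real L)" by (simp add: F_def)
    also have "\<dots> < e" by (rule L0[OF LL0])
    finally show "\<exists>enc dec. is_code K SNR INR N ?M enc dec \<and> error_prob K SNR INR N ?M enc dec \<le> e"
      using E.is_codeA by (intro exI conjI) auto
  qed
qed

lemma sum_rates_bdd: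
  assumes "0 < SNR"
  shows "bdd_above {\<Sum>k<K. R k | R. achievable K SNR INR R}"
proof (rule bdd_aboveI)
  fix x assume "x \<in> {\<Sum>k<K. R k | R. achievable K SNR INR R}"
  then obtain R where R: "achievable K SNR INR R" "x = (\<Sum>k<K. R k)" by auto
  show "x \<le> (\<Sum>k<K. rate_bound SNR)"
    unfolding R(2) using achievable_le_rate_bound[OF assms R(1)] by (intro sum_mono) auto
qed

lemma sum_capacity_ge:
  assumes SNR: "0 < SNR" and K: "0 < K"
  shows "real K * (1/2 * log 2 (1 + 2 * SNR)) \<le> sum_capacity K SNR INR"
proof (rule field_le_epsilon)
  fix e :: real assume e: "0 < e"
  define C where "C = 1/2 * log 2 (1 + 2 * SNR)"
  have C: "0 < C" using SNR by (simp add: C_def)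
  have l2: "0 < ln (2::real)" by simp
  define R where "R = max 0 (C - e / real K)"
  have RC: "0 \<le> R" "R < C" using C e K by (auto simp: R_def)
  have "2 * R * ln 2 < 2 * C * ln 2" using RC l2 by simp
  also have "2 * C * ln 2 = ln (1 + 2 * SNR)" by (simp add: C_def log_def)
  finally have "achievable K SNR INR (\<lambda>_. R)" by (intro achievable_symmetric SNR K RC)
  then have "(\<Sum>k<K. R) \<in> {\<Sum>k<K. R k | R. achievable K SNR INR R}"
    by (intro CollectI exI[of _ "\<lambda>_. R"] conjI refl)
  then have "(\<Sum>k<K. R) \<le> sum_capacity K SNR INR"
    unfolding sum_capacity_def by (rule cSup_upper[OF _ sum_rates_bdd[OF SNR]])
  moreover have "real K * C - e \<le> (\<Sum>k<K. R)"
  proof -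
    have "real K * (C - e / real K) \<le> real K * R" by (intro mult_left_mono) (auto simp: R_def)
    then show ?thesis using K by (simp add: algebra_simps)
  qed
  ultimately show "real K * C \<le> sum_capacity K SNR INR + e" by linarith
qed

section \<open>Upper bound from matchings of bottleneck links\<close>

lemma bottleneck_pair:
  assumes SNR: "0 < SNR" and R: "achievable K SNR INR R" and rt: "r < K" "t < K" "r \<noteq> t" and b: "bottleneck SNR \<epsilon> (INR (r, t))"
  shows "R r + R t \<le> log 2 (1 + 2 * SNR) + \<epsilon>"
proof -
  let ?G = "\<lambda>p. if p = (0, 1) then INR (r, t) else 0" and ?R = "\<lambda>c::nat. if c = 0 then R r else R t"
  have "(\<Sum>c<2. ?R c) \<in> {\<Sum>k<2. R k | R. achievable 2 SNR ?G R}" using achievable_Z[OF R rt] by blast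
  then have "(\<Sum>c<2. ?R c) \<le> C_Z SNR (INR (r, t))"
    unfolding C_Z_def sum_capacity_def by (rule cSup_upper[OF _ sum_rates_bdd[OF SNR]])
  moreover have "(\<Sum>c<2. ?R c) = R r + R t" by (simp add: eval_nat_numeral)
  ultimately show ?thesis using b by (simp add: bottleneck_def)
qed

text \<open>\<open>U\<close> is the set of vertices left over by a maximal matching.\<close>
lemma matching_sum_le:
  fixes R :: "'v \<Rightarrow> real"
  assumes "finite V" and B: "0 \<le> B" and E: "\<And>r t. r \<in> V \<Longrightarrow> t \<in> V \<Longrightarrow> r \<noteq> t \<Longrightarrow> E r t \<Longrightarrow> R r + R t \<le> B"
  shows "\<exists>U\<subseteq>V. (\<forall>r\<in>U. \<forall>t\<in>U. r \<noteq> t \<longrightarrow> \<not> E r t) \<and> (\<Sum>v\<in>V - U. R v) \<le> real (card V) / 2 * B"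
  using assms(1) E
proof (induction V rule: finite_psubset_induct)
  case (psubset V)
  show ?case
  proof (cases "\<forall>r\<in>V. \<forall>t\<in>V. r \<noteq> t \<longrightarrow> \<not> E r t")
    case True
    then show ?thesis using B by (intro exI[of _ V]) auto
  next
    case False
    then obtain r t where rt: "r \<in> V" "t \<in> V" "r \<noteq> t" "E r t" by blast
    let ?V = "V - {r, t}"
    obtain U where U: "U \<subseteq> ?V" "\<forall>r\<in>U. \<forall>t\<in>U. r \<noteq> t \<longrightarrow> \<not> E r t" "(\<Sum>v\<in>?V - U. R v) \<le> real (card ?V) / 2 * B"
      using psubset.IH[of ?V] psubset.prems rt by blast
    have c: "real (card ?V) = real (card V) - 2"
    proof -
      have "card {r, t} \<le> card V" using rt psubset.hyps by (intro card_mono) auto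
      then show ?thesis using rt psubset.hyps by (simp add: card_Diff_subset of_nat_diff)
    qed
    have "V - U = {r, t} \<union> (?V - U)" using U rt by auto
    then have "(\<Sum>v\<in>V - U. R v) = (\<Sum>v\<in>{r, t}. R v) + (\<Sum>v\<in>?V - U. R v)"
      using psubset.hyps by (simp only:) (intro sum.union_disjoint, auto)
    also have "\<dots> \<le> B + real (card ?V) / 2 * B"
      using psubset.prems[OF rt] U(3) rt by simp
    also have "\<dots> = real (card V) / 2 * B" unfolding c by (simp add: field_simps)
    finally show ?thesis using U by (intro exI[of _ U]) auto
  qed
qed

text \<open>The two directions between a pair of users are separate independent links, so the event
  constrains \<open>card U * (card U - 1)\<close> coordinates, each independently avoiding
  \<open>B\<close>.\<close>

lemma independent_set_prob:
  assumes \<mu>: "prob_space \<mu>" and B: "B \<in> sets \<mu>" and U: "U \<subseteq> {..<K}"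
  defines "A \<equiv> {G \<in> space (INR_dist K \<mu>). \<forall>r\<in>U. \<forall>t\<in>U. r \<noteq> t \<longrightarrow> G (r, t) \<notin> B}"
  shows "A \<in> sets (INR_dist K \<mu>)" and "measure (INR_dist K \<mu>) A = (1 - measure \<mu> B) ^ (card U * (card U - 1))"
proof -
  interpret \<mu>: prob_space \<mu> by (rule \<mu>)
  let ?J = "{(r, t). r \<in> U \<and> t \<in> U \<and> r \<noteq> t}"
  have fU: "finite U" using U finite_subset by blast
  have "?J = U \<times> U - (\<lambda>u. (u, u)) ` U" by auto
  moreover have "card ((\<lambda>u. (u, u)) ` U) = card U" by (intro card_image) (auto simp: inj_on_def)
  ultimately have cJ: "card ?J = card U * (card U - 1)"
    using fU by (simp add: card_Diff_subset card_cartesian_product diff_mult_distrib2 image_subset_iff)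
  have J: "finite ?J" "?J \<subseteq> offdiag K"
    using fU U by (auto simp: offdiag_def intro: finite_subset[of _ "U \<times> U"])
  have eq: "A = prod_emb (offdiag K) (\<lambda>_. \<mu>) ?J (Pi\<^sub>E ?J (\<lambda>_. space \<mu> - B))"
    using J(2) by (auto simp: A_def INR_dist_def prod_emb_iff space_PiM PiE_iff subset_eq)
  show "A \<in> sets (INR_dist K \<mu>)"
    unfolding eq INR_dist_def using J B by (intro sets_PiM_I) auto
  have "emeasure (INR_dist K \<mu>) A = (\<Prod>j\<in>?J. emeasure \<mu> (space \<mu> - B))"
    unfolding eq INR_dist_def using J B \<mu> by (intro emeasure_PiM_emb) auto
  also have "\<dots> = ennreal ((1 - measure \<mu> B) ^ (card U * (card U - 1)))"
    using B by (simp add: \<mu>.emeasure_eq_measure \<mu>.prob_compl cJ ennreal_power)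
  finally show "measure (INR_dist K \<mu>) A = (1 - measure \<mu> B) ^ (card U * (card U - 1))"
    by (intro measure_eq_emeasure_eq_ennreal) simp_all
qed

lemma sum_capacity_le:
  assumes SNR: "0 < SNR" and K: "0 < K" and \<epsilon>: "0 < \<epsilon>" and B: "\<And>a. a \<in> B \<Longrightarrow> bottleneck SNR \<epsilon> a"
    and indep: "\<And>U. U \<subseteq> {..<K} \<Longrightarrow> (\<forall>r\<in>U. \<forall>t\<in>U. r \<noteq> t \<longrightarrow> INR (r, t) \<notin> B) \<Longrightarrow> real (card U) \<le> \<zeta> * real K"
  shows "sum_capacity K SNR INR \<le> real K * (1/2 * (log 2 (1 + 2 * SNR) + \<epsilon>) + \<zeta> * rate_bound SNR)"
  unfolding sum_capacity_def
proof (rule cSup_least)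
  have "achievable K SNR INR (\<lambda>_. 0)" using SNR by (intro achievable_symmetric SNR K) auto
  then show "{\<Sum>k<K. R k | R. achievable K SNR INR R} \<noteq> {}" by blast
  fix x assume "x \<in> {\<Sum>k<K. R k | R. achievable K SNR INR R}"
  then obtain R where R: "achievable K SNR INR R" and x: "x = (\<Sum>k<K. R k)" by auto
  let ?b = "log 2 (1 + 2 * SNR) + \<epsilon>"
  have b: "0 \<le> ?b" using SNR \<epsilon> by (simp add: add_nonneg_nonneg)
  have "1 \<le> exp (4 * SNR)" using SNR by simp
  then have "1 \<le> 2 * exp (4 * SNR)" by linarith
  then have rb: "0 \<le> rate_bound SNR" by (simp add: rate_bound_def)
  obtain U where U: "U \<subseteq> {..<K}" "\<forall>r\<in>U. \<forall>t\<in>U. r \<noteq> t \<longrightarrow> INR (r, t) \<notin> B"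
    and le: "(\<Sum>v\<in>{..<K} - U. R v) \<le> real (card {..<K}) / 2 * ?b"
    using matching_sum_le[OF finite_lessThan b, of K "\<lambda>r t. INR (r, t) \<in> B" R] bottleneck_pair[OF SNR R _ _ _ B] by auto
  have "x = (\<Sum>v\<in>{..<K} - U. R v) + (\<Sum>v\<in>U. R v)" unfolding x using U(1) by (intro sum.subset_diff) auto
  also have "(\<Sum>v\<in>U. R v) \<le> (\<Sum>v\<in>U. rate_bound SNR)"
    using U(1) achievable_le_rate_bound[OF SNR R] by (intro sum_mono) auto
  also have "(\<Sum>v\<in>U. rate_bound SNR) \<le> \<zeta> * real K * rate_bound SNR"
    using indep[OF U] rb by (simp add: mult_right_mono)
  also note le
  finally show "x \<le> real K * (1/2 * ?b + \<zeta> * rate_bound SNR)" by (simp add: algebra_simps)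
qed

lemma outer_prob_le: "A \<subseteq> B \<Longrightarrow> B \<in> sets M \<Longrightarrow> outer_prob M A \<le> measure M B"
  unfolding outer_prob_def by (rule cINF_lower) (auto intro!: bdd_belowI[of _ 0])

lemma outer_prob_nonneg: "A \<subseteq> space M \<Longrightarrow> 0 \<le> outer_prob M A"
  unfolding outer_prob_def by (rule cINF_greatest) auto

theorem theorem5:
  fixes SNR :: real and \<mu> :: "real measure"
  assumes "0 < SNR"
    and "prob_space \<mu>" and "sets \<mu> = sets borel" and "measure \<mu> {0..} = 1"
    and "\<forall>\<epsilon>>0. \<exists>B\<in>sets \<mu>. B \<subseteq> {a. 0 \<le> a \<and> bottleneck SNR \<epsilon> a} \<and> 0 < measure \<mu> B"
  shows "\<forall>\<epsilon>>0. (\<lambda>K. outer_prob (INR_dist K \<mu>)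
            {G \<in> space (INR_dist K \<mu>).
               \<bar>sum_capacity K SNR G / real K - 1/2 * log 2 (1 + 2 * SNR)\<bar> > \<epsilon>})
          \<longlonglongrightarrow> 0"
proof (intro allI impI)
  fix \<epsilon> :: real assume \<epsilon>: "0 < \<epsilon>"
  note SNR = assms(1)
  interpret \<mu>: prob_space \<mu> by (rule assms(2))
  \<comment> \<open>From here on a link counts as an edge if its strength lies in the measurable set
    \<open>B\<close> of bottleneck strengths.\<close>
  obtain B where B: "B \<in> sets \<mu>" "\<And>a. a \<in> B \<Longrightarrow> bottleneck SNR \<epsilon> a" "0 < measure \<mu> B"
    using assms(5)[rule_format, OF \<epsilon>] by auto
  define q where "q = 1 - measure \<mu> B"
  have q: "0 \<le> q" "q < 1" using B(3) by (auto simp: q_def)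
  \<comment> \<open>Chosen so that the users outside the matching add at most
    \<open>\<epsilon> / 4\<close> per user; the matching itself adds \<open>\<epsilon> / 2\<close>,
    which leaves the total strictly below \<open>\<epsilon>\<close>. Absolute value and summand 1
    keep the denominator positive.\<close>
  define \<zeta> where "\<zeta> = \<epsilon> / (4 * (\<bar>rate_bound SNR\<bar> + 1))"
  have \<zeta>: "0 < \<zeta>" using \<epsilon> by (simp add: \<zeta>_def add_pos_nonneg)
  have \<zeta>r: "\<zeta> * rate_bound SNR \<le> \<epsilon> / 4"
  proof -
    have "\<zeta> * rate_bound SNR \<le> \<zeta> * (\<bar>rate_bound SNR\<bar> + 1)" using \<zeta> by (intro mult_left_mono) auto
    also have "\<dots> = \<epsilon> / 4"
    proof -
      have *: "\<epsilon> / (4 * d) * d = \<epsilon> / 4" if "d \<noteq> 0" for d :: real using that by simp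
      show ?thesis unfolding \<zeta>_def by (rule *) linarith
    qed
    finally show ?thesis .
  qed
  let ?E = "\<lambda>K. {G \<in> space (INR_dist K \<mu>). \<bar>sum_capacity K SNR G / real K - 1/2 * log 2 (1 + 2 * SNR)\<bar> > \<epsilon>}"
  let ?A = "\<lambda>K U. {G \<in> space (INR_dist K \<mu>). \<forall>r\<in>U. \<forall>t\<in>U. r \<noteq> t \<longrightarrow> G (r, t) \<notin> B}"
  let ?\<U> = "\<lambda>K. {U. U \<subseteq> {..<K} \<and> \<zeta> * real K < real (card U)}"
  \<comment> \<open>The deviation event is covered by finitely many measurable events, one for each
    large set of users without an edge; the lower bound on the sum capacity rules out deviations
    downwards for all strengths.\<close>
  have sub: "?E K \<subseteq> (\<Union>U\<in>?\<U> K. ?A K U)" if K: "0 < K" for K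
  proof
    fix G assume G: "G \<in> ?E K"
    show "G \<in> (\<Union>U\<in>?\<U> K. ?A K U)"
    proof (rule ccontr)
      assume n: "G \<notin> (\<Union>U\<in>?\<U> K. ?A K U)"
      have "sum_capacity K SNR G \<le> real K * (1/2 * (log 2 (1 + 2 * SNR) + \<epsilon>) + \<zeta> * rate_bound SNR)"
      proof (rule sum_capacity_le[OF SNR K \<epsilon> B(2)])
        fix U assume "U \<subseteq> {..<K}" "\<forall>r\<in>U. \<forall>t\<in>U. r \<noteq> t \<longrightarrow> G (r, t) \<notin> B"
        then show "real (card U) \<le> \<zeta> * real K" using n G by (force simp: not_less)
      qed
      then have "sum_capacity K SNR G / real K \<le> 1/2 * (log 2 (1 + 2 * SNR) + \<epsilon>) + \<zeta> * rate_bound SNR"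
        using K by (simp add: pos_divide_le_eq mult.commute)
      moreover have "1/2 * log 2 (1 + 2 * SNR) \<le> sum_capacity K SNR G / real K"
        using sum_capacity_ge[OF SNR K, of G] K by (simp add: pos_le_divide_eq mult.commute)
      ultimately show False using G \<zeta>r \<epsilon> by (auto simp: abs_if algebra_simps split: if_splits)
    qed
  qed
  \<comment> \<open>There are at most \<open>2 ^ K\<close> sets of users, so each of them should
    have probability at most \<open>(1/4) ^ K\<close>; this leaves \<open>(1/2) ^ K\<close> for the
    union.\<close>
  obtain j where j: "q ^ j < 1/4" using real_arch_pow_inv[of "1/4" q] q by auto
  \<comment> \<open>The condition on \<open>K\<close> says that
    \<open>\<zeta> * (\<zeta> * K - 1)\<close> is at least \<open>j\<close>. A set of
    \<open>n\<close> users with \<open>n\<close> above \<open>\<zeta> * K\<close> then has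
    \<open>n * (n - 1)\<close> ordered pairs, at least \<open>j * K\<close>, so the number of links
    grows quadratically while the number of sets is only exponential.\<close>
  have bound: "measure (INR_dist K \<mu>) (\<Union>U\<in>?\<U> K. ?A K U) \<le> (1/2) ^ K" if K: "real K \<ge> (real j / \<zeta> + 1) / \<zeta>" for K
  proof -
    have fin: "finite (?\<U> K)" by (rule finite_subset[of _ "Pow {..<K}"]) auto
    have "measure (INR_dist K \<mu>) (\<Union>U\<in>?\<U> K. ?A K U) \<le> (\<Sum>U\<in>?\<U> K. measure (INR_dist K \<mu>) (?A K U))"
      by (rule measure_UNION_le[OF fin], rule independent_set_prob(1)[OF assms(2) B(1)]) simp
    also have "\<dots> \<le> (\<Sum>U\<in>?\<U> K. (1/4) ^ K)"
    proof (rule sum_mono)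
      fix U assume U: "U \<in> ?\<U> K"
      let ?n = "card U"
      have n: "\<zeta> * real K < real ?n" using U by simp
      have jz: "real j / \<zeta> \<le> \<zeta> * real K - 1"
        using pos_divide_le_eq[OF \<zeta>, THEN iffD1, OF K] by (simp only: mult.commute)
      have "real j \<le> \<zeta> * (\<zeta> * real K - 1)"
        using pos_divide_le_eq[OF \<zeta>, THEN iffD1, OF jz] by (simp only: mult.commute)
      then have "real j * real K \<le> (\<zeta> * (\<zeta> * real K - 1)) * real K" by (intro mult_right_mono) auto
      also have "\<dots> = (\<zeta> * real K) * (\<zeta> * real K - 1)" by (simp add: algebra_simps)
      also have "\<dots> \<le> real ?n * (real ?n - 1)"
      proof (rule mult_mono)
        have "0 \<le> real j / \<zeta>" using \<zeta> by simp
        then show "0 \<le> \<zeta> * real K - 1" using jz by linarith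
      qed (use n in auto)
      also have "\<dots> = real (?n * (?n - 1))" by (cases ?n) (auto simp: algebra_simps)
      finally have jn: "j * K \<le> ?n * (?n - 1)" by (metis of_nat_le_iff of_nat_mult)
      have "measure (INR_dist K \<mu>) (?A K U) = q ^ (?n * (?n - 1))"
        unfolding q_def using U by (intro independent_set_prob(2)[OF assms(2) B(1)]) auto
      also have "\<dots> \<le> q ^ (j * K)" using q jn by (intro power_decreasing) auto
      also have "\<dots> = (q ^ j) ^ K" by (simp add: power_mult)
      also have "\<dots> \<le> (1/4) ^ K" using j q by (intro power_mono) auto
      finally show "measure (INR_dist K \<mu>) (?A K U) \<le> (1/4) ^ K" .
    qed
    also have "\<dots> = real (card (?\<U> K)) * (1/4) ^ K" by simp
    also have "\<dots> \<le> 2 ^ K * (1/4) ^ K"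
    proof (rule mult_right_mono)
      have "card (?\<U> K) \<le> card (Pow {..<K})" by (rule card_mono) auto
      then show "real (card (?\<U> K)) \<le> 2 ^ K" by (simp add: card_Pow)
    qed simp
    also have "\<dots> = (1/2) ^ K" by (simp add: power_mult_distrib[symmetric])
    finally show ?thesis .
  qed
  show "(\<lambda>K. outer_prob (INR_dist K \<mu>) (?E K)) \<longlonglongrightarrow> 0"
  proof (rule real_tendsto_sandwich)
    show "\<forall>\<^sub>F K in sequentially. 0 \<le> outer_prob (INR_dist K \<mu>) (?E K)"
      by (intro always_eventually allI outer_prob_nonneg) auto
    show "\<forall>\<^sub>F K in sequentially. outer_prob (INR_dist K \<mu>) (?E K) \<le> (1/2) ^ K"
    proof (rule eventually_sequentiallyI[of "max 1 (nat \<lceil>(real j / \<zeta> + 1) / \<zeta>\<rceil>)"])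
      fix K assume "max 1 (nat \<lceil>(real j / \<zeta> + 1) / \<zeta>\<rceil>) \<le> K"
      then have K: "0 < K" "(real j / \<zeta> + 1) / \<zeta> \<le> real K" by linarith+
      have "(\<Union>U\<in>?\<U> K. ?A K U) \<in> sets (INR_dist K \<mu>)"
      proof (rule sets.finite_UN)
        show "finite (?\<U> K)" by (rule finite_subset[of _ "Pow {..<K}"]) auto
        show "?A K U \<in> sets (INR_dist K \<mu>)" if "U \<in> ?\<U> K" for U
          by (rule independent_set_prob(1)[OF assms(2) B(1)]) (use that in simp)
      qed
      then have "outer_prob (INR_dist K \<mu>) (?E K) \<le> measure (INR_dist K \<mu>) (\<Union>U\<in>?\<U> K. ?A K U)"
        by (rule outer_prob_le[OF sub[OF K(1)]])
      also have "\<dots> \<le> (1/2) ^ K" by (rule bound[OF K(2)])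
      finally show "outer_prob (INR_dist K \<mu>) (?E K) \<le> (1/2) ^ K" .
    qed
    show "(\<lambda>K. (1/2 :: real) ^ K) \<longlonglongrightarrow> 0" by (rule LIMSEQ_power_zero) simp
  qed simp
qed

end
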